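(* Let $\bar p=(p_1,p_2,\dots)$ be an infinite sequence of probabilities such that $\{l\ge1:p_l=1\}=\{l^*\}$ for a single $l^*$, and $\lim_{n\to\infty}\log\big(\prod_{l\in[n]\setminus\{l^*\}}(1-p_l)\big)/\log n=0$. Assume that $\bar p$ has no unavoidable circles, that $\sum_{l=1}^\infty p_l=\infty$, and that $\sum_{l=1}^\infty p_l^2<\infty$. Then $M^n_{\bar p}$ satisfies the 0-1 law for $L$.
   Context: $M^n_{\bar p}$ is the random graph on $[n]=\{1,\dots,n\}$ where for $i\ne j$, $\{i,j\}$ is an edge with probability $p_{|i-j|}$, independently. $L$ is first-order logic in the vocabulary $\{\sim\}$ of graphs; the 0-1 law holds if for every $L$-sentence $\psi$, $\lim_n\Pr[M^n_{\bar p}\models\psi]$ exists and lies in $\{0,1\}$. For a sequence $\bar x=(x_0,\dots,x_k)$ of elements of $[n]$ (some $n$) and $0\le i<k$ let $l^{\bar x}_i=x_{i+1}-x_i$. $\bar x$ is possible (for $\bar p$) if $x_{i+1}\neq x_i$ and $p_{|l^{\bar x}_i|}>0$ for each $0\le i<k$. $\bar x$ is a circle of length $k$ if $x_0=x_k$ and the sets $\{x_i,x_{i+1}\}$, $0\le i<k$, are pairwise distinct. A symmetric partition of $\bar x$ is a pair $(S,A)$ with $S\cup A=\{0,\dots,k-1\}$, $S\cap A=\emptyset$, such that $l^{\bar x}_i+l^{\bar x}_j\ne0$ for distinct $i,j\in A$, and the indices in $S$ can be split into pairs $\{i,i'\}$ with $l^{\bar x}_i+l^{\bar x}_{i'}=0$.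 For each $\bar x$ fix one symmetric partition $(Sym(\bar x),Asym(\bar x))$ (say the first in some fixed order). $\bar p$ has no unavoidable circles if for every $k\in\mathbb N$ there is $m_k\in\mathbb N$ such that for every possible circle $\bar x$ of length $k$ (in any $[n]$) and every $i\in Asym(\bar x)$, $|l^{\bar x}_i|\le m_k$. *)

theory Defs
  imports "HOL-Probability.Probability" "HOL-Probability.Product_PMF" "HOL-Library.Disjoint_Sets"
begin

section \<open>First-order logic of graphs\<close>

text \<open>First-order formulas with equality in the vocabulary of graphs, with variables named by
  natural numbers. The remaining connectives and the universal quantifier are definable.\<close>

datatype fm =
    Adj nat nat
  | Eq nat nat
  | Neg fm
  | Conj fm fm
  | Ex nat fm

primrec fv :: "fm \<Rightarrow> nat set" where
  "fv (Adj x y) = {x, y}"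
| "fv (Eq x y) = {x, y}"
| "fv (Neg \<phi>) = fv \<phi>"
| "fv (Conj \<phi> \<psi>) = fv \<phi> \<union> fv \<psi>"
| "fv (Ex x \<phi>) = fv \<phi> - {x}"

definition sentence :: "fm \<Rightarrow> bool" where
  "sentence \<phi> \<longleftrightarrow> fv \<phi> = {}"

text \<open>A graph is given by its vertex set \<open>V\<close> and its set \<open>E\<close> of edges, which are
  two-element sets of vertices.\<close>

primrec sat :: "'a set \<Rightarrow> 'a set set \<Rightarrow> (nat \<Rightarrow> 'a) \<Rightarrow> fm \<Rightarrow> bool" where
  "sat V E s (Adj x y) \<longleftrightarrow> {s x, s y} \<in> E"
| "sat V E s (Eq x y) \<longleftrightarrow> s x = s y"
| "sat V E s (Neg \<phi>) \<longleftrightarrow> \<not> sat V E s \<phi>"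
| "sat V E s (Conj \<phi> \<psi>) \<longleftrightarrow> sat V E s \<phi> \<and> sat V E s \<psi>"
| "sat V E s (Ex x \<phi>) \<longleftrightarrow> (\<exists>v\<in>V. sat V E (s(x := v)) \<phi>)"

lemma sat_cong:
  "(\<And>x. x \<in> fv \<phi> \<Longrightarrow> s x = t x) \<Longrightarrow> sat V E s \<phi> \<longleftrightarrow> sat V E t \<phi>"
proof (induction \<phi> arbitrary: s t)
  case (Conj \<phi> \<psi>)
  have "sat V E s \<phi> \<longleftrightarrow> sat V E t \<phi>" "sat V E s \<psi> \<longleftrightarrow> sat V E t \<psi>"
    by (rule Conj.IH; use Conj.prems in simp)+
  then show ?case by simp
next
  case (Ex x \<phi>)
  have "sat V E (s(x := v)) \<phi> \<longleftrightarrow> sat V E (t(x := v)) \<phi>" for v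
    by (rule Ex.IH) (use Ex.prems in auto)
  then show ?case by simp
next
  case (Neg \<phi>)
  have "sat V E s \<phi> \<longleftrightarrow> sat V E t \<phi>"
    by (rule Neg.IH) (use Neg.prems in simp)
  then show ?case by simp
qed auto

text \<open>For sentences the assignment \<open>s\<close> is irrelevant (see \<open>models_sentence\<close>), even when it takes
  values outside \<open>V\<close>, so that the empty graph needs no special treatment.\<close>

definition models :: "'a set \<Rightarrow> 'a set set \<Rightarrow> fm \<Rightarrow> bool" where
  "models V E \<phi> \<longleftrightarrow> (\<forall>s. sat V E s \<phi>)"

lemma models_sentence:
  assumes "sentence \<phi>"
  shows "models V E \<phi> \<longleftrightarrow> sat V E s \<phi>"
  using assms sat_cong[of \<phi>] unfolding models_def sentence_def by blast


section \<open>The random graph and the 0-1 law\<close>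

text \<open>A sequence \<open>(p\<^sub>1, p\<^sub>2, \<dots>)\<close> is a function \<open>p\<close> on the natural numbers whose value at \<open>0\<close> is
  never used.\<close>

definition prob_seq :: "(nat \<Rightarrow> real) \<Rightarrow> bool" where
  "prob_seq p \<longleftrightarrow> (\<forall>l\<ge>1. 0 \<le> p l \<and> p l \<le> 1)"

definition vertex_pairs :: "nat \<Rightarrow> nat set set" where
  "vertex_pairs n = {{i, j} | i j. i \<in> {1..n} \<and> j \<in> {1..n} \<and> i \<noteq> j}"

text \<open>The distribution of the edge set: one independent coin flip for each pair \<open>e = {i, j}\<close>, where
  \<open>Max e - Min e = \<bar>i - j\<bar>\<close>.\<close>

definition random_graph :: "(nat \<Rightarrow> real) \<Rightarrow> nat \<Rightarrow> nat set set pmf" where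
  "random_graph p n =
     map_pmf (\<lambda>f. {e \<in> vertex_pairs n. f e})
       (Pi_pmf (vertex_pairs n) False (\<lambda>e. bernoulli_pmf (p (Max e - Min e))))"

definition zero_one_law :: "(nat \<Rightarrow> real) \<Rightarrow> bool" where
  "zero_one_law p \<longleftrightarrow>
     (\<forall>\<psi>. sentence \<psi> \<longrightarrow>
       (\<exists>c\<in>{0, 1}. (\<lambda>n. measure_pmf.prob (random_graph p n) {E. models {1..n} E \<psi>})
                      \<longlonglongrightarrow> c))"


section \<open>Unavoidable circles\<close>

text \<open>A sequence \<open>(x\<^sub>0, \<dots>, x\<^sub>k)\<close> is a list of length \<open>k + 1\<close>.\<close>

definition step :: "nat list \<Rightarrow> nat \<Rightarrow> int" where
  "step x i = int (x ! Suc i) - int (x ! i)"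

definition possible :: "(nat \<Rightarrow> real) \<Rightarrow> nat list \<Rightarrow> bool" where
  "possible p x \<longleftrightarrow>
     (\<forall>i < length x - 1. x ! Suc i \<noteq> x ! i \<and> p (nat \<bar>step x i\<bar>) > 0)"

definition circle :: "nat \<Rightarrow> nat list \<Rightarrow> bool" where
  "circle k x \<longleftrightarrow> length x = Suc k \<and> x ! 0 = x ! k \<and>
     inj_on (\<lambda>i. {x ! i, x ! Suc i}) {..<k}"

definition symmetric_partition :: "nat list \<Rightarrow> nat set \<times> nat set \<Rightarrow> bool" where
  "symmetric_partition x = (\<lambda>(S, A).
     S \<union> A = {..<length x - 1} \<and> S \<inter> A = {} \<and>
     (\<forall>i\<in>A. \<forall>j\<in>A. i \<noteq> j \<longrightarrow> step x i + step x j \<noteq> 0) \<and>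
     (\<exists>P. partition_on S P \<and>
        (\<forall>e\<in>P. \<exists>i i'. i \<noteq> i' \<and> e = {i, i'} \<and> step x i + step x i' = 0)))"

lemma symmetric_partition_exists: "\<exists>SA. symmetric_partition x SA"
proof -
  have "\<exists>S A. S \<union> A = I \<and> S \<inter> A = {} \<and>
     (\<forall>i\<in>A. \<forall>j\<in>A. i \<noteq> j \<longrightarrow> step x i + step x j \<noteq> 0) \<and>
     (\<exists>P. partition_on S P \<and>
        (\<forall>e\<in>P. \<exists>i i'. i \<noteq> i' \<and> e = {i, i'} \<and> step x i + step x i' = 0))"
    if "finite I" for I
    using that
  proof (induction I rule: finite_psubset_induct)
    case (psubset I)
    show ?case
    proof (cases "\<exists>i\<in>I. \<exists>j\<in>I. i \<noteq> j \<and> step x i + step x j = 0")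
      case False
      then show ?thesis
        by (intro exI[of _ "{}"] exI[of _ I]) (auto simp: partition_on_def)
    next
      case True
      then obtain i j where ij: "i \<in> I" "j \<in> I" "i \<noteq> j" "step x i + step x j = 0"
        by blast
      then have "I - {i, j} \<subset> I" by blast
      from psubset.IH[OF this] obtain S A P where SAP:
        "S \<union> A = I - {i, j}" "S \<inter> A = {}"
        "\<forall>i\<in>A. \<forall>j\<in>A. i \<noteq> j \<longrightarrow> step x i + step x j \<noteq> 0"
        "partition_on S P"
        "\<forall>e\<in>P. \<exists>i i'. i \<noteq> i' \<and> e = {i, i'} \<and> step x i + step x i' = 0"
        by (elim exE conjE)
      have "partition_on (insert i (insert j S)) (insert {i, j} P)"
        unfolding partition_on_def
      proof (intro conjI)
        show "\<Union> (insert {i, j} P) = insert i (insert j S)"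
          using partition_onD1[OF SAP(4)] by simp
        show "{} \<notin> insert {i, j} P"
          using partition_onD3[OF SAP(4)] by simp
        have "{i, j} \<inter> q = {}" if "q \<in> P" for q
          using that partition_onD1[OF SAP(4)] SAP(1) by blast
        then show "disjoint (insert {i, j} P)"
          using partition_onD2[OF SAP(4)] unfolding disjoint_def
          by (metis Int_commute insertE)
      qed
      moreover have "\<forall>e\<in>insert {i, j} P. \<exists>i i'. i \<noteq> i' \<and> e = {i, i'} \<and> step x i + step x i' = 0"
        using SAP(5) ij by blast
      moreover have "insert i (insert j S) \<union> A = I"
        using SAP(1) ij(1,2) by auto
      moreover have "insert i (insert j S) \<inter> A = {}"
        using SAP(1,2) by auto
      ultimately show ?thesis
        using SAP(3)
        by (intro exI[of _ "insert i (insert j S)"] exI[of _ A] conjI exI[of _ "insert {i, j} P"])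
    qed
  qed
  from this[of "{..<length x - 1}"] show ?thesis
    unfolding symmetric_partition_def by auto
qed

text \<open>The choice of one symmetric partition for each sequence.\<close>

definition sym_asym :: "nat list \<Rightarrow> nat set \<times> nat set" where
  "sym_asym x = (SOME SA. symmetric_partition x SA)"

definition Sym :: "nat list \<Rightarrow> nat set" where
  "Sym x = fst (sym_asym x)"

definition Asym :: "nat list \<Rightarrow> nat set" where
  "Asym x = snd (sym_asym x)"

lemma symmetric_partition_Sym_Asym: "symmetric_partition x (Sym x, Asym x)"
  unfolding Sym_def Asym_def sym_asym_def
  using someI_ex[OF symmetric_partition_exists[of x]] by simp

definition no_unavoidable_circles :: "(nat \<Rightarrow> real) \<Rightarrow> bool" where
  "no_unavoidable_circles p \<longleftrightarrow>
     (\<forall>k. \<exists>m::nat. \<forall>n x. set x \<subseteq> {1..n} \<and> possible p x \<and> circle k x \<longrightarrow>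
        (\<forall>i\<in>Asym x. \<bar>step x i\<bar> \<le> int m))"

end

(* Let a cycle be short if its length is bounded by a fixed constant. The absence of unavoidable
   circles means that in every short zero-sum list of possible steps all large steps cancel in
   pairs; as the squares of the probabilities are summable, all expected numbers of short cycles
   and of short paths with given end points are bounded. A template is a finite pattern on the
   integers in which every vertex near the centre has both forced neighbours, at distance l*.
   Since the product of all 1 - p_l decays more slowly than any power of n, a second moment
   computation shows that each template has many disjoint exact copies in the random graph.
   By locality of first-order logic it then suffices that with high probability every small ball is
   isomorphic to a template. This is obvious away from the borders. A vertex v close to a border
   lacks one forced neighbour, but with high probability it has a neighbour y whose surroundings
   lie on no short cycle: re-embed the same graph so that the edge from v to y plays the role of
   the missing forced edge, while the forced edge from y to y + l* and the other edges hanging off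
   the line of y become generic long edges. Now y + l* lacks a forced neighbour instead, and after
   finitely many repetitions the defect has left the ball. *)

theory Submission
  imports Defs "HOL-Real_Asymp.Real_Asymp"
begin

subsection \<open>Local back-and-forth equivalence\<close>

text \<open>The forced distance constrains a re-embedding both ways: a pattern can occur exactly
  only if each of its pairs at distance \<open>lstar\<close> is an edge and no central vertex has a
  forced neighbour outside it. So altering a step must not bring unrelated vertices to distance 0 or
  \<open>lstar\<close>. For this reason the edges hanging off an altered line receive steps from a
  sequence growing so fast that the largest one on a path dominates all others. The change is
  consistent because it affects only edges at vertices on no short cycle: along short closed walks
  the changes cancel, so summing steps along any short walk from the centre defines positions.
  Suitable neighbours y exist because the sum of \<open>p l\<close> diverges, while the expected
  number of short returns to used vertices stays bounded even when summed over all candidates l.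
  Chains have \<open>2 * r + 1\<close> joints because a ball of radius r has diameter at most
  \<open>2 * r\<close>. Joints repair the lower border only; a ball at the upper border is mirrored,
  and with high probability no small ball meets both borders.\<close>

primrec nball :: "'a set set \<Rightarrow> nat \<Rightarrow> 'a \<Rightarrow> 'a set" where
  "nball E 0 x = {x}"
| "nball E (Suc k) x = nball E k x \<union> {w. \<exists>v\<in>nball E k x. {v, w} \<in> E}"

definition near :: "'a set set \<Rightarrow> nat \<Rightarrow> 'a set \<Rightarrow> 'a set" where
  "near E k A = (\<Union>x\<in>A. nball E k x)"

lemma nball_mono: "k \<le> l \<Longrightarrow> nball E k x \<subseteq> nball E l x"
  by (induction rule: dec_induct) auto

lemma nball_self [simp]: "x \<in> nball E k x"
  by (induction k) auto

lemma nball_trans: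
  assumes "v \<in> nball E i u" "w \<in> nball E j v"
  shows "w \<in> nball E (i + j) u"
  using assms(2)
proof (induction j arbitrary: w)
  case 0
  then show ?case using assms(1) by simp
next
  case (Suc j)
  then show ?case by auto
qed

lemma nball_sym: "v \<in> nball E k u \<Longrightarrow> u \<in> nball E k v"
proof (induction k arbitrary: v)
  case (Suc k)
  from Suc.prems consider "v \<in> nball E k u" | t where "t \<in> nball E k u" "{t, v} \<in> E"
    by auto
  then show ?case
  proof cases
    case 1
    then show ?thesis using Suc.IH by simp
  next
    case 2
    have "t \<in> nball E 1 v" using 2 by (auto simp: insert_commute)
    moreover have "u \<in> nball E k t" using Suc.IH 2 by simp
    ultimately have "u \<in> nball E (1 + k) v" by (rule nball_trans)
    then show ?thesis by simp
  qed
qed simp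

lemma nball_subset: "x \<in> V \<Longrightarrow> \<Union>E \<subseteq> V \<Longrightarrow> nball E k x \<subseteq> V"
  by (induction k) auto

lemma near_insert [simp]: "near E k (insert x A) = nball E k x \<union> near E k A"
  by (simp add: near_def)

lemma near_Un: "near E k (A \<union> B) = near E k A \<union> near E k B"
  by (simp add: near_def)

lemma near_mono: "k \<le> l \<Longrightarrow> near E k A \<subseteq> near E l A"
  unfolding near_def by (intro UN_mono nball_mono) auto

lemma near_subset: "A \<subseteq> V \<Longrightarrow> \<Union>E \<subseteq> V \<Longrightarrow> near E k A \<subseteq> V"
  unfolding near_def by (intro UN_least nball_subset) auto

definition partial_iso :: "'a set set \<Rightarrow> 'b set set \<Rightarrow> ('a \<times> 'b) set \<Rightarrow> bool" where
  "partial_iso E F P \<longleftrightarrow> (\<forall>x y x' y'. (x, y) \<in> P \<longrightarrow> (x', y') \<in> P \<longrightarrow>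
     (x = x' \<longleftrightarrow> y = y') \<and> ({x, x'} \<in> E \<longleftrightarrow> {y, y'} \<in> F))"

text \<open>An Ehrenfeucht-Fraisse game with local moves: with \<open>Suc q\<close> rounds left, the
  new point lies within \<open>2 ^ q\<close> of an earlier one. The halving radii sum to less than
  \<open>2 ^ Suc q\<close>, so the outcome depends only on a ball of that radius around the starting
  points. The conjunct \<open>loc q E F P\<close> makes monotonicity in the number of rounds
  immediate.\<close>

primrec loc :: "nat \<Rightarrow> 'a set set \<Rightarrow> 'b set set \<Rightarrow> ('a \<times> 'b) set \<Rightarrow> bool" where
  "loc 0 E F P \<longleftrightarrow> partial_iso E F P"
| "loc (Suc q) E F P \<longleftrightarrow> loc q E F P \<and>
     (\<forall>c\<in>near E (2 ^ q) (Domain P). \<exists>d\<in>near F (2 ^ q) (Range P). loc q E F (insert (c, d) P)) \<and>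
     (\<forall>d\<in>near F (2 ^ q) (Range P). \<exists>c\<in>near E (2 ^ q) (Domain P). loc q E F (insert (c, d) P))"

lemma loc_partial_iso: "loc q E F P \<Longrightarrow> partial_iso E F P"
  by (induction q) auto

lemma partial_iso_converse: "partial_iso F E (P\<inverse>) \<longleftrightarrow> partial_iso E F P"
  unfolding partial_iso_def converse_iff by blast

lemma loc_converse: "loc q F E (P\<inverse>) \<longleftrightarrow> loc q E F P"
proof (induction q arbitrary: P)
  case (Suc q)
  have ins: "insert (d, c) (P\<inverse>) = (insert (c, d) P)\<inverse>" for c d by auto
  show ?case by (auto simp: ins Suc.IH)
qed (simp add: partial_iso_converse)

lemma loc_mono: "q \<le> q' \<Longrightarrow> loc q' E F P \<Longrightarrow> loc q E F P"
  by (induction rule: dec_induct) auto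

lemma partial_iso_Un:
  assumes "partial_iso E F P" "partial_iso E F P'"
    and "Domain P' \<inter> near E 1 (Domain P) = {}" "Range P' \<inter> near F 1 (Range P) = {}"
  shows "partial_iso E F (P \<union> P')"
proof -
  have cross: "(x = x' \<longleftrightarrow> y = y') \<and> ({x, x'} \<in> E \<longleftrightarrow> {y, y'} \<in> F)"
    if "(x, y) \<in> P" "(x', y') \<in> P'" for x y x' y'
  proof -
    have "x' \<notin> nball E 1 x" "y' \<notin> nball F 1 y"
      using assms(3,4) that unfolding near_def by blast+
    then show ?thesis by auto
  qed
  show ?thesis
    unfolding partial_iso_def
  proof (intro allI impI)
    fix x y x' y'
    assume a: "(x, y) \<in> P \<union> P'" "(x', y') \<in> P \<union> P'"
    consider "(x, y) \<in> P" "(x', y') \<in> P" | "(x, y) \<in> P'" "(x', y') \<in> P'"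
      | "(x, y) \<in> P" "(x', y') \<in> P'" | "(x, y) \<in> P'" "(x', y') \<in> P" using a by blast
    then show "(x = x' \<longleftrightarrow> y = y') \<and> ({x, x'} \<in> E \<longleftrightarrow> {y, y'} \<in> F)"
    proof cases
      case 1 then show ?thesis using assms(1) unfolding partial_iso_def by blast
    next
      case 2 then show ?thesis using assms(2) unfolding partial_iso_def by blast
    next
      case 3 then show ?thesis by (rule cross)
    next
      case 4 then show ?thesis using cross[of x' y' x y] by (auto simp: insert_commute)
    qed
  qed
qed

text \<open>Halving the radius pays for the move: the ball of radius \<open>2 ^ q\<close> about the
  new point lies in the ball of radius \<open>2 ^ Suc q\<close> about an old one, so separation
  survives at the next smaller radius.\<close>

lemma near_far:
  assumes "B \<inter> near E (2 ^ Suc q) A = {}" "c \<in> near E (2 ^ q) A"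
  shows "B \<inter> near E (2 ^ q) (insert c A) = {}"
proof -
  obtain a where a: "a \<in> A" "c \<in> nball E (2 ^ q) a" using assms(2) by (auto simp: near_def)
  have "nball E (2 ^ q) c \<subseteq> nball E (2 ^ Suc q) a"
    using nball_trans[OF a(2), of _ "2 ^ q"] by (auto simp: mult_2)
  moreover have "nball E (2 ^ q) b \<subseteq> nball E (2 ^ Suc q) b" for b
    by (rule nball_mono) simp
  ultimately have "near E (2 ^ q) (insert c A) \<subseteq> near E (2 ^ Suc q) A"
    using a(1) unfolding near_def by blast
  then show ?thesis using assms(1) by blast
qed

lemma far_sym: "B \<inter> near E k A = {} \<longleftrightarrow> A \<inter> near E k B = {}"
  unfolding near_def using nball_sym by fastforce

text \<open>Positions far apart are played independently: a legal move is near one of them and is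
  answered there, and by \<open>near_far\<close> the enlarged position is still far from the other.
  This is what lets a distant move be answered by any distant point of the same local type.\<close>

lemma loc_Un:
  assumes "loc q E F P" "loc q E F P'"
    and "Domain P' \<inter> near E (2 ^ q) (Domain P) = {}" "Range P' \<inter> near F (2 ^ q) (Range P) = {}"
  shows "loc q E F (P \<union> P')"
  using assms
proof (induction q arbitrary: P P')
  case 0
  then show ?case by (simp add: partial_iso_Un)
next
  case (Suc q)
  have far': "Domain P' \<inter> near E (2 ^ q) (Domain P) = {}"
    "Range P' \<inter> near F (2 ^ q) (Range P) = {}"
    using Suc.prems(3,4) near_mono[of "2 ^ q" "2 ^ Suc q" E "Domain P"]
      near_mono[of "2 ^ q" "2 ^ Suc q" F "Range P"] by (auto simp del: power_Suc)
  have base: "loc q E F (P \<union> P')"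
    using Suc.IH[of P P'] Suc.prems far' by simp
  have forth: "loc q E F (insert (c, d) (P \<union> P'))"
    if "loc q E F (insert (c, d) P)" "loc q E F P'"
      and f: "Domain P' \<inter> near E (2 ^ Suc q) (Domain P) = {}"
        "Range P' \<inter> near F (2 ^ Suc q) (Range P) = {}"
      and "c \<in> near E (2 ^ q) (Domain P)" "d \<in> near F (2 ^ q) (Range P)"
    for c d P P'
  proof -
    have "Domain P' \<inter> near E (2 ^ q) (Domain (insert (c, d) P)) = {}"
      "Range P' \<inter> near F (2 ^ q) (Range (insert (c, d) P)) = {}"
      using near_far[OF f(1) that(5)] near_far[OF f(2) that(6)]
      by (simp_all add: Domain_insert Range_insert)
    then have "loc q E F (insert (c, d) P \<union> P')"
      by (intro Suc.IH that(1,2))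
    then show ?thesis by simp
  qed
  have f1: "Domain P' \<inter> near E (2 ^ Suc q) (Domain P) = {}"
    "Range P' \<inter> near F (2 ^ Suc q) (Range P) = {}" using Suc.prems by simp_all
  have f2: "Domain P \<inter> near E (2 ^ Suc q) (Domain P') = {}"
    "Range P \<inter> near F (2 ^ Suc q) (Range P') = {}" by (rule far_sym[THEN iffD1, OF f1(1)], rule far_sym[THEN iffD1, OF f1(2)])
  have l: "loc q E F P" "loc q E F P'" using Suc.prems by auto
  show ?case
    unfolding loc.simps
  proof (intro conjI ballI base)
    fix c assume "c \<in> near E (2 ^ q) (Domain (P \<union> P'))"
    then consider "c \<in> near E (2 ^ q) (Domain P)" | "c \<in> near E (2 ^ q) (Domain P')"
      by (auto simp: near_Un Domain_Un_eq Range_Un_eq)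
    then show "\<exists>d\<in>near F (2 ^ q) (Range (P \<union> P')). loc q E F (insert (c, d) (P \<union> P'))"
    proof cases
      case 1
      then obtain d where "d \<in> near F (2 ^ q) (Range P)" "loc q E F (insert (c, d) P)"
        using Suc.prems(1) by auto
      then show ?thesis using forth[of c d P P'] f1 l 1 by (auto simp: near_Un Domain_Un_eq Range_Un_eq)
    next
      case 2
      then obtain d where "d \<in> near F (2 ^ q) (Range P')" "loc q E F (insert (c, d) P')"
        using Suc.prems(2) by auto
      then show ?thesis using forth[of c d P' P] f2 l 2 by (auto simp: near_Un Domain_Un_eq Range_Un_eq Un_commute)
    qed
  next
    fix d assume "d \<in> near F (2 ^ q) (Range (P \<union> P'))"
    then consider "d \<in> near F (2 ^ q) (Range P)" | "d \<in> near F (2 ^ q) (Range P')"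
      by (auto simp: near_Un Domain_Un_eq Range_Un_eq)
    then show "\<exists>c\<in>near E (2 ^ q) (Domain (P \<union> P')). loc q E F (insert (c, d) (P \<union> P'))"
    proof cases
      case 1
      then obtain c where "c \<in> near E (2 ^ q) (Domain P)" "loc q E F (insert (c, d) P)"
        using Suc.prems(1) by auto
      then show ?thesis using forth[of c d P P'] f1 l 1 by (auto simp: near_Un Domain_Un_eq Range_Un_eq)
    next
      case 2
      then obtain c where "c \<in> near E (2 ^ q) (Domain P')" "loc q E F (insert (c, d) P')"
        using Suc.prems(2) by auto
      then show ?thesis using forth[of c d P' P] f2 l 2 by (auto simp: near_Un Domain_Un_eq Range_Un_eq Un_commute)
    qed
  qed
qed

lemma Domain_zip: "length xs = length ys \<Longrightarrow> Domain (set (zip xs ys)) = set xs"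
  by (metis Domain_fst map_fst_zip set_map)

lemma Range_zip: "length xs = length ys \<Longrightarrow> Range (set (zip xs ys)) = set ys"
  by (metis Range_snd map_snd_zip set_map)

lemma partial_iso_zip:
  assumes "length xs = length ys"
  shows "partial_iso E F (set (zip xs ys)) \<longleftrightarrow> (\<forall>i<length xs. \<forall>j<length xs.
     (xs ! i = xs ! j \<longleftrightarrow> ys ! i = ys ! j) \<and> ({xs ! i, xs ! j} \<in> E \<longleftrightarrow> {ys ! i, ys ! j} \<in> F))"
  (is "_ \<longleftrightarrow> ?R")
proof
  assume a: "partial_iso E F (set (zip xs ys))"
  show ?R
  proof (intro allI impI)
    fix i j assume "i < length xs" "j < length xs"
    then have "(xs ! i, ys ! i) \<in> set (zip xs ys)" "(xs ! j, ys ! j) \<in> set (zip xs ys)"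
      using assms by (auto simp: in_set_zip)
    then show "(xs ! i = xs ! j \<longleftrightarrow> ys ! i = ys ! j) \<and> ({xs ! i, xs ! j} \<in> E \<longleftrightarrow> {ys ! i, ys ! j} \<in> F)"
      using a unfolding partial_iso_def by blast
  qed
next
  assume ?R
  then show "partial_iso E F (set (zip xs ys))"
    unfolding partial_iso_def by (fastforce simp: in_set_zip)
qed

text \<open>Replies are composed through the middle structure. Positions are zipped lists so that
  the common index records which middle point links each outer pair.\<close>

lemma loc_trans:
  assumes "length xs = length ys" "length ys = length zs"
    and "loc q E F (set (zip xs ys))" "loc q F H (set (zip ys zs))"
  shows "loc q E H (set (zip xs zs))"
  using assms
proof (induction q arbitrary: xs ys zs)
  case 0
  then show ?case by (simp add: partial_iso_zip)
next
  case (Suc q)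
  note len = Suc.prems(1,2)
  note D = Domain_zip[OF len(1)] Range_zip[OF len(1)] Domain_zip[OF len(2)] Range_zip[OF len(2)]
    Domain_zip[OF trans[OF len]] Range_zip[OF trans[OF len]]
  have base: "loc q E H (set (zip xs zs))"
    using Suc.IH[OF len] Suc.prems(3,4) by simp
  have step: "loc q E H (insert (a, c) (set (zip xs zs)))"
    if "loc q E F (insert (a, b) (set (zip xs ys)))" "loc q F H (insert (b, c) (set (zip ys zs)))"
    for a b c
    using Suc.IH[of "a # xs" "b # ys" "c # zs"] that len by simp
  show ?case
    unfolding loc.simps
  proof (intro conjI ballI base)
    fix a assume "a \<in> near E (2 ^ q) (Domain (set (zip xs zs)))"
    then obtain b where b: "b \<in> near F (2 ^ q) (set ys)" "loc q E F (insert (a, b) (set (zip xs ys)))"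
      using Suc.prems(3) by (auto simp: D)
    then obtain c where "c \<in> near H (2 ^ q) (set zs)" "loc q F H (insert (b, c) (set (zip ys zs)))"
      using Suc.prems(4) by (auto simp: D)
    then show "\<exists>c\<in>near H (2 ^ q) (Range (set (zip xs zs))). loc q E H (insert (a, c) (set (zip xs zs)))"
      using step b(2) by (auto simp: D)
  next
    fix c assume "c \<in> near H (2 ^ q) (Range (set (zip xs zs)))"
    then obtain b where b: "b \<in> near F (2 ^ q) (set ys)" "loc q F H (insert (b, c) (set (zip ys zs)))"
      using Suc.prems(4) by (auto simp: D)
    then obtain a where "a \<in> near E (2 ^ q) (set xs)" "loc q E F (insert (a, b) (set (zip xs ys)))"
      using Suc.prems(3) by (auto simp: D)
    then show "\<exists>a\<in>near E (2 ^ q) (Domain (set (zip xs zs))). loc q E H (insert (a, c) (set (zip xs zs)))"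
      using step b(2) by (auto simp: D)
  qed
qed

lemma loc_trans1: "loc q E F {(x, y)} \<Longrightarrow> loc q F H {(y, z)} \<Longrightarrow> loc q E H {(x, z)}"
  using loc_trans[of "[x]" "[y]" "[z]" q E F H] by simp

lemma loc_sym1: "loc q E F {(x, y)} \<Longrightarrow> loc q F E {(y, x)}"
proof -
  assume "loc q E F {(x, y)}"
  moreover have "{(x, y)}\<inverse> = {(y, x)}" by auto
  ultimately show ?thesis using loc_converse[of q F E "{(x, y)}"] by simp
qed

section \<open>Finitely many local types\<close>

lemma finite_representatives:
  assumes "finite (f ` A)"
  shows "\<exists>R. finite R \<and> R \<subseteq> A \<and> (\<forall>a\<in>A. \<exists>r\<in>R. f a = f r)"
proof -
  have "\<exists>g. \<forall>y\<in>f ` A. g y \<in> A \<and> f (g y) = y" by (intro bchoice) auto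
  then obtain g where g: "\<forall>y\<in>f ` A. g y \<in> A \<and> f (g y) = y" ..
  show ?thesis
    using assms g by (intro exI[of _ "g ` f ` A"]) force
qed

text \<open>The type for \<open>Suc q\<close> rounds is determined by the type for \<open>q\<close>
  rounds together with the set of such types realized by adding one nearby point; both range over
  finitely many classes by induction. The class \<open>A\<close> is arbitrary and \<open>R\<close>
  is chosen inside it, so that later the representatives are themselves templates.\<close>

lemma loc_finite_index:
  fixes A :: "('a set set \<times> 'a list) set"
  assumes "\<forall>(E, xs)\<in>A. length xs = k"
  shows "\<exists>R. finite R \<and> R \<subseteq> A \<and>
    (\<forall>(E, xs)\<in>A. \<exists>(F, ys)\<in>R. loc q E F (set (zip xs ys)))"
  using assms
proof (induction q arbitrary: A k)
  case 0
  define f where "f = (\<lambda>(E :: 'a set set, xs :: 'a list).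
    ({(i, j). i < k \<and> j < k \<and> xs ! i = xs ! j}, {(i, j). i < k \<and> j < k \<and> {xs ! i, xs ! j} \<in> E}))"
  have "f ` A \<subseteq> Pow ({..<k} \<times> {..<k}) \<times> Pow ({..<k} \<times> {..<k})"
    by (auto simp: f_def)
  then have "finite (f ` A)" by (rule finite_subset) simp
  from finite_representatives[OF this]
  obtain R where R: "finite R" "R \<subseteq> A" "\<forall>a\<in>A. \<exists>r\<in>R. f a = f r"
    by (elim exE conjE)
  have "\<exists>(F, ys)\<in>R. loc 0 E F (set (zip xs ys))" if a: "(E, xs) \<in> A" for E xs
  proof -
    obtain F ys where r: "(F, ys) \<in> R" "f (E, xs) = f (F, ys)" using bspec[OF R(3) a] by auto
    have len: "length xs = k" "length ys = k" using 0 a r R(2) by auto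
    have "(xs ! i = xs ! j \<longleftrightarrow> ys ! i = ys ! j) \<and> ({xs ! i, xs ! j} \<in> E \<longleftrightarrow> {ys ! i, ys ! j} \<in> F)"
      if ij: "i < k" "j < k" for i j
    proof -
      have "(i, j) \<in> fst (f (E, xs)) \<longleftrightarrow> (i, j) \<in> fst (f (F, ys))"
        "(i, j) \<in> snd (f (E, xs)) \<longleftrightarrow> (i, j) \<in> snd (f (F, ys))" using r(2) by simp_all
      then show ?thesis using ij by (simp add: f_def)
    qed
    then have "loc 0 E F (set (zip xs ys))" using len by (simp add: partial_iso_zip)
    then show ?thesis using r(1) by auto
  qed
  then show ?case using R(1,2) by auto
next
  case (Suc q)
  from Suc.IH[of A k, OF Suc.prems] obtain R0 where R0: "finite R0" "R0 \<subseteq> A"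
    "\<forall>(E, xs)\<in>A. \<exists>(F, ys)\<in>R0. loc q E F (set (zip xs ys))" by (elim exE conjE)
  define A' where "A' = {(E, c # xs) | E c xs. (E, xs) \<in> A \<and> c \<in> near E (2 ^ q) (set xs)}"
  have lenA': "\<forall>(E, xs)\<in>A'. length xs = Suc k" using Suc.prems by (auto simp: A'_def)
  from Suc.IH[of A' "Suc k", OF lenA'] obtain R1 where R1: "finite R1" "R1 \<subseteq> A'"
    "\<forall>(E, xs)\<in>A'. \<exists>(F, ys)\<in>R1. loc q E F (set (zip xs ys))" by (elim exE conjE)
  define f where "f = (\<lambda>(E :: 'a set set, xs :: 'a list).
    ({(F, ys) \<in> R0. loc q E F (set (zip xs ys))},
     {(F, ys) \<in> R1. \<exists>c\<in>near E (2 ^ q) (set xs). loc q E F (set (zip (c # xs) ys))}))"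
  have "f ` A \<subseteq> Pow R0 \<times> Pow R1" by (auto simp: f_def)
  then have "finite (f ` A)" by (rule finite_subset) (simp add: R0(1) R1(1))
  from finite_representatives[OF this]
  obtain R where R: "finite R" "R \<subseteq> A" "\<forall>a\<in>A. \<exists>r\<in>R. f a = f r"
    by (elim exE conjE)
  have forth: "\<exists>d\<in>near F (2 ^ q) (set ys). loc q E F (insert (c, d) (set (zip xs ys)))"
    if "(E, xs) \<in> A" "(F, ys) \<in> A" "f (E, xs) = f (F, ys)" "c \<in> near E (2 ^ q) (set xs)"
    for E xs F ys c
  proof -
    have len: "length xs = k" "length ys = k" using Suc.prems that by auto
    have "(E, c # xs) \<in> A'" using that by (auto simp: A'_def)
    then obtain H zs where H: "(H, zs) \<in> R1" "loc q E H (set (zip (c # xs) zs))" using R1(3) by blast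
    have lz: "length zs = Suc k" using H(1) R1(2) lenA' by auto
    have "(H, zs) \<in> snd (f (E, xs))" using H that(4) by (auto simp: f_def)
    then have "(H, zs) \<in> snd (f (F, ys))" using that(3) by simp
    then obtain d where d: "d \<in> near F (2 ^ q) (set ys)" "loc q F H (set (zip (d # ys) zs))"
      by (auto simp: f_def)
    have "(set (zip (d # ys) zs))\<inverse> = set (zip zs (d # ys))"
      using len lz by (auto simp: in_set_zip)
    then have "loc q H F (set (zip zs (d # ys)))"
      using d(2) loc_converse[of q H F "set (zip (d # ys) zs)"] by simp
    then have "loc q E F (set (zip (c # xs) (d # ys)))"
      using loc_trans[of "c # xs" zs "d # ys"] len lz H(2) by simp
    then show ?thesis using d(1) by auto
  qed
  have "\<exists>(F, ys)\<in>R. loc (Suc q) E F (set (zip xs ys))" if a: "(E, xs) \<in> A" for E xs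
  proof -
    obtain F ys where r: "(F, ys) \<in> R" "f (E, xs) = f (F, ys)" using bspec[OF R(3) a] by auto
    then have b: "(F, ys) \<in> A" using R(2) by auto
    have len: "length xs = k" "length ys = k" using Suc.prems a b by auto
    have conv: "(set (zip ys xs))\<inverse> = set (zip xs ys)"
      using len by (auto simp: in_set_zip)
    obtain H zs where H: "(H, zs) \<in> R0" "loc q E H (set (zip xs zs))" using R0(3) a by blast
    have lz: "length zs = k" using H(1) R0(2) Suc.prems by auto
    have "(H, zs) \<in> fst (f (E, xs))" using H by (auto simp: f_def)
    then have "loc q F H (set (zip ys zs))" using r(2) by (auto simp: f_def)
    moreover have "(set (zip ys zs))\<inverse> = set (zip zs ys)" using len lz by (auto simp: in_set_zip)
    ultimately have "loc q H F (set (zip zs ys))" using loc_converse[of q H F "set (zip ys zs)"] by simp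
    then have base: "loc q E F (set (zip xs ys))"
      using loc_trans[of xs zs ys q E H F] len lz H(2) by simp
    have "loc (Suc q) E F (set (zip xs ys))"
      unfolding loc.simps
    proof (intro conjI ballI base)
      fix c assume "c \<in> near E (2 ^ q) (Domain (set (zip xs ys)))"
      then show "\<exists>d\<in>near F (2 ^ q) (Range (set (zip xs ys))). loc q E F (insert (c, d) (set (zip xs ys)))"
        using forth[OF a b r(2)] len by (simp add: Domain_zip Range_zip)
    next
      fix d assume "d \<in> near F (2 ^ q) (Range (set (zip xs ys)))"
      then obtain c where c: "c \<in> near E (2 ^ q) (set xs)" "loc q F E (insert (d, c) (set (zip ys xs)))"
        using forth[OF b a r(2)[symmetric]] len by (auto simp: Domain_zip Range_zip)
      have "(insert (d, c) (set (zip ys xs)))\<inverse> = insert (c, d) (set (zip xs ys))" using conv by auto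
      then have "loc q E F (insert (c, d) (set (zip xs ys)))"
        using c(2) loc_converse[of q E F "insert (d, c) (set (zip ys xs))"] by simp
      then show "\<exists>c\<in>near E (2 ^ q) (Domain (set (zip xs ys))). loc q E F (insert (c, d) (set (zip xs ys)))"
        using c(1) len by (auto simp: Domain_zip Range_zip)
    qed
    then show ?thesis using r(1) by auto
  qed
  then show ?case using R(1,2) by auto
qed

text \<open>The hypothesis \<open>closed\<close> stops walks in the target from escaping: all
  neighbours of an image of the \<open>r\<close>-ball are images again. Nothing is known of
  \<open>f\<close> beyond radius \<open>Suc r\<close>, hence the bound
  \<open>m + k \<le> Suc r\<close>.\<close>

lemma nball_image:
  assumes adj: "\<And>u w. u \<in> nball E (Suc r) x \<Longrightarrow> w \<in> nball E (Suc r) x \<Longrightarrow>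
      {f u, f w} \<in> F \<longleftrightarrow> {u, w} \<in> E"
    and closed: "\<And>u w. u \<in> nball E r x \<Longrightarrow> {f u, w} \<in> F \<Longrightarrow> w \<in> f ` nball E (Suc r) x"
    and u: "u \<in> nball E m x" "m + k \<le> Suc r"
  shows "nball F k (f u) = f ` nball E k u"
  using u(2)
proof (induction k)
  case (Suc k)
  then have IH: "nball F k (f u) = f ` nball E k u" by simp
  have sub: "nball E k u \<subseteq> nball E r x"
    using nball_trans[OF u(1), of _ k] nball_mono[of "m + k" r E x] Suc.prems by auto
  have sub': "nball E (Suc k) u \<subseteq> nball E (Suc r) x"
    using nball_trans[OF u(1), of _ "Suc k"] nball_mono[of "m + Suc k" "Suc r" E x] Suc.prems by blast
  have subm: "nball E k u \<subseteq> nball E (Suc r) x" using sub by auto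
  show ?case
  proof
    show "nball F (Suc k) (f u) \<subseteq> f ` nball E (Suc k) u"
    proof
      fix w assume "w \<in> nball F (Suc k) (f u)"
      then consider "w \<in> f ` nball E k u" | v where "v \<in> nball E k u" "{f v, w} \<in> F"
        using IH by auto
      then show "w \<in> f ` nball E (Suc k) u"
      proof cases
        case 1 then show ?thesis by auto
      next
        case 2
        then obtain w' where w': "w' \<in> nball E (Suc r) x" "w = f w'" using closed sub by blast
        then have "{v, w'} \<in> E" using adj[of v w'] 2 subm by blast
        then show ?thesis using 2 w' by auto
      qed
    qed
    show "f ` nball E (Suc k) u \<subseteq> nball F (Suc k) (f u)"
    proof
      fix w assume "w \<in> f ` nball E (Suc k) u"
      then obtain w' where w': "w' \<in> nball E (Suc k) u" "w = f w'" by auto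
      then consider "w' \<in> nball E k u" | v where "v \<in> nball E k u" "{v, w'} \<in> E" by auto
      then show "w \<in> nball F (Suc k) (f u)"
      proof cases
        case 1 then show ?thesis using IH w' by auto
      next
        case 2
        then have "{f v, f w'} \<in> F" using adj[of v w'] subm sub' w'(1) by blast
        then show ?thesis using IH w' 2 by auto
      qed
    qed
  qed
qed simp

text \<open>Moves are copied through \<open>f\<close>. A position within \<open>m\<close> of the
  centre grows to \<open>m + 2 ^ q\<close> in one move, and
  \<open>m + 2 ^ Suc q = (m + 2 ^ q) + 2 ^ q\<close> keeps the invariant of the induction.\<close>

lemma loc_of_ball_iso:
  assumes inj: "inj_on f (nball E (Suc r) x)"
    and adj: "\<And>u w. u \<in> nball E (Suc r) x \<Longrightarrow> w \<in> nball E (Suc r) x \<Longrightarrow>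
      {f u, f w} \<in> F \<longleftrightarrow> {u, w} \<in> E"
    and closed: "\<And>u w. u \<in> nball E r x \<Longrightarrow> {f u, w} \<in> F \<Longrightarrow> w \<in> f ` nball E (Suc r) x"
    and "A \<subseteq> nball E m x" "m + 2 ^ q \<le> Suc r"
  shows "loc q E F ((\<lambda>u. (u, f u)) ` A)"
proof -
  note ball_image = nball_image[OF adj closed]
  have near_image: "near F k (f ` A) = f ` near E k A" if "A \<subseteq> nball E m x" "m + k \<le> Suc r" for A k m
  proof -
    have "near F k (f ` A) = (\<Union>u\<in>A. nball F k (f u))" by (auto simp: near_def)
    also have "\<dots> = (\<Union>u\<in>A. f ` nball E k u)"
      using ball_image that by (intro SUP_cong) auto
    finally show ?thesis by (auto simp: near_def)
  qed
  show ?thesis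
    using assms(4,5)
  proof (induction q arbitrary: A m)
    case 0
    have "A \<subseteq> nball E (Suc r) x" using 0 nball_mono[of m "Suc r" E x] by auto
    show ?case
      unfolding loc.simps partial_iso_def
    proof (intro allI impI)
      fix a b a' b' assume "(a, b) \<in> (\<lambda>u. (u, f u)) ` A" "(a', b') \<in> (\<lambda>u. (u, f u)) ` A"
      then have "a \<in> nball E (Suc r) x" "a' \<in> nball E (Suc r) x" "b = f a" "b' = f a'"
        using \<open>A \<subseteq> nball E (Suc r) x\<close> by auto
      then show "(a = a') = (b = b') \<and> ({a, a'} \<in> E) = ({b, b'} \<in> F)"
        using adj[of a a'] inj_on_eq_iff[OF inj, of a a'] by simp
    qed
  next
    case (Suc q)
    let ?P = "(\<lambda>u. (u, f u)) ` A"
    have D: "Domain ?P = A" "Range ?P = f ` A" by auto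
    have sub: "near E (2 ^ q) A \<subseteq> nball E (m + 2 ^ q) x"
    proof
      fix c assume "c \<in> near E (2 ^ q) A"
      then obtain a where "a \<in> A" "c \<in> nball E (2 ^ q) a" by (auto simp: near_def)
      then show "c \<in> nball E (m + 2 ^ q) x"
        using Suc.prems(1) by (intro nball_trans[of a]) auto
    qed
    have im: "near F (2 ^ q) (f ` A) = f ` near E (2 ^ q) A"
      by (rule near_image[OF Suc.prems(1)]) (use Suc.prems(2) in simp)
    have base: "loc q E F ?P" by (rule Suc.IH[OF Suc.prems(1)]) (use Suc.prems(2) in simp)
    have step: "loc q E F (insert (c, f c) ?P)" if "c \<in> near E (2 ^ q) A" for c
    proof -
      have "insert c A \<subseteq> nball E (m + 2 ^ q) x"
        using that sub Suc.prems(1) nball_mono[of m "m + 2 ^ q" E x] by auto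
      then have "loc q E F ((\<lambda>u. (u, f u)) ` insert c A)"
        by (rule Suc.IH) (use Suc.prems(2) in simp)
      then show ?thesis by simp
    qed
    show ?case unfolding loc.simps D im
      using base step by auto
  qed
qed

section \<open>From local types to first-order sentences\<close>

primrec qd :: "fm \<Rightarrow> nat" where
  "qd (Adj x y) = 0"
| "qd (Eq x y) = 0"
| "qd (Neg \<phi>) = qd \<phi>"
| "qd (Conj \<phi> \<psi>) = max (qd \<phi>) (qd \<psi>)"
| "qd (Ex x \<phi>) = Suc (qd \<phi>)"

text \<open>\<open>Y\<close> stands for the points already played, and the point \<open>w\<close>
  answers a move far from all of them. The single parameter \<open>Q\<close> bounds the number of
  rounds, the number of points played and the exponent of the radius.\<close>

definition rich :: "nat \<Rightarrow> 'a set \<Rightarrow> 'a set set \<Rightarrow> 'b set \<Rightarrow> 'b set set \<Rightarrow> bool" where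
  "rich Q V E W F \<longleftrightarrow> (\<forall>v\<in>V. \<forall>Y. finite Y \<and> Y \<subseteq> W \<and> card Y \<le> Q \<longrightarrow>
     (\<exists>w\<in>W. loc Q E F {(v, w)} \<and> w \<notin> near F (2 ^ Q) Y))"

text \<open>The unrestricted game is won by answering near moves with \<open>loc\<close> and far
  moves with a fresh point from \<open>rich\<close>, joined to the position by
  \<open>loc_Un\<close>. The invariant \<open>card P + q \<le> Q\<close> ensures that the points
  played never exceed what \<open>rich\<close> can avoid.\<close>

lemma sat_eq_of_loc:
  assumes r: "rich Q V E W F" "rich Q W F V E"
    and E: "\<Union>E \<subseteq> V" "\<Union>F \<subseteq> W"
    and "qd \<phi> \<le> q" "loc q E F P" "finite P" "card P + q \<le> Q" "P \<subseteq> V \<times> W"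
    and "\<And>x. x \<in> fv \<phi> \<Longrightarrow> (s x, t x) \<in> P"
  shows "sat V E s \<phi> \<longleftrightarrow> sat W F t \<phi>"
  using assms(5-)
proof (induction \<phi> arbitrary: q P s t)
  case (Adj x y)
  then have "partial_iso E F P" "(s x, t x) \<in> P" "(s y, t y) \<in> P" using loc_partial_iso by auto
  then show ?case unfolding partial_iso_def sat.simps by blast
next
  case (Eq x y)
  then have "partial_iso E F P" "(s x, t x) \<in> P" "(s y, t y) \<in> P" using loc_partial_iso by auto
  then show ?case unfolding partial_iso_def sat.simps by blast
next
  case (Neg \<phi>)
  show ?case using Neg.IH[of q P s t] Neg.prems by simp
next
  case (Conj \<phi> \<psi>)
  show ?case using Conj.IH(1)[of q P s t] Conj.IH(2)[of q P s t] Conj.prems by simp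
next
  case (Ex x \<phi>)
  then obtain q' where q: "q = Suc q'" by (cases q) auto
  have IH: "sat V E (s(x := v)) \<phi> \<longleftrightarrow> sat W F (t(x := w)) \<phi>"
    if "loc q' E F (insert (v, w) P)" "v \<in> V" "w \<in> W" for v w
  proof (rule Ex.IH[OF _ that(1)])
    show "qd \<phi> \<le> q'" "finite (insert (v, w) P)" "insert (v, w) P \<subseteq> V \<times> W"
      using Ex.prems that q by auto
    have "card (insert (v, w) P) \<le> Suc (card P)" by (rule card_insert_le_m1) simp_all
    then show "card (insert (v, w) P) + q' \<le> Q" using Ex.prems(4) q by simp
    show "((s(x := v)) y, (t(x := w)) y) \<in> insert (v, w) P" if "y \<in> fv \<phi>" for y
      using Ex.prems(6) that by auto
  qed
  have l: "loc q' E F P" using Ex.prems(2) q by simp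
  have qQ: "q' \<le> Q" using Ex.prems(4) q by simp
  have pow: "(2::nat) ^ q' \<le> 2 ^ Q" using qQ by (simp add: power_increasing)
  have DV: "Domain P \<subseteq> V" "Range P \<subseteq> W" using Ex.prems(5) by auto
  have fin: "finite (Domain P)" "finite (Range P)" using Ex.prems(3) by (auto simp: finite_Domain finite_Range)
  have cd: "card (Domain P) \<le> Q" "card (Range P) \<le> Q"
    using card_image_le[OF Ex.prems(3), of fst] card_image_le[OF Ex.prems(3), of snd] Ex.prems(4)
    by (auto simp: Domain_fst Range_snd)
  have forth: "\<exists>w\<in>W. loc q' E F (insert (v, w) P)" if v: "v \<in> V" for v
  proof (cases "v \<in> near E (2 ^ q') (Domain P)")
    case True
    then obtain w where w: "w \<in> near F (2 ^ q') (Range P)" "loc q' E F (insert (v, w) P)"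
      using Ex.prems(2) q by auto
    then have "w \<in> W" using near_subset[OF DV(2) E(2)] by blast
    then show ?thesis using w by auto
  next
    case False
    obtain w where w: "w \<in> W" "loc Q E F {(v, w)}" "w \<notin> near F (2 ^ Q) (Range P)"
      using r(1)[unfolded rich_def, rule_format, OF v, of "Range P"] fin cd DV by blast
    have "w \<notin> near F (2 ^ q') (Range P)" using w(3) near_mono[OF pow, of F "Range P"] by blast
    then have "loc q' E F (P \<union> {(v, w)})"
      using False by (intro loc_Un l loc_mono[OF qQ w(2)]) auto
    then show ?thesis using w(1) by auto
  qed
  have backward: "\<exists>v\<in>V. loc q' E F (insert (v, w) P)" if w: "w \<in> W" for w
  proof (cases "w \<in> near F (2 ^ q') (Range P)")
    case True
    then obtain v where v: "v \<in> near E (2 ^ q') (Domain P)" "loc q' E F (insert (v, w) P)"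
      using Ex.prems(2) q by auto
    then have "v \<in> V" using near_subset[OF DV(1) E(1)] by blast
    then show ?thesis using v by auto
  next
    case False
    obtain v where v: "v \<in> V" "loc Q F E {(w, v)}" "v \<notin> near E (2 ^ Q) (Domain P)"
      using r(2)[unfolded rich_def, rule_format, OF w, of "Domain P"] fin cd DV by blast
    have "v \<notin> near E (2 ^ q') (Domain P)" using v(3) near_mono[OF pow, of E "Domain P"] by blast
    then have "loc q' E F (P \<union> {(v, w)})"
      using False by (intro loc_Un l loc_mono[OF qQ loc_sym1[OF v(2)]]) auto
    then show ?thesis using v(1) by auto
  qed
  show ?case using IH forth backward by (simp only: sat.simps) blast
qed

lemma loc_empty: "loc q E F {}"
  by (induction q) (auto simp: partial_iso_def near_def)

lemma models_eq_of_rich: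
  assumes "rich Q V E W F" "rich Q W F V E" "\<Union>E \<subseteq> V" "\<Union>F \<subseteq> W"
    and "sentence \<phi>" "qd \<phi> \<le> Q"
  shows "models V E \<phi> \<longleftrightarrow> models W F \<phi>"
proof -
  have "sat V E s \<phi> \<longleftrightarrow> sat W F t \<phi>" for s t
    using assms(5,6) by (intro sat_eq_of_loc[OF assms(1-4), of _ Q "{}"])
      (auto simp: loc_empty sentence_def)
  then show ?thesis using models_sentence[OF assms(5)] by metis
qed

subsection \<open>Weighted sums over step lists\<close>

locale distance_graph =
  fixes p :: "nat \<Rightarrow> real" and lstar :: nat
  assumes prob: "prob_seq p"
    and lstar: "{l. l \<ge> 1 \<and> p l = 1} = {lstar}"
    and log_prod: "(\<lambda>n. ln (\<Prod>l\<in>{1..n} - {lstar}. 1 - p l) / ln (real n)) \<longlonglongrightarrow> 0"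
    and no_circles: "no_unavoidable_circles p"
    and diverges: "filterlim (\<lambda>n. \<Sum>l=1..n. p l) at_top sequentially"
    and square_summable: "summable (\<lambda>l. (p (Suc l))\<^sup>2)"
begin

lemma p_nonneg: "l \<ge> 1 \<Longrightarrow> 0 \<le> p l" and p_le_1: "l \<ge> 1 \<Longrightarrow> p l \<le> 1"
  using prob by (auto simp: prob_seq_def)

lemma lstar_ge_1: "lstar \<ge> 1" and p_lstar: "p lstar = 1"
  using lstar by auto

lemma p_less_1: "l \<ge> 1 \<Longrightarrow> l \<noteq> lstar \<Longrightarrow> p l < 1"
  using lstar p_le_1[of l] by (metis (mono_tags, lifting) mem_Collect_eq order_le_less singletonD)

text \<open>The value \<open>p 0\<close> is unconstrained, so the step 0 is given weight 0
  explicitly; positive weight then characterizes the possible steps.\<close>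

definition wgt :: "int \<Rightarrow> real" where
  "wgt s = (if s = 0 then 0 else p (nat \<bar>s\<bar>))"

lemma wgt_nonneg [simp]: "0 \<le> wgt s" and wgt_le_1 [simp]: "wgt s \<le> 1"
  by (auto simp: wgt_def intro!: p_nonneg p_le_1)

lemma wgt_minus [simp]: "wgt (- s) = wgt s"
  by (simp add: wgt_def)

lemma wgt_lstar [simp]: "wgt (int lstar) = 1"
  using lstar_ge_1 p_lstar by (simp add: wgt_def)

lemma wgt_pos_neq_0: "wgt s \<noteq> 0 \<Longrightarrow> s \<noteq> 0"
  by (auto simp: wgt_def)

lemma wgt_0 [simp]: "wgt 0 = 0"
  by (simp add: wgt_def)

text \<open>The partial sums of \<open>xs\<close>, shifted into the positive integers, form a
  possible circle: \<open>dist\<close> makes its vertices distinct and \<open>no_opp\<close>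
  excludes an edge traversed back. Without opposite steps every symmetric partition has empty
  symmetric part, so the bound reaches all steps whichever partition was fixed.\<close>

lemma zero_sum_circle:
  assumes "length xs = k" "\<And>s. s \<in> set xs \<Longrightarrow> wgt s > 0" "sum_list xs = 0"
    and no_opp: "\<And>s. s \<in> set xs \<Longrightarrow> - s \<notin> set xs"
    and dist: "\<And>i j. i < j \<Longrightarrow> j < k \<Longrightarrow> sum_list (take i xs) \<noteq> sum_list (take j xs)"
    and m: "\<forall>n x. set x \<subseteq> {1..n} \<and> possible p x \<and> circle k x \<longrightarrow> (\<forall>i\<in>Asym x. \<bar>step x i\<bar> \<le> int m)"
    and "s \<in> set xs"
  shows "\<bar>s\<bar> \<le> int m"
proof -
  \<comment> \<open>Exceeds every partial sum in absolute value, so all vertices lie between 1 and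
    \<open>c + c\<close>.\<close>
  define c where "c = 1 + (\<Sum>s\<leftarrow>xs. \<bar>s\<bar>)"
  define S where "S = (\<lambda>i. c + sum_list (take i xs))"
  have part: "\<bar>sum_list (take i xs)\<bar> \<le> (\<Sum>s\<leftarrow>xs. \<bar>s\<bar>)" for i
  proof -
    have "\<bar>sum_list (take i xs)\<bar> \<le> (\<Sum>s\<leftarrow>take i xs. \<bar>s\<bar>)" by (rule sum_list_abs)
    also have "\<dots> \<le> (\<Sum>s\<leftarrow>take i xs. \<bar>s\<bar>) + (\<Sum>s\<leftarrow>drop i xs. \<bar>s\<bar>)"
      by (auto intro!: sum_list_nonneg)
    also have "\<dots> = (\<Sum>s\<leftarrow>take i xs @ drop i xs. \<bar>s\<bar>)" by (simp only: map_append sum_list_append)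
    finally show ?thesis by simp
  qed
  have S1: "S i \<ge> 1" for i using part[of i] by (simp add: S_def c_def)
  define x where "x = map (\<lambda>i. nat (S i)) [0..<Suc k]"
  have len: "length x = Suc k" by (simp add: x_def)
  have xi: "int (x ! i) = S i" if "i \<le> k" for i
    using that S1[of i] nth_map_upt[of i "Suc k" 0 "\<lambda>i. nat (S i)"] by (simp add: x_def)
  have step: "step x i = xs ! i" if "i < k" for i
    using that xi[of i] xi[of "Suc i"] assms(1)
    by (simp add: step_def S_def take_Suc_conv_app_nth)
  have pos: "wgt (xs ! i) > 0" if "i < k" for i using that assms(1,2) by simp
  have "set x \<subseteq> {1..nat (c + c)}"
  proof
    fix y assume "y \<in> set x"
    then obtain i where "y = nat (S i)" by (auto simp: x_def)
    moreover have "S i \<le> c + c" using part[of i] by (simp add: S_def c_def)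
    ultimately show "y \<in> {1..nat (c + c)}"
      using S1[of i] by (simp add: Suc_le_eq nat_mono)
  qed
  moreover have "possible p x"
    unfolding possible_def
  proof (intro allI impI conjI)
    fix i assume "i < length x - 1"
    then have i: "i < k" using len by simp
    have "step x i \<noteq> 0" using step[OF i] pos[OF i] wgt_pos_neq_0 by auto
    then show "x ! Suc i \<noteq> x ! i" by (auto simp: step_def)
    show "p (nat \<bar>step x i\<bar>) > 0" using \<open>step x i \<noteq> 0\<close> pos[OF i] step[OF i] by (simp add: wgt_def)
  qed
  moreover have "circle k x"
    unfolding circle_def
  proof (intro conjI len)
    have "int (x ! 0) = int (x ! k)" using assms(1,3) by (simp add: xi S_def)
    then show x0: "x ! 0 = x ! k" by simp
    have ne: "x ! i \<noteq> x ! j" if "i < j" "j < k" for i j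
    proof -
      have "int (x ! i) \<noteq> int (x ! j)" using dist[OF that] that by (simp add: xi S_def)
      then show ?thesis by auto
    qed
    show "inj_on (\<lambda>i. {x ! i, x ! Suc i}) {..<k}"
    proof (rule inj_onI)
      fix i j assume ij: "i \<in> {..<k}" "j \<in> {..<k}" "{x ! i, x ! Suc i} = {x ! j, x ! Suc j}"
      show "i = j"
      proof (cases "x ! i = x ! j")
        case True
        then show ?thesis using ne[of i j] ne[of j i] ij by (cases i j rule: linorder_cases) auto
      next
        case False
        then have "x ! i = x ! Suc j" "x ! Suc i = x ! j" using ij(3) by (auto simp: doubleton_eq_iff)
        then have "step x j = - step x i" by (simp add: step_def)
        then have "xs ! j = - (xs ! i)" using step ij by simp
        then show ?thesis using no_opp[of "xs ! i"] ij assms(1) by (metis lessThan_iff nth_mem)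
      qed
    qed
  qed
  ultimately have A: "\<bar>step x i\<bar> \<le> int m" if "i \<in> Asym x" for i using m that by blast
  have "symmetric_partition x (Sym x, Asym x)" by (rule symmetric_partition_Sym_Asym)
  then obtain P where P: "Sym x \<union> Asym x = {..<k}" "partition_on (Sym x) P"
    "\<forall>e\<in>P. \<exists>i i'. i \<noteq> i' \<and> e = {i, i'} \<and> step x i + step x i' = 0"
    using len by (auto simp: symmetric_partition_def)
  have "P = {}"
  proof (rule ccontr)
    assume "P \<noteq> {}"
    then obtain e where "e \<in> P" by blast
    then obtain i i' where i: "e = {i, i'}" "step x i + step x i' = 0" using P(3) by blast
    have "e \<subseteq> Sym x" using P(2) \<open>e \<in> P\<close> partition_onD1 by auto
    then have "i < k" "i' < k" using P(1) i(1) by auto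
    then have "xs ! i' = - (xs ! i)" using i(2) step by simp
    then show False using no_opp[of "xs ! i"] \<open>i < k\<close> \<open>i' < k\<close> assms(1) by (metis nth_mem)
  qed
  then have "Sym x = {}" using P(2) partition_onD1 by auto
  then have "Asym x = {..<k}" using P(1) by simp
  moreover obtain i where "i < k" "s = xs ! i" using \<open>s \<in> set xs\<close> assms(1) by (auto simp: in_set_conv_nth)
  ultimately show ?thesis using A[of i] step[of i] by simp
qed

text \<open>Induction on the length: a repeated partial sum splits the list into two shorter
  zero-sum lists, which inherit the absence of opposite steps; if there is none,
  \<open>zero_sum_circle\<close> applies.\<close>

lemma zero_sum_bounded:
  "\<exists>m. \<forall>xs. length xs \<le> k \<and> (\<forall>s\<in>set xs. wgt s > 0 \<and> - s \<notin> set xs) \<and> sum_list xs = 0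
     \<longrightarrow> (\<forall>s\<in>set xs. \<bar>s\<bar> \<le> int m)"
proof -
  from no_circles obtain mm where mm: "\<And>k n x. set x \<subseteq> {1..n} \<and> possible p x \<and> circle k x \<longrightarrow>
        (\<forall>i\<in>Asym x. \<bar>step x i\<bar> \<le> int (mm k))"
    unfolding no_unavoidable_circles_def by metis
  define m where "m = Max (mm ` {..k})"
  have mk: "mm j \<le> m" if "j \<le> k" for j
    unfolding m_def using that by (intro Max_ge) auto
  have "\<bar>s\<bar> \<le> int m"
    if "length xs \<le> k" "\<forall>s\<in>set xs. wgt s > 0 \<and> - s \<notin> set xs" "sum_list xs = 0" "s \<in> set xs" for xs s
    using that
  proof (induction "length xs" arbitrary: xs rule: less_induct)
    case less
    show ?case
    proof (cases "\<exists>i j. i < j \<and> j < length xs \<and> sum_list (take i xs) = sum_list (take j xs)")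
      case True
      then obtain i j where ij: "i < j" "j < length xs" "sum_list (take i xs) = sum_list (take j xs)"
        by blast
      define mid where "mid = drop i (take j xs)"
      have xs: "xs = take i xs @ mid @ drop j xs"
        using ij unfolding mid_def
        by (metis append.assoc append_take_drop_id less_or_eq_imp_le min.absorb1 take_take)
      have "take j xs = take i xs @ mid"
        using ij unfolding mid_def by (metis append_take_drop_id less_or_eq_imp_le min.absorb1 take_take)
      then have s0: "sum_list mid = 0" using ij(3) by (metis add_cancel_right_right sum_list_append)
      then have s1: "sum_list (take i xs @ drop j xs) = 0"
        using less.prems(3) by (subst (asm) xs) simp
      have sets: "set xs = set mid \<union> set (take i xs @ drop j xs)" by (subst xs) auto
      have l: "length mid < length xs" "length (take i xs @ drop j xs) < length xs"
        using ij by (auto simp: mid_def)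
      have a: "\<forall>s\<in>set ys. 0 < wgt s \<and> - s \<notin> set ys" if "set ys \<subseteq> set xs" for ys
        using less.prems(2) that by blast
      consider "s \<in> set mid" | "s \<in> set (take i xs @ drop j xs)" using less.prems(4) sets by blast
      then show ?thesis
      proof cases
        case 1
        show ?thesis
          by (rule less.hyps[OF l(1) _ a s0 1]) (use l(1) less.prems(1) sets in auto)
      next
        case 2
        show ?thesis
          by (rule less.hyps[OF l(2) _ a s1 2]) (use l(2) less.prems(1) sets in auto)
      qed
    next
      case False
      have "\<bar>s\<bar> \<le> int (mm (length xs))"
        by (rule zero_sum_circle[of xs "length xs"]) (use less.prems False mm in blast)+
      then show ?thesis using mk[OF less.prems(1)] by simp
    qed
  qed
  then show ?thesis by blast
qed

text \<open>Cancelling pairs are removed one at a time, which keeps the sum zero. Either some pair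
  contains \<open>s\<close>, or a list without pairs is reached and \<open>zero_sum_bounded\<close>
  contradicts the size of \<open>s\<close>.\<close>

lemma zero_sum_opposite:
  "\<exists>m. \<forall>xs. length xs \<le> k \<and> (\<forall>s\<in>set xs. wgt s > 0) \<and> sum_list xs = 0
     \<longrightarrow> (\<forall>s\<in>set xs. \<bar>s\<bar> > int m \<longrightarrow> - s \<in> set xs)"
proof -
  from zero_sum_bounded[of k] obtain m where m: "\<And>xs s. length xs \<le> k \<Longrightarrow>
    (\<forall>s\<in>set xs. wgt s > 0 \<and> - s \<notin> set xs) \<Longrightarrow> sum_list xs = 0 \<Longrightarrow> s \<in> set xs \<Longrightarrow> \<bar>s\<bar> \<le> int m"
    by blast
  have "- s \<in> set xs"
    if "length xs \<le> k" "\<forall>s\<in>set xs. wgt s > 0" "sum_list xs = 0" "s \<in> set xs" "\<bar>s\<bar> > int m" for xs s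
    using that
  proof (induction "length xs" arbitrary: xs rule: less_induct)
    case less
    show ?case
    proof (cases "\<exists>a\<in>set xs. - a \<in> set xs")
      case False
      then have "\<bar>s\<bar> \<le> int m" using m less.prems by blast
      then show ?thesis using less.prems by simp
    next
      case True
      then obtain a where a: "a \<in> set xs" "- a \<in> set xs" by blast
      then have a0: "a \<noteq> - a" using less.prems(2) wgt_pos_neq_0 by force
      show ?thesis
      proof (cases "s = a \<or> s = - a")
        case True
        then show ?thesis using a by auto
      next
        case s: False
        define ys where "ys = remove1 (- a) (remove1 a xs)"
        have ma: "- a \<in> set (remove1 a xs)" using a a0 by (metis in_set_remove1)
        have sub: "set ys \<subseteq> set xs" unfolding ys_def by (meson notin_set_remove1 subsetI)
        have len: "length ys < length xs"
          using a(1) ma by (simp add: ys_def length_remove1) (use length_pos_if_in_set in force)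
        have "sum_list xs = a + sum_list (remove1 a xs)" using sum_list_map_remove1[OF a(1), of id] by simp
        also have "sum_list (remove1 a xs) = - a + sum_list ys"
          unfolding ys_def using sum_list_map_remove1[OF ma, of id] by simp
        finally have "sum_list ys = 0" using less.prems by simp
        moreover have "s \<in> set ys" using s less.prems(4) by (simp add: ys_def in_set_remove1)
        ultimately have "- s \<in> set ys"
          using less.hyps[OF len] less.prems len sub by auto
        then show ?thesis using sub by blast
      qed
    qed
  qed
  then show ?thesis by blast
qed

section \<open>Weights of step lists with prescribed sum\<close>

definition step_lists :: "nat \<Rightarrow> nat \<Rightarrow> int \<Rightarrow> int list set" where
  "step_lists k N t = {xs. length xs = k \<and> set xs \<subseteq> {- int N..int N} \<and> sum_list xs = t}"

definition wt :: "int list \<Rightarrow> real" where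
  "wt xs = prod_list (map wgt xs)"

text \<open>The \<open>k\<close>-fold convolution of \<open>wgt\<close> at \<open>t\<close>,
  truncated to steps of size at most \<open>N\<close> to keep the sum finite. All bounds below are
  uniform in \<open>N\<close>.\<close>

definition conv :: "nat \<Rightarrow> nat \<Rightarrow> int \<Rightarrow> real" where
  "conv k N t = (\<Sum>xs\<in>step_lists k N t. wt xs)"

lemma wt_nonneg [simp]: "0 \<le> wt xs"
  unfolding wt_def by (rule prod_list_nonneg) auto

lemma wt_le_1 [simp]: "wt xs \<le> 1"
proof (induction xs)
  case (Cons a xs)
  have "wgt a * wt xs \<le> 1 * 1" using Cons by (intro mult_mono) auto
  then show ?case by (simp add: wt_def)
qed (simp add: wt_def)

lemma wt_simps [simp]: "wt [] = 1" "wt (a # xs) = wgt a * wt xs" "wt (xs @ ys) = wt xs * wt ys"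
  by (simp_all add: wt_def)

lemma wt_le_member: "s \<in> set xs \<Longrightarrow> wt xs \<le> wgt s"
proof -
  assume "s \<in> set xs"
  then obtain us vs where "xs = us @ s # vs" by (meson split_list)
  then have "wt xs = (wt us * wt vs) * wgt s" by simp
  also have "\<dots> \<le> 1 * wgt s" by (intro mult_right_mono mult_le_one) auto
  finally show ?thesis by simp
qed

lemma wt_neq_0: "wt xs \<noteq> 0 \<Longrightarrow> s \<in> set xs \<Longrightarrow> wgt s > 0"
  using wt_le_member[of s xs] wt_nonneg[of xs] by linarith

lemma finite_step_lists [simp]: "finite (step_lists k N t)"
  unfolding step_lists_def by (rule finite_subset[OF _ finite_lists_length_eq[of "{- int N..int N}" k]]) auto

lemma conv_nonneg [simp]: "0 \<le> conv k N t"
  unfolding conv_def by (intro sum_nonneg) simp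

text \<open>A list containing \<open>a\<close> and \<open>- a\<close> arises from a list shorter by
  two, with the same sum, by two insertions: at most \<open>(k + 2)\<^sup>2\<close> pairs of
  positions, and a factor \<open>(wgt a)\<^sup>2\<close> in the weight. Counting a list several
  times does no harm to an upper bound.\<close>

lemma pair_sum_bound:
  assumes T: "T \<subseteq> step_lists (Suc (Suc k)) N t"
    and D: "D \<subseteq> {- int N..int N}"
    and opp: "\<And>xs. xs \<in> T \<Longrightarrow> wt xs \<noteq> 0 \<Longrightarrow> \<exists>a\<in>D. a \<noteq> 0 \<and> a \<in> set xs \<and> - a \<in> set xs"
  shows "(\<Sum>xs\<in>T. wt xs) \<le> (real k + 2)\<^sup>2 * (\<Sum>a\<in>D. (wgt a)\<^sup>2) * conv k N t"
proof -
  define ins where "ins = (\<lambda>i (a :: int) ys. take i ys @ a # drop i ys)"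
  define I where "I = {..<Suc (Suc k)} \<times> {..<Suc (Suc k)} \<times> D \<times> step_lists k N t"
  define f where "f = (\<lambda>(i, j, a, ys). ins i a (ins j (- a) ys))"
  have finD: "finite D" using D finite_subset by blast
  have finI: "finite I" unfolding I_def using finD by simp
  have wins: "wt (ins i a ys) = wgt a * wt ys" for i a ys
  proof -
    have "wt ys = wt (take i ys @ drop i ys)" by simp
    then show ?thesis unfolding ins_def by (simp only: wt_simps) simp
  qed
  have sins: "sum_list (ins i a ys) = a + sum_list ys" for i a ys
  proof -
    have "sum_list ys = sum_list (take i ys @ drop i ys)" by simp
    then show ?thesis unfolding ins_def by (simp only: sum_list_append sum_list.Cons)
  qed
  have setins: "set (ins i a ys) = insert a (set ys)" for i a ys
  proof -
    have "set ys = set (take i ys) \<union> set (drop i ys)" by (metis append_take_drop_id set_append)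
    then show ?thesis unfolding ins_def by simp
  qed
  have lins: "length (ins i a ys) = Suc (length ys)" for i a ys by (simp add: ins_def)
  have ex_ins: "\<exists>i<length xs. \<exists>ys. xs = ins i a ys" if mem: "a \<in> set xs" for a xs
  proof -
    obtain us vs where "xs = us @ a # vs" using mem by (meson split_list)
    then have "xs = ins (length us) a (us @ vs)" by (simp add: ins_def)
    moreover have "length us < length xs" using \<open>xs = us @ a # vs\<close> by simp
    ultimately show ?thesis by blast
  qed
  have "xs \<in> f ` I" if xs: "xs \<in> T" "wt xs \<noteq> 0" for xs
  proof -
    obtain a where a: "a \<in> D" "a \<noteq> 0" "a \<in> set xs" "- a \<in> set xs" using opp xs by blast
    have L: "length xs = Suc (Suc k)" "set xs \<subseteq> {- int N..int N}" "sum_list xs = t"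
      using T xs by (auto simp: step_lists_def)
    obtain i ys where i: "i < length xs" "xs = ins i a ys" using ex_ins a(3) by blast
    have "- a \<in> set ys" using a i(2) by (auto simp: setins)
    then obtain j zs where j: "j < length ys" "ys = ins j (- a) zs" using ex_ins by blast
    have "zs \<in> step_lists k N t"
      using L i j by (auto simp: step_lists_def lins sins setins)
    then have "(i, j, a, zs) \<in> I" using i j L a by (auto simp: I_def lins)
    moreover have "xs = f (i, j, a, zs)" using i j by (simp add: f_def)
    ultimately show ?thesis by blast
  qed
  then have sub: "{xs \<in> T. wt xs \<noteq> 0} \<subseteq> f ` I" by blast
  have "finite T" using T finite_subset finite_step_lists by blast
  then have "(\<Sum>xs\<in>T. wt xs) = (\<Sum>xs\<in>{xs \<in> T. wt xs \<noteq> 0}. wt xs)"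
    by (intro sum.mono_neutral_right) auto
  also have "\<dots> \<le> (\<Sum>xs\<in>f ` I. wt xs)"
    using sub finI by (intro sum_mono2) auto
  also have "\<dots> \<le> (\<Sum>z\<in>I. wt (f z))"
    using sum_image_le[of I wt f] finI by (simp add: o_def)
  also have "\<dots> = (\<Sum>z\<in>I. case z of (i, j, a, ys) \<Rightarrow> (wgt a)\<^sup>2 * wt ys)"
    by (intro sum.cong refl) (auto simp: f_def wins power2_eq_square)
  also have "\<dots> = (real k + 2)\<^sup>2 * (\<Sum>a\<in>D. (wgt a)\<^sup>2) * conv k N t"
    unfolding I_def conv_def
    by (simp add: sum.cartesian_product[symmetric] sum_product[symmetric] power2_eq_square add.commute)
  finally show ?thesis .
qed

lemma square_sum_eq:
  "(\<Sum>a\<in>{a \<in> {- int N..int N}. \<bar>a\<bar> > int M}. (wgt a)\<^sup>2) = 2 * (\<Sum>l\<in>{M..<N}. (p (Suc l))\<^sup>2)"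
proof -
  let ?f = "\<lambda>l. int (Suc l)" and ?g = "\<lambda>l. - int (Suc l)"
  have eq: "{a \<in> {- int N..int N}. \<bar>a\<bar> > int M} = ?f ` {M..<N} \<union> ?g ` {M..<N}" (is "?A = ?B")
  proof
    show "?A \<subseteq> ?B"
    proof
      fix a assume a: "a \<in> ?A"
      then have "nat \<bar>a\<bar> - 1 \<in> {M..<N}" by auto
      moreover have "a = ?f (nat \<bar>a\<bar> - 1) \<or> a = ?g (nat \<bar>a\<bar> - 1)" using a by auto
      ultimately show "a \<in> ?B" by blast
    qed
  qed auto
  have "(\<Sum>a\<in>?f ` {M..<N}. (wgt a)\<^sup>2) = (\<Sum>l\<in>{M..<N}. (p (Suc l))\<^sup>2)"
    by (subst sum.reindex) (auto simp: inj_on_def wgt_def nat_add_distrib)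
  moreover have "(\<Sum>a\<in>?g ` {M..<N}. (wgt a)\<^sup>2) = (\<Sum>l\<in>{M..<N}. (p (Suc l))\<^sup>2)"
    by (subst sum.reindex) (auto simp: inj_on_def wgt_def nat_add_distrib)
  moreover have "?f ` {M..<N} \<inter> ?g ` {M..<N} = {}" by auto
  ultimately show ?thesis unfolding eq by (subst sum.union_disjoint) auto
qed

lemma square_sum_bounded: "\<exists>B\<ge>0. \<forall>N. (\<Sum>a\<in>{- int N..int N}. (wgt a)\<^sup>2) \<le> B"
proof (intro exI[of _ "2 * (\<Sum>l. (p (Suc l))\<^sup>2)"] conjI allI)
  show "0 \<le> 2 * (\<Sum>l. (p (Suc l))\<^sup>2)" by (simp add: suminf_nonneg[OF square_summable])
  fix N
  have "(\<Sum>a\<in>{- int N..int N}. (wgt a)\<^sup>2) = (\<Sum>a\<in>{a \<in> {- int N..int N}. \<bar>a\<bar> > int 0}. (wgt a)\<^sup>2)"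
    by (intro sum.mono_neutral_right) (auto simp: wgt_def)
  also have "\<dots> = 2 * (\<Sum>l\<in>{0..<N}. (p (Suc l))\<^sup>2)" by (rule square_sum_eq)
  also have "\<dots> \<le> 2 * (\<Sum>l. (p (Suc l))\<^sup>2)"
    by (intro mult_left_mono sum_le_suminf[OF square_summable]) auto
  finally show "(\<Sum>a\<in>{- int N..int N}. (wgt a)\<^sup>2) \<le> 2 * (\<Sum>l. (p (Suc l))\<^sup>2)" .
qed

lemma square_sum_tail:
  assumes "e > 0"
  shows "\<exists>M\<ge>M0. \<forall>N. (\<Sum>a\<in>{a \<in> {- int N..int N}. \<bar>a\<bar> > int M}. (wgt a)\<^sup>2) \<le> e"
proof -
  obtain M where M: "\<And>m n. m \<ge> M \<Longrightarrow> norm (\<Sum>l\<in>{m..<n}. (p (Suc l))\<^sup>2) < e / 2"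
    using square_summable assms unfolding summable_Cauchy by (meson half_gt_zero)
  have "2 * (\<Sum>l\<in>{max M M0..<N}. (p (Suc l))\<^sup>2) \<le> e" for N
    using M[of "max M M0" N] by (simp add: sum_nonneg)
  then show ?thesis unfolding square_sum_eq by (intro exI[of _ "max M M0"] conjI allI) auto
qed

lemma p_tendsto_0: "p \<longlonglongrightarrow> 0"
proof -
  have "(\<lambda>l. (p (Suc l))\<^sup>2) \<longlonglongrightarrow> 0" by (rule summable_LIMSEQ_zero[OF square_summable])
  then have "(\<lambda>l. sqrt ((p (Suc l))\<^sup>2)) \<longlonglongrightarrow> sqrt 0" by (rule tendsto_real_sqrt)
  then have "(\<lambda>l. p (Suc l)) \<longlonglongrightarrow> 0" by (simp add: p_nonneg)
  then show ?thesis by (simp only: filterlim_sequentially_Suc)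
qed

lemma wgt_small:
  assumes "e > 0"
  shows "\<exists>L. \<forall>s. \<bar>s\<bar> \<ge> int L \<longrightarrow> wgt s \<le> e"
proof -
  obtain L where L: "\<And>l. l \<ge> L \<Longrightarrow> norm (p l - 0) < e"
    using LIMSEQ_D[OF p_tendsto_0 assms] by blast
  have "wgt s \<le> e" if "\<bar>s\<bar> \<ge> int L" for s
  proof -
    have "L \<le> nat \<bar>s\<bar>" using that by linarith
    then show ?thesis using L[of "nat \<bar>s\<bar>"] assms by (auto simp: wgt_def)
  qed
  then show ?thesis by blast
qed

text \<open>Two step lists with the same sum differ by a zero-sum list; hence every large step
  of the first that does not occur in the second is cancelled within the first.\<close>

lemma conv_rec:
  "\<exists>c B. B \<ge> 0 \<and> (\<forall>N t. \<exists>G\<subseteq>step_lists (Suc (Suc k)) N t. card G \<le> c \<and>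
     conv (Suc (Suc k)) N t \<le> (\<Sum>xs\<in>G. wt xs) + B * conv k N t)"
proof -
  let ?k = "Suc (Suc k)"
  obtain m where m: "\<And>xs s. length xs \<le> 2 * ?k \<Longrightarrow> (\<forall>s\<in>set xs. wgt s > 0) \<Longrightarrow> sum_list xs = 0 \<Longrightarrow>
     s \<in> set xs \<Longrightarrow> \<bar>s\<bar> > int m \<Longrightarrow> - s \<in> set xs"
    using zero_sum_opposite[of "2 * ?k"] by blast
  obtain B where B: "B \<ge> 0" "\<And>N. (\<Sum>a\<in>{- int N..int N}. (wgt a)\<^sup>2) \<le> B"
    using square_sum_bounded by blast
  have main: "\<exists>G\<subseteq>step_lists ?k N t. card G \<le> (2 * m + 1 + ?k) ^ ?k \<and>
     conv ?k N t \<le> (\<Sum>xs\<in>G. wt xs) + (real k + 2)\<^sup>2 * B * conv k N t" for N t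
  proof (cases "\<exists>xs\<in>step_lists ?k N t. wt xs \<noteq> 0")
    case False
    then have "conv ?k N t = 0" by (simp add: conv_def)
    then show ?thesis using B(1) by (intro exI[of _ "{}"]) simp
  next
    case True
    then obtain w0 where w0: "w0 \<in> step_lists ?k N t" "wt w0 \<noteq> 0" by blast
    \<comment> \<open>The fixed list \<open>w0\<close> serves as reference. The bound on the size of
      \<open>S\<close> depends on neither \<open>N\<close> nor \<open>t\<close>, and hence neither
      does the bound on the number of lists in \<open>G\<close>.\<close>
    define S where "S = set w0 \<union> {- int m..int m}"
    define G where "G = {xs \<in> step_lists ?k N t. set xs \<subseteq> S}"
    have finS: "finite S" by (simp add: S_def)
    have cS: "card S \<le> 2 * m + 1 + ?k"
    proof -
      have "card S \<le> card (set w0) + card {- int m..int m}" unfolding S_def by (rule card_Un_le)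
      also have "card (set w0) \<le> ?k" using card_length[of w0] w0(1) by (simp add: step_lists_def)
      finally show ?thesis by simp
    qed
    have "card G \<le> card {xs. set xs \<subseteq> S \<and> length xs = ?k}"
      by (rule card_mono[OF finite_lists_length_eq[OF finS]]) (auto simp: G_def step_lists_def)
    also have "\<dots> = card S ^ ?k" by (rule card_lists_length_eq[OF finS])
    also have "\<dots> \<le> (2 * m + 1 + ?k) ^ ?k" by (rule power_mono[OF cS]) simp
    finally have cG: "card G \<le> (2 * m + 1 + ?k) ^ ?k" .
    let ?T = "step_lists ?k N t - G"
    have opp: "\<exists>a\<in>{- int N..int N}. a \<noteq> 0 \<and> a \<in> set xs \<and> - a \<in> set xs" if xs: "xs \<in> ?T" "wt xs \<noteq> 0" for xs
    proof -
      obtain a where a: "a \<in> set xs" "a \<notin> S" using xs by (auto simp: G_def)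
      let ?z = "xs @ map uminus w0"
      have "sum_list (map uminus w0) = - sum_list w0" by (induction w0) auto
      then have "sum_list ?z = 0" using xs w0 by (simp add: step_lists_def)
      moreover have "length ?z \<le> 2 * ?k" using xs w0 by (simp add: step_lists_def)
      moreover have "\<forall>s\<in>set ?z. wgt s > 0" using wt_neq_0[OF xs(2)] wt_neq_0[OF w0(2)] by auto
      moreover have "\<bar>a\<bar> > int m" "a \<noteq> 0" "a \<in> set ?z" using a by (auto simp: S_def)
      ultimately have "- a \<in> set ?z" using m by blast
      moreover have "- a \<notin> set (map uminus w0)" using a(2) by (auto simp: S_def)
      ultimately have "- a \<in> set xs" by simp
      moreover have "a \<in> {- int N..int N}" using a(1) xs(1) by (auto simp: step_lists_def)
      ultimately show ?thesis using a \<open>a \<noteq> 0\<close> by blast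
    qed
    have "conv ?k N t = (\<Sum>xs\<in>?T. wt xs) + (\<Sum>xs\<in>G. wt xs)"
      unfolding conv_def by (rule sum.subset_diff) (auto simp: G_def)
    also have "(\<Sum>xs\<in>?T. wt xs) \<le> (real k + 2)\<^sup>2 * (\<Sum>a\<in>{- int N..int N}. (wgt a)\<^sup>2) * conv k N t"
      by (rule pair_sum_bound[OF _ _ opp]) auto
    also have "\<dots> \<le> (real k + 2)\<^sup>2 * B * conv k N t"
      using B by (intro mult_right_mono mult_left_mono) auto
    finally have "conv ?k N t \<le> (\<Sum>xs\<in>G. wt xs) + (real k + 2)\<^sup>2 * B * conv k N t" by simp
    then show ?thesis using cG by (intro exI[of _ G]) (auto simp: G_def)
  qed
  show ?thesis
    by (intro exI[of _ "(2 * m + 1 + ?k) ^ ?k"] exI[of _ "(real k + 2)\<^sup>2 * B"] conjI allI main)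
      (simp add: B(1))
qed

lemma step_lists_0: "step_lists 0 N t \<subseteq> {[]}" and step_lists_1: "step_lists (Suc 0) N t \<subseteq> {[t]}"
  by (auto simp: step_lists_def length_Suc_conv)

text \<open>Recursion by twos: the exceptional lists of \<open>conv_rec\<close> have weight at most
  1 and are boundedly many. In the random graph this bounds the expected number of paths of
  \<open>k\<close> edges between two given vertices.\<close>

lemma conv_bounded: "\<exists>C\<ge>0. \<forall>N t. conv k N t \<le> C"
proof (induction k rule: induct_nat_012)
  case 0
  have "conv 0 N t \<le> (\<Sum>xs\<in>{[]}. wt xs)" for N t
    unfolding conv_def using step_lists_0 by (intro sum_mono2) auto
  then show ?case by (intro exI[of _ 1]) simp
next
  case 1
  have "conv (Suc 0) N t \<le> (\<Sum>xs\<in>{[t]}. wt xs)" for N t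
    unfolding conv_def using step_lists_1 by (intro sum_mono2) auto
  then have "conv (Suc 0) N t \<le> wgt t" for N t by simp
  then have "conv (Suc 0) N t \<le> 1" for N t using wgt_le_1 order_trans by blast
  then show ?case by (intro exI[of _ 1]) simp
next
  case (ge2 k)
  obtain C where C: "C \<ge> 0" "\<And>N t. conv k N t \<le> C" using ge2 by blast
  obtain c B where cB: "B \<ge> 0" "\<And>N t. \<exists>G\<subseteq>step_lists (Suc (Suc k)) N t. card G \<le> c \<and>
     conv (Suc (Suc k)) N t \<le> (\<Sum>xs\<in>G. wt xs) + B * conv k N t" using conv_rec[of k] by blast
  have "conv (Suc (Suc k)) N t \<le> real c + B * C" for N t
  proof -
    obtain G where G: "card G \<le> c" "conv (Suc (Suc k)) N t \<le> (\<Sum>xs\<in>G. wt xs) + B * conv k N t"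
      using cB(2) by blast
    have "(\<Sum>xs\<in>G. wt xs) \<le> of_nat (card G) * 1" by (rule sum_bounded_above) simp
    also have "\<dots> \<le> real c" using G(1) by simp
    finally show ?thesis using G(2) mult_left_mono[OF C(2) cB(1), of N t] by linarith
  qed
  then show ?case using cB(1) C(1) by (intro exI[of _ "real c + B * C"]) simp
qed

text \<open>If \<open>t\<close> is large, every list summing to \<open>t\<close> contains a large
  step and so has small weight. The exceptional lists of \<open>conv_rec\<close> are boundedly many,
  and the rest is controlled two levels below. This will keep the two borders apart.\<close>

lemma conv_vanishes:
  assumes "e > 0"
  shows "\<exists>T. \<forall>N t. \<bar>t\<bar> \<ge> int T \<longrightarrow> conv k N t \<le> e"
  using assms
proof (induction k arbitrary: e rule: induct_nat_012)
  case 0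
  have "conv 0 N t = 0" if "\<bar>t\<bar> \<ge> int 1" for N t
    using that by (auto simp: conv_def step_lists_def intro!: sum.neutral)
  then show ?case using 0 by (intro exI[of _ 1]) auto
next
  case 1
  obtain L where L: "\<And>s. \<bar>s\<bar> \<ge> int L \<Longrightarrow> wgt s \<le> e" using wgt_small[OF 1] by blast
  have "conv (Suc 0) N t \<le> (\<Sum>xs\<in>{[t]}. wt xs)" for N t
    unfolding conv_def using step_lists_1 by (intro sum_mono2) auto
  then have "conv (Suc 0) N t \<le> wgt t" for N t by simp
  then show ?case using L by (meson order_trans)
next
  case (ge2 k)
  obtain c B where cB: "B \<ge> 0" "\<And>N t. \<exists>G\<subseteq>step_lists (Suc (Suc k)) N t. card G \<le> c \<and>
     conv (Suc (Suc k)) N t \<le> (\<Sum>xs\<in>G. wt xs) + B * conv k N t" using conv_rec[of k] by blast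
  have e1: "e / (2 * (real c + 1)) > 0" "e / (2 * (B + 1)) > 0" using ge2.prems cB(1) by auto
  obtain L where L: "\<And>s. \<bar>s\<bar> \<ge> int L \<Longrightarrow> wgt s \<le> e / (2 * (real c + 1))"
    using wgt_small[OF e1(1)] by blast
  obtain T where T: "\<And>N t. \<bar>t\<bar> \<ge> int T \<Longrightarrow> conv k N t \<le> e / (2 * (B + 1))"
    using ge2.IH(1)[OF e1(2)] by blast
  have "conv (Suc (Suc k)) N t \<le> e" if t: "\<bar>t\<bar> \<ge> int (T + Suc (Suc k) * L + 1)" for N t
  proof -
    obtain G where G: "G \<subseteq> step_lists (Suc (Suc k)) N t" "card G \<le> c"
      "conv (Suc (Suc k)) N t \<le> (\<Sum>xs\<in>G. wt xs) + B * conv k N t"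
      using cB(2) by blast
    have "wt xs \<le> e / (2 * (real c + 1))" if "xs \<in> G" for xs
    proof -
      have xs: "length xs = Suc (Suc k)" "sum_list xs = t" using that G(1) by (auto simp: step_lists_def)
      have "\<exists>s\<in>set xs. \<bar>s\<bar> \<ge> int L"
      proof (rule ccontr)
        assume "\<not> ?thesis"
        then have "\<And>s. s \<in> set xs \<Longrightarrow> \<bar>s\<bar> \<le> int L" by force
        then have "(\<Sum>s\<leftarrow>xs. \<bar>s\<bar>) \<le> (\<Sum>s\<leftarrow>xs. int L)" by (rule sum_list_mono)
        also have "\<dots> = int (length xs) * int L" by (simp add: sum_list_triv)
        finally show False using sum_list_abs[of xs] xs t by (simp add: algebra_simps)
      qed
      then show ?thesis using L wt_le_member by (meson order_trans)
    qed
    then have "(\<Sum>xs\<in>G. wt xs) \<le> of_nat (card G) * (e / (2 * (real c + 1)))"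
      by (rule sum_bounded_above)
    also have "\<dots> \<le> real c * (e / (2 * (real c + 1)))"
      using G(2) e1(1) by (intro mult_right_mono) auto
    also have "\<dots> \<le> e / 2" using ge2.prems by (simp add: field_simps)
    finally have 1: "(\<Sum>xs\<in>G. wt xs) \<le> e / 2" .
    have "B * conv k N t \<le> B * (e / (2 * (B + 1)))"
      using T[of t N] t cB(1) by (intro mult_left_mono) auto
    also have "\<dots> \<le> e / 2" using ge2.prems cB(1) by (simp add: field_simps)
    finally show ?thesis using 1 G(3) by linarith
  qed
  then show ?case by blast
qed

text \<open>In a zero-sum list a large step occurs together with its opposite, so
  \<open>pair_sum_bound\<close> produces a tail of the convergent series of squares. This makes
  short cycles with a long step unlikely at any given vertex.\<close>

lemma zero_sum_tail:
  assumes "e > 0"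
  shows "\<exists>M\<ge>M0. \<forall>N. (\<Sum>xs\<in>{xs \<in> step_lists k N 0. \<exists>s\<in>set xs. \<bar>s\<bar> > int M}. wt xs) \<le> e"
proof (cases "k < 2")
  case True
  have E: "{xs \<in> step_lists k N 0. \<exists>s\<in>set xs. \<bar>s\<bar> > int M} = {}" for N M
  proof -
    have "k = 0 \<or> k = 1" using True by linarith
    then show ?thesis using step_lists_0[of N 0] step_lists_1[of N 0] by auto
  qed
  show ?thesis unfolding E using assms by (intro exI[of _ M0]) simp
next
  case False
  then obtain k' where k: "k = Suc (Suc k')" by (metis add_2_eq_Suc le_Suc_ex not_less)
  obtain C where C: "C \<ge> 0" "\<And>N t. conv k' N t \<le> C" using conv_bounded by blast
  obtain m where m: "\<And>xs s. length xs \<le> k \<Longrightarrow> (\<forall>s\<in>set xs. wgt s > 0) \<Longrightarrow> sum_list xs = 0 \<Longrightarrow>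
     s \<in> set xs \<Longrightarrow> \<bar>s\<bar> > int m \<Longrightarrow> - s \<in> set xs"
    using zero_sum_opposite[of k] by blast
  define q where "q = (real k' + 2)\<^sup>2 * (C + 1)"
  have q: "q > 0" using C(1) by (auto simp: q_def)
  obtain M where M: "M \<ge> max m M0" "\<And>N. (\<Sum>a\<in>{a \<in> {- int N..int N}. \<bar>a\<bar> > int M}. (wgt a)\<^sup>2) \<le> e / q"
    using square_sum_tail[of "e / q" "max m M0"] assms q by auto
  have "(\<Sum>xs\<in>{xs \<in> step_lists k N 0. \<exists>s\<in>set xs. \<bar>s\<bar> > int M}. wt xs) \<le> e" for N
  proof -
    let ?D = "{a \<in> {- int N..int N}. \<bar>a\<bar> > int M}"
    have "(\<Sum>xs\<in>{xs \<in> step_lists k N 0. \<exists>s\<in>set xs. \<bar>s\<bar> > int M}. wt xs)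
        \<le> (real k' + 2)\<^sup>2 * (\<Sum>a\<in>?D. (wgt a)\<^sup>2) * conv k' N 0"
    proof (rule pair_sum_bound)
      fix xs assume xs: "xs \<in> {xs \<in> step_lists k N 0. \<exists>s\<in>set xs. \<bar>s\<bar> > int M}" "wt xs \<noteq> 0"
      then obtain a where a: "a \<in> set xs" "\<bar>a\<bar> > int M" by blast
      have "- a \<in> set xs"
        by (rule m) (use xs a M(1) wt_neq_0[OF xs(2)] in \<open>auto simp: step_lists_def\<close>)
      then show "\<exists>a\<in>?D. a \<noteq> 0 \<and> a \<in> set xs \<and> - a \<in> set xs"
        using a xs by (intro bexI[of _ a]) (auto simp: step_lists_def)
    qed (auto simp: k)
    also have "\<dots> \<le> (real k' + 2)\<^sup>2 * (e / q) * (C + 1)"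
      using C(2)[of N 0] assms q C(1) by (intro mult_mono M(2) mult_left_mono) (auto intro!: mult_nonneg_nonneg sum_nonneg)
    also have "\<dots> = e" using q C(1) by (simp add: q_def)
    finally show ?thesis .
  qed
  then show ?thesis using M(1) by (intro exI[of _ M]) simp
qed

end

subsection \<open>Independent coins\<close>

definition coins :: "'e set \<Rightarrow> ('e \<Rightarrow> real) \<Rightarrow> ('e \<Rightarrow> bool) pmf" where
  "coins V q = Pi_pmf V False (\<lambda>e. bernoulli_pmf (q e))"

definition pattern :: "'e set \<Rightarrow> 'e set \<Rightarrow> ('e \<Rightarrow> bool) set" where
  "pattern A B = {f. (\<forall>e\<in>A. f e) \<and> (\<forall>e\<in>B. \<not> f e)}"

definition update_coins :: "'e set \<Rightarrow> 'e set \<Rightarrow> ('e \<Rightarrow> real) \<Rightarrow> 'e \<Rightarrow> real" where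
  "update_coins A B q e = (if e \<in> A then 1 else if e \<in> B then 0 else q e)"

lemma pattern_Int: "pattern A B \<inter> pattern A' B' = pattern (A \<union> A') (B \<union> B')"
  by (auto simp: pattern_def)

lemma prob_pattern:
  assumes "finite V" "\<And>e. e \<in> V \<Longrightarrow> 0 \<le> q e \<and> q e \<le> 1" "A \<subseteq> V" "B \<subseteq> V" "A \<inter> B = {}"
  shows "measure_pmf.prob (coins V q) (pattern A B) = (\<Prod>e\<in>A. q e) * (\<Prod>e\<in>B. 1 - q e)"
proof -
  define S where "S = (\<lambda>e. if e \<in> A then {True} else if e \<in> B then {False} else (UNIV :: bool set))"
  have "pattern A B = Pi V S"
    using assms(3-5) by (auto simp: pattern_def S_def Pi_def split: if_splits)
  then have "measure_pmf.prob (coins V q) (pattern A B) =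
      (\<Prod>e\<in>V. measure_pmf.prob (bernoulli_pmf (q e)) (S e))"
    unfolding coins_def using measure_Pi_pmf_Pi[OF assms(1)] by metis
  also have "\<dots> = (\<Prod>e\<in>V. (if e \<in> A then q e else 1) * (if e \<in> B then 1 - q e else 1))"
    using assms by (intro prod.cong refl) (auto simp: S_def measure_pmf_single)
  also have "\<dots> = (\<Prod>e\<in>V. if e \<in> A then q e else 1) * (\<Prod>e\<in>V. if e \<in> B then 1 - q e else 1)"
    by (rule prod.distrib)
  also have "(\<Prod>e\<in>V. if e \<in> A then q e else 1) = (\<Prod>e\<in>A. q e)"
    using assms(1,3) by (intro prod.mono_neutral_cong_right) auto
  also have "(\<Prod>e\<in>V. if e \<in> B then 1 - q e else 1) = (\<Prod>e\<in>B. 1 - q e)"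
    using assms(1,4) by (intro prod.mono_neutral_cong_right) auto
  finally show ?thesis .
qed

text \<open>Conditioning independent coins on some of their values leaves independent coins, now
  with parameters 0 and 1 there. Hence an estimate proved for general parameters can be applied
  again after some edges have been revealed.\<close>

lemma prob_pattern_cond:
  assumes "finite V" "\<And>e. e \<in> V \<Longrightarrow> 0 \<le> q e \<and> q e \<le> 1" "A \<subseteq> V" "B \<subseteq> V" "A \<inter> B = {}"
  shows "measure_pmf.prob (coins V q) (pattern A B \<inter> T) =
    measure_pmf.prob (coins V q) (pattern A B) * measure_pmf.prob (coins V (update_coins A B q)) T"
proof -
  let ?q = "update_coins A B q"
  \<comment> \<open>All mass lies on assignments with the default value \<open>False\<close> outside
    \<open>V\<close>; these are finitely many, so probabilities become finite sums.\<close>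
  define W where "W = PiE_dflt V False (\<lambda>_. UNIV :: bool set)"
  have finW: "finite W" unfolding W_def using assms(1) by (intro finite_PiE_dflt) auto
  have meas: "measure_pmf.prob (coins V r) Z = (\<Sum>f\<in>W \<inter> Z. pmf (coins V r) f)" for r Z
  proof -
    have "measure_pmf.prob (coins V r) Z = measure_pmf.prob (coins V r) (W \<inter> Z)"
      unfolding coins_def W_def
      by (intro measure_prob_cong_0) (auto simp: PiE_dflt_def intro!: pmf_Pi_outside assms(1))
    then show ?thesis using finW by (simp add: measure_measure_pmf_finite)
  qed
  have pmfW: "pmf (coins V r) f = (\<Prod>e\<in>V. pmf (bernoulli_pmf (r e)) (f e))" if "f \<in> W" for r f
    unfolding coins_def using that assms(1) by (intro pmf_Pi') (auto simp: W_def PiE_dflt_def)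
  have q': "0 \<le> ?q e \<and> ?q e \<le> 1" if "e \<in> V" for e
    using assms(2)[OF that] by (auto simp: update_coins_def)
  let ?c = "(\<Prod>e\<in>A. q e) * (\<Prod>e\<in>B. 1 - q e)"
  have key: "pmf (coins V q) f = ?c * pmf (coins V ?q) f" if f: "f \<in> W" "f \<in> pattern A B" for f
  proof -
    let ?R = "V - (A \<union> B)"
    have split: "(\<Prod>e\<in>V. h e) = (\<Prod>e\<in>A. h e) * (\<Prod>e\<in>B. h e) * (\<Prod>e\<in>?R. h e)" for h :: "_ \<Rightarrow> real"
    proof -
      have "(\<Prod>e\<in>V. h e) = (\<Prod>e\<in>?R. h e) * (\<Prod>e\<in>A \<union> B. h e)"
        using assms by (intro prod.subset_diff) auto
      also have "(\<Prod>e\<in>A \<union> B. h e) = (\<Prod>e\<in>A. h e) * (\<Prod>e\<in>B. h e)"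
        using assms finite_subset by (intro prod.union_disjoint) auto
      finally show ?thesis by simp
    qed
    have fA: "f e" if "e \<in> A" for e using f that by (auto simp: pattern_def)
    have fB: "\<not> f e" if "e \<in> B" for e using f that by (auto simp: pattern_def)
    have 1: "(\<Prod>e\<in>A. pmf (bernoulli_pmf (q e)) (f e)) = (\<Prod>e\<in>A. q e)"
      using assms fA by (intro prod.cong) auto
    have 2: "(\<Prod>e\<in>B. pmf (bernoulli_pmf (q e)) (f e)) = (\<Prod>e\<in>B. 1 - q e)"
      using assms fB by (intro prod.cong) auto
    have 3: "(\<Prod>e\<in>A. pmf (bernoulli_pmf (?q e)) (f e)) = 1"
      using fA by (intro prod.neutral) (auto simp: update_coins_def)
    have 4: "(\<Prod>e\<in>B. pmf (bernoulli_pmf (?q e)) (f e)) = 1"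
      using fB assms(5) by (intro prod.neutral) (auto simp: update_coins_def)
    have 5: "(\<Prod>e\<in>?R. pmf (bernoulli_pmf (?q e)) (f e)) = (\<Prod>e\<in>?R. pmf (bernoulli_pmf (q e)) (f e))"
      by (intro prod.cong) (auto simp: update_coins_def)
    show ?thesis unfolding pmfW[OF f(1)] split 1 2 3 4 5 by simp
  qed
  have zero: "pmf (coins V ?q) f = 0" if "f \<in> W" "f \<notin> pattern A B" for f
  proof -
    have "\<exists>e. e \<in> A \<and> \<not> f e \<or> e \<in> B \<and> f e" using that by (auto simp: pattern_def)
    then obtain e where "e \<in> A \<and> \<not> f e \<or> e \<in> B \<and> f e" ..
    then have "e \<in> V" "pmf (bernoulli_pmf (?q e)) (f e) = 0"
      using assms(3-5) by (auto simp: update_coins_def)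
    then show ?thesis unfolding pmfW[OF that(1)] using assms(1) by (intro prod_zero) auto
  qed
  have "measure_pmf.prob (coins V q) (pattern A B \<inter> T)
      = (\<Sum>f\<in>W \<inter> (pattern A B \<inter> T). ?c * pmf (coins V ?q) f)"
    unfolding meas by (intro sum.cong refl key) auto
  also have "\<dots> = ?c * (\<Sum>f\<in>W \<inter> (pattern A B \<inter> T). pmf (coins V ?q) f)"
    by (simp add: sum_distrib_left)
  also have "(\<Sum>f\<in>W \<inter> (pattern A B \<inter> T). pmf (coins V ?q) f) = (\<Sum>f\<in>W \<inter> T. pmf (coins V ?q) f)"
    using finW zero by (intro sum.mono_neutral_left) auto
  moreover have "measure_pmf.prob (coins V q) (pattern A B) = ?c"
    by (rule prob_pattern) (use assms in auto)
  ultimately show ?thesis unfolding meas[of "update_coins A B q" T] by simp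
qed

text \<open>If \<open>Y\<close> meets \<open>B\<close> the event is empty, otherwise the edges of
  \<open>Y\<close> are fresh and independent of the pattern. So in first-moment bounds the revealed
  non-edges can be ignored.\<close>

lemma prob_pattern_extra:
  assumes "finite V" "\<And>e. e \<in> V \<Longrightarrow> 0 \<le> q e \<and> q e \<le> 1" "A \<subseteq> V" "B \<subseteq> V" "A \<inter> B = {}"
    and "Y \<subseteq> V" "Y \<inter> A = {}"
  shows "measure_pmf.prob (coins V q) (pattern A B \<inter> pattern Y {}) \<le>
    measure_pmf.prob (coins V q) (pattern A B) * (\<Prod>e\<in>Y. q e)"
proof (cases "Y \<inter> B = {}")
  case True
  have fin: "finite A" "finite Y" using assms finite_subset by metis+
  have "measure_pmf.prob (coins V q) (pattern A B \<inter> pattern Y {})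
      = (\<Prod>e\<in>A \<union> Y. q e) * (\<Prod>e\<in>B. 1 - q e)"
    unfolding pattern_Int using assms True by (subst prob_pattern) auto
  also have "(\<Prod>e\<in>A \<union> Y. q e) = (\<Prod>e\<in>A. q e) * (\<Prod>e\<in>Y. q e)"
    using assms(7) fin by (intro prod.union_disjoint) auto
  finally show ?thesis using prob_pattern[OF assms(1-5)] by simp
next
  case False
  then have "pattern A B \<inter> pattern Y {} = {}" by (auto simp: pattern_def)
  moreover have "0 \<le> (\<Prod>e\<in>Y. q e)" using assms by (intro prod_nonneg) auto
  ultimately show ?thesis by simp
qed

lemma prob_UN_le:
  assumes "finite I"
  shows "measure_pmf.prob M (\<Union>i\<in>I. A i) \<le> (\<Sum>i\<in>I. measure_pmf.prob M (A i))"
  by (rule measure_pmf.finite_measure_subadditive_finite[OF assms]) auto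

lemma prob_mono: "A \<subseteq> B \<Longrightarrow> measure_pmf.prob M A \<le> measure_pmf.prob M B"
  by (rule measure_pmf.finite_measure_mono) auto

lemma integrable_indicator_pmf [simp]: "integrable (measure_pmf M) (indicator A :: _ \<Rightarrow> real)"
  by (rule measure_pmf.integrable_const_bound[of _ 1]) auto

lemma expectation_card:
  assumes "finite I"
  shows "measure_pmf.expectation M (\<lambda>x. real (card {i \<in> I. x \<in> A i})) = (\<Sum>i\<in>I. measure_pmf.prob M (A i))"
proof -
  have "real (card {i \<in> I. x \<in> A i}) = (\<Sum>i\<in>I. indicator (A i) x)" for x
    using assms by (simp add: indicator_def sum.If_cases Int_def)
  then show ?thesis
    by (simp only: Bochner_Integration.integral_sum[OF integrable_indicator_pmf]) simp
qed

text \<open>Markov's inequality for the number of occurring events.\<close>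

lemma prob_card_ge:
  assumes "finite I" "c > 0"
  shows "measure_pmf.prob M {x. c \<le> real (card {i \<in> I. x \<in> A i})} \<le> (\<Sum>i\<in>I. measure_pmf.prob M (A i)) / c"
proof -
  let ?N = "\<lambda>x. real (card {i \<in> I. x \<in> A i})"
  have int: "integrable (measure_pmf M) ?N"
    by (rule measure_pmf.integrable_const_bound[of _ "real (card I)"])
      (auto intro!: AE_I2 card_mono assms(1))
  have "measure_pmf.prob M {x. c \<le> ?N x} * c \<le> measure_pmf.expectation M ?N"
  proof -
    have "measure_pmf.prob M {x. c \<le> ?N x} * c = measure_pmf.expectation M (\<lambda>x. c * indicator {x. c \<le> ?N x} x)"
      by simp
    also have "\<dots> \<le> measure_pmf.expectation M ?N"
      by (rule integral_mono[OF integrable_mult_right[OF integrable_indicator_pmf] int])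
        (auto simp: indicator_def)
    finally show ?thesis .
  qed
  then show ?thesis unfolding expectation_card[OF assms(1)] using assms(2) by (simp add: field_simps)
qed

text \<open>Chebyshev's inequality: the condition on pairs bounds the variance by
  \<open>d * mu\<^sup>2 + mu\<close>, the last term coming from the diagonal, and the deviation
  \<open>mu / 2\<close> accounts for the factor 4.\<close>

lemma prob_card_le_half:
  assumes "finite I" "d \<ge> 0"
    and mu: "mu = (\<Sum>i\<in>I. measure_pmf.prob M (A i))" "mu > 0"
    and pair: "\<And>i j. i \<in> I \<Longrightarrow> j \<in> I \<Longrightarrow> i \<noteq> j \<Longrightarrow>
      measure_pmf.prob M (A i \<inter> A j) \<le> (1 + d) * (measure_pmf.prob M (A i) * measure_pmf.prob M (A j))"
  shows "measure_pmf.prob M {x. real (card {i \<in> I. x \<in> A i}) \<le> mu / 2} \<le> 4 * (1 / mu + d)"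
proof -
  let ?N = "\<lambda>x. real (card {i \<in> I. x \<in> A i})" and ?P = "measure_pmf.prob M"
  let ?E = "measure_pmf.expectation M"
  have N: "?N x = (\<Sum>i\<in>I. indicator (A i) x)" for x
    using assms(1) by (simp add: indicator_def sum.If_cases Int_def)
  have bnd: "integrable (measure_pmf M) g" if "\<And>x. \<bar>g x\<bar> \<le> B" for g :: "_ \<Rightarrow> real" and B
    by (rule measure_pmf.integrable_const_bound[of _ B]) (auto intro!: AE_I2 that)
  have NI: "?N x \<le> real (card I)" for x by (auto intro!: card_mono assms(1))
  have i1: "integrable (measure_pmf M) ?N" by (rule bnd[of _ "real (card I)"]) (use NI in simp)
  have i2: "integrable (measure_pmf M) (\<lambda>x. (?N x)\<^sup>2)"
    by (rule bnd[of _ "(real (card I))\<^sup>2"]) (use NI in \<open>auto intro!: power_mono\<close>)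
  have "?E (\<lambda>x. (?N x)\<^sup>2) = ?E (\<lambda>x. \<Sum>i\<in>I. \<Sum>j\<in>I. indicator (A i \<inter> A j) x)"
    unfolding N power2_eq_square sum_product by (simp add: indicator_inter_arith)
  also have "\<dots> = (\<Sum>i\<in>I. \<Sum>j\<in>I. ?P (A i \<inter> A j))"
    by (subst Bochner_Integration.integral_sum
        [OF Bochner_Integration.integrable_sum[OF integrable_indicator_pmf]])
      (simp only: Bochner_Integration.integral_sum[OF integrable_indicator_pmf], simp)
  also have "\<dots> \<le> (\<Sum>i\<in>I. \<Sum>j\<in>I. (1 + d) * (?P (A i) * ?P (A j)) + (if i = j then ?P (A i) else 0))"
  proof (intro sum_mono)
    fix i j assume ij: "i \<in> I" "j \<in> I"
    show "?P (A i \<inter> A j) \<le> (1 + d) * (?P (A i) * ?P (A j)) + (if i = j then ?P (A i) else 0)"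
      using pair[OF ij] assms(2) by auto
  qed
  also have "\<dots> = (1 + d) * mu\<^sup>2 + mu"
    using assms(1) unfolding mu
    by (simp add: sum.distrib sum_distrib_left[symmetric] sum_product[symmetric] power2_eq_square
        sum_distrib_right[symmetric])
  finally have E2: "?E (\<lambda>x. (?N x)\<^sup>2) \<le> (1 + d) * mu\<^sup>2 + mu" .
  have E1: "?E ?N = mu" unfolding mu by (rule expectation_card[OF assms(1)])
  have i3: "integrable (measure_pmf M) (\<lambda>x. (?N x - mu)\<^sup>2)"
    unfolding power2_diff using i1 i2 by (intro Bochner_Integration.integrable_diff Bochner_Integration.integrable_add) auto
  have "?E (\<lambda>x. (?N x - mu)\<^sup>2) = ?E (\<lambda>x. (?N x)\<^sup>2) + mu\<^sup>2 - 2 * mu * ?E ?N"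
    unfolding power2_diff using i1 i2
    by (subst Bochner_Integration.integral_diff) (auto simp: mult.assoc)
  also have "\<dots> \<le> d * mu\<^sup>2 + mu" using E2 unfolding E1 by (simp add: power2_eq_square algebra_simps)
  finally have V: "?E (\<lambda>x. (?N x - mu)\<^sup>2) \<le> d * mu\<^sup>2 + mu" .
  let ?S = "{x. ?N x \<le> mu / 2}"
  have "?P ?S * (mu / 2)\<^sup>2 = ?E (\<lambda>x. (mu / 2)\<^sup>2 * indicator ?S x)" by simp
  also have "\<dots> \<le> ?E (\<lambda>x. (?N x - mu)\<^sup>2)"
  proof (rule integral_mono[OF _ i3])
    fix x
    show "(mu / 2)\<^sup>2 * indicator ?S x \<le> (?N x - mu)\<^sup>2"
    proof (cases "x \<in> ?S")
      case True
      then have "(mu / 2)\<^sup>2 \<le> (mu - ?N x)\<^sup>2" using mu(2) by (intro power_mono) auto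
      then show ?thesis using True by (simp add: power2_commute)
    qed simp
  qed simp
  also note V
  finally have "?P ?S \<le> (d * mu\<^sup>2 + mu) / (mu / 2)\<^sup>2" using mu(2) by (simp add: pos_le_divide_eq)
  also have "\<dots> = 4 * (1 / mu + d)" using mu(2) by (simp add: field_simps power2_eq_square)
  finally show ?thesis .
qed


subsection \<open>Walks, paths and cycles\<close>

fun path_edges :: "'a list \<Rightarrow> 'a set set" where
  "path_edges (x # y # zs) = insert {x, y} (path_edges (y # zs))"
| "path_edges _ = {}"

definition walk :: "'a set set \<Rightarrow> 'a list \<Rightarrow> bool" where
  "walk E vs \<longleftrightarrow> vs \<noteq> [] \<and> path_edges vs \<subseteq> E"

definition is_cycle :: "'a list \<Rightarrow> bool" where
  "is_cycle vs \<longleftrightarrow> distinct vs \<and> 3 \<le> length vs"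

definition cycle_edges :: "'a list \<Rightarrow> 'a set set" where
  "cycle_edges vs = path_edges (vs @ [hd vs])"

lemma path_edges_append:
  "vs \<noteq> [] \<Longrightarrow> ws \<noteq> [] \<Longrightarrow>
    path_edges (vs @ ws) = path_edges vs \<union> {{last vs, hd ws}} \<union> path_edges ws"
proof (induction vs rule: path_edges.induct)
  case ("2_2" v)
  then show ?case by (cases ws) auto
qed auto

lemma path_edges_Cons: "vs \<noteq> [] \<Longrightarrow> path_edges (x # vs) = insert {x, hd vs} (path_edges vs)"
  by (cases vs) auto

lemma path_edges_snoc: "vs \<noteq> [] \<Longrightarrow> path_edges (vs @ [x]) = insert {last vs, x} (path_edges vs)"
  by (simp add: path_edges_append insert_commute Un_commute)

lemma path_edges_rev: "path_edges (rev vs) = path_edges vs"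
proof (induction vs)
  case (Cons x vs)
  show ?case
  proof (cases "vs = []")
    case False
    then show ?thesis using Cons
      by (simp add: path_edges_snoc path_edges_Cons last_rev insert_commute)
  qed simp
qed simp

lemma path_edges_subset: "e \<in> path_edges vs \<Longrightarrow> e \<subseteq> set vs"
  by (induction vs rule: path_edges.induct) auto

lemma finite_path_edges [simp]: "finite (path_edges vs)"
  by (induction vs rule: path_edges.induct) auto

lemma path_edges_in_pairs:
  "distinct vs \<Longrightarrow> set vs \<subseteq> {1..n} \<Longrightarrow> path_edges vs \<subseteq> vertex_pairs n"
  by (induction vs rule: path_edges.induct) (auto simp: vertex_pairs_def)

lemma path_edges_vertices:
  "path_edges vs \<subseteq> E \<Longrightarrow> \<Union>E \<subseteq> V \<Longrightarrow> hd vs \<in> V \<Longrightarrow> vs \<noteq> [] \<Longrightarrow> set vs \<subseteq> V"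
  by (induction vs rule: path_edges.induct) auto

text \<open>Ensures that the closing edge contributes a factor of its own to the product over a
  cycle. It fails for two vertices, hence the minimal length 3.\<close>

lemma last_edge_notin:
  assumes "distinct vs" "3 \<le> length vs"
  shows "{last vs, hd vs} \<notin> path_edges vs"
proof -
  obtain x y zs where vs: "vs = x # y # zs" "zs \<noteq> []"
    using assms(2) by (cases vs; cases "tl vs") (auto simp: Suc_le_eq)
  have l: "last vs = last zs" "last zs \<in> set zs" using vs by auto
  show ?thesis
  proof
    assume "{last vs, hd vs} \<in> path_edges vs"
    then have "{last zs, x} = {x, y} \<or> {last zs, x} \<in> path_edges (y # zs)" using vs l by auto
    then show False
    proof
      assume "{last zs, x} = {x, y}"
      then show False using assms(1) vs l by (auto simp: doubleton_eq_iff)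
    next
      assume "{last zs, x} \<in> path_edges (y # zs)"
      then show False using path_edges_subset assms(1) vs by fastforce
    qed
  qed
qed

lemma cycle_edges_eq: "vs \<noteq> [] \<Longrightarrow> cycle_edges vs = insert {last vs, hd vs} (path_edges vs)"
  by (simp add: cycle_edges_def path_edges_snoc)

lemma cycle_edges_in_pairs:
  assumes "is_cycle vs" "set vs \<subseteq> {1..n}"
  shows "cycle_edges vs \<subseteq> vertex_pairs n"
proof -
  have ne: "vs \<noteq> []" using assms by (auto simp: is_cycle_def)
  have "last vs \<noteq> hd vs"
    using assms(1) by (cases vs) (auto simp: is_cycle_def split: if_splits)
  moreover have "last vs \<in> {1..n}" "hd vs \<in> {1..n}" using assms(2) ne hd_in_set last_in_set by blast+
  ultimately have "{last vs, hd vs} \<in> vertex_pairs n" by (auto simp: vertex_pairs_def)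
  then show ?thesis using assms path_edges_in_pairs[of vs n] ne
    by (simp add: cycle_edges_eq is_cycle_def)
qed

lemma cycle_rotate:
  assumes "is_cycle (as @ bs)"
  shows "is_cycle (bs @ as)" "cycle_edges (bs @ as) = cycle_edges (as @ bs)"
proof -
  show "is_cycle (bs @ as)" using assms by (auto simp: is_cycle_def)
  show "cycle_edges (bs @ as) = cycle_edges (as @ bs)"
  proof (cases "as = [] \<or> bs = []")
    case False
    then show ?thesis
      by (simp add: cycle_edges_eq path_edges_append insert_commute Un_commute Un_left_commute)
  qed auto
qed

lemma cycle_rotate_to:
  assumes "is_cycle vs" "u \<in> set vs"
  obtains ws where "is_cycle (u # ws)" "cycle_edges (u # ws) = cycle_edges vs"
    "length (u # ws) = length vs" "set (u # ws) = set vs"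
proof -
  obtain as bs where vs: "vs = as @ u # bs" using assms(2) by (meson split_list)
  show ?thesis
    using cycle_rotate[of as "u # bs"] assms(1) vs by (intro that[of "bs @ as"]) auto
qed

text \<open>Loop erasure: the piece between two occurrences of a vertex is cut out.\<close>

lemma walk_shorten:
  assumes "walk E vs"
  shows "\<exists>ws. walk E ws \<and> distinct ws \<and> hd ws = hd vs \<and> last ws = last vs \<and> length ws \<le> length vs"
  using assms
proof (induction "length vs" arbitrary: vs rule: less_induct)
  case less
  show ?case
  proof (cases "distinct vs")
    case True
    then show ?thesis using less.prems by auto
  next
    case False
    then obtain as bs cs y where vs: "vs = as @ [y] @ bs @ [y] @ cs" by (meson not_distinct_decomp)
    let ?ws = "as @ y # cs"
    have sub: "path_edges ?ws \<subseteq> path_edges vs"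
    proof (cases "as = []")
      case True
      have "path_edges vs = path_edges ((y # bs) @ (y # cs))" using vs True by simp
      then show ?thesis using True path_edges_append[of "y # bs" "y # cs"] by auto
    next
      case False
      have "path_edges vs = path_edges as \<union> {{last as, y}} \<union> path_edges ((y # bs) @ (y # cs))"
        using vs False by (simp add: path_edges_append)
      moreover have "path_edges (y # cs) \<subseteq> path_edges ((y # bs) @ (y # cs))"
        using path_edges_append[of "y # bs" "y # cs"] by auto
      ultimately show ?thesis using False by (auto simp: path_edges_append)
    qed
    have "walk E ?ws" using less.prems sub by (auto simp: walk_def)
    moreover have "length ?ws < length vs" using vs by simp
    ultimately obtain ws where "walk E ws" "distinct ws" "hd ws = hd ?ws" "last ws = last ?ws"
      "length ws \<le> length ?ws" using less.hyps by blast
    moreover have "hd ?ws = hd vs" "last ?ws = last vs" using vs by (cases as; simp)+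
    ultimately show ?thesis using \<open>length ?ws < length vs\<close> by (intro exI[of _ ws]) auto
  qed
qed

lemma nball_walk:
  "w \<in> nball E k u \<longleftrightarrow> (\<exists>vs. walk E vs \<and> hd vs = u \<and> last vs = w \<and> length vs \<le> Suc k)"
proof (induction k arbitrary: w)
  case 0
  show ?case
  proof
    assume "w \<in> nball E 0 u"
    then show "\<exists>vs. walk E vs \<and> hd vs = u \<and> last vs = w \<and> length vs \<le> Suc 0"
      by (intro exI[of _ "[u]"]) (auto simp: walk_def)
  next
    assume "\<exists>vs. walk E vs \<and> hd vs = u \<and> last vs = w \<and> length vs \<le> Suc 0"
    then obtain vs where vs: "walk E vs" "hd vs = u" "last vs = w" "length vs \<le> Suc 0" by blast
    then obtain x where "vs = [x]" by (cases vs) (auto simp: walk_def)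
    then show "w \<in> nball E 0 u" using vs by simp
  qed
next
  case (Suc k)
  show ?case
  proof
    assume "w \<in> nball E (Suc k) u"
    then consider "w \<in> nball E k u" | v where "v \<in> nball E k u" "{v, w} \<in> E" by auto
    then show "\<exists>vs. walk E vs \<and> hd vs = u \<and> last vs = w \<and> length vs \<le> Suc (Suc k)"
    proof cases
      case 1
      then obtain vs where "walk E vs" "hd vs = u" "last vs = w" "length vs \<le> Suc k"
        using Suc.IH[of w] by blast
      then show ?thesis by (intro exI[of _ vs]) simp
    next
      case 2
      then obtain vs where vs: "walk E vs" "hd vs = u" "last vs = v" "length vs \<le> Suc k"
        using Suc.IH[of v] by blast
      then have "walk E (vs @ [w])" using 2 by (auto simp: walk_def path_edges_snoc)
      then show ?thesis using vs by (intro exI[of _ "vs @ [w]"]) (auto simp: walk_def)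
    qed
  next
    assume "\<exists>vs. walk E vs \<and> hd vs = u \<and> last vs = w \<and> length vs \<le> Suc (Suc k)"
    then obtain vs where vs: "walk E vs" "hd vs = u" "last vs = w" "length vs \<le> Suc (Suc k)" by blast
    then obtain us where us: "vs = us @ [w]" by (metis append_butlast_last_id walk_def)
    show "w \<in> nball E (Suc k) u"
    proof (cases "us = []")
      case True
      then show ?thesis using us vs by (simp del: nball.simps)
    next
      case False
      then have "walk E us" "hd us = u" "{last us, w} \<in> E" "length us \<le> Suc k"
        using vs us by (auto simp: walk_def path_edges_snoc)
      then have "last us \<in> nball E k u" using Suc.IH by blast
      then show ?thesis using \<open>{last us, w} \<in> E\<close> by auto
    qed
  qed
qed

fun steps :: "nat list \<Rightarrow> int list" where
  "steps (x # y # zs) = (int y - int x) # steps (y # zs)"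
| "steps _ = []"

lemma steps_append:
  "vs \<noteq> [] \<Longrightarrow> ws \<noteq> [] \<Longrightarrow> steps (vs @ ws) = steps vs @ (int (hd ws) - int (last vs)) # steps ws"
proof (induction vs rule: steps.induct)
  case ("2_2" v)
  then show ?case by (cases ws) auto
qed auto

lemma length_steps: "length (steps vs) = length vs - 1"
  by (induction vs rule: steps.induct) auto

lemma sum_steps: "vs \<noteq> [] \<Longrightarrow> sum_list (steps vs) = int (last vs) - int (hd vs)"
  by (induction vs rule: steps.induct) auto

lemma steps_bounded: "set vs \<subseteq> {1..n} \<Longrightarrow> set (steps vs) \<subseteq> {- int n..int n}"
  by (induction vs rule: steps.induct) auto

lemma steps_inj: "steps vs = steps ws \<Longrightarrow> hd vs = hd ws \<Longrightarrow> length vs = length ws \<Longrightarrow> vs = ws"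
proof (induction vs arbitrary: ws rule: steps.induct)
  case (1 x y zs)
  then obtain x' y' zs' where ws: "ws = x' # y' # zs'"
    by (metis length_Suc_conv)
  then have "y = y'" using 1 by simp
  then show ?case using 1(1)[of "y' # zs'"] 1(2-) ws by simp
next
  case ("2_2" v)
  then show ?case by (cases ws) auto
qed auto

context distance_graph
begin

definition edge_prob :: "nat set \<Rightarrow> real" where
  "edge_prob e = p (Max e - Min e)"

lemma edge_prob_pair: "x \<noteq> y \<Longrightarrow> edge_prob {x, y} = wgt (int y - int x)"
proof -
  assume a: "x \<noteq> y"
  have "max x y - min x y = nat \<bar>int y - int x\<bar>" by (auto simp: max_def min_def nat_diff_distrib)
  then show ?thesis using a by (simp add: edge_prob_def wgt_def)
qed

lemma edge_prob_bounds: "e \<in> vertex_pairs n \<Longrightarrow> 0 \<le> edge_prob e \<and> edge_prob e \<le> 1"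
  by (auto simp: vertex_pairs_def edge_prob_pair)

lemma prod_path_edges: "distinct vs \<Longrightarrow> (\<Prod>e\<in>path_edges vs. edge_prob e) = wt (steps vs)"
proof (induction vs rule: path_edges.induct)
  case (1 x y zs)
  have "{x, y} \<notin> path_edges (y # zs)" using path_edges_subset 1(2) by fastforce
  then show ?case using 1 by (simp add: edge_prob_pair)
qed (auto simp: wt_def)

lemma prod_cycle_edges:
  assumes "is_cycle vs"
  shows "(\<Prod>e\<in>cycle_edges vs. edge_prob e) = wt (steps (vs @ [hd vs]))"
proof -
  have ne: "vs \<noteq> []" using assms by (auto simp: is_cycle_def)
  have "last vs \<noteq> hd vs"
    using assms by (cases vs) (auto simp: is_cycle_def split: if_splits)
  then have "edge_prob {last vs, hd vs} = wgt (int (hd vs) - int (last vs))" by (rule edge_prob_pair)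
  then show ?thesis
    using assms last_edge_notin[of vs] ne
    by (simp add: cycle_edges_eq is_cycle_def prod_path_edges steps_append)
qed

text \<open>Steps determine a path of given length from a given start, so expected numbers of paths
  turn into sums over step lists without loss.\<close>

lemma sum_wt_steps_le:
  assumes "finite L" "\<And>vs. vs \<in> P \<Longrightarrow> hd vs = u \<and> length vs = k \<and> steps vs \<in> L"
  shows "(\<Sum>vs\<in>P. wt (steps vs)) \<le> (\<Sum>xs\<in>L. wt xs)"
proof -
  have inj: "inj_on steps P"
    by (rule inj_onI) (metis assms(2) steps_inj)
  have "(\<Sum>vs\<in>P. wt (steps vs)) = (\<Sum>xs\<in>steps ` P. wt xs)"
    by (simp add: sum.reindex[OF inj])
  also have "\<dots> \<le> (\<Sum>xs\<in>L. wt xs)"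
    using assms by (intro sum_mono2) auto
  finally show ?thesis .
qed

end

lemma finite_vertex_pairs [simp]: "finite (vertex_pairs n)"
proof -
  have "vertex_pairs n \<subseteq> Pow {1..n}" by (auto simp: vertex_pairs_def)
  then show ?thesis by (rule finite_subset) simp
qed

subsection \<open>Re-embedding balls that touch the border\<close>

text \<open>For closed walks of bounded length the edges at a clean vertex behave like
  bridges.\<close>

definition clean :: "'a set set \<Rightarrow> nat \<Rightarrow> 'a \<Rightarrow> bool" where
  "clean E K u \<longleftrightarrow> \<not> (\<exists>vs. is_cycle vs \<and> length vs \<le> K \<and> u \<in> set vs \<and> cycle_edges vs \<subseteq> E)"

section \<open>Sums of antisymmetric functions along walks\<close>

fun walk_sum :: "('a \<Rightarrow> 'a \<Rightarrow> int) \<Rightarrow> 'a list \<Rightarrow> int" where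
  "walk_sum d (x # y # zs) = d x y + walk_sum d (y # zs)"
| "walk_sum d _ = 0"

lemma walk_sum_split: "walk_sum d (as @ y # bs) = walk_sum d (as @ [y]) + walk_sum d (y # bs)"
proof (induction as)
  case (Cons a as)
  then show ?case by (cases as) auto
qed simp

lemma path_edges_split: "path_edges (as @ y # bs) = path_edges (as @ [y]) \<union> path_edges (y # bs)"
proof (induction as)
  case (Cons a as)
  then show ?case by (cases as) auto
qed simp

lemma walk_sum_rev:
  assumes "\<And>x y. d y x = - d x y"
  shows "walk_sum d (rev vs) = - walk_sum d vs"
proof (induction vs)
  case (Cons x vs)
  show ?case
  proof (cases vs)
    case (Cons y zs)
    have "walk_sum d (rev (x # vs)) = walk_sum d (rev zs @ [y]) + d y x"
      unfolding Cons using walk_sum_split[of d "rev zs" y "[x]"] by simp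
    then show ?thesis using Cons.IH assms[of y x] unfolding Cons by simp
  qed simp
qed simp

lemma walk_sum_zero:
  "(\<And>x y. {x, y} \<in> path_edges vs \<Longrightarrow> d x y = 0) \<Longrightarrow> walk_sum d vs = 0"
  by (induction vs rule: path_edges.induct) auto

lemma walk_sum_cong:
  "(\<And>x y. {x, y} \<in> path_edges vs \<Longrightarrow> d x y = d' x y) \<Longrightarrow> walk_sum d vs = walk_sum d' vs"
  by (induction vs rule: path_edges.induct) auto

lemma walk_sum_diff: "walk_sum (\<lambda>x y. d x y - d' x y) vs = walk_sum d vs - walk_sum d' vs"
  by (induction vs rule: path_edges.induct) auto

lemma walk_sum_telescope: "vs \<noteq> [] \<Longrightarrow> walk_sum (\<lambda>x y. int y - int x) vs = int (last vs) - int (hd vs)"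
  by (induction vs rule: path_edges.induct) auto

lemma walk_sum_bound:
  assumes "\<And>x y. {x, y} \<in> path_edges vs \<Longrightarrow> \<bar>d x y\<bar> \<le> M"
  shows "\<bar>walk_sum d vs\<bar> \<le> int (length vs - 1) * M"
  using assms
proof (induction vs rule: path_edges.induct)
  case (1 x y zs)
  have "\<bar>d x y\<bar> \<le> M" "\<bar>walk_sum d (y # zs)\<bar> \<le> int (length (y # zs) - 1) * M"
    using 1 by auto
  then show ?case by (simp add: algebra_simps)
qed auto

text \<open>Decomposing a short closed walk into cycles and backtracking edges shows that an
  edge on no short cycle is traversed equally often in both directions.\<close>

lemma closed_walk_sum:
  assumes antisym: "\<And>x y. d y x = - d x y"
    and supp: "\<And>x y. d x y \<noteq> 0 \<Longrightarrow> x \<in> C \<or> y \<in> C"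
    and clean: "\<And>u. u \<in> C \<Longrightarrow> clean E K u"
    and loops: "\<And>x. {x} \<notin> E"
    and "walk E vs" "hd vs = last vs" "length vs \<le> Suc K"
  shows "walk_sum d vs = 0"
  using assms(5-)
proof (induction "length vs" arbitrary: vs rule: less_induct)
  case less
  obtain ws x where vs: "vs = ws @ [x]" using less.prems(1) by (metis append_butlast_last_id walk_def)
  show ?case
  proof (cases "distinct ws")
    case True
    show ?thesis
    proof (cases "length ws \<le> 2")
      case True
      then consider "ws = []" | a where "ws = [a]" | a b where "ws = [a, b]"
        by (cases ws; cases "tl ws") auto
      then show ?thesis
      proof cases
        case 1
        then show ?thesis using vs by simp
      next
        case 2
        then have "{x} \<in> E" using less.prems vs by (auto simp: walk_def)
        then show ?thesis using loops by blast
      next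
        case 3
        then have "x = a" using less.prems vs by simp
        then show ?thesis using 3 vs antisym[of a b] by simp
      qed
    next
      case long: False
      have x: "x = hd ws" using less.prems(2) vs long by (cases ws) auto
      have cyc: "is_cycle ws" using True long by (auto simp: is_cycle_def)
      have edges: "cycle_edges ws \<subseteq> E"
        using less.prems(1) vs x by (simp add: cycle_edges_def walk_def)
      have noC: "u \<notin> C" if "u \<in> set ws" for u
        using clean[of u] cyc edges that less.prems(3) vs unfolding clean_def by auto
      show ?thesis
      proof (rule walk_sum_zero)
        fix a b assume "{a, b} \<in> path_edges vs"
        then have "{a, b} \<subseteq> set vs" by (rule path_edges_subset)
        also have "set vs = set ws" using vs x long by (cases ws) auto
        finally show "d a b = 0" using noC supp by blast
      qed
    qed
  next
    case False
    then obtain as bs cs y where ws: "ws = as @ [y] @ bs @ [y] @ cs" by (meson not_distinct_decomp)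
    let ?A = "y # bs @ [y]" and ?B = "as @ y # (cs @ [x])"
    have vs': "vs = as @ y # (bs @ y # (cs @ [x]))" using vs ws by simp
    have sum: "walk_sum d vs = walk_sum d ?A + walk_sum d ?B"
      unfolding vs' using walk_sum_split[of d as y "bs @ y # (cs @ [x])"]
        walk_sum_split[of d "y # bs" y "cs @ [x]"] walk_sum_split[of d as y "cs @ [x]"] by simp
    have edges: "path_edges vs = path_edges ?A \<union> path_edges ?B"
      unfolding vs' using path_edges_split[of as y "bs @ y # (cs @ [x])"]
        path_edges_split[of "y # bs" y "cs @ [x]"] path_edges_split[of as y "cs @ [x]"] by auto
    have "walk E ?A" "walk E ?B" using less.prems(1) edges by (auto simp: walk_def)
    moreover have "hd ?A = last ?A" by simp
    moreover have "hd ?B = last ?B" using less.prems(2) vs' by (cases as) auto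
    moreover have "length ?A < length vs" "length ?B < length vs" using vs' by simp_all
    ultimately have "walk_sum d ?A = 0" "walk_sum d ?B = 0"
      using less.hyps[of ?A] less.hyps[of ?B] less.prems(3) by auto
    then show ?thesis using sum by simp
  qed
qed

context distance_graph
begin

text \<open>The conditions that allow a translate to occur exactly: edges are possible, pairs at the
  forced distance are edges, and the forced neighbours of central vertices belong to the pattern, so
  that no forced edge leaves it from the centre.\<close>

definition template :: "nat \<Rightarrow> int set \<Rightarrow> int set set \<Rightarrow> int \<Rightarrow> bool" where
  "template r S H x \<longleftrightarrow> finite S \<and> x \<in> S \<and>
     (\<forall>e\<in>H. \<exists>u\<in>S. \<exists>w\<in>S. e = {u, w} \<and> wgt (w - u) > 0) \<and>
     (\<forall>u\<in>S. \<forall>w\<in>S. w - u = int lstar \<longrightarrow> {u, w} \<in> H) \<and>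
     (\<forall>u\<in>nball H r x. u + int lstar \<in> S \<and> u - int lstar \<in> S)"

text \<open>The map \<open>f\<close> need not respect the positions in \<open>{1..n}\<close>; only
  the isomorphism type of the ball counts. The radius \<open>Suc r\<close> leaves room for the
  neighbours of the \<open>r\<close>-ball.\<close>

definition realizable :: "nat set set \<Rightarrow> nat \<Rightarrow> nat \<Rightarrow> bool" where
  "realizable E r x \<longleftrightarrow> (\<exists>S H f. template r S H (f x) \<and> inj_on f (nball E (Suc r) x) \<and>
     S = f ` nball E (Suc r) x \<and>
     (\<forall>u\<in>nball E (Suc r) x. \<forall>w\<in>nball E (Suc r) x. {f u, f w} \<in> H \<longleftrightarrow> {u, w} \<in> E))"

definition possible_graph :: "nat \<Rightarrow> nat set set \<Rightarrow> bool" where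
  "possible_graph n E \<longleftrightarrow> E \<subseteq> vertex_pairs n \<and>
     (\<forall>u w. {u, w} \<in> E \<longrightarrow> wgt (int w - int u) > 0) \<and>
     (\<forall>u\<in>{1..n}. u + lstar \<le> n \<longrightarrow> {u, u + lstar} \<in> E)"

text \<open>A joint \<open>(v, y)\<close> lets the random edge from \<open>v\<close> to \<open>y\<close> play the role of the missing
  forced edge from \<open>v\<close> downwards; then \<open>y + lstar\<close> loses its forced edge downwards instead.\<close>

definition segment :: "nat \<Rightarrow> nat \<Rightarrow> nat set" where
  "segment R y = {u. \<exists>k\<le>R. u + k * lstar = y}"

text \<open>Two vertices of the ball are joined by a path with at most \<open>2 * r + 3\<close>
  vertices, fewer than \<open>R\<close>. The bound \<open>K\<close> covers every closed walk used
  below: a path with two walks to the centre, a path with a run along a forced line, and a chain of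
  \<open>2 * r + 1\<close> joints with a way back of \<open>2 * r\<close> edges. Targets are spaced
  by more than such walks can cover in forced steps.\<close>

definition joints :: "nat \<Rightarrow> nat set set \<Rightarrow> (nat \<times> nat) set \<Rightarrow> nat \<Rightarrow> bool" where
  "joints n E J r \<longleftrightarrow> (let R = 2 * r + 4; K = 6 * r + 12 in
     (\<forall>(v, y)\<in>J. {v, y} \<in> E \<and> v < y \<and> (2 * R + 8) * lstar < y \<and> y + lstar \<le> n \<and>
        (\<forall>u\<in>segment R y. clean E K u) \<and> (v \<le> lstar \<or> (\<exists>(v', y')\<in>J. v = y' + lstar))) \<and>
     (\<forall>(v, y)\<in>J. \<forall>(v', y')\<in>J. (v = v' \<longleftrightarrow> y = y') \<and> (y < y' \<longrightarrow> y + (2 * R + 8) * lstar < y')))"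

lemma infinitely_many_steps: "\<exists>l>N. p l > 0"
proof (rule ccontr)
  assume "\<not> ?thesis"
  then have z: "p l = 0" if "l > N" for l using that p_nonneg[of l] by (metis le_antisym less_one not_le_imp_less order_le_less not_less_zero order_less_le)
  have "(\<Sum>l=1..n. p l) \<le> (\<Sum>l=1..N. p l)" for n
  proof -
    have "(\<Sum>l=1..n. p l) = (\<Sum>l\<in>{1..n} \<inter> {1..N}. p l)"
      by (intro sum.mono_neutral_right) (auto simp: z)
    also have "\<dots> \<le> (\<Sum>l=1..N. p l)" by (intro sum_mono2) (auto intro: p_nonneg)
    finally show ?thesis .
  qed
  moreover have "eventually (\<lambda>n. (\<Sum>l=1..n. p l) > (\<Sum>l=1..N. p l)) sequentially"
    using diverges by (auto simp: filterlim_at_top_dense)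
  then obtain n where "(\<Sum>l=1..n. p l) > (\<Sum>l=1..N. p l)" by (auto simp: eventually_sequentially)
  ultimately show False by (meson not_less)
qed

text \<open>A superincreasing sequence of possible steps: up to \<open>W\<close> terms from below,
  together with an error up to \<open>c\<close>, cannot cancel the next one.\<close>

lemma sparse_steps: "\<exists>G :: nat \<Rightarrow> nat. \<forall>i. (p (G i) > 0 \<and> c < G i) \<and> W * G i + c < G (Suc i)"
proof (rule dependent_nat_choice)
  show "\<exists>x. p x > 0 \<and> c < x" using infinitely_many_steps by blast
  show "\<exists>y. (p y > 0 \<and> c < y) \<and> W * x + c < y" for x
    using infinitely_many_steps[of "W * x + c"] by (metis le_add2 order_le_less_trans)
qed

end

text \<open>A ball clear of the upper border. By \<open>low\<close>, its vertices without forced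
  neighbour below are sources of joints; by \<open>mid\<close>, so is every vertex
  \<open>y + lstar\<close> of the ball whose lower neighbour is taken away by a joint. Hence no
  defect stays inside.\<close>

locale joint_ball = distance_graph +
  fixes n :: nat and E :: "nat set set" and J :: "(nat \<times> nat) set" and r x :: nat
  assumes graph: "possible_graph n E" and J: "joints n E J r" and x: "x \<in> {1..n}"
    and low: "\<And>u. u \<in> nball E r x \<Longrightarrow> u \<le> lstar \<Longrightarrow> u \<in> fst ` J"
    and mid: "\<And>v y. (v, y) \<in> J \<Longrightarrow> y + lstar \<in> nball E r x \<Longrightarrow> y + lstar \<in> fst ` J"
    and high: "\<And>u. u \<in> nball E r x \<Longrightarrow> u + lstar \<le> n"
begin

abbreviation "L \<equiv> lstar"
abbreviation "R \<equiv> 2 * r + 4"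
abbreviation "K \<equiv> 6 * r + 12"

lemma pairs: "E \<subseteq> vertex_pairs n" and poss: "{u, w} \<in> E \<Longrightarrow> wgt (int w - int u) > 0"
  and forced: "u \<in> {1..n} \<Longrightarrow> u + L \<le> n \<Longrightarrow> {u, u + L} \<in> E"
  using graph by (auto simp: possible_graph_def)

lemma edgeD: "{u, w} \<in> E \<Longrightarrow> u \<in> {1..n} \<and> w \<in> {1..n} \<and> u \<noteq> w"
  using pairs by (auto simp: vertex_pairs_def doubleton_eq_iff)

lemma no_loop: "{u} \<notin> E"
  using edgeD[of u u] by auto

lemma JD:
  assumes "(v, y) \<in> J"
  shows "{v, y} \<in> E" "v < y" "(2 * R + 8) * L < y" "y + L \<le> n" "\<And>u. u \<in> segment R y \<Longrightarrow> clean E K u"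
    "v \<le> L \<or> (\<exists>v' y'. (v', y') \<in> J \<and> v = y' + L)"
  using J assms unfolding joints_def Let_def by blast+

lemma J_pairs:
  assumes "a \<in> J" "b \<in> J"
  shows "(fst a = fst b \<longleftrightarrow> snd a = snd b) \<and> (snd a < snd b \<longrightarrow> snd a + (2 * R + 8) * L < snd b)"
proof -
  have "\<forall>(v, y)\<in>J. \<forall>(v', y')\<in>J. (v = v' \<longleftrightarrow> y = y') \<and> (y < y' \<longrightarrow> y + (2 * R + 8) * L < y')"
    using J unfolding joints_def Let_def by (elim conjE)
  from bspec[OF this assms(1)] have "\<forall>(v', y')\<in>J. (fst a = v' \<longleftrightarrow> snd a = y') \<and>
      (snd a < y' \<longrightarrow> snd a + (2 * R + 8) * L < y')" by (simp add: case_prod_unfold)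
  from bspec[OF this assms(2)] show ?thesis by (simp add: case_prod_unfold)
qed

lemma J_unique: "(v, y) \<in> J \<Longrightarrow> (v', y') \<in> J \<Longrightarrow> v = v' \<longleftrightarrow> y = y'"
  using J_pairs[of "(v, y)" "(v', y')"] by simp

lemma J_sep: "(v, y) \<in> J \<Longrightarrow> (v', y') \<in> J \<Longrightarrow> y < y' \<Longrightarrow> y + (2 * R + 8) * L < y'"
  using J_pairs[of "(v, y)" "(v', y')"] by simp

lemma J_near:
  assumes "(v, y) \<in> J" "(v', y') \<in> J" "y \<le> y' + (2 * R + 8) * L" "y' \<le> y + (2 * R + 8) * L"
  shows "y = y'"
  using J_sep[OF assms(1,2)] J_sep[OF assms(2,1)] assms(3,4) by (cases y y' rule: linorder_cases) auto

lemma L_pos: "L \<ge> 1" by (rule lstar_ge_1)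

text \<open>A source is within \<open>L\<close> of the border or directly above a target. Targets
  are far from the border and from each other, so none is reached by a few forced steps upwards from
  a source.\<close>

lemma source_far:
  assumes "(v, y) \<in> J" "(v', y') \<in> J" "v + k * L = y'" "k \<le> R + 4"
  shows False
proof -
  have kL: "k * L \<le> (R + 4) * L" using assms(4) by (rule mult_le_mono1)
  from JD(6)[OF assms(1)] show False
  proof (elim disjE exE conjE)
    assume "v \<le> L"
    then have "y' \<le> (R + 5) * L" using kL assms(3) by (simp add: algebra_simps)
    also have "\<dots> \<le> (2 * R + 8) * L" by (rule mult_le_mono1) simp
    finally show False using JD(3)[OF assms(2)] by simp
  next
    fix v1 y1 assume v1: "(v1, y1) \<in> J" "v = y1 + L"
    have "y' = y1 + (k + 1) * L" using assms(3) v1 by simp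
    moreover have "(k + 1) * L \<le> (2 * R + 8) * L" using assms(4) by (intro mult_le_mono1) simp
    ultimately have "y1 = y'" using J_near[OF v1(1) assms(2)] by simp
    then show False using assms(3) v1(2) L_pos by simp
  qed
qed

definition seg :: "nat set" where
  "seg = (\<Union>(v, y)\<in>J. segment R y)"

lemma y_in_seg: "(v, y) \<in> J \<Longrightarrow> y \<in> seg"
  unfolding seg_def segment_def by (intro UN_I[of "(v, y)"]) (auto intro!: exI[of _ 0])

lemma seg_clean: "u \<in> seg \<Longrightarrow> clean E K u"
  unfolding seg_def using JD(5) by blast

text \<open>The edges to be stretched: those at a segment that are neither joints nor forced, and
  the forced edge above each target, which is thereby cut. The forced edges below a target keep
  their length, so the line continues downwards from \<open>y\<close>.\<close>

definition generic :: "nat set set" where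
  "generic = {e \<in> E. e \<inter> seg \<noteq> {} \<and> (\<forall>(v, y)\<in>J. e \<noteq> {v, y}) \<and>
     ((\<forall>u. e \<noteq> {u, u + L}) \<or> (\<exists>(v, y)\<in>J. e = {y, y + L}))}"

lemma finite_generic: "finite generic"
proof (rule finite_subset)
  show "generic \<subseteq> E" by (auto simp: generic_def)
  show "finite E" by (rule finite_subset[OF pairs finite_vertex_pairs])
qed

definition W :: nat where "W = 2 * r + 3"

text \<open>The bound \<open>n + L\<close> holds for every step that is not generic, and the paths
  in question have at most \<open>W\<close> edges; so \<open>c\<close> exceeds any sum of such steps
  even after adding \<open>L\<close>.\<close>

definition c :: nat where "c = W * (n + L) + n + L"

definition G :: "nat \<Rightarrow> nat" where
  "G = (SOME G. \<forall>i. (p (G i) > 0 \<and> c < G i) \<and> W * G i + c < G (Suc i))"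

lemma G: "p (G i) > 0" "c < G i" "W * G i + c < G (Suc i)"
  using someI_ex[OF sparse_steps[of c W]] unfolding G_def by blast+

lemma G_mono: "i \<le> j \<Longrightarrow> G i \<le> G j"
proof (induction j rule: dec_induct)
  case (step j)
  have "G j \<le> W * G j" by (simp add: W_def)
  then show ?case using step G(3)[of j] by linarith
qed simp

definition idx :: "nat set \<Rightarrow> nat" where
  "idx = (SOME f. bij_betw f generic {0..<card generic})"

lemma idx: "bij_betw idx generic {0..<card generic}"
  unfolding idx_def by (rule someI_ex[OF ex_bij_betw_finite_nat[OF finite_generic]])

text \<open>The displacement an edge is to have in the new picture: from source to target it is the
  missing step \<open>- L\<close>, each generic edge gets a huge step of its own, and all other
  edges keep their true difference.\<close>

definition ms :: "nat \<Rightarrow> nat \<Rightarrow> int" where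
  "ms u w = (if (u, w) \<in> J then - int L else if (w, u) \<in> J then int L
     else if {u, w} \<in> generic then (if u < w then int (G (idx {u, w})) else - int (G (idx {u, w})))
     else int w - int u)"

lemma J_asym: "(u, w) \<in> J \<Longrightarrow> (w, u) \<notin> J"
  using JD(2) by (meson less_asym)

lemma generic_D: "e \<in> generic \<Longrightarrow> e \<in> E"
  by (simp add: generic_def)

lemma ms_antisym: "ms w u = - ms u w"
proof -
  have "{u, w} \<in> generic \<Longrightarrow> u \<noteq> w" using generic_D edgeD by blast
  then show ?thesis
    using J_asym[of u w] J_asym[of w u] by (auto simp: ms_def insert_commute[of w])
qed

section \<open>The new positions are well defined\<close>

definition shift :: "nat \<Rightarrow> nat \<Rightarrow> int" where
  "shift u w = ms u w - (int w - int u)"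

lemma shift_supp: "shift u w \<noteq> 0 \<Longrightarrow> u \<in> seg \<or> w \<in> seg"
  using y_in_seg by (auto simp: shift_def ms_def generic_def split: if_splits)

text \<open>The true differences telescope to zero, and the correction \<open>shift\<close> lives on
  edges at clean vertices, where \<open>closed_walk_sum\<close> applies.\<close>

lemma closed_ms:
  assumes "walk E vs" "hd vs = last vs" "length vs \<le> Suc K"
  shows "walk_sum ms vs = 0"
proof -
  have "walk_sum shift vs = 0"
  proof (rule closed_walk_sum[OF _ _ _ _ assms])
    show "shift w u = - shift u w" for u w using ms_antisym[of w u] by (simp add: shift_def)
    show "u \<in> seg \<or> w \<in> seg" if "shift u w \<noteq> 0" for u w by (rule shift_supp[OF that])
  qed (use seg_clean no_loop in auto)
  moreover have "walk_sum shift vs = walk_sum ms vs - walk_sum (\<lambda>u w. int w - int u) vs"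
    unfolding shift_def by (rule walk_sum_diff)
  moreover have "vs \<noteq> []" using assms(1) by (simp add: walk_def)
  ultimately show ?thesis using assms(2) by (simp add: walk_sum_telescope)
qed

definition B where "B = nball E (Suc r) x"

definition way :: "nat \<Rightarrow> nat list" where
  "way u = (SOME vs. walk E vs \<and> hd vs = x \<and> last vs = u \<and> length vs \<le> r + 2)"

lemma way: "u \<in> B \<Longrightarrow> walk E (way u) \<and> hd (way u) = x \<and> last (way u) = u \<and> length (way u) \<le> r + 2"
  unfolding way_def B_def nball_walk by (rule someI_ex) simp

definition pos :: "nat \<Rightarrow> int" where
  "pos u = walk_sum ms (way u)"

lemma walk_append:
  assumes "walk E (as @ [y])" "walk E (y # bs)"
  shows "walk E (as @ y # bs)"
  using assms path_edges_split[of as y bs] by (auto simp: walk_def)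

text \<open>The walk to \<open>u\<close>, the given walk and the reversed walk to \<open>w\<close>
  together close up within \<open>Suc K\<close> vertices, so their total is zero. In particular the
  choice of \<open>way\<close> is immaterial.\<close>

lemma pos_diff:
  assumes "u \<in> B" "w \<in> B" "walk E vs" "hd vs = u" "last vs = w" "length vs \<le> 2 * r + 4"
  shows "pos w - pos u = walk_sum ms vs"
proof -
  obtain a where a: "way u = a @ [u]" using way[OF assms(1)] by (metis append_butlast_last_id walk_def)
  obtain b where b: "vs = u # b" using assms(3,4) by (cases vs) (auto simp: walk_def)
  obtain b' where b': "vs = b' @ [w]" using assms(3,5) by (metis append_butlast_last_id walk_def)
  obtain d where d: "rev (way w) = w # d"
    using way[OF assms(2)] by (cases "rev (way w)") (auto simp: walk_def rev_swap)
  have wd: "walk E (w # d)" "last (w # d) = x"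
    using way[OF assms(2)] d by (metis path_edges_rev rev_is_Nil_conv walk_def, metis last_rev d way assms(2) walk_def)
  have sd: "walk_sum ms (w # d) = - pos w"
    unfolding pos_def d[symmetric] by (rule walk_sum_rev) (rule ms_antisym)
  have "walk E (b' @ w # d)" using walk_append[of b' w d] assms(3) b' wd by simp
  moreover have bb: "b' @ w # d = u # (b @ d)" using b b' by (metis append.assoc append_Cons append_Nil)
  ultimately have "walk E (a @ u # (b @ d))"
    using walk_append[of a u "b @ d"] way[OF assms(1)] a by simp
  moreover have "last (a @ u # (b @ d)) = x" using wd(2) bb by (metis last_appendR list.simps(3))
  moreover have "hd (a @ u # (b @ d)) = x" using way[OF assms(1)] a by (cases a) auto
  moreover have "length (a @ u # (b @ d)) \<le> Suc K"
    using way[OF assms(1)] way[OF assms(2)] a b assms(6) arg_cong[OF d, of length] by simp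
  ultimately have "walk_sum ms (a @ u # (b @ d)) = 0" by (intro closed_ms) auto
  moreover have "walk_sum ms (a @ u # (b @ d)) = pos u + walk_sum ms (u # (b @ d))"
    using walk_sum_split[of ms a u "b @ d"] a by (simp add: pos_def)
  moreover have "walk_sum ms (u # (b @ d)) = walk_sum ms vs + walk_sum ms (w # d)"
    unfolding bb[symmetric] using walk_sum_split[of ms b' w d] b' by simp
  ultimately show ?thesis using sd by simp
qed

lemma pos_edge:
  assumes "u \<in> B" "w \<in> B" "{u, w} \<in> E"
  shows "pos w - pos u = ms u w"
  using pos_diff[OF assms(1,2), of "[u, w]"] assms(3) by (simp add: walk_def)

lemma ms_bound:
  assumes "{u, w} \<in> E" "{u, w} \<notin> generic"
  shows "\<bar>ms u w\<bar> \<le> int (n + L)"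
  using assms edgeD[OF assms(1)] by (auto simp: ms_def)

lemma ms_generic:
  assumes "{u, w} \<in> generic"
  shows "\<bar>ms u w\<bar> = int (G (idx {u, w}))"
proof -
  have "(u, w) \<notin> J" "(w, u) \<notin> J" using assms by (auto simp: generic_def insert_commute)
  then show ?thesis using assms by (simp add: ms_def)
qed

text \<open>The largest generic step on a path dominates all others.\<close>

lemma generic_path_large:
  assumes "walk E P" "distinct P" "length P \<le> 2 * r + 3" "path_edges P \<inter> generic \<noteq> {}"
  shows "\<bar>walk_sum ms P\<bar> > int L"
proof -
  define I where "I = idx ` (path_edges P \<inter> generic)"
  have finI: "finite I" "I \<noteq> {}" using assms(4) by (auto simp: I_def)
  then have "Max I \<in> I" by (rule Max_in)
  then obtain e where e: "e \<in> path_edges P" "e \<in> generic" "idx e = Max I" unfolding I_def by auto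
  have "\<exists>as a b bs. P = as @ a # b # bs \<and> e = {a, b}"
    using e(1)
  proof (induction P rule: path_edges.induct)
    case (1 u v zs)
    then consider "e = {u, v}" | "e \<in> path_edges (v # zs)" by auto
    then show ?case
    proof cases
      case 1
      then show ?thesis by (intro exI[of _ "[]"]) auto
    next
      case 2
      then obtain as a b bs where "v # zs = as @ a # b # bs" "e = {a, b}" using "1.IH" by blast
      then show ?thesis by (intro exI[of _ "u # as"]) auto
    qed
  qed auto
  then obtain as a b bs where P: "P = as @ a # b # bs" "e = {a, b}" by blast
  have sum: "walk_sum ms P = walk_sum ms (as @ [a]) + ms a b + walk_sum ms (b # bs)"
    using walk_sum_split[of ms as a "b # bs"] P(1) by simp
  have edges: "path_edges P = path_edges (as @ [a]) \<union> {e} \<union> path_edges (b # bs)"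
    using path_edges_split[of as a "b # bs"] P by auto
  have notin: "e \<notin> path_edges (as @ [a])" "e \<notin> path_edges (b # bs)"
    using path_edges_subset[of e "as @ [a]"] path_edges_subset[of e "b # bs"] assms(2) P by auto
  \<comment> \<open>Bounds every other step of the path: generic ones have smaller index, the rest
    are at most \<open>n + L\<close>, which alone remains if the largest index is 0.\<close>
  define M where "M = (if Max I = 0 then n + L else G (Max I - 1))"
  have big: "W * M + L < G (Max I)"
  proof (cases "Max I")
    case 0
    then show ?thesis using G(2)[of 0] by (simp add: M_def c_def)
  next
    case (Suc j)
    then show ?thesis using G(3)[of j] by (simp add: M_def c_def)
  qed
  have nM: "n + L \<le> M"
  proof (cases "Max I = 0")
    case False
    have "n + L \<le> c" by (simp add: c_def)
    then show ?thesis using False G(2)[of "Max I - 1"] by (simp add: M_def)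
  qed (simp add: M_def)
  have bnd: "\<bar>ms u w\<bar> \<le> int M" if uw: "{u, w} \<in> path_edges P" "{u, w} \<noteq> e" for u w
  proof (cases "{u, w} \<in> generic")
    case False
    have "{u, w} \<in> E" using uw assms(1) by (auto simp: walk_def)
    then show ?thesis using ms_bound[OF _ False] nM by force
  next
    case True
    have "idx {u, w} \<le> Max I" using uw(1) True finI by (intro Max_ge) (auto simp: I_def)
    moreover have "idx {u, w} \<noteq> idx e"
      using uw(2) True e(2) idx by (auto simp: bij_betw_def inj_on_def)
    ultimately have "idx {u, w} \<le> Max I - 1" "Max I \<noteq> 0" using e(3) by auto
    then have "G (idx {u, w}) \<le> M" using G_mono by (simp add: M_def)
    then show ?thesis using ms_generic[OF True] by simp
  qed
  have 1: "\<bar>walk_sum ms (as @ [a])\<bar> \<le> int (length (as @ [a]) - 1) * int M"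
    by (rule walk_sum_bound, rule bnd) (use edges notin in auto)
  have 2: "\<bar>walk_sum ms (b # bs)\<bar> \<le> int (length (b # bs) - 1) * int M"
    by (rule walk_sum_bound, rule bnd) (use edges notin in auto)
  have "\<bar>walk_sum ms (as @ [a])\<bar> + \<bar>walk_sum ms (b # bs)\<bar> \<le> int (length as + length bs) * int M"
    using 1 2 by (simp add: algebra_simps)
  also have "\<dots> \<le> int W * int M"
    using assms(3) P(1) by (intro mult_right_mono) (auto simp: W_def)
  also have "int W * int M < int (G (Max I)) - int L"
    using big by (metis less_diff_eq of_nat_add of_nat_less_iff of_nat_mult)
  finally have "\<bar>walk_sum ms (as @ [a])\<bar> + \<bar>walk_sum ms (b # bs)\<bar> + int L < int (G (Max I))"
    by linarith
  moreover have "\<bar>ms a b\<bar> = int (G (Max I))" using ms_generic e P(2) by metis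
  ultimately show ?thesis using sum by linarith
qed

text \<open>After passing a joint downwards, a path without generic edges can only follow the segment.\<close>

lemma segment_run:
  assumes "(v, y) \<in> J" "b + k * L = y" "k + length bs \<le> R"
    and "distinct (b # bs)" "walk E (b # bs)" "path_edges (b # bs) \<inter> generic = {}"
    and "k = 0 \<Longrightarrow> v \<notin> set bs" "k > 0 \<Longrightarrow> b + L \<notin> set bs"
  shows "last (b # bs) + (k + length bs) * L = y \<and> walk_sum ms (b # bs) = - int (length bs * L)"
  using assms(2-)
proof (induction bs arbitrary: b k)
  case (Cons d bs)
  have edge: "{b, d} \<in> E" "{b, d} \<notin> generic" using Cons.prems by (auto simp: walk_def)
  have "b \<in> segment R y" using Cons.prems unfolding segment_def by (intro CollectI exI[of _ k]) simp
  then have bseg: "b \<in> seg" using assms(1) unfolding seg_def by blast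
  have notJ1: "(b, d) \<notin> J" using source_far[OF _ assms(1) Cons.prems(1)] Cons.prems(2) by (metis add_leD1 trans_le_add1)
  \<comment> \<open>Leaving \<open>b\<close> backwards through a joint requires \<open>b\<close> to
    be a target. The only target this close is \<open>y\<close>, and its source is excluded in the
    case \<open>k = 0\<close>.\<close>
  have notJ2: "(d, b) \<notin> J"
  proof
    assume db: "(d, b) \<in> J"
    have "k * L \<le> (2 * R + 8) * L" using Cons.prems(2) by (intro mult_le_mono1) simp
    then have "y \<le> b + (2 * R + 8) * L" "b \<le> y + (2 * R + 8) * L" using Cons.prems(1) by linarith+
    then have "b = y" by (intro J_near[OF db assms(1)])
    then have "k = 0" "d = v" using Cons.prems(1) L_pos J_unique[OF db assms(1)] by auto
    then show False using Cons.prems(6) by simp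
  qed
  have "\<exists>u. {b, d} = {u, u + L}" and top: "\<And>v' y'. (v', y') \<in> J \<Longrightarrow> {b, d} \<noteq> {y', y' + L}"
    using edge bseg notJ1 notJ2 unfolding generic_def by (auto simp: doubleton_eq_iff)
  then have "d = b + L \<or> b = d + L" by (auto simp: doubleton_eq_iff)
  \<comment> \<open>At \<open>y\<close> the forced edge upwards is generic; below \<open>y\<close>
    its upper end is the vertex just left, excluded by hypothesis.\<close>
  moreover have "d \<noteq> b + L"
  proof
    assume d: "d = b + L"
    show False
    proof (cases "k = 0")
      case True
      then show False using top[OF assms(1)] d Cons.prems(1) by simp
    next
      case False
      then show False using Cons.prems(7) d by simp
    qed
  qed
  ultimately have d: "b = d + L" by simp
  have "last (d # bs) + (Suc k + length bs) * L = y \<and> walk_sum ms (d # bs) = - int (length bs * L)"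
  proof (rule Cons.IH)
    show "d + Suc k * L = y" using d Cons.prems(1) by simp
    show "Suc k + length bs \<le> R" "distinct (d # bs)" using Cons.prems(2,3) by auto
    show "walk E (d # bs)" "path_edges (d # bs) \<inter> generic = {}" using Cons.prems(4,5) by (auto simp: walk_def)
    show "d + L \<notin> set bs" using Cons.prems(3) d by auto
  qed simp
  moreover have "ms b d = - int L" using notJ1 notJ2 edge(2) d by (simp add: ms_def)
  ultimately show ?case by (simp add: algebra_simps)
qed simp

section \<open>Paths through joints, and separation of the new positions\<close>

definition down_joint :: "nat list \<Rightarrow> bool" where
  "down_joint P \<longleftrightarrow> (\<exists>as bs v y. (v, y) \<in> J \<and> P = as @ v # y # bs)"

text \<open>After the joint \<open>segment_run\<close> leaves no choice: the rest of the path
  descends the segment, contributing \<open>- L\<close> per edge.\<close>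

lemma down_joint_end:
  assumes "(v, y) \<in> J" "P = as @ v # y # bs"
    and "walk E P" "distinct P" "length P \<le> R" "path_edges P \<inter> generic = {}"
  shows "last P + length bs * L = y \<and> walk_sum ms P = walk_sum ms (as @ [v]) - int (Suc (length bs) * L)"
proof -
  have e: "path_edges P = path_edges (as @ [v]) \<union> {{v, y}} \<union> path_edges (y # bs)"
    unfolding assms(2) using path_edges_split[of as v "y # bs"] by simp
  have "last (y # bs) + (0 + length bs) * L = y \<and> walk_sum ms (y # bs) = - int (length bs * L)"
    by (rule segment_run[OF assms(1)]) (use assms e in \<open>auto simp: walk_def\<close>)
  moreover have "walk_sum ms P = walk_sum ms (as @ [v]) + ms v y + walk_sum ms (y # bs)"
    using walk_sum_split[of ms as v "y # bs"] assms(2) by simp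
  moreover have "ms v y = - int L" using assms(1) by (simp add: ms_def)
  ultimately show ?thesis using assms(2) by (simp add: algebra_simps)
qed

lemma no_joint_sum:
  assumes "walk E P" "path_edges P \<inter> generic = {}" "\<not> down_joint P" "\<not> down_joint (rev P)"
  shows "walk_sum ms P = int (last P) - int (hd P)"
proof -
  have "walk_sum ms P = walk_sum (\<lambda>x y. int y - int x) P"
  proof (rule walk_sum_cong)
    fix u w assume uw: "{u, w} \<in> path_edges P"
    have split: "\<exists>as bs. Q = as @ u # w # bs \<or> Q = as @ w # u # bs" if "{u, w} \<in> path_edges Q" for Q
      using that
    proof (induction Q rule: path_edges.induct)
      case (1 a b zs)
      then consider "{u, w} = {a, b}" | "{u, w} \<in> path_edges (b # zs)" by auto
      then show ?case
      proof cases
        case 1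
        then show ?thesis by (intro exI[of _ "[]"] exI[of _ zs]) (auto simp: doubleton_eq_iff)
      next
        case 2
        then obtain as bs where "b # zs = as @ u # w # bs \<or> b # zs = as @ w # u # bs" using "1.IH" by blast
        then show ?thesis by (intro exI[of _ "a # as"] exI[of _ bs]) auto
      qed
    qed auto
    obtain as bs where P: "P = as @ u # w # bs \<or> P = as @ w # u # bs" using split[OF uw] by blast
    have down: "(a, b) \<notin> J" if "P = as @ a # b # bs \<or> P = as @ b # a # bs" for a b
    proof
      assume ab: "(a, b) \<in> J"
      from that show False
      proof
        assume "P = as @ a # b # bs"
        then show False using assms(3) ab unfolding down_joint_def by blast
      next
        assume "P = as @ b # a # bs"
        then have "rev P = rev bs @ a # b # rev as" by simp
        then show False using assms(4) ab unfolding down_joint_def by blast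
      qed
    qed
    have "(u, w) \<notin> J" "(w, u) \<notin> J" using down[of u w] down[of w u] P by blast+
    moreover have "{u, w} \<notin> generic" using uw assms(2) by blast
    ultimately show "ms u w = int w - int u" by (simp add: ms_def)
  qed
  moreover have "P \<noteq> []" using assms(1) by (simp add: walk_def)
  ultimately show ?thesis by (simp add: walk_sum_telescope)
qed

text \<open>A joint crossed downwards would make \<open>v\<close> the foot of a run below a target,
  against \<open>source_far\<close>. If one is crossed upwards, the reversed path crosses it
  downwards, so \<open>Q\<close> must begin by climbing its segment; the same argument excludes a
  second joint.\<close>

lemma path_to_source:
  assumes "(v, y) \<in> J" "walk E Q" "distinct Q" "last Q = v" "length Q \<le> R" "path_edges Q \<inter> generic = {}"
  shows "walk_sum ms Q = int v - int (hd Q) \<or>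
    (\<exists>v' y' k. (v', y') \<in> J \<and> k \<le> R \<and> y' \<in> set Q \<and> hd Q + k * L = y' \<and>
       walk_sum ms Q = int (Suc k * L) + int v - int v')"
proof (cases "down_joint (rev Q)")
  case False
  have "\<not> down_joint Q"
  proof
    assume "down_joint Q"
    then obtain as bs v' y' where d: "(v', y') \<in> J" "Q = as @ v' # y' # bs" unfolding down_joint_def by blast
    have "v + length bs * L = y'" using down_joint_end[OF d assms(2,3,5,6)] assms(4) by simp
    then show False using source_far[OF assms(1) d(1), of "length bs"] d(2) assms(5) by simp
  qed
  then show ?thesis using no_joint_sum[OF assms(2,6) _ False] assms(4) by simp
next
  case True
  then obtain as bs v' y' where d: "(v', y') \<in> J" "rev Q = as @ v' # y' # bs" unfolding down_joint_def by blast
  have rQ: "walk E (rev Q)" "distinct (rev Q)" "length (rev Q) \<le> R" "path_edges (rev Q) \<inter> generic = {}"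
    using assms by (auto simp: walk_def path_edges_rev)
  note run = down_joint_end[OF d rQ]
  have lastQ: "last (rev Q) = hd Q" using assms(2) by (simp add: walk_def last_rev)
  have k: "length bs \<le> R" using d(2) rQ(3) by simp
  have A: "walk E (as @ [v'])" "path_edges (as @ [v']) \<inter> generic = {}" "distinct (as @ [v'])"
    "length (as @ [v']) \<le> R"
    using rQ d(2) path_edges_split[of as v' "y' # bs"] by (auto simp: walk_def)
  have nodown: "\<not> down_joint (as @ [v'])"
  proof
    assume "down_joint (as @ [v'])"
    then obtain as1 bs1 v1 y1 where d1: "(v1, y1) \<in> J" "as @ [v'] = as1 @ v1 # y1 # bs1"
      unfolding down_joint_def by blast
    have "v' + length bs1 * L = y1" using down_joint_end[OF d1 A(1,3,4,2)] by simp
    moreover have "length bs1 \<le> R" using A(4) unfolding d1(2) by simp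
    ultimately show False using source_far[OF d(1) d1(1), of "length bs1"] by simp
  qed
  have nodown': "\<not> down_joint (rev (as @ [v']))"
  proof
    assume "down_joint (rev (as @ [v']))"
    then obtain as1 bs1 v1 y1 where d1: "(v1, y1) \<in> J" "rev (as @ [v']) = as1 @ v1 # y1 # bs1"
      unfolding down_joint_def by blast
    have rA: "walk E (rev (as @ [v']))" "distinct (rev (as @ [v']))" "length (rev (as @ [v'])) \<le> R"
      "path_edges (rev (as @ [v'])) \<inter> generic = {}"
      using A by (auto simp only: walk_def path_edges_rev distinct_rev length_rev rev_is_Nil_conv)
    have "last (rev (as @ [v'])) + length bs1 * L = y1" using down_joint_end[OF d1 rA] by simp
    moreover have "last (rev (as @ [v'])) = v"
      using assms(4) d(2) by (metis Nil_is_append_conv append_is_Nil_conv hd_append2 hd_rev last_rev list.sel(1) list.discI self_append_conv2 append_Nil)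
    moreover have "length bs1 \<le> R" using rA(3) unfolding d1(2) by simp
    ultimately show False using source_far[OF assms(1) d1(1), of "length bs1"] by simp
  qed
  have hdA: "hd (as @ [v']) = v"
    using assms(4) d(2) hd_rev[of Q] by (cases as) auto
  have "walk_sum ms (as @ [v']) = int v' - int v"
    using no_joint_sum[OF A(1,2) nodown nodown'] hdA by simp
  moreover have "walk_sum ms (rev Q) = - walk_sum ms Q" by (rule walk_sum_rev) (rule ms_antisym)
  ultimately have "walk_sum ms Q = int (Suc (length bs) * L) + int v - int v'" using run by simp
  moreover have "y' \<in> set Q" using d(2) by (metis in_set_conv_decomp append_Cons append_assoc set_rev append.left_neutral)
  moreover have "hd Q + length bs * L = y'" using run lastQ by simp
  ultimately show ?thesis using d(1) k by blast
qed

text \<open>Sources beyond the border sit \<open>L\<close> above widely spaced targets that are also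
  far from the border, so two different sources cannot be a few forced steps apart.\<close>

lemma sources_apart:
  assumes "(v, y) \<in> J" "(v', y') \<in> J" "v' = v + j * L" "j \<le> R + 4"
  shows "v = v'"
proof (rule ccontr)
  assume "v \<noteq> v'"
  then have j: "j > 0" using assms(3) by (cases j) auto
  have jL: "j * L \<le> (R + 4) * L" using assms(4) by (rule mult_le_mono1)
  have v1: "v \<ge> 1" using JD(1)[OF assms(1)] edgeD by fastforce
  have "v' > L" using assms(3) j v1 L_pos by (cases j) auto
  then obtain v2 y2 where 2: "(v2, y2) \<in> J" "v' = y2 + L" using JD(6)[OF assms(2)] by auto
  from JD(6)[OF assms(1)] show False
  proof (elim disjE exE conjE)
    assume "v \<le> L"
    then have "y2 \<le> (R + 4) * L" using assms(3) 2 jL by linarith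
    also have "\<dots> \<le> (2 * R + 8) * L" by (intro mult_le_mono1) simp
    finally show False using JD(3)[OF 2(1)] by simp
  next
    fix v3 y3 assume 3: "(v3, y3) \<in> J" "v = y3 + L"
    then have "y2 = y3 + j * L" using 2 assms(3) by simp
    moreover have "(R + 4) * L \<le> (2 * R + 8) * L" by (intro mult_le_mono1) simp
    ultimately have "y3 \<le> y2 + (2 * R + 8) * L" "y2 \<le> y3 + (2 * R + 8) * L" using jL by linarith+
    then have "y3 = y2" by (rule J_near[OF 3(1) 2(1)])
    then show False using \<open>y2 = y3 + j * L\<close> j L_pos by simp
  qed
qed

text \<open>Here \<open>v\<close> is the upper end of a cut edge \<open>{y', v}\<close>. The forced
  line from \<open>hd Q\<close> up to \<open>y'\<close>, the cut edge and the reversed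
  \<open>Q\<close> would form a short closed walk using the cut edge exactly once, although
  \<open>y'\<close> is clean.\<close>

lemma below_source:
  assumes "(v, y) \<in> J" "walk E Q" "last Q = v" "length Q \<le> R" "path_edges Q \<inter> generic = {}"
    and "hd Q + j * L = v" "0 < j" "j \<le> R + 1" "1 \<le> hd Q"
  shows False
proof -
  have "L < v" using assms(6,7,9) by (cases j) auto
  then obtain v' y' where 1: "(v', y') \<in> J" "v = y' + L" using JD(6)[OF assms(1)] by auto
  define i where "i = j - 1"
  define u where "u = hd Q"
  have ui: "u + i * L = y'" using assms(6,7) 1 by (cases j) (auto simp: i_def u_def)
  define line where "line = map (\<lambda>k. u + k * L) [0..<Suc i]"
  have line: "hd line = u" "last line = y'" "length line = Suc i" "line \<noteq> []"
    using ui by (auto simp: line_def hd_map last_map simp del: upt_Suc) (simp add: upt_rec)?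
  have edge: "path_edges (map (\<lambda>k. u + k * L) [a..<Suc i]) \<subseteq> E" for a
  proof (induction "i - a" arbitrary: a)
    case 0
    then show ?case by (cases "a = i") (auto simp: upt_rec[of a])
  next
    case (Suc m)
    then have a: "a < i" by simp
    have "[a..<Suc i] = a # Suc a # [Suc (Suc a)..<Suc i]"
      using a by (simp add: upt_conv_Cons del: upt_Suc)
    moreover have "[Suc a..<Suc i] = Suc a # [Suc (Suc a)..<Suc i]" using a by (simp add: upt_conv_Cons del: upt_Suc)
    moreover have "path_edges (map (\<lambda>k. u + k * L) [Suc a..<Suc i]) \<subseteq> E" using Suc by simp
    moreover have "{u + a * L, u + Suc a * L} \<in> E"
    proof -
      have "Suc a * L \<le> i * L" using a by (intro mult_le_mono1) simp
      then have "u + a * L + L \<le> n" using ui JD(4)[OF 1(1)] by simp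
      moreover have "u + a * L \<ge> 1" using assms(9) by (simp add: u_def)
      moreover have "u + Suc a * L = u + a * L + L" by simp
      ultimately show ?thesis using forced[of "u + a * L"] by (simp only: atLeastAtMost_iff) simp
    qed
    ultimately show ?case by simp
  qed
  have wl: "walk E line" using edge[of 0] line(4) by (simp add: walk_def line_def)
  \<comment> \<open>Signed count of traversals of the cut edge. It totals 1 on the closed walk,
    which contradicts \<open>closed_walk_sum\<close>.\<close>
  define d where "d = (\<lambda>a b. if a = y' \<and> b = v then 1 else if a = v \<and> b = y' then -1 else 0 :: int)"
  have top: "{y', v} \<in> generic"
  proof -
    have "1 \<le> y'" using JD(3)[OF 1(1)] by simp
    then have "{y', v} \<in> E" using forced[of y'] JD(4)[OF 1(1)] 1(2) by simp
    moreover have "{y', v} \<inter> seg \<noteq> {}" using y_in_seg[OF 1(1)] by blast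
    moreover have "{y', v} \<noteq> {v1, y1}" if "(v1, y1) \<in> J" for v1 y1
    proof
      assume e: "{y', v} = {v1, y1}"
      have "v1 = y'" "y1 = v" using e JD(2)[OF that] 1(2) by (auto simp: doubleton_eq_iff)
      then show False using J_near[OF 1(1) that] 1(2) L_pos by (simp add: trans_le_add2)
    qed
    moreover have "\<exists>(v1, y1)\<in>J. {y', v} = {y1, y1 + L}" using 1 by blast
    ultimately show ?thesis unfolding generic_def by blast
  qed
  have Q0: "walk_sum d Q = 0"
  proof (rule walk_sum_zero)
    fix a b assume "{a, b} \<in> path_edges Q"
    then have "{a, b} \<notin> generic" using assms(5) by (meson disjoint_iff)
    then have "{a, b} \<noteq> {y', v}" using top by metis
    then show "d a b = 0" by (auto simp: d_def)
  qed
  obtain q where q: "Q = q @ [v]" using assms(2,3) by (metis append_butlast_last_id walk_def)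
  obtain l where l: "line = l @ [y']" using line by (metis append_butlast_last_id)
  have l0: "walk_sum d line = 0"
  proof (rule walk_sum_zero)
    fix a b assume "{a, b} \<in> path_edges line"
    then have "{a, b} \<subseteq> set line" by (rule path_edges_subset)
    moreover have "v \<notin> set line"
    proof
      assume "v \<in> set line"
      then obtain k where k: "k < Suc i" "v = u + k * L" by (auto simp: line_def simp del: upt_Suc)
      then have "k * L \<le> i * L" by (intro mult_le_mono1) simp
      then show False using ui 1(2) L_pos k(2) by linarith
    qed
    ultimately show "d a b = 0" by (auto simp: d_def)
  qed
  let ?C = "line @ rev Q"
  have rq: "rev Q = v # rev q" using q by simp
  have C: "?C = l @ y' # v # rev q" using l rq by simp
  have "walk E ?C"
  proof -
    have "walk E (v # rev q)" using assms(2) rq by (metis path_edges_rev walk_def list.distinct(1))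
    then have "walk E (y' # v # rev q)" using generic_D[OF top] by (auto simp: walk_def)
    then show ?thesis unfolding C using walk_append[of l y' "v # rev q"] wl unfolding l by simp
  qed
  moreover have "hd ?C = last ?C"
    using line assms(2) by (simp add: walk_def last_rev u_def)
  moreover have "length ?C \<le> Suc K" using line(3) assms(4,8) by (simp add: i_def)
  moreover have anti: "d b a = - d a b" for a b using 1(2) L_pos by (simp add: d_def)
  moreover have "a \<in> {y'} \<or> b \<in> {y'}" if "d a b \<noteq> 0" for a b
    using that by (simp add: d_def split: if_splits)
  moreover have "clean E K a" if "a \<in> {y'}" for a
    using that seg_clean[OF y_in_seg[OF 1(1)]] by simp
  ultimately have "walk_sum d ?C = 0" using no_loop by (intro closed_walk_sum[of d "{y'}" E K])
  moreover have "walk_sum d ?C = walk_sum d line + d y' v + walk_sum d (rev Q)"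
    unfolding C using walk_sum_split[of d l y' "v # rev q"] l rq by simp
  moreover have "walk_sum d (rev Q) = 0" using Q0 walk_sum_rev[of d Q, OF anti] by simp
  ultimately show False using l0 by (simp add: d_def)
qed

text \<open>If the part before the joint uses true steps, the value of the sum puts
  \<open>hd P\<close> on the forced line below \<open>v\<close>, against
  \<open>below_source\<close>, unless the endpoints are those of the joint. If that part climbs
  through another joint, the two sources are a few multiples of \<open>L\<close> apart, against
  \<open>sources_apart\<close>.\<close>

lemma down_joint_case:
  assumes "walk E P" "distinct P" "length P \<le> 2 * r + 3" "path_edges P \<inter> generic = {}" "down_joint P"
    and "walk_sum ms P = 0 \<or> \<bar>walk_sum ms P\<bar> = int L"
  shows "walk_sum ms P \<noteq> 0 \<and> {hd P, last P} \<in> E"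
proof -
  obtain as bs v y where d: "(v, y) \<in> J" "P = as @ v # y # bs" using assms(5) unfolding down_joint_def by blast
  define k where "k = length bs"
  define Q where "Q = as @ [v]"
  have lenP: "length P \<le> R" using assms(3) by simp
  have run: "last P + k * L = y" "walk_sum ms P = walk_sum ms Q - int (Suc k * L)"
    using down_joint_end[OF d assms(1,2) lenP assms(4)] by (auto simp: k_def Q_def)
  have Q: "walk E Q" "distinct Q" "last Q = v" "length Q \<le> R" "path_edges Q \<inter> generic = {}"
    using assms d(2) path_edges_split[of as v "y # bs"] by (auto simp: walk_def Q_def)
  have hdQ: "hd Q = hd P" using d(2) by (cases as) (auto simp: Q_def)
  have lens: "length as + k + 2 \<le> 2 * r + 3" using assms(3) d(2) by (simp add: k_def)
  have hdV: "1 \<le> hd P"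
  proof -
    have "\<Union>E \<subseteq> {1..n}" using pairs by (auto simp: vertex_pairs_def)
    moreover have "v \<in> {1..n}" using JD(1)[OF d(1)] edgeD by blast
    then have "hd (rev Q) \<in> {1..n}" using Q(1,3) by (simp add: hd_rev)
    ultimately have "set (rev Q) \<subseteq> {1..n}"
      using Q(1) by (intro path_edges_vertices[of _ E]) (auto simp: walk_def path_edges_rev)
    then have "hd Q \<in> {1..n}" using Q(1) by (metis hd_in_set set_rev subsetD walk_def)
    then show ?thesis using hdQ by simp
  qed
  from path_to_source[OF d(1) Q(1-5)] show ?thesis
  proof (elim disjE exE conjE)
    assume "walk_sum ms Q = int v - int (hd Q)"
    then have t: "walk_sum ms P = int v - int (hd P) - int (Suc k * L)" using run hdQ by simp
    consider (0) "walk_sum ms P = 0" | (plus) "walk_sum ms P = int L" | (minus) "walk_sum ms P = - int L"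
      using assms(6) by linarith
    then show ?thesis
    proof cases
      case 0
      then have "hd Q + Suc k * L = v" using t hdQ by linarith
      then show ?thesis using below_source[OF d(1) Q(1,3-5), of "Suc k"] lens hdV hdQ by simp
    next
      case plus
      have "Suc (Suc k) * L = Suc k * L + L" by simp
      then have "hd Q + Suc (Suc k) * L = v" using t hdQ plus by linarith
      then show ?thesis using below_source[OF d(1) Q(1,3-5), of "Suc (Suc k)"] lens hdV hdQ by simp
    next
      case minus
      have "Suc k * L = k * L + L" by simp
      then have e: "hd Q + k * L = v" using t hdQ minus by linarith
      show ?thesis
      proof (cases "k = 0")
        case True
        then have "hd P = v" "last P = y" using e run(1) hdQ by auto
        then show ?thesis using JD(1)[OF d(1)] minus L_pos by simp
      next
        case False
        then show ?thesis using below_source[OF d(1) Q(1,3-5), of k] e lens hdV hdQ by simp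
      qed
    qed
  next
    fix v' y' k' assume 1: "(v', y') \<in> J" "k' \<le> R" "y' \<in> set Q" "hd Q + k' * L = y'"
      "walk_sum ms Q = int (Suc k' * L) + int v - int v'"
    have "y \<notin> set Q" using assms(2) d(2) by (auto simp: Q_def)
    then have "v \<noteq> v'" using J_unique[OF d(1) 1(1)] 1(3) by auto
    have t: "walk_sum ms P = int (Suc k' * L) + int v - int v' - int (Suc k * L)" using run 1(5) by simp
    have "\<exists>j. \<bar>j\<bar> \<le> int R + 2 \<and> int v' - int v = j * int L"
    proof -
      consider (0) "walk_sum ms P = 0" | (plus) "walk_sum ms P = int L" | (minus) "walk_sum ms P = - int L"
        using assms(6) by linarith
      then show ?thesis
      proof cases
        case 0
        then show ?thesis using t 1(2) lens by (intro exI[of _ "int k' - int k"]) (auto simp: algebra_simps)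
      next
        case plus
        then show ?thesis using t 1(2) lens by (intro exI[of _ "int k' - int k - 1"]) (auto simp: algebra_simps)
      next
        case minus
        then show ?thesis using t 1(2) lens by (intro exI[of _ "int k' - int k + 1"]) (auto simp: algebra_simps)
      qed
    qed
    then obtain j where j: "\<bar>j\<bar> \<le> int R + 2" "int v' - int v = j * int L" by blast
    have le: "nat j \<le> R + 4" "nat (- j) \<le> R + 4" using j(1) by linarith+
    show ?thesis
    proof (cases "j \<ge> 0")
      case True
      then have "int v' = int (v + nat j * L)" using j(2) by simp
      then have "v' = v + nat j * L" by (simp only: of_nat_eq_iff)
      then show ?thesis using sources_apart[OF d(1) 1(1) _ le(1)] \<open>v \<noteq> v'\<close> by simp
    next
      case False
      then have "int v = int (v' + nat (- j) * L)" using j(2) by (simp add: algebra_simps)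
      then have "v = v' + nat (- j) * L" by (simp only: of_nat_eq_iff)
      then show ?thesis using sources_apart[OF 1(1) d(1) _ le(2)] \<open>v \<noteq> v'\<close> by simp
    qed
  qed
qed

text \<open>Excludes the two accidents that a template forbids. On a repetition-free path between
  the vertices a generic edge makes the displacement exceed \<open>L\<close>; a joint is handled by
  \<open>down_joint_case\<close>, on the path or its reverse; otherwise the displacement is the true
  difference.\<close>

lemma pos_separates:
  assumes "u \<in> B" "w \<in> B"
  shows "pos u = pos w \<Longrightarrow> u = w" "pos w - pos u = int L \<Longrightarrow> {u, w} \<in> E"
proof -
  have "w \<in> nball E (Suc r + Suc r) u"
    using assms nball_trans nball_sym unfolding B_def by metis
  then obtain vs where "walk E vs" "hd vs = u" "last vs = w" "length vs \<le> 2 * r + 3"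
    unfolding nball_walk by auto
  then obtain P where P: "walk E P" "distinct P" "hd P = u" "last P = w" "length P \<le> 2 * r + 3"
    using walk_shorten by (metis order_trans)
  have t: "pos w - pos u = walk_sum ms P" using pos_diff[OF assms P(1,3,4)] P(5) by simp
  have rP: "walk E (rev P)" "distinct (rev P)" "length (rev P) \<le> 2 * r + 3"
    "walk_sum ms (rev P) = - walk_sum ms P" "hd (rev P) = w" "last (rev P) = u"
    using P walk_sum_rev[of ms P, OF ms_antisym] by (auto simp: walk_def path_edges_rev hd_rev last_rev)
  have main: "if walk_sum ms P = 0 then u = w else {u, w} \<in> E"
    if c: "walk_sum ms P = 0 \<or> \<bar>walk_sum ms P\<bar> = int L"
  proof -
    have "\<not> \<bar>walk_sum ms P\<bar> > int L" using c by auto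
    then have ng: "path_edges P \<inter> generic = {}" using generic_path_large[OF P(1,2,5)] by blast
    consider "down_joint P" | "down_joint (rev P)" | "\<not> down_joint P" "\<not> down_joint (rev P)" by blast
    then show ?thesis
    proof cases
      case 1
      then show ?thesis using down_joint_case[OF P(1,2,5) ng 1] c P by simp
    next
      case 2
      then show ?thesis using down_joint_case[OF rP(1-3) _ 2] ng c rP by (simp add: path_edges_rev insert_commute)
    next
      case 3
      then have s: "walk_sum ms P = int w - int u" using no_joint_sum[OF P(1) ng] P by simp
      have V: "u \<in> {1..n}" "w \<in> {1..n}"
      proof -
        have "\<Union>E \<subseteq> {1..n}" using pairs by (auto simp: vertex_pairs_def)
        then show "u \<in> {1..n}" "w \<in> {1..n}" using assms nball_subset[OF x] unfolding B_def by blast+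
      qed
      show ?thesis
      proof (cases "walk_sum ms P = 0")
        case False
        then have "w = u + L \<or> u = w + L" using c s by auto
        then have "{u, w} \<in> E" using forced[of u] forced[of w] V by (auto simp: insert_commute)
        then show ?thesis using False by simp
      qed (use s in simp)
    qed
  qed
  show "u = w" if "pos u = pos w" using main t that by simp
  show "{u, w} \<in> E" if "pos w - pos u = int L" using main t that L_pos by simp
qed

lemma ms_weight: "{u, w} \<in> E \<Longrightarrow> wgt (ms u w) > 0"
proof -
  assume e: "{u, w} \<in> E"
  have "wgt (int (G i)) > 0" for i using G(1)[of i] G(2)[of i] by (simp add: wgt_def)
  then show ?thesis unfolding ms_def using poss[OF e] by simp
qed

theorem realizable: "realizable E r x"
proof -
  define S where "S = pos ` B"
  define H where "H = {{pos u, pos w} | u w. u \<in> B \<and> w \<in> B \<and> {u, w} \<in> E}"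
  have inj: "inj_on pos B" by (rule inj_onI) (use pos_separates(1) in blast)
  have adj: "{pos u, pos w} \<in> H \<longleftrightarrow> {u, w} \<in> E" if "u \<in> B" "w \<in> B" for u w
  proof
    assume "{pos u, pos w} \<in> H"
    then obtain u' w' where "u' \<in> B" "w' \<in> B" "{u', w'} \<in> E" "{pos u, pos w} = {pos u', pos w'}"
      unfolding H_def by blast
    moreover from this have "u = u' \<and> w = w' \<or> u = w' \<and> w = u'"
      using inj_onD[OF inj] that by (metis doubleton_eq_iff)
    ultimately show "{u, w} \<in> E" by (auto simp: insert_commute)
  qed (use that in \<open>auto simp: H_def\<close>)
  have closed: "w \<in> pos ` nball E (Suc r) x" if "{pos u, w} \<in> H" for u w
    using that unfolding H_def B_def by (auto simp: doubleton_eq_iff)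
  have sub: "nball E r x \<subseteq> B" unfolding B_def by (rule nball_mono) simp
  have nbr: "w \<in> B" if "u \<in> nball E r x" "{u, w} \<in> E" for u w using that unfolding B_def by auto
  have VB: "B \<subseteq> {1..n}"
    unfolding B_def by (rule nball_subset[OF x]) (use pairs in \<open>auto simp: vertex_pairs_def\<close>)
  have plain: "ms u w = int w - int u"
    if a: "{u, w} \<in> E" "w = u + L" "\<And>v y. (v, y) \<in> J \<Longrightarrow> u \<noteq> y" for u w
  proof -
    have "(u, w) \<notin> J" using source_far[of u w u w 1] that by auto
    moreover have "(w, u) \<notin> J" using that(3) by blast
    moreover have "{u, w} \<notin> generic"
    proof
      assume "{u, w} \<in> generic"
      then obtain v y where "(v, y) \<in> J" "{u, w} = {y, y + L}" using a(2) unfolding generic_def by blast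
      then show False using that(2,3) L_pos by (auto simp: doubleton_eq_iff)
    qed
    ultimately show ?thesis by (simp add: ms_def)
  qed
  \<comment> \<open>In the new picture the upper neighbour of a target is its source, and the lower
    neighbour of a source is its target. In the other cases the true forced neighbour exists by
    \<open>high\<close> or \<open>low\<close>, and the edge to it is not cut, downwards because of
    \<open>mid\<close>.\<close>
  have inner: "pos u + int L \<in> S \<and> pos u - int L \<in> S" if u: "u \<in> nball E r x" for u
  proof
    have uB: "u \<in> B" using u sub by blast
    have un: "u \<in> {1..n}" "u + L \<le> n" using uB VB high[OF u] by auto
    show "pos u + int L \<in> S"
    proof (cases "\<exists>v. (v, u) \<in> J")
      case True
      then obtain v where v: "(v, u) \<in> J" by blast
      have e: "{u, v} \<in> E" using JD(1)[OF v] by (simp add: insert_commute)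
      have "pos v - pos u = ms u v" by (rule pos_edge[OF uB nbr[OF u e] e])
      also have "\<dots> = int L" using v J_asym[OF v] by (simp add: ms_def)
      finally show ?thesis using nbr[OF u e] unfolding S_def by (metis add.commute diff_add_cancel imageI)
    next
      case False
      have e: "{u, u + L} \<in> E" by (rule forced[OF un])
      have "pos (u + L) - pos u = ms u (u + L)" by (rule pos_edge[OF uB nbr[OF u e] e])
      also have "\<dots> = int L" using plain[OF e refl] False by auto
      finally show ?thesis using nbr[OF u e] unfolding S_def by (metis add.commute diff_add_cancel imageI)
    qed
    show "pos u - int L \<in> S"
    proof (cases "u \<in> fst ` J")
      case True
      then obtain y where y: "(u, y) \<in> J" by auto
      have e: "{u, y} \<in> E" by (rule JD(1)[OF y])
      have "pos y - pos u = ms u y" by (rule pos_edge[OF uB nbr[OF u e] e])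
      also have "\<dots> = - int L" using y by (simp add: ms_def)
      finally have "pos u - int L = pos y" by simp
      then show ?thesis using nbr[OF u e] unfolding S_def by simp
    next
      case False
      then have uL: "u > L" using low[OF u] by force
      define w where "w = u - L"
      have w: "u = w + L" "w \<in> {1..n}" using uL un by (auto simp: w_def)
      have e: "{w, u} \<in> E" using forced[OF w(2)] w(1) un by simp
      have e': "{u, w} \<in> E" using e by (simp add: insert_commute)
      have "w \<noteq> y" if "(v, y) \<in> J" for v y using mid[OF that] u False w(1) by auto
      then have "ms w u = int L" using plain[OF e w(1)] w(1) by simp
      moreover have "pos u - pos w = ms w u" by (rule pos_edge[OF nbr[OF u e'] uB e])
      ultimately have "pos u - int L = pos w" by simp
      then show ?thesis using nbr[OF u e'] unfolding S_def by simp
    qed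
  qed
  have "template r S H (pos x)"
    unfolding template_def
  proof (intro conjI ballI impI)
    show "finite S" using VB finite_subset unfolding S_def by blast
    show "pos x \<in> S" unfolding S_def B_def by (intro imageI nball_self)
    show "\<exists>u\<in>S. \<exists>w\<in>S. e = {u, w} \<and> wgt (w - u) > 0" if eH: "e \<in> H" for e
    proof -
      obtain u w where e: "e = {pos u, pos w}" "u \<in> B" "w \<in> B" "{u, w} \<in> E" using eH unfolding H_def by blast
      have "wgt (pos w - pos u) > 0" using pos_edge[OF e(2-4)] ms_weight[OF e(4)] by simp
      then show ?thesis using e unfolding S_def by blast
    qed
    show "{a, b} \<in> H" if ab: "a \<in> S" "b \<in> S" "b - a = int L" for a b
    proof -
      obtain u w where uw: "u \<in> B" "w \<in> B" "a = pos u" "b = pos w" using ab(1,2) unfolding S_def by blast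
      then have "{u, w} \<in> E" using pos_separates(2) ab(3) by blast
      then show ?thesis using adj uw by blast
    qed
    fix a assume "a \<in> nball H r (pos x)"
    moreover have "nball H r (pos x) = pos ` nball E r x"
      by (rule nball_image[of E r x pos H x 0 r]) (use adj closed in \<open>auto simp: B_def\<close>)
    ultimately obtain u where "u \<in> nball E r x" "a = pos u" by blast
    then show "a + int L \<in> S" "a - int L \<in> S" using inner by auto
  qed
  then show ?thesis
    unfolding realizable_def using inj adj unfolding S_def B_def by blast
qed

end

subsection \<open>Chains of joints exist with high probability\<close>

definition graph_of :: "nat \<Rightarrow> (nat set \<Rightarrow> bool) \<Rightarrow> nat set set" where
  "graph_of n f = {e \<in> vertex_pairs n. f e}"

text \<open>The path is truncated just before its first edge in \<open>X\<close>, so it ends at an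
  endpoint of that edge.\<close>

lemma path_first_hit:
  assumes "vs \<noteq> []" "path_edges vs \<inter> X \<noteq> {}" "distinct vs"
  shows "\<exists>ws. ws \<noteq> [] \<and> distinct ws \<and> hd ws = hd vs \<and> length ws \<le> length vs \<and> last ws \<in> \<Union>X \<and>
    path_edges ws \<subseteq> path_edges vs \<and> path_edges ws \<inter> X = {} \<and> set ws \<subseteq> set vs"
  using assms
proof (induction vs rule: path_edges.induct)
  case (1 x y zs)
  show ?case
  proof (cases "{x, y} \<in> X")
    case True
    then show ?thesis by (intro exI[of _ "[x]"]) auto
  next
    case False
    then obtain ws where ws: "ws \<noteq> []" "distinct ws" "hd ws = y" "length ws \<le> length (y # zs)" "last ws \<in> \<Union>X"
      "path_edges ws \<subseteq> path_edges (y # zs)" "path_edges ws \<inter> X = {}" "set ws \<subseteq> set (y # zs)"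
      using 1 by auto
    have "x \<notin> set ws" using ws(8) 1(4) by auto
    then show ?thesis using ws False by (intro exI[of _ "x # ws"]) (auto simp: path_edges_Cons)
  qed
qed auto

lemma cycle_reverse:
  assumes "is_cycle (y # ws)"
  shows "is_cycle (y # rev ws)" "cycle_edges (y # rev ws) = cycle_edges (y # ws)"
proof -
  show "is_cycle (y # rev ws)" using assms by (simp add: is_cycle_def)
  have "ws \<noteq> []" using assms by (auto simp: is_cycle_def)
  then show "cycle_edges (y # rev ws) = cycle_edges (y # ws)"
    by (simp add: cycle_edges_eq path_edges_Cons path_edges_rev hd_rev last_rev insert_commute)
qed

text \<open>Turns a cycle through revealed edges into a path of unrevealed ones, which can be
  estimated. A cycle through \<open>{v, y}\<close> is opened there and followed from
  \<open>y\<close> towards \<open>v\<close>, any other is followed from \<open>u\<close>; in both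
  cases only up to the first edge of \<open>X\<close>.\<close>

lemma cycle_to_path:
  assumes "is_cycle vs" "u \<in> set vs" "v \<noteq> y" "cycle_edges vs \<inter> insert {v, y} X \<noteq> {}"
  shows "\<exists>ws. ws \<noteq> [] \<and> distinct ws \<and> hd ws \<in> {u, y} \<and> length ws \<le> length vs \<and>
    last ws \<in> insert v (\<Union>X) \<and> path_edges ws \<subseteq> cycle_edges vs \<and> path_edges ws \<inter> insert {v, y} X = {} \<and>
    set ws \<subseteq> set vs"
proof (cases "{v, y} \<in> cycle_edges vs")
  case False
  obtain ws where ws: "is_cycle (u # ws)" "cycle_edges (u # ws) = cycle_edges vs"
    "length (u # ws) = length vs" "set (u # ws) = set vs"
    using cycle_rotate_to[OF assms(1,2)] .
  have d: "distinct (u # ws)" using ws(1) by (simp add: is_cycle_def)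
  have sub: "path_edges (u # ws) \<subseteq> cycle_edges vs" using ws(2) by (auto simp: cycle_edges_eq)
  show ?thesis
  proof (cases "path_edges (u # ws) \<inter> X = {}")
    case True
    obtain e where e: "e \<in> cycle_edges (u # ws)" "e \<in> insert {v, y} X" using assms(4) ws(2) by blast
    have "cycle_edges (u # ws) = insert {last (u # ws), hd (u # ws)} (path_edges (u # ws))"
      by (rule cycle_edges_eq) simp
    then have "{last (u # ws), u} \<in> X" using e True False ws(2) by auto
    \<comment> \<open>Only the closing edge lies in \<open>X\<close>, so \<open>u\<close> is an
      endpoint of it and the trivial path suffices.\<close>
    then show ?thesis using assms(2) ws(3) by (intro exI[of _ "[u]"]) auto
  next
    case hit: False
    from path_first_hit[OF _ hit d] obtain zs where zs: "zs \<noteq> []" "distinct zs" "hd zs = u"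
      "length zs \<le> length (u # ws)" "last zs \<in> \<Union>X" "path_edges zs \<subseteq> path_edges (u # ws)"
      "path_edges zs \<inter> X = {}" "set zs \<subseteq> set (u # ws)" by auto
    have "{v, y} \<notin> path_edges zs" using False sub zs(6) by blast
    then show ?thesis using zs sub ws(3,4) by (intro exI[of _ zs]) auto
  qed
next
  case True
  have y: "y \<in> set vs"
  proof -
    have "{v, y} \<subseteq> set (vs @ [hd vs])" using True path_edges_subset unfolding cycle_edges_def by blast
    moreover have "hd vs \<in> set vs" using assms(2) by (cases vs) auto
    ultimately show ?thesis by auto
  qed
  obtain ws where ws: "is_cycle (y # ws)" "cycle_edges (y # ws) = cycle_edges vs"
    "length (y # ws) = length vs" "set (y # ws) = set vs"
    using cycle_rotate_to[OF assms(1) y] .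
  have ne: "ws \<noteq> []" and yn: "y \<notin> set ws" using ws(1) by (auto simp: is_cycle_def)
  have "{v, y} = {y, hd ws} \<or> {v, y} = {last ws, y}"
  proof -
    have np: "{v, y} \<notin> path_edges ws" using path_edges_subset[of "{v, y}" ws] yn by auto
    have "cycle_edges (y # ws) = insert {last ws, y} (insert {y, hd ws} (path_edges ws))"
      using ne by (simp add: cycle_edges_eq path_edges_Cons)
    then have "{v, y} \<in> insert {last ws, y} (insert {y, hd ws} (path_edges ws))"
      using True ws(2) by simp
    then show ?thesis using np by (simp only: insert_iff[of "{v, y}"]) (elim disjE; simp)
  qed
  then have "v = hd ws \<or> v = last ws" using assms(3) by (auto simp: doubleton_eq_iff)
  then obtain zs where zs: "is_cycle (y # zs)" "cycle_edges (y # zs) = cycle_edges vs"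
    "length (y # zs) = length vs" "set (y # zs) = set vs" "last zs = v" "zs \<noteq> []"
  proof
    assume "v = hd ws"
    then show thesis
      using cycle_reverse[OF ws(1)] ws ne that[of "rev ws"] by (simp add: last_rev)
  next
    assume "v = last ws"
    then show thesis using ws ne that[of ws] by simp
  qed
  have d: "distinct (y # zs)" using zs(1) by (simp add: is_cycle_def)
  have sub: "path_edges (y # zs) \<subseteq> cycle_edges vs" using zs(2) by (auto simp: cycle_edges_eq)
  have vy: "{v, y} \<notin> path_edges (y # zs)"
    using last_edge_notin[OF d] zs(1,5,6) by (simp add: is_cycle_def)
  show ?thesis
  proof (cases "path_edges (y # zs) \<inter> X = {}")
    case True
    then show ?thesis using d zs vy sub by (intro exI[of _ "y # zs"]) auto
  next
    case hit: False
    from path_first_hit[OF _ hit d] obtain us where us: "us \<noteq> []" "distinct us" "hd us = y"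
      "length us \<le> length (y # zs)" "last us \<in> \<Union>X" "path_edges us \<subseteq> path_edges (y # zs)"
      "path_edges us \<inter> X = {}" "set us \<subseteq> set (y # zs)" by auto
    have "{v, y} \<notin> path_edges us" using vy us(6) by blast
    then show ?thesis using us sub zs(3,4) by (intro exI[of _ us]) auto
  qed
qed

lemma steps_of_edge:
  "{a, b} \<in> path_edges vs \<Longrightarrow> int b - int a \<in> set (steps vs) \<or> int a - int b \<in> set (steps vs)"
  by (induction vs rule: steps.induct) (auto simp: doubleton_eq_iff)

lemma path_range:
  assumes "\<And>s. s \<in> set (steps vs) \<Longrightarrow> \<bar>s\<bar> \<le> int M" "x \<in> set vs"
  shows "\<bar>int x - int (hd vs)\<bar> \<le> int (length vs) * int M"
  using assms
proof (induction vs rule: steps.induct)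
  case (1 a b zs)
  show ?case
  proof (cases "x = a")
    case False
    then have "\<bar>int x - int b\<bar> \<le> int (length (b # zs)) * int M" using 1 by auto
    moreover have "\<bar>int b - int a\<bar> \<le> int M" using 1(2) by simp
    ultimately show ?thesis by (simp add: algebra_simps)
  qed simp
qed auto

text \<open>Both neighbours of the largest vertex would have to be the one vertex \<open>L\<close>
  below it.\<close>

lemma no_arithmetic_cycle:
  assumes "is_cycle vs" "\<And>a b. {a, b} \<in> cycle_edges vs \<Longrightarrow> b = a + L \<or> a = b + (L :: nat)"
  shows False
proof -
  have ne: "vs \<noteq> []" using assms(1) by (auto simp: is_cycle_def)
  define m where "m = Max (set vs)"
  have m: "m \<in> set vs" unfolding m_def using ne by (intro Max_in) auto
  have mx: "x \<le> m" if "x \<in> set vs" for x unfolding m_def using that by (intro Max_ge) auto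
  obtain ws where ws: "is_cycle (m # ws)" "cycle_edges (m # ws) = cycle_edges vs"
    "length (m # ws) = length vs" "set (m # ws) = set vs"
    using cycle_rotate_to[OF assms(1) m] .
  have ne': "ws \<noteq> []" using ws(1) by (auto simp: is_cycle_def)
  have mn: "m \<notin> set ws" using ws(1) by (simp add: is_cycle_def)
  have "{m, hd ws} \<in> cycle_edges vs" "{last ws, m} \<in> cycle_edges vs"
    using ws(2) ne' by (auto simp: cycle_edges_eq path_edges_Cons)
  moreover have "hd ws < m" "last ws < m"
    using mx[of "hd ws"] mx[of "last ws"] ws(4) ne' mn
    by (metis hd_in_set insertCI le_neq_implies_less list.simps(15), metis insertCI last_in_set le_neq_implies_less list.simps(15))
  ultimately have "hd ws + L = m" "last ws + L = m" using assms(2)[of m "hd ws"] assms(2)[of "last ws" m] by auto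
  then have "hd ws = last ws" by simp
  moreover have "distinct ws" "length ws \<ge> 2" using ws(1) by (auto simp: is_cycle_def)
  ultimately show False by (cases ws) (auto split: if_splits)
qed

context distance_graph
begin

text \<open>The state after revealing the edges in \<open>X\<close>: there the parameters are
  arbitrary, elsewhere still the original ones. Estimates uniform over such \<open>q\<close> survive
  conditioning.\<close>

definition agrees :: "nat \<Rightarrow> nat set set \<Rightarrow> (nat set \<Rightarrow> real) \<Rightarrow> bool" where
  "agrees n X q \<longleftrightarrow> X \<subseteq> vertex_pairs n \<and>
     (\<forall>e\<in>vertex_pairs n. 0 \<le> q e \<and> q e \<le> 1 \<and> (e \<notin> X \<longrightarrow> q e = edge_prob e))"

text \<open>The next source is \<open>y + lstar\<close>, the vertex deprived of its lower neighbour
  by the joint \<open>(v, y)\<close>. The parameter \<open>g\<close> is a minimal length for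
  joints.\<close>

fun chain :: "nat \<Rightarrow> nat \<Rightarrow> nat \<Rightarrow> nat set set \<Rightarrow> nat \<Rightarrow> nat list \<Rightarrow> bool" where
  "chain R K g E v [] \<longleftrightarrow> True"
| "chain R K g E v (y # ys) \<longleftrightarrow> {v, y} \<in> E \<and> v + g \<le> y \<and> (\<forall>u\<in>segment R y. clean E K u) \<and>
     chain R K g E (y + lstar) ys"

definition has_chain :: "nat \<Rightarrow> nat \<Rightarrow> nat \<Rightarrow> nat \<Rightarrow> nat \<Rightarrow> nat set set \<Rightarrow> nat \<Rightarrow> bool" where
  "has_chain R K d g D E v \<longleftrightarrow>
     (\<exists>ys. length ys = d \<and> chain R K g E v ys \<and> (\<forall>y\<in>set ys. y + lstar \<le> v + D))"

text \<open>Some residue class modulo \<open>sep\<close> must have a large sum, since otherwise the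
  partial sums of the whole series would be bounded.\<close>

lemma sparse_set:
  assumes "sep \<ge> 1"
  shows "\<exists>I. finite I \<and> (\<forall>l\<in>I. lo \<le> l) \<and> (\<forall>l\<in>I. \<forall>l'\<in>I. l < l' \<longrightarrow> l + sep \<le> l') \<and>
    \<Lambda> \<le> (\<Sum>l\<in>I. p l)"
proof (rule ccontr)
  assume no: "\<not> ?thesis"
  define lo' where "lo' = Suc lo"
  have small: "(\<Sum>l\<in>{l \<in> {lo'..N}. l mod sep = c}. p l) < \<Lambda>" for N c
  proof -
    let ?I = "{l \<in> {lo'..N}. l mod sep = c}"
    have "l + sep \<le> l'" if "l \<in> ?I" "l' \<in> ?I" "l < l'" for l l'
    proof -
      have "sep dvd l' - l" using that by (metis (mono_tags, lifting) less_imp_le mem_Collect_eq mod_eq_dvd_iff_nat)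
      then have "sep \<le> l' - l" using that(3) by (simp add: dvd_imp_le)
      then show ?thesis using that(3) by linarith
    qed
    then have "\<not> \<Lambda> \<le> (\<Sum>l\<in>?I. p l)"
      using no[unfolded not_ex, rule_format, of ?I] by (auto simp: lo'_def)
    then show ?thesis by simp
  qed
  have "(\<Sum>l=1..N. p l) \<le> (\<Sum>l=1..lo. p l) + real sep * \<Lambda>" for N
  proof -
    have "(\<Sum>l=1..N. p l) \<le> (\<Sum>l\<in>{1..lo} \<union> {lo'..N}. p l)"
      by (intro sum_mono2) (auto simp: lo'_def intro: p_nonneg)
    also have "\<dots> = (\<Sum>l=1..lo. p l) + (\<Sum>l\<in>{lo'..N}. p l)"
      by (intro sum.union_disjoint) (auto simp: lo'_def)
    also have "(\<Sum>l\<in>{lo'..N}. p l) = (\<Sum>c<sep. \<Sum>l\<in>{l \<in> {lo'..N}. l mod sep = c}. p l)"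
      using assms by (intro sum.group[symmetric]) auto
    also have "\<dots> \<le> of_nat (card {..<sep}) * \<Lambda>"
      by (intro sum_bounded_above less_imp_le small)
    finally show ?thesis by simp
  qed
  moreover have "eventually (\<lambda>N. (\<Sum>l=1..N. p l) > (\<Sum>l=1..lo. p l) + real sep * \<Lambda>) sequentially"
    using diverges by (auto simp: filterlim_at_top_dense)
  then obtain N where "(\<Sum>l=1..N. p l) > (\<Sum>l=1..lo. p l) + real sep * \<Lambda>"
    by (auto simp: eventually_sequentially)
  ultimately show False by (meson not_less)
qed

lemma zero_sum_tail_all:
  assumes "e > 0"
  shows "\<exists>M. \<forall>k\<le>K. \<forall>N. (\<Sum>xs\<in>{xs \<in> step_lists k N 0. \<exists>s\<in>set xs. \<bar>s\<bar> > int M}. wt xs) \<le> e"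
proof -
  have "\<forall>k. \<exists>M. \<forall>N. (\<Sum>xs\<in>{xs \<in> step_lists k N 0. \<exists>s\<in>set xs. \<bar>s\<bar> > int M}. wt xs) \<le> e"
    using zero_sum_tail[OF assms, of 0] by blast
  from choice[OF this] obtain MM where MM:
    "\<And>k N. (\<Sum>xs\<in>{xs \<in> step_lists k N 0. \<exists>s\<in>set xs. \<bar>s\<bar> > int (MM k)}. wt xs) \<le> e"
    by blast
  define M where "M = Max (MM ` {..K})"
  have "(\<Sum>xs\<in>{xs \<in> step_lists k N 0. \<exists>s\<in>set xs. \<bar>s\<bar> > int M}. wt xs) \<le> e" if "k \<le> K" for k N
  proof -
    have "MM k \<le> M" unfolding M_def using that by (intro Max_ge) auto
    then have "(\<Sum>xs\<in>{xs \<in> step_lists k N 0. \<exists>s\<in>set xs. \<bar>s\<bar> > int M}. wt xs)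
      \<le> (\<Sum>xs\<in>{xs \<in> step_lists k N 0. \<exists>s\<in>set xs. \<bar>s\<bar> > int (MM k)}. wt xs)"
    proof (intro sum_mono2 subsetI)
      fix xs assume "xs \<in> {xs \<in> step_lists k N 0. \<exists>s\<in>set xs. \<bar>s\<bar> > int M}"
      then obtain s where "xs \<in> step_lists k N 0" "s \<in> set xs" "\<bar>s\<bar> > int M" by blast
      moreover from this have "\<bar>s\<bar> > int (MM k)" using \<open>MM k \<le> M\<close> by linarith
      ultimately show "xs \<in> {xs \<in> step_lists k N 0. \<exists>s\<in>set xs. \<bar>s\<bar> > int (MM k)}" by blast
    qed auto
    then show ?thesis using MM order_trans by blast
  qed
  then show ?thesis by blast
qed

lemma conv_bounded_all: "\<exists>C\<ge>0. \<forall>k\<le>K. \<forall>N t. conv k N t \<le> C"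
proof -
  obtain CC where CC: "\<And>k. CC k \<ge> 0" "\<And>k N t. conv k N t \<le> CC k" using conv_bounded by metis
  have "conv k N t \<le> (\<Sum>k\<le>K. CC k)" if "k \<le> K" for k N t
    using member_le_sum[of k "{..K}" CC] CC that by (meson atMost_iff finite_atMost order_trans)
  moreover have "(\<Sum>k\<le>K. CC k) \<ge> 0" by (intro sum_nonneg CC)
  ultimately show ?thesis by blast
qed

text \<open>The unforced pairs of span at most \<open>M\<close> near \<open>y\<close>. If all are
  absent, a cycle near \<open>y\<close> must make a long step.\<close>

definition window :: "nat \<Rightarrow> nat \<Rightarrow> nat \<Rightarrow> nat set set" where
  "window w M y = {{a, b} | a b. a < b \<and> b \<le> a + M \<and> b \<noteq> a + lstar \<and> y \<le> a + w \<and> b \<le> y + w}"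

lemma window_bounds: "e \<in> window w M y \<Longrightarrow> u \<in> e \<Longrightarrow> y \<le> u + w \<and> u \<le> y + w"
  unfolding window_def by auto

lemma window_pairs: "w < y \<Longrightarrow> y + w \<le> n \<Longrightarrow> window w M y \<subseteq> vertex_pairs n"
proof
  fix e assume w: "w < y" "y + w \<le> n" and "e \<in> window w M y"
  then obtain a b where "e = {a, b}" "a < b" "y \<le> a + w" "b \<le> y + w" unfolding window_def by blast
  then show "e \<in> vertex_pairs n"
    using w unfolding vertex_pairs_def by (intro CollectI exI[of _ a] exI[of _ b]) auto
qed

lemma window_card: "finite (window w M y)" "card (window w M y) \<le> (2 * w + 1)\<^sup>2"
proof -
  let ?S = "{y - w..y + w}"
  have sub: "window w M y \<subseteq> (\<lambda>(a, b). {a, b}) ` (?S \<times> ?S)" unfolding window_def by force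
  then show "finite (window w M y)" by (rule finite_subset) simp
  have "card (window w M y) \<le> card ((\<lambda>(a, b). {a, b}) ` (?S \<times> ?S))" by (rule card_mono[OF _ sub]) simp
  also have "\<dots> \<le> card (?S \<times> ?S)" by (rule card_image_le) simp
  also have "\<dots> = (card ?S)\<^sup>2" by (simp add: power2_eq_square)
  also have "\<dots> \<le> (2 * w + 1)\<^sup>2" by (rule power_mono) auto
  finally show "card (window w M y) \<le> (2 * w + 1)\<^sup>2" .
qed

text \<open>Only finitely many unforced lengths occur, each with probability below 1, and the number
  of pairs is bounded; so \<open>\<delta>\<close> does not depend on \<open>y\<close>.\<close>

lemma window_prob: "\<exists>\<delta>>0. \<delta> \<le> 1 \<and> (\<forall>y. \<delta> \<le> (\<Prod>e\<in>window w M y. 1 - edge_prob e))"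
proof -
  define A where "A = insert 0 (p ` ({1..M} - {lstar}))"
  have finA: "finite A" "A \<noteq> {}" by (auto simp: A_def)
  define \<pi> where "\<pi> = Max A"
  have pi: "0 \<le> \<pi>" "\<pi> < 1"
    using finA p_less_1 unfolding \<pi>_def by (auto simp: A_def Max_less_iff intro!: Max_ge)
  define N where "N = (2 * w + 1)\<^sup>2"
  have "(1 - \<pi>) ^ N \<le> (\<Prod>e\<in>window w M y. 1 - edge_prob e)" for y
  proof -
    have ge: "1 - \<pi> \<le> 1 - edge_prob e" if eW: "e \<in> window w M y" for e
    proof -
      obtain a b where ab: "e = {a, b}" "a < b" "b \<le> a + M" "b \<noteq> a + lstar"
        using eW unfolding window_def by auto
      have "edge_prob e = p (b - a)" using ab by (simp add: edge_prob_def)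
      also have "b - a \<in> {1..M} - {lstar}" using ab by auto
      then have "p (b - a) \<in> A" unfolding A_def by blast
      then have "p (b - a) \<le> \<pi>" unfolding \<pi>_def using finA by (intro Max_ge)
      finally show ?thesis by simp
    qed
    have "(1 - \<pi>) ^ N \<le> (1 - \<pi>) ^ card (window w M y)"
      using window_card(2)[of w M y] pi by (intro power_decreasing) (auto simp: N_def)
    also have "\<dots> = (\<Prod>e\<in>window w M y. 1 - \<pi>)" by simp
    also have "\<dots> \<le> (\<Prod>e\<in>window w M y. 1 - edge_prob e)"
      using ge pi by (intro prod_mono) auto
    finally show ?thesis .
  qed
  moreover have "(1 - \<pi>) ^ N > 0" using pi by simp
  moreover have "(1 - \<pi>) ^ N \<le> 1" using pi by (intro power_le_one) auto
  ultimately show ?thesis by blast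
qed

text \<open>If all steps were at most \<open>M\<close>, the cycle would stay within
  \<open>R * lstar + K * M\<close> of \<open>y\<close>; outside the window only forced edges remain
  there, and these contain no cycle.\<close>

lemma long_step_of_clear_window:
  assumes "is_cycle vs" "length vs \<le> K" "hd vs = u" "u \<in> segment R y"
    and "cycle_edges vs \<inter> window (R * lstar + K * M) M y = {}"
  shows "\<exists>s\<in>set (steps (vs @ [hd vs])). \<bar>s\<bar> > int M"
proof (rule ccontr)
  assume no: "\<not> ?thesis"
  have ne: "vs \<noteq> []" using assms(1) by (auto simp: is_cycle_def)
  let ?w = "R * lstar + K * M"
  have S: "\<bar>s\<bar> \<le> int M" if "s \<in> set (steps (vs @ [hd vs]))" for s using no that by force
  have rng: "\<bar>int x - int u\<bar> \<le> int (K * M)" if "x \<in> set vs" for x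
  proof -
    have "set (steps vs) \<subseteq> set (steps (vs @ [hd vs]))" using ne by (auto simp: steps_append)
    then have "\<bar>int x - int (hd vs)\<bar> \<le> int (length vs) * int M"
      using S by (intro path_range that) auto
    also have "\<dots> \<le> int (K * M)" using assms(2) by (simp add: mult_right_mono)
    finally show ?thesis using assms(3) by simp
  qed
  obtain k where k: "k \<le> R" "u + k * lstar = y" using assms(4) by (auto simp: segment_def)
  have kR: "k * lstar \<le> R * lstar" using k(1) by (rule mult_le_mono1)
  have near: "y \<le> x + ?w \<and> x \<le> y + ?w" if "x \<in> set vs" for x
  proof -
    have "int x - int u \<le> int (K * M)" "int u - int x \<le> int (K * M)" using rng[OF that] by linarith+
    then have "x \<le> u + K * M" "u \<le> x + K * M" by linarith+
    then show ?thesis using k(2) kR by linarith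
  qed
  have "b = a + lstar \<or> a = b + lstar" if ab: "{a, b} \<in> cycle_edges vs" for a b
  proof -
    have "set (vs @ [hd vs]) = set vs" using ne by auto
    then have mem: "a \<in> set vs" "b \<in> set vs"
      using path_edges_subset ab unfolding cycle_edges_def by blast+
    have "int b - int a \<in> set (steps (vs @ [hd vs])) \<or> int a - int b \<in> set (steps (vs @ [hd vs]))"
      using steps_of_edge ab unfolding cycle_edges_def by blast
    then have ab': "\<bar>int b - int a\<bar> \<le> int M" using S[of "int b - int a"] S[of "int a - int b"] by auto
    have neq: "a \<noteq> b"
    proof -
      have "card {a, b} = 2"
      proof -
        have "\<forall>e\<in>path_edges vs. card e = 2" if "distinct vs" for vs :: "nat list"
          using that by (induction vs rule: path_edges.induct) auto
        moreover have "last vs \<noteq> hd vs" using assms(1) by (cases vs) (auto simp: is_cycle_def split: if_splits)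
        ultimately show ?thesis using ab assms(1) ne by (auto simp: cycle_edges_eq is_cycle_def)
      qed
      then show ?thesis by auto
    qed
    have notw: "{a, b} \<notin> window ?w M y" using ab assms(5) by blast
    show ?thesis
    proof (rule ccontr)
      assume nL: "\<not> ?thesis"
      define a' b' where "a' = min a b" and "b' = max a b"
      have "{a, b} = {a', b'}" by (auto simp: a'_def b'_def min_def max_def)
      moreover have "a' < b'" using neq by (auto simp: a'_def b'_def)
      moreover have "b' \<le> a' + M" using ab' by (auto simp: a'_def b'_def)
      moreover have "b' \<noteq> a' + lstar" using nL by (auto simp: a'_def b'_def min_def max_def)
      moreover have "y \<le> a' + ?w" "b' \<le> y + ?w"
        using near[OF mem(1)] near[OF mem(2)] by (auto simp: a'_def b'_def min_def max_def)
      ultimately have "{a, b} \<in> window ?w M y" unfolding window_def by blast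
      then show False using notw by simp
    qed
  qed
  then show False by (rule no_arithmetic_cycle[OF assms(1)])
qed

text \<open>Prefixing the path with the step \<open>l\<close> to the target and \<open>k\<close>
  steps \<open>- lstar\<close> down the segment gives a step list from \<open>v\<close> to
  \<open>w\<close>, injectively in \<open>l\<close> and the path. Hence the whole sum over
  candidates, not just each term, is bounded by one convolution.\<close>

lemma conv_shift_bound:
  assumes "finite I" "\<And>l. l \<in> I \<Longrightarrow> 1 \<le> l \<and> l \<le> n \<and> k * lstar < l" "lstar \<le> n"
    and P: "\<And>l vs. l \<in> I \<Longrightarrow> vs \<in> P l \<Longrightarrow> vs \<noteq> [] \<and> hd vs + k * lstar = v + l \<and> last vs = w \<and>
      length vs = Suc m \<and> set vs \<subseteq> {1..n}"
  shows "(\<Sum>l\<in>I. \<Sum>vs\<in>P l. p l * wt (steps vs)) \<le> conv (Suc (k + m)) n (int w - int v)"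
proof -
  define g where "g = (\<lambda>(l, vs). int l # replicate k (- int lstar) @ steps vs)"
  have finP: "finite (P l)" if "l \<in> I" for l
  proof (rule finite_subset)
    show "P l \<subseteq> {vs. set vs \<subseteq> {1..n} \<and> length vs = Suc m}" using P[OF that] by auto
    show "finite {vs. set vs \<subseteq> {1..n} \<and> length vs = Suc m}" by (rule finite_lists_length_eq) simp
  qed
  have inj: "inj_on g (Sigma I P)"
  proof (rule inj_onI)
    fix z z' assume z: "z \<in> Sigma I P" "z' \<in> Sigma I P" "g z = g z'"
    obtain l vs l' vs' where e: "z = (l, vs)" "z' = (l', vs')" by (metis surj_pair)
    have "l = l'" "steps vs = steps vs'" using z(3) by (auto simp: g_def e)
    moreover have "hd vs = hd vs'" "length vs = length vs'"
      using P[of l vs] P[of l' vs'] z e \<open>l = l'\<close> by auto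
    ultimately show "z = z'" using steps_inj e by blast
  qed
  have wrep: "wt (replicate k (- int lstar)) = 1" by (induction k) auto
  have wg: "wt (g (l, vs)) = p l * wt (steps vs)" if "l \<in> I" for l vs
    using assms(2)[OF that] wrep by (simp add: g_def) (simp add: wgt_def)
  have sub: "g ` Sigma I P \<subseteq> step_lists (Suc (k + m)) n (int w - int v)"
  proof
    fix xs assume "xs \<in> g ` Sigma I P"
    then obtain l vs where lv: "l \<in> I" "vs \<in> P l" "xs = g (l, vs)" by auto
    note Pl = P[OF lv(1,2)]
    have "int (hd vs) + int k * int lstar = int v + int l"
      using Pl by (metis of_nat_add of_nat_mult)
    then have "sum_list xs = int w - int v"
      using Pl by (simp add: lv(3) g_def sum_list_replicate sum_steps)
    moreover have "length xs = Suc (k + m)" using Pl by (simp add: lv(3) g_def length_steps)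
    moreover have "set xs \<subseteq> {- int n..int n}"
      using steps_bounded[of vs n] Pl assms(2)[OF lv(1)] assms(3)
      by (auto simp: lv(3) g_def set_replicate_conv_if split: if_splits)
    ultimately show "xs \<in> step_lists (Suc (k + m)) n (int w - int v)" by (simp add: step_lists_def)
  qed
  have "(\<Sum>l\<in>I. \<Sum>vs\<in>P l. p l * wt (steps vs)) = (\<Sum>(l, vs)\<in>Sigma I P. p l * wt (steps vs))"
    using assms(1) finP by (intro sum.Sigma) auto
  also have "\<dots> = (\<Sum>z\<in>Sigma I P. wt (g z))" by (intro sum.cong refl) (auto simp: wg)
  also have "\<dots> = (\<Sum>xs\<in>g ` Sigma I P. wt xs)" by (simp add: sum.reindex[OF inj])
  also have "\<dots> \<le> conv (Suc (k + m)) n (int w - int v)"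
    unfolding conv_def using sub by (intro sum_mono2) auto
  finally show ?thesis .
qed

end

lemma pair_in_vertex_pairs: "{a, b} \<in> vertex_pairs n \<longleftrightarrow> a \<in> {1..n} \<and> b \<in> {1..n} \<and> a \<noteq> b"
  unfolding vertex_pairs_def by (auto simp: doubleton_eq_iff)

lemma prob_Un_le: "measure_pmf.prob M (A \<union> B) \<le> measure_pmf.prob M A + measure_pmf.prob M B"
  by (rule measure_Un_le) auto

context distance_graph
begin

section \<open>First-moment bounds and the construction of one chain\<close>

lemma agrees_bounds: "agrees n X q \<Longrightarrow> e \<in> vertex_pairs n \<Longrightarrow> 0 \<le> q e \<and> q e \<le> 1"
  by (simp add: agrees_def)

lemma agrees_prod:
  assumes "agrees n X q" "Y \<subseteq> vertex_pairs n" "Y \<inter> X = {}"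
  shows "(\<Prod>e\<in>Y. q e) = (\<Prod>e\<in>Y. edge_prob e)"
  using assms by (intro prod.cong refl) (auto simp: agrees_def)

lemma cycle_vertices:
  assumes "is_cycle vs" "cycle_edges vs \<subseteq> vertex_pairs n"
  shows "set vs \<subseteq> {1..n}"
proof -
  have ne: "vs \<noteq> []" using assms by (auto simp: is_cycle_def)
  have U: "\<Union>(vertex_pairs n) \<subseteq> {1..n}" by (auto simp: vertex_pairs_def)
  have e: "cycle_edges vs = insert {last vs, hd vs} (path_edges vs)" by (rule cycle_edges_eq[OF ne])
  then have "hd vs \<in> {1..n}" using U assms(2) by blast
  moreover have "path_edges vs \<subseteq> vertex_pairs n" using e assms(2) by blast
  ultimately show ?thesis using path_edges_vertices[OF _ U] ne by blast
qed

text \<open>Union bound over cycles of unrevealed edges: given the pattern, each contributes at most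
  the weight of its step list, which is zero-sum and has a long step.\<close>

lemma prob_long_cycle:
  assumes q: "agrees n X q" and AB: "A \<subseteq> vertex_pairs n" "B \<subseteq> vertex_pairs n" "A \<inter> B = {}"
    and tail: "\<And>k N. k \<le> K \<Longrightarrow> (\<Sum>xs\<in>{xs \<in> step_lists k N 0. \<exists>s\<in>set xs. \<bar>s\<bar> > int M}. wt xs) \<le> e"
  shows "measure_pmf.prob (coins (vertex_pairs n) q) (pattern A B \<inter> {f. \<exists>vs. is_cycle vs \<and> length vs \<le> K \<and>
      hd vs = u \<and> cycle_edges vs \<subseteq> graph_of n f \<and> cycle_edges vs \<inter> (A \<union> X) = {} \<and>
      (\<exists>s\<in>set (steps (vs @ [hd vs])). \<bar>s\<bar> > int M)})
    \<le> measure_pmf.prob (coins (vertex_pairs n) q) (pattern A B) * (real (K + 1) * e)"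
    (is "?P (_ \<inter> ?S) \<le> _")
proof -
  define C where "C = (\<lambda>k. {vs. is_cycle vs \<and> length vs = k \<and> hd vs = u \<and> set vs \<subseteq> {1..n} \<and>
      cycle_edges vs \<inter> (A \<union> X) = {} \<and> (\<exists>s\<in>set (steps (vs @ [hd vs])). \<bar>s\<bar> > int M)})"
  have finC: "finite (C k)" for k
    by (rule finite_subset[OF _ finite_lists_length_eq[of "{1..n}" k]]) (auto simp: C_def)
  have "pattern A B \<inter> ?S \<subseteq> (\<Union>k\<in>{..K}. \<Union>vs\<in>C k. pattern A B \<inter> pattern (cycle_edges vs) {})"
  proof
    fix f assume f: "f \<in> pattern A B \<inter> ?S"
    then obtain vs where vs: "is_cycle vs" "length vs \<le> K" "hd vs = u" "cycle_edges vs \<subseteq> graph_of n f"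
      "cycle_edges vs \<inter> (A \<union> X) = {}" "\<exists>s\<in>set (steps (vs @ [hd vs])). \<bar>s\<bar> > int M" by blast
    have "cycle_edges vs \<subseteq> vertex_pairs n" using vs(4) by (auto simp: graph_of_def)
    then have "set vs \<subseteq> {1..n}" by (rule cycle_vertices[OF vs(1)])
    then have "vs \<in> C (length vs)" using vs by (simp add: C_def)
    moreover have "f \<in> pattern A B \<inter> pattern (cycle_edges vs) {}"
      using f vs(4) by (auto simp: pattern_def graph_of_def)
    ultimately show "f \<in> (\<Union>k\<in>{..K}. \<Union>vs\<in>C k. pattern A B \<inter> pattern (cycle_edges vs) {})"
      using vs(2) by blast
  qed
  then have "?P (pattern A B \<inter> ?S) \<le> ?P (\<Union>k\<in>{..K}. \<Union>vs\<in>C k. pattern A B \<inter> pattern (cycle_edges vs) {})"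
    by (rule prob_mono)
  also have "\<dots> \<le> (\<Sum>k\<in>{..K}. ?P (\<Union>vs\<in>C k. pattern A B \<inter> pattern (cycle_edges vs) {}))"
    by (rule prob_UN_le) simp
  also have "\<dots> \<le> (\<Sum>k\<in>{..K}. ?P (pattern A B) * e)"
  proof (rule sum_mono)
    fix k assume k: "k \<in> {..K}"
    have each: "?P (pattern A B \<inter> pattern (cycle_edges vs) {}) \<le> ?P (pattern A B) * wt (steps (vs @ [hd vs]))"
      if "vs \<in> C k" for vs
    proof -
      have vs: "is_cycle vs" "set vs \<subseteq> {1..n}" "cycle_edges vs \<inter> (A \<union> X) = {}" using that by (auto simp: C_def)
      have sub: "cycle_edges vs \<subseteq> vertex_pairs n" by (rule cycle_edges_in_pairs[OF vs(1,2)])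
      have "?P (pattern A B \<inter> pattern (cycle_edges vs) {}) \<le> ?P (pattern A B) * (\<Prod>e\<in>cycle_edges vs. q e)"
        by (rule prob_pattern_extra) (use agrees_bounds[OF q] AB sub vs(3) in auto)
      also have "(\<Prod>e\<in>cycle_edges vs. q e) = (\<Prod>e\<in>cycle_edges vs. edge_prob e)"
        by (rule agrees_prod[OF q sub]) (use vs(3) in auto)
      also have "\<dots> = wt (steps (vs @ [hd vs]))" by (rule prod_cycle_edges[OF vs(1)])
      finally show ?thesis .
    qed
    have "?P (\<Union>vs\<in>C k. pattern A B \<inter> pattern (cycle_edges vs) {})
        \<le> (\<Sum>vs\<in>C k. ?P (pattern A B \<inter> pattern (cycle_edges vs) {}))"
      by (rule prob_UN_le[OF finC])
    also have "\<dots> \<le> (\<Sum>vs\<in>C k. ?P (pattern A B) * wt (steps (vs @ [hd vs])))"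
      by (rule sum_mono[OF each])
    also have "\<dots> = ?P (pattern A B) * (\<Sum>vs\<in>C k. wt (steps (vs @ [hd vs])))"
      by (simp add: sum_distrib_left)
    also have "(\<Sum>vs\<in>C k. wt (steps (vs @ [hd vs]))) = (\<Sum>ws\<in>(\<lambda>vs. vs @ [hd vs]) ` C k. wt (steps ws))"
      by (subst sum.reindex) (auto simp: inj_on_def)
    also have "\<dots> \<le> (\<Sum>xs\<in>{xs \<in> step_lists k n 0. \<exists>s\<in>set xs. \<bar>s\<bar> > int M}. wt xs)"
    proof (rule sum_wt_steps_le)
      fix ws assume "ws \<in> (\<lambda>vs. vs @ [hd vs]) ` C k"
      then obtain vs where vs: "vs \<in> C k" "ws = vs @ [hd vs]" by blast
      have ne: "vs \<noteq> []" using vs(1) by (auto simp: C_def is_cycle_def)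
      have "set ws \<subseteq> {1..n}" using vs ne hd_in_set[OF ne] by (auto simp: C_def)
      then have "set (steps ws) \<subseteq> {- int n..int n}" by (rule steps_bounded)
      moreover have "sum_list (steps ws) = 0" using sum_steps[of ws] vs(2) ne by simp
      ultimately show "hd ws = u \<and> length ws = Suc k \<and>
          steps ws \<in> {xs \<in> step_lists k n 0. \<exists>s\<in>set xs. \<bar>s\<bar> > int M}"
        using vs ne by (auto simp: C_def step_lists_def length_steps)
    qed simp
    also have "\<dots> \<le> e" using tail k by simp
    finally show "?P (\<Union>vs\<in>C k. pattern A B \<inter> pattern (cycle_edges vs) {}) \<le> ?P (pattern A B) * e"
      by (simp add: mult_left_mono)
  qed
  also have "\<dots> = ?P (pattern A B) * (real (K + 1) * e)" by simp
  finally show ?thesis .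
qed

text \<open>Union bound over the start on the segment, the end in \<open>W\<close> and the length;
  each case is a \<open>conv_shift_bound\<close>. The result does not depend on \<open>I\<close>,
  whereas the sum of \<open>p\<close> over \<open>I\<close> can be made as large as desired.\<close>

lemma prob_return_path:
  assumes q: "agrees n X q" and I: "finite I" "1 \<le> v"
    "\<And>l. l \<in> I \<Longrightarrow> R * lstar < l \<and> v + l \<le> n \<and> {v, v + l} \<notin> X"
    and W: "finite W" and L: "lstar \<le> n"
    and C: "\<And>k N t. k \<le> R + K \<Longrightarrow> conv k N t \<le> C"
  shows "(\<Sum>l\<in>I. measure_pmf.prob (coins (vertex_pairs n) q) (pattern {{v, v + l}} {} \<inter>
      {f. \<exists>vs. vs \<noteq> [] \<and> distinct vs \<and> hd vs \<in> segment R (v + l) \<and> length vs \<le> K \<and> last vs \<in> W \<and>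
        path_edges vs \<subseteq> graph_of n f \<and> path_edges vs \<inter> insert {v, v + l} X = {} \<and> set vs \<subseteq> {1..n}}))
    \<le> real ((R + 1) * card W * K) * C"
    (is "(\<Sum>l\<in>I. ?P (_ \<inter> ?S l)) \<le> _")
proof -
  define Z where "Z = {..R} \<times> W \<times> {..<K}"
  define Q where "Q = (\<lambda>(k, w, m) l. {vs. vs \<noteq> [] \<and> distinct vs \<and> hd vs + k * lstar = v + l \<and> last vs = w \<and>
    length vs = Suc m \<and> set vs \<subseteq> {1..n} \<and> path_edges vs \<inter> insert {v, v + l} X = {}})"
  have finZ: "finite Z" using W by (simp add: Z_def)
  have finQ: "finite (Q z l)" for z l
  proof -
    obtain k w m where z: "z = (k, w, m)" by (metis surj_pair)
    show ?thesis unfolding z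
      by (rule finite_subset[OF _ finite_lists_length_eq[of "{1..n}" "Suc m"]]) (auto simp: Q_def)
  qed
  have bound: "?P (pattern {{v, v + l}} {} \<inter> ?S l) \<le> (\<Sum>z\<in>Z. \<Sum>vs\<in>Q z l. p l * wt (steps vs))"
    if l: "l \<in> I" for l
  proof -
    have l0: "l \<ge> 1" "v + l \<le> n" "{v, v + l} \<notin> X" using I(3)[OF l] by auto
    have vl: "{v, v + l} \<in> vertex_pairs n" using l0 I(2) by (simp add: pair_in_vertex_pairs)
    have "pattern {{v, v + l}} {} \<inter> ?S l \<subseteq>
        (\<Union>z\<in>Z. \<Union>vs\<in>Q z l. pattern {{v, v + l}} {} \<inter> pattern (path_edges vs) {})"
    proof
      fix f assume f: "f \<in> pattern {{v, v + l}} {} \<inter> ?S l"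
      then obtain vs where vs: "vs \<noteq> []" "distinct vs" "hd vs \<in> segment R (v + l)" "length vs \<le> K" "last vs \<in> W"
        "path_edges vs \<subseteq> graph_of n f" "path_edges vs \<inter> insert {v, v + l} X = {}" "set vs \<subseteq> {1..n}" by blast
      obtain k where k: "k \<le> R" "hd vs + k * lstar = v + l" using vs(3) by (auto simp: segment_def)
      have "(k, last vs, length vs - 1) \<in> Z" using k vs by (cases vs) (auto simp: Z_def)
      moreover have "vs \<in> Q (k, last vs, length vs - 1) l" using k vs by (simp add: Q_def)
      moreover have "f \<in> pattern {{v, v + l}} {} \<inter> pattern (path_edges vs) {}"
        using f vs(6) by (auto simp: pattern_def graph_of_def)
      ultimately show "f \<in> (\<Union>z\<in>Z. \<Union>vs\<in>Q z l. pattern {{v, v + l}} {} \<inter> pattern (path_edges vs) {})"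
        by blast
    qed
    then have "?P (pattern {{v, v + l}} {} \<inter> ?S l) \<le>
        ?P (\<Union>z\<in>Z. \<Union>vs\<in>Q z l. pattern {{v, v + l}} {} \<inter> pattern (path_edges vs) {})" by (rule prob_mono)
    also have "\<dots> \<le> (\<Sum>z\<in>Z. ?P (\<Union>vs\<in>Q z l. pattern {{v, v + l}} {} \<inter> pattern (path_edges vs) {}))"
      by (rule prob_UN_le[OF finZ])
    also have "\<dots> \<le> (\<Sum>z\<in>Z. \<Sum>vs\<in>Q z l. ?P (pattern {{v, v + l}} {} \<inter> pattern (path_edges vs) {}))"
      by (intro sum_mono prob_UN_le finQ)
    also have "\<dots> \<le> (\<Sum>z\<in>Z. \<Sum>vs\<in>Q z l. p l * wt (steps vs))"
    proof (intro sum_mono)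
      fix z vs assume "vs \<in> Q z l"
      then have vs: "distinct vs" "set vs \<subseteq> {1..n}" "path_edges vs \<inter> insert {v, v + l} X = {}"
        by (auto simp: Q_def split: prod.splits)
      have sub: "path_edges vs \<subseteq> vertex_pairs n" by (rule path_edges_in_pairs[OF vs(1,2)])
      have "?P (pattern {{v, v + l}} {} \<inter> pattern (path_edges vs) {})
          \<le> ?P (pattern {{v, v + l}} {}) * (\<Prod>e\<in>path_edges vs. q e)"
        by (rule prob_pattern_extra) (use agrees_bounds[OF q] vl sub vs(3) in auto)
      also have "(\<Prod>e\<in>path_edges vs. q e) = (\<Prod>e\<in>path_edges vs. edge_prob e)"
        by (rule agrees_prod[OF q sub]) (use vs(3) in auto)
      also have "\<dots> = wt (steps vs)" by (rule prod_path_edges[OF vs(1)])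
      also have "?P (pattern {{v, v + l}} {}) = (\<Prod>e\<in>{{v, v + l}}. q e) * (\<Prod>e\<in>{}. 1 - q e)"
        by (rule prob_pattern) (use agrees_bounds[OF q] vl in auto)
      also have "\<dots> = p l" using q vl l0 by (simp add: agrees_def edge_prob_def)
      finally show "?P (pattern {{v, v + l}} {} \<inter> pattern (path_edges vs) {}) \<le> p l * wt (steps vs)" .
    qed
    finally show ?thesis .
  qed
  have "(\<Sum>l\<in>I. ?P (pattern {{v, v + l}} {} \<inter> ?S l)) \<le> (\<Sum>l\<in>I. \<Sum>z\<in>Z. \<Sum>vs\<in>Q z l. p l * wt (steps vs))"
    by (rule sum_mono[OF bound])
  also have "\<dots> = (\<Sum>z\<in>Z. \<Sum>l\<in>I. \<Sum>vs\<in>Q z l. p l * wt (steps vs))" by (rule sum.swap)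
  also have "\<dots> \<le> (\<Sum>z\<in>Z. C)"
  proof (rule sum_mono)
    fix z assume "z \<in> Z"
    then obtain k w m where z: "z = (k, w, m)" "k \<le> R" "m < K" by (auto simp: Z_def)
    have kR: "k * lstar \<le> R * lstar" using z(2) by (rule mult_le_mono1)
    have "(\<Sum>l\<in>I. \<Sum>vs\<in>Q z l. p l * wt (steps vs)) \<le> conv (Suc (k + m)) n (int w - int v)"
    proof (rule conv_shift_bound[OF I(1) _ L])
      fix l assume l: "l \<in> I"
      show "1 \<le> l \<and> l \<le> n \<and> k * lstar < l" using I(3)[OF l] kR by linarith
      fix vs assume "vs \<in> Q z l"
      then show "vs \<noteq> [] \<and> hd vs + k * lstar = v + l \<and> last vs = w \<and> length vs = Suc m \<and> set vs \<subseteq> {1..n}"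
        by (simp add: Q_def z)
    qed
    also have "\<dots> \<le> C" using z by (intro C) simp
    finally show "(\<Sum>l\<in>I. \<Sum>vs\<in>Q z l. p l * wt (steps vs)) \<le> C" .
  qed
  also have "\<dots> = real ((R + 1) * card W * K) * C" by (simp add: Z_def card_cartesian_product algebra_simps)
  finally show ?thesis .
qed

text \<open>A short cycle through the segment either avoids the revealed edges, and then has a long
  step because the window is empty, or contains one, and then \<open>cycle_to_path\<close> gives a
  return path. Both are excluded, so the segment is clean.\<close>

lemma chain_step:
  assumes E: "E \<subseteq> vertex_pairs n" "{v, y} \<in> E" "E \<inter> window (R * lstar + K * M) M y = {}"
    and g: "v + g \<le> y" "v < y"
    and chain: "has_chain R K d g D' E (y + lstar)"
    and D: "y + lstar + D' \<le> v + D"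
    and no_long: "\<not> (\<exists>u\<in>segment R y. \<exists>vs. is_cycle vs \<and> length vs \<le> K \<and> hd vs = u \<and> cycle_edges vs \<subseteq> E \<and>
      cycle_edges vs \<inter> ({{v, y}} \<union> X) = {} \<and> (\<exists>s\<in>set (steps (vs @ [hd vs])). \<bar>s\<bar> > int M))"
    and no_return: "\<not> (\<exists>vs. vs \<noteq> [] \<and> distinct vs \<and> hd vs \<in> segment R y \<and> length vs \<le> K \<and>
      last vs \<in> insert v (\<Union>X) \<and> path_edges vs \<subseteq> E \<and> path_edges vs \<inter> insert {v, y} X = {} \<and> set vs \<subseteq> {1..n})"
  shows "has_chain R K (Suc d) g D E v"
proof -
  obtain ys where ys: "length ys = d" "chain R K g E (y + lstar) ys" "\<forall>z\<in>set ys. z + lstar \<le> y + lstar + D'"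
    using chain unfolding has_chain_def by blast
  have "clean E K u" if u: "u \<in> segment R y" for u
    unfolding clean_def
  proof
    assume "\<exists>vs. is_cycle vs \<and> length vs \<le> K \<and> u \<in> set vs \<and> cycle_edges vs \<subseteq> E"
    then obtain vs where vs: "is_cycle vs" "length vs \<le> K" "u \<in> set vs" "cycle_edges vs \<subseteq> E" by blast
    have V: "set vs \<subseteq> {1..n}" using cycle_vertices[OF vs(1)] vs(4) E(1) by blast
    show False
    proof (cases "cycle_edges vs \<inter> insert {v, y} X = {}")
      case True
      obtain ws where ws: "is_cycle (u # ws)" "cycle_edges (u # ws) = cycle_edges vs"
        "length (u # ws) = length vs" "set (u # ws) = set vs"
        using cycle_rotate_to[OF vs(1,3)] .
      have "\<exists>s\<in>set (steps ((u # ws) @ [hd (u # ws)])). \<bar>s\<bar> > int M"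
        by (rule long_step_of_clear_window[OF ws(1) _ _ u, of K]) (use ws(2,3) vs(2,4) E(3) in auto)
      then show False using no_long u ws vs True by (metis insert_is_Un list.sel(1))
    next
      case False
      have "v \<noteq> y" using g(2) by simp
      from cycle_to_path[OF vs(1,3) this False] obtain ws where ws: "ws \<noteq> []" "distinct ws" "hd ws \<in> {u, y}"
        "length ws \<le> length vs" "last ws \<in> insert v (\<Union>X)" "path_edges ws \<subseteq> cycle_edges vs"
        "path_edges ws \<inter> insert {v, y} X = {}" "set ws \<subseteq> set vs" by blast
      have "y \<in> segment R y" by (auto simp: segment_def intro: exI[of _ 0])
      then have "hd ws \<in> segment R y" using ws(3) u by blast
      moreover have "length ws \<le> K" "path_edges ws \<subseteq> E" "set ws \<subseteq> {1..n}" using ws vs V by auto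
      ultimately show False using no_return ws(1,2,5,7) by blast
    qed
  qed
  then have "chain R K g E v (y # ys)" using ys(2) E(2) g by simp
  moreover have "\<forall>z\<in>set (y # ys). z + lstar \<le> v + D" using ys(3) D by force
  ultimately show ?thesis unfolding has_chain_def using ys(1) by (intro exI[of _ "y # ys"]) simp
qed

lemma edge_prob_step: "1 \<le> l \<Longrightarrow> edge_prob {v, v + l} = p l"
  by (simp add: edge_prob_def)

lemma card_Union_pairs: "X \<subseteq> vertex_pairs n \<Longrightarrow> finite (\<Union>X) \<and> card (\<Union>X) \<le> 2 * card X"
proof -
  assume X: "X \<subseteq> vertex_pairs n"
  then have fin: "finite X" by (rule finite_subset) simp
  have c2: "card e = 2" if "e \<in> X" for e using X that by (auto simp: vertex_pairs_def)
  have "card (\<Union>X) \<le> (\<Sum>e\<in>X. card e)" by (rule card_Union_le_sum_card)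
  also have "\<dots> = 2 * card X" using c2 by simp
  finally have "card (\<Union>X) \<le> 2 * card X" .
  moreover have "finite (\<Union>X)"
    using fin c2 by (intro finite_Union) (auto intro: card_ge_0_finite)
  ultimately show ?thesis by blast
qed

text \<open>Among many candidate targets \<open>v + l\<close> the second moment method finds one
  joined to \<open>v\<close> with an empty window, no long cycle, no return path and a continuing
  chain. The induction must allow revealed edges, since testing a candidate reveals its joint and
  window before the rest of the chain is sought.\<close>

lemma chain_prob:
  assumes "\<epsilon> > 0"
  shows "\<exists>D. \<forall>n v X q. 1 \<le> v \<longrightarrow> v + D \<le> n \<longrightarrow> card X \<le> s \<longrightarrow> agrees n X q \<longrightarrow>
    measure_pmf.prob (coins (vertex_pairs n) q) {f. \<not> has_chain R K d g D (graph_of n f) v} \<le> \<epsilon>"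
  using assms
proof (induction d arbitrary: \<epsilon> s)
  case 0
  have "has_chain R K 0 g 0 E v" for E v by (auto simp: has_chain_def)
  then show ?case using 0 by (intro exI[of _ 0]) simp
next
  case (Suc d)
  obtain C where C: "C \<ge> 0" "\<And>k N t. k \<le> R + K \<Longrightarrow> conv k N t \<le> C"
    using conv_bounded_all[of "R + K"] by blast
  define \<epsilon>1 where "\<epsilon>1 = \<epsilon> / 8"
  define e0 where "e0 = \<epsilon>1 / (real (R + 1) * real (K + 1))"
  have e0: "e0 > 0" "\<epsilon>1 > 0" using Suc.prems by (auto simp: e0_def \<epsilon>1_def)
  obtain M where M: "\<And>k N. k \<le> K \<Longrightarrow> (\<Sum>xs\<in>{xs \<in> step_lists k N 0. \<exists>s\<in>set xs. \<bar>s\<bar> > int M}. wt xs) \<le> e0"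
    using zero_sum_tail_all[OF e0(1), of K] by blast
  define w where "w = R * lstar + K * M"
  obtain \<delta> where \<delta>: "\<delta> > 0" "\<delta> \<le> 1" "\<And>y. \<delta> \<le> (\<Prod>e\<in>window w M y. 1 - edge_prob e)"
    using window_prob[of w M] by blast
  \<comment> \<open>The edges revealed earlier, the new joint and its window.\<close>
  define s' where "s' = s + 1 + (2 * w + 1)\<^sup>2"
  obtain D' where D': "\<And>n v X q. 1 \<le> v \<Longrightarrow> v + D' \<le> n \<Longrightarrow> card X \<le> s' \<Longrightarrow> agrees n X q \<Longrightarrow>
    measure_pmf.prob (coins (vertex_pairs n) q) {f. \<not> has_chain R K d g D' (graph_of n f) v} \<le> \<epsilon>1"
    using Suc.IH[OF e0(2), of s'] by blast
  \<comment> \<open>Return paths end at \<open>v\<close> or at one of at most \<open>2 * s\<close>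
    endpoints of edges in \<open>X\<close>.\<close>
  define C3 where "C3 = real ((R + 1) * (2 * s + 1) * K) * C"
  \<comment> \<open>Chosen so that \<open>(2 * C3 + 4) / \<mu>0 = \<epsilon> / 2\<close>; the other
    half of \<open>\<epsilon>\<close> is \<open>4 * \<epsilon>1\<close>.\<close>
  define \<mu>0 where "\<mu>0 = (2 * C3 + 4) * 2 / \<epsilon>"
  have C3: "C3 \<ge> 0" using C(1) unfolding C3_def by (intro mult_nonneg_nonneg) auto
  have \<mu>0: "\<mu>0 > 0" using C3 Suc.prems by (simp add: \<mu>0_def)
  define lo where "lo = g + w + lstar + 1"
  \<comment> \<open>The spacing makes the windows of different candidates disjoint; the extra
    \<open>s\<close> compensates for candidates spoiled by \<open>X\<close>.\<close>
  obtain I where I: "finite I" "\<And>l. l \<in> I \<Longrightarrow> lo \<le> l" "\<And>l l'. l \<in> I \<Longrightarrow> l' \<in> I \<Longrightarrow> l < l' \<Longrightarrow> l + (2 * w + 1) \<le> l'"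
    "real s + \<mu>0 / \<delta> \<le> (\<Sum>l\<in>I. p l)"
    using sparse_set[of "2 * w + 1" lo "real s + \<mu>0 / \<delta>"] by auto
  define D where "D = Max (insert 0 I) + lstar + D' + w"
  have Imax: "l \<le> Max (insert 0 I)" if "l \<in> I" for l using that I(1) by (intro Max_ge) auto
  have "measure_pmf.prob (coins (vertex_pairs n) q) {f. \<not> has_chain R K (Suc d) g D (graph_of n f) v} \<le> \<epsilon>"
    if v: "1 \<le> v" and vD: "v + D \<le> n" and X: "card X \<le> s" and q: "agrees n X q" for n v X q
  proof -
    let ?P = "measure_pmf.prob (coins (vertex_pairs n) q)"
    define Win where "Win = (\<lambda>l. window w M (v + l))"
    define U where "U = (\<lambda>l. insert {v, v + l} (Win l))"
    define I' where "I' = {l \<in> I. U l \<inter> X = {}}"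
    define A where "A = (\<lambda>l. pattern {{v, v + l}} (Win l))"
    have XV: "X \<subseteq> vertex_pairs n" using q by (simp add: agrees_def)
    have finX: "finite X" using XV by (rule finite_subset) simp
    have finI': "finite I'" using I(1) by (simp add: I'_def)
    have l_props: "1 \<le> l" "g \<le> l" "R * lstar < l" "w < v + l" "w < l" "v + l + w \<le> n" "v + l + lstar + D' \<le> v + D"
      if "l \<in> I" for l
      using I(2)[OF that] Imax[OF that] vD by (auto simp: lo_def w_def D_def)
    have WinV: "Win l \<subseteq> vertex_pairs n" if "l \<in> I" for l
      unfolding Win_def using l_props[OF that] by (intro window_pairs) auto
    have finWin: "finite (Win l)" and cWin: "card (Win l) \<le> (2 * w + 1)\<^sup>2" for l
      unfolding Win_def by (rule window_card)+
    have vlV: "{v, v + l} \<in> vertex_pairs n" if "l \<in> I" for l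
      using l_props[OF that] v by (simp add: pair_in_vertex_pairs)
    have UV: "U l \<subseteq> vertex_pairs n" if "l \<in> I" for l using WinV[OF that] vlV[OF that] by (simp add: U_def)
    have v_notin: "{v, v + l'} \<notin> Win l" if "l \<in> I" for l l'
    proof
      assume "{v, v + l'} \<in> Win l"
      then have "v + l \<le> v + w" unfolding Win_def using window_bounds by blast
      then show False using l_props[OF that] by simp
    qed
    have Win_disj: "Win l \<inter> Win l' = {}" if "l \<in> I" "l' \<in> I" "l < l'" for l l'
    proof (rule ccontr)
      assume "Win l \<inter> Win l' \<noteq> {}"
      then obtain e where e: "e \<in> Win l" "e \<in> Win l'" by blast
      then obtain u where u: "u \<in> e" unfolding Win_def window_def by blast
      have "u \<le> v + l + w" "v + l' \<le> u + w" using window_bounds e u unfolding Win_def by blast+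
      then show False using I(3)[OF that] by simp
    qed
    have U_disj: "U l \<inter> U l' = {}" if ll: "l \<in> I" "l' \<in> I" "l \<noteq> l'" for l l'
    proof -
      have "Win l \<inter> Win l' = {}" using Win_disj[of l l'] Win_disj[of l' l] ll by (cases l l' rule: linorder_cases) auto
      moreover have "{v, v + l} \<noteq> {v, v + l'}" using ll(3) by (auto simp: doubleton_eq_iff)
      ultimately show ?thesis using v_notin[OF ll(1)] v_notin[OF ll(2)] by (auto simp: U_def)
    qed
    \<comment> \<open>The sets \<open>U l\<close> are disjoint, so each edge of \<open>X\<close>
      spoils at most one candidate.\<close>
    have card_bad: "card (I - I') \<le> s"
    proof -
      have "\<forall>l\<in>I - I'. \<exists>e. e \<in> U l \<inter> X" by (auto simp: I'_def)
      then obtain h where h: "\<forall>l\<in>I - I'. h l \<in> U l \<inter> X" by (rule bchoice[THEN exE])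
      have "inj_on h (I - I')"
      proof (rule inj_onI, rule ccontr)
        fix l l' assume "l \<in> I - I'" "l' \<in> I - I'" "h l = h l'" "l \<noteq> l'"
        then show False using U_disj[of l l'] h by (metis DiffD1 IntD1 disjoint_iff)
      qed
      then have "card (I - I') \<le> card X" using h finX by (intro card_inj_on_le[of h]) auto
      then show ?thesis using X by simp
    qed
    have sumI': "\<mu>0 / \<delta> \<le> (\<Sum>l\<in>I'. p l)"
    proof -
      have "(\<Sum>l\<in>I. p l) = (\<Sum>l\<in>I - I'. p l) + (\<Sum>l\<in>I'. p l)"
        using I(1) by (intro sum.subset_diff) (auto simp: I'_def)
      moreover have "(\<Sum>l\<in>I - I'. p l) \<le> of_nat (card (I - I')) * 1"
        by (rule sum_bounded_above) (use l_props p_le_1 in auto)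
      moreover have "of_nat (card (I - I')) \<le> real s" using card_bad by simp
      ultimately show ?thesis using I(4) by linarith
    qed
    have I'I: "l \<in> I" "U l \<inter> X = {}" if "l \<in> I'" for l using that by (auto simp: I'_def)
    have a: "?P (A l) = p l * (\<Prod>e\<in>Win l. 1 - edge_prob e)" if l: "l \<in> I'" for l
    proof -
      have "?P (A l) = (\<Prod>e\<in>{{v, v + l}}. q e) * (\<Prod>e\<in>Win l. 1 - q e)"
        unfolding A_def
        by (rule prob_pattern) (use agrees_bounds[OF q] WinV[OF I'I(1)[OF l]] vlV[OF I'I(1)[OF l]]
            v_notin[OF I'I(1)[OF l]] in auto)
      also have "(\<Prod>e\<in>{{v, v + l}}. q e) = p l"
        using q vlV[OF I'I(1)[OF l]] I'I(2)[OF l] l_props(1)[OF I'I(1)[OF l]]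
        by (simp add: agrees_def U_def edge_prob_step)
      also have "(\<Prod>e\<in>Win l. 1 - q e) = (\<Prod>e\<in>Win l. 1 - edge_prob e)"
        using q WinV[OF I'I(1)[OF l]] I'I(2)[OF l] by (intro prod.cong refl) (auto simp: agrees_def U_def)
      finally show ?thesis .
    qed
    define mu where "mu = (\<Sum>l\<in>I'. ?P (A l))"
    have mu: "\<mu>0 \<le> mu"
    proof -
      have "\<delta> * (\<Sum>l\<in>I'. p l) = (\<Sum>l\<in>I'. p l * \<delta>)" by (simp add: sum_distrib_left mult.commute)
      also have "\<dots> \<le> mu"
        unfolding mu_def
      proof (rule sum_mono)
        fix l assume l: "l \<in> I'"
        show "p l * \<delta> \<le> ?P (A l)"
          unfolding a[OF l] Win_def using \<delta>(3) p_nonneg[OF l_props(1)[OF I'I(1)[OF l]]]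
          by (intro mult_left_mono)
      qed
      finally have "\<delta> * (\<Sum>l\<in>I'. p l) \<le> mu" .
      moreover have "\<mu>0 \<le> \<delta> * (\<Sum>l\<in>I'. p l)" using sumI' \<delta>(1) by (simp add: field_simps)
      ultimately show ?thesis by simp
    qed
    have mu_pos: "mu > 0" using mu \<mu>0 by simp
    \<comment> \<open>Disjointness of the sets \<open>U l\<close> makes the events
      \<open>A l\<close> pairwise independent, so the correlation term is 0.\<close>
    have few: "?P {f. real (card {l \<in> I'. f \<in> A l}) \<le> mu / 2} \<le> 4 * (1 / mu + 0)"
    proof (rule prob_card_le_half[OF finI' _ mu_def mu_pos])
      fix l l' assume ll: "l \<in> I'" "l' \<in> I'" "l \<noteq> l'"
      have d: "U l \<inter> U l' = {}" using U_disj I'I(1) ll by blast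
      have "A l \<inter> A l' = pattern {{v, v + l}, {v, v + l'}} (Win l \<union> Win l')"
        unfolding A_def pattern_Int by (simp add: insert_is_Un[symmetric] insert_commute)
      then have "?P (A l \<inter> A l') = (\<Prod>e\<in>{{v, v + l}, {v, v + l'}}. q e) * (\<Prod>e\<in>Win l \<union> Win l'. 1 - q e)"
        using prob_pattern[of "vertex_pairs n" q "{{v, v + l}, {v, v + l'}}" "Win l \<union> Win l'"]
          agrees_bounds[OF q] WinV[OF I'I(1)[OF ll(1)]] WinV[OF I'I(1)[OF ll(2)]] vlV[OF I'I(1)[OF ll(1)]]
          vlV[OF I'I(1)[OF ll(2)]] v_notin[OF I'I(1)[OF ll(1)]] v_notin[OF I'I(1)[OF ll(2)]]
        by simp
      also have "(\<Prod>e\<in>{{v, v + l}, {v, v + l'}}. q e) = q {v, v + l} * q {v, v + l'}"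
        using ll(3) by (subst prod.insert) (auto simp: doubleton_eq_iff)
      also have "(\<Prod>e\<in>Win l \<union> Win l'. 1 - q e) = (\<Prod>e\<in>Win l. 1 - q e) * (\<Prod>e\<in>Win l'. 1 - q e)"
        using d by (intro prod.union_disjoint finWin) (auto simp: U_def)
      also have "q {v, v + l} * q {v, v + l'} * ((\<Prod>e\<in>Win l. 1 - q e) * (\<Prod>e\<in>Win l'. 1 - q e)) =
          ?P (A l) * ?P (A l')"
      proof -
        have "?P (A j) = q {v, v + j} * (\<Prod>e\<in>Win j. 1 - q e)" if j: "j \<in> I'" for j
          unfolding A_def using prob_pattern[of "vertex_pairs n" q "{{v, v + j}}" "Win j"]
            agrees_bounds[OF q] WinV[OF I'I(1)[OF j]] vlV[OF I'I(1)[OF j]] v_notin[OF I'I(1)[OF j]] by simp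
        then show ?thesis using ll by simp
      qed
      finally show "?P (A l \<inter> A l') \<le> (1 + 0) * (?P (A l) * ?P (A l'))" by simp
    qed simp
    define bad1 where "bad1 = (\<lambda>l. {f. \<not> has_chain R K d g D' (graph_of n f) (v + l + lstar)})"
    define long where "long = (\<lambda>l u. {f. \<exists>vs. is_cycle vs \<and> length vs \<le> K \<and>
      hd vs = u \<and> cycle_edges vs \<subseteq> graph_of n f \<and> cycle_edges vs \<inter> ({{v, v + l}} \<union> X) = {} \<and>
      (\<exists>s\<in>set (steps (vs @ [hd vs])). \<bar>s\<bar> > int M)})"
    define bad2 where "bad2 = (\<lambda>l. \<Union>u\<in>segment R (v + l). long l u)"
    define bad3 where "bad3 = (\<lambda>l. {f. \<exists>vs. vs \<noteq> [] \<and> distinct vs \<and> hd vs \<in> segment R (v + l) \<and> length vs \<le> K \<and>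
        last vs \<in> insert v (\<Union>X) \<and> path_edges vs \<subseteq> graph_of n f \<and>
        path_edges vs \<inter> insert {v, v + l} X = {} \<and> set vs \<subseteq> {1..n}})"
    define Bad where "Bad = (\<lambda>l. A l \<inter> (bad1 l \<union> bad2 l \<union> bad3 l))"
    have P1: "?P (A l \<inter> bad1 l) \<le> ?P (A l) * \<epsilon>1" if l: "l \<in> I'" for l
    proof -
      let ?q = "update_coins {{v, v + l}} (Win l) q"
      have lI: "l \<in> I" using I'I(1)[OF l] .
      have "?P (A l \<inter> bad1 l) = ?P (A l) * measure_pmf.prob (coins (vertex_pairs n) ?q) (bad1 l)"
        unfolding A_def by (rule prob_pattern_cond)
          (use agrees_bounds[OF q] WinV[OF lI] vlV[OF lI] v_notin[OF lI] in auto)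
      also have "measure_pmf.prob (coins (vertex_pairs n) ?q) (bad1 l) \<le> \<epsilon>1"
        unfolding bad1_def
      proof (rule D'[of _ _ "X \<union> U l"])
        show "1 \<le> v + l + lstar" using v by simp
        show "v + l + lstar + D' \<le> n" using l_props(7)[OF lI] vD by simp
        have "card (X \<union> U l) \<le> card X + card (U l)" by (rule card_Un_le)
        also have "card (U l) \<le> Suc (card (Win l))" unfolding U_def by (rule card_insert_le_m1) simp_all
        finally show "card (X \<union> U l) \<le> s'" using X cWin[of l] by (simp add: s'_def)
        show "agrees n (X \<union> U l) ?q"
          using q UV[OF lI] by (auto simp: agrees_def update_coins_def U_def)
      qed
      finally show ?thesis by (simp add: mult_left_mono)
    qed
    have cseg: "finite (segment R y)" "card (segment R y) \<le> R + 1" for y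
    proof -
      have sub: "segment R y \<subseteq> (\<lambda>k. y - k * lstar) ` {..R}" unfolding segment_def by force
      then show "finite (segment R y)" by (rule finite_subset) simp
      have "card (segment R y) \<le> card ((\<lambda>k. y - k * lstar) ` {..R})" by (rule card_mono[OF _ sub]) simp
      also have "\<dots> \<le> card {..R}" by (rule card_image_le) simp
      finally show "card (segment R y) \<le> R + 1" by simp
    qed
    have P2: "?P (A l \<inter> bad2 l) \<le> ?P (A l) * \<epsilon>1" if l: "l \<in> I'" for l
    proof -
      have lI: "l \<in> I" using I'I(1)[OF l] .
      have "A l \<inter> bad2 l = (\<Union>u\<in>segment R (v + l). A l \<inter> long l u)" by (auto simp: bad2_def)
      then have "?P (A l \<inter> bad2 l) \<le> (\<Sum>u\<in>segment R (v + l). ?P (A l \<inter> long l u))"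
        using prob_UN_le[OF cseg(1)] by metis
      also have "\<dots> \<le> (\<Sum>u\<in>segment R (v + l). ?P (A l) * (real (K + 1) * e0))"
        unfolding A_def long_def
        by (intro sum_mono prob_long_cycle[OF q]) (use WinV[OF lI] vlV[OF lI] v_notin[OF lI] M in auto)
      also have "\<dots> = real (card (segment R (v + l))) * (?P (A l) * (real (K + 1) * e0))" by simp
      also have "\<dots> \<le> real (R + 1) * (?P (A l) * (real (K + 1) * e0))"
        using cseg(2)[of "v + l"] e0 by (intro mult_right_mono) auto
      also have "\<dots> = ?P (A l) * \<epsilon>1" 
      proof -
        have "real (R + 1) * real (K + 1) * e0 = \<epsilon>1" unfolding e0_def by simp
        then show ?thesis by (metis mult.assoc mult.left_commute)
      qed
      finally show ?thesis .
    qed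
    have P3: "(\<Sum>l\<in>I'. ?P (A l \<inter> bad3 l)) \<le> C3"
    proof -
      have "(\<Sum>l\<in>I'. ?P (A l \<inter> bad3 l)) \<le> (\<Sum>l\<in>I'. ?P (pattern {{v, v + l}} {} \<inter> bad3 l))"
        by (intro sum_mono prob_mono) (auto simp: A_def pattern_def)
      also have "\<dots> \<le> real ((R + 1) * card (insert v (\<Union>X)) * K) * C"
        unfolding bad3_def
      proof (rule prob_return_path[OF q finI' v])
        show "R * lstar < l \<and> v + l \<le> n \<and> {v, v + l} \<notin> X" if "l \<in> I'" for l
          using l_props[OF I'I(1)[OF that]] I'I(2)[OF that] by (auto simp: U_def)
        show "finite (insert v (\<Union>X))" using card_Union_pairs[OF XV] by simp
        show "lstar \<le> n" using vD by (simp add: D_def)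
      qed (rule C(2))
      also have "\<dots> \<le> C3"
      proof -
        have "card (insert v (\<Union>X)) \<le> Suc (card (\<Union>X))" by (rule card_insert_le_m1) simp_all
        then have "card (insert v (\<Union>X)) \<le> 2 * s + 1" using card_Union_pairs[OF XV] X by linarith
        then have "(R + 1) * card (insert v (\<Union>X)) * K \<le> (R + 1) * (2 * s + 1) * K"
          by (intro mult_le_mono) auto
        then have "real ((R + 1) * card (insert v (\<Union>X)) * K) \<le> real ((R + 1) * (2 * s + 1) * K)"
          by (rule of_nat_mono)
        then show ?thesis unfolding C3_def using C(1) by (rule mult_right_mono)
      qed
      finally show ?thesis .
    qed
    have sumBad: "(\<Sum>l\<in>I'. ?P (Bad l)) \<le> 2 * \<epsilon>1 * mu + C3"
    proof -
      have "?P (Bad l) \<le> 2 * \<epsilon>1 * ?P (A l) + ?P (A l \<inter> bad3 l)" if l: "l \<in> I'" for l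
      proof -
        have "Bad l = (A l \<inter> bad1 l \<union> A l \<inter> bad2 l) \<union> A l \<inter> bad3 l" by (auto simp: Bad_def)
        then have "?P (Bad l) \<le> ?P (A l \<inter> bad1 l \<union> A l \<inter> bad2 l) + ?P (A l \<inter> bad3 l)"
          using prob_Un_le by metis
        also have "?P (A l \<inter> bad1 l \<union> A l \<inter> bad2 l) \<le> ?P (A l \<inter> bad1 l) + ?P (A l \<inter> bad2 l)"
          by (rule prob_Un_le)
        finally show ?thesis using P1[OF l] P2[OF l] by (simp add: algebra_simps)
      qed
      then have "(\<Sum>l\<in>I'. ?P (Bad l)) \<le> (\<Sum>l\<in>I'. 2 * \<epsilon>1 * ?P (A l) + ?P (A l \<inter> bad3 l))"
        by (rule sum_mono)
      also have "\<dots> = 2 * \<epsilon>1 * mu + (\<Sum>l\<in>I'. ?P (A l \<inter> bad3 l))"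
        by (simp add: mu_def sum.distrib sum_distrib_left)
      finally show ?thesis using P3 by simp
    qed
    have good: "has_chain R K (Suc d) g D (graph_of n f) v" if l: "l \<in> I'" "f \<in> A l" "f \<notin> Bad l" for f l
    proof -
      have lI: "l \<in> I" using I'I(1)[OF l(1)] .
      have nb: "f \<notin> bad1 l" "f \<notin> bad2 l" "f \<notin> bad3 l" using l by (auto simp: Bad_def)
      have fA: "f {v, v + l}" "\<And>e. e \<in> Win l \<Longrightarrow> \<not> f e" using l(2) by (auto simp: A_def pattern_def)
      show ?thesis
      proof (rule chain_step[of "graph_of n f" n v "v + l" R K M g d D' D X])
        show "graph_of n f \<subseteq> vertex_pairs n" by (auto simp: graph_of_def)
        show "{v, v + l} \<in> graph_of n f" using fA(1) vlV[OF lI] by (simp add: graph_of_def)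
        show "graph_of n f \<inter> window (R * lstar + K * M) M (v + l) = {}"
          using fA(2) by (auto simp: graph_of_def Win_def w_def)
        show "v + g \<le> v + l" "v < v + l" "v + l + lstar + D' \<le> v + D" using l_props[OF lI] by auto
        show "has_chain R K d g D' (graph_of n f) (v + l + lstar)" using nb(1) by (simp add: bad1_def)
        show "\<not> (\<exists>u\<in>segment R (v + l). \<exists>vs. is_cycle vs \<and> length vs \<le> K \<and> hd vs = u \<and>
          cycle_edges vs \<subseteq> graph_of n f \<and> cycle_edges vs \<inter> ({{v, v + l}} \<union> X) = {} \<and>
          (\<exists>s\<in>set (steps (vs @ [hd vs])). \<bar>s\<bar> > int M))"
          using nb(2) unfolding bad2_def long_def by blast
        show "\<not> (\<exists>vs. vs \<noteq> [] \<and> distinct vs \<and> hd vs \<in> segment R (v + l) \<and> length vs \<le> K \<and>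
          last vs \<in> insert v (\<Union>X) \<and> path_edges vs \<subseteq> graph_of n f \<and>
          path_edges vs \<inter> insert {v, v + l} X = {} \<and> set vs \<subseteq> {1..n})"
          using nb(3) unfolding bad3_def by blast
      qed
    qed
    let ?F = "{f. \<not> has_chain R K (Suc d) g D (graph_of n f) v}"
    \<comment> \<open>If no candidate succeeds, every occurring \<open>A l\<close> is bad: so either
      few candidates occur or many bad ones do.\<close>
    have "?F \<subseteq> {f. real (card {l \<in> I'. f \<in> A l}) \<le> mu / 2} \<union> {f. mu / 2 \<le> real (card {l \<in> I'. f \<in> Bad l})}"
    proof
      fix f assume "f \<in> ?F"
      then have "{l \<in> I'. f \<in> A l} = {l \<in> I'. f \<in> Bad l}" using good by (auto simp: Bad_def)
      then show "f \<in> {f. real (card {l \<in> I'. f \<in> A l}) \<le> mu / 2} \<union> {f. mu / 2 \<le> real (card {l \<in> I'. f \<in> Bad l})}"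
        by auto
    qed
    then have "?P ?F \<le> ?P ({f. real (card {l \<in> I'. f \<in> A l}) \<le> mu / 2} \<union> {f. mu / 2 \<le> real (card {l \<in> I'. f \<in> Bad l})})"
      by (rule prob_mono)
    also have "\<dots> \<le> ?P {f. real (card {l \<in> I'. f \<in> A l}) \<le> mu / 2} + ?P {f. mu / 2 \<le> real (card {l \<in> I'. f \<in> Bad l})}"
      by (rule prob_Un_le)
    also have "\<dots> \<le> 4 / mu + (2 * \<epsilon>1 * mu + C3) / (mu / 2)"
    proof (rule add_mono)
      show "?P {f. real (card {l \<in> I'. f \<in> A l}) \<le> mu / 2} \<le> 4 / mu" using few by simp
      have "?P {f. mu / 2 \<le> real (card {l \<in> I'. f \<in> Bad l})} \<le> (\<Sum>l\<in>I'. ?P (Bad l)) / (mu / 2)"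
        by (rule prob_card_ge[OF finI']) (use mu_pos in simp)
      also have "\<dots> \<le> (2 * \<epsilon>1 * mu + C3) / (mu / 2)"
        using sumBad mu_pos by (intro divide_right_mono) auto
      finally show "?P {f. mu / 2 \<le> real (card {l \<in> I'. f \<in> Bad l})} \<le> (2 * \<epsilon>1 * mu + C3) / (mu / 2)" .
    qed
    also have "\<dots> = (2 * C3 + 4) / mu + 4 * \<epsilon>1" using mu_pos by (simp add: field_simps)
    also have "(2 * C3 + 4) / mu \<le> (2 * C3 + 4) / \<mu>0"
      using mu \<mu>0 C3 by (intro divide_left_mono) auto
    also have "(2 * C3 + 4) / \<mu>0 = \<epsilon> / 2" using C3 Suc.prems by (simp add: \<mu>0_def field_simps)
    finally show ?thesis by (simp add: \<epsilon>1_def)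
  qed
  then show ?case by blast
qed

end

subsection \<open>Copies of templates\<close>

lemma prod_Un_ge:
  fixes g :: "'a \<Rightarrow> real"
  assumes "finite A" "finite B" "\<And>x. x \<in> A \<union> B \<Longrightarrow> 0 \<le> g x \<and> g x \<le> 1"
  shows "(\<Prod>x\<in>A. g x) * (\<Prod>x\<in>B. g x) \<le> (\<Prod>x\<in>A \<union> B. g x)"
proof -
  have "(\<Prod>x\<in>A. g x) * (\<Prod>x\<in>B. g x) = (\<Prod>x\<in>A \<union> B. g x) * (\<Prod>x\<in>A \<inter> B. g x)"
    using prod.union_inter[OF assms(1,2), of g] by simp
  also have "\<dots> \<le> (\<Prod>x\<in>A \<union> B. g x) * 1"
    using assms(3) by (intro mult_left_mono prod_le_1 prod_nonneg) auto
  finally show ?thesis by simp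
qed

lemma prod_UN_ge:
  fixes g :: "'a \<Rightarrow> real"
  assumes "finite I" "\<And>i. i \<in> I \<Longrightarrow> finite (A i)" "\<And>i x. i \<in> I \<Longrightarrow> x \<in> A i \<Longrightarrow> 0 \<le> g x \<and> g x \<le> 1"
  shows "(\<Prod>i\<in>I. \<Prod>x\<in>A i. g x) \<le> (\<Prod>x\<in>(\<Union>i\<in>I. A i). g x)"
  using assms
proof (induction I rule: finite_induct)
  case (insert i I)
  have "(\<Prod>i\<in>insert i I. \<Prod>x\<in>A i. g x) = (\<Prod>x\<in>A i. g x) * (\<Prod>i\<in>I. \<Prod>x\<in>A i. g x)"
    using insert by simp
  also have "\<dots> \<le> (\<Prod>x\<in>A i. g x) * (\<Prod>x\<in>(\<Union>i\<in>I. A i). g x)"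
    using insert by (intro mult_left_mono prod_nonneg) auto
  also have "\<dots> \<le> (\<Prod>x\<in>A i \<union> (\<Union>i\<in>I. A i). g x)"
    using insert by (intro prod_Un_ge) auto
  finally show ?case by simp
qed simp

lemma prod_ge_power:
  fixes g :: "'a \<Rightarrow> real"
  assumes "0 \<le> c" "c \<le> 1" "\<And>x. x \<in> A \<Longrightarrow> c \<le> g x" "card A \<le> k"
  shows "c ^ k \<le> (\<Prod>x\<in>A. g x)"
proof -
  have "c ^ k \<le> c ^ card A" using assms by (intro power_decreasing) auto
  also have "\<dots> = (\<Prod>x\<in>A. c)" by simp
  also have "\<dots> \<le> (\<Prod>x\<in>A. g x)" using assms by (intro prod_mono) auto
  finally show ?thesis .
qed

lemma prod_reindex_ge:
  fixes g :: "'b \<Rightarrow> real"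
  assumes "inj_on f A" "f ` A \<subseteq> B" "finite B" "\<And>x. x \<in> B \<Longrightarrow> 0 \<le> g x \<and> g x \<le> 1"
  shows "(\<Prod>x\<in>B. g x) \<le> (\<Prod>x\<in>A. g (f x))"
proof -
  have "(\<Prod>x\<in>B. g x) = (\<Prod>x\<in>B - f ` A. g x) * (\<Prod>x\<in>f ` A. g x)"
    using assms by (intro prod.subset_diff) auto
  also have "\<dots> \<le> 1 * (\<Prod>x\<in>f ` A. g x)"
    using assms by (intro mult_right_mono prod_le_1 prod_nonneg) auto
  also have "\<dots> = (\<Prod>x\<in>A. g (f x))" by (simp add: prod.reindex[OF assms(1)])
  finally show ?thesis .
qed

context distance_graph
begin

definition place :: "nat \<Rightarrow> int \<Rightarrow> nat" where
  "place a u = nat (int a + u)"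

text \<open>Only central vertices are forbidden outside neighbours; that already fixes the ball of
  radius \<open>Suc r\<close> about the centre.\<close>

definition copy_at :: "nat \<Rightarrow> int set \<Rightarrow> int set set \<Rightarrow> int \<Rightarrow> nat \<Rightarrow> nat set set \<Rightarrow> nat \<Rightarrow> bool" where
  "copy_at r S H x n E a \<longleftrightarrow> (\<forall>u\<in>S. 1 \<le> int a + u \<and> int a + u \<le> int n) \<and>
     (\<forall>u\<in>S. \<forall>w\<in>S. {place a u, place a w} \<in> E \<longleftrightarrow> {u, w} \<in> H) \<and>
     (\<forall>u\<in>nball H r x. \<forall>w. {place a u, w} \<in> E \<longrightarrow> w \<in> place a ` S)"

definition copies :: "nat \<Rightarrow> int set \<Rightarrow> int set set \<Rightarrow> int \<Rightarrow> nat \<Rightarrow> nat \<Rightarrow> nat set set \<Rightarrow> bool" where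
  "copies r S H x m n E \<longleftrightarrow> (\<exists>As. finite As \<and> m \<le> card As \<and> (\<forall>a\<in>As. copy_at r S H x n E a) \<and>
     (\<forall>a\<in>As. \<forall>a'\<in>As. a \<noteq> a' \<longrightarrow> place a ` S \<inter> place a' ` S = {}))"

lemma templateD:
  assumes "template r S H x"
  shows "finite S" "x \<in> S" "\<And>e. e \<in> H \<Longrightarrow> \<exists>u\<in>S. \<exists>w\<in>S. e = {u, w} \<and> wgt (w - u) > 0"
    "\<And>u w. u \<in> S \<Longrightarrow> w \<in> S \<Longrightarrow> w - u = int lstar \<Longrightarrow> {u, w} \<in> H"
    "\<And>u. u \<in> nball H r x \<Longrightarrow> u + int lstar \<in> S \<and> u - int lstar \<in> S"
    "\<Union>H \<subseteq> S" "nball H k x \<subseteq> S"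
proof -
  show "finite S" "x \<in> S" and 1: "\<And>e. e \<in> H \<Longrightarrow> \<exists>u\<in>S. \<exists>w\<in>S. e = {u, w} \<and> wgt (w - u) > 0"
    "\<And>u w. u \<in> S \<Longrightarrow> w \<in> S \<Longrightarrow> w - u = int lstar \<Longrightarrow> {u, w} \<in> H"
    "\<And>u. u \<in> nball H r x \<Longrightarrow> u + int lstar \<in> S \<and> u - int lstar \<in> S"
    using assms unfolding template_def by blast+
  show "\<Union>H \<subseteq> S" using 1(1) by fastforce
  then show "nball H k x \<subseteq> S" using \<open>x \<in> S\<close> by (rule nball_subset[rotated])
qed

lemma copy_at_ball:
  assumes t: "template r S H x" and c: "copy_at r S H x n E a"
  shows "nball E (Suc r) (place a x) \<subseteq> place a ` S"
    "2 ^ q \<le> Suc r \<Longrightarrow> loc q H E {(x, place a x)}"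
proof -
  note T = templateD[OF t]
  have inj: "inj_on (place a) S"
    by (rule inj_onI) (use c in \<open>auto simp: copy_at_def place_def\<close>)
  have adj: "{place a u, place a w} \<in> E \<longleftrightarrow> {u, w} \<in> H"
    if "u \<in> nball H (Suc r) x" "w \<in> nball H (Suc r) x" for u w
    using c that T(7)[of "Suc r"] unfolding copy_at_def by blast
  have closed: "w \<in> place a ` nball H (Suc r) x" if u: "u \<in> nball H r x" and w: "{place a u, w} \<in> E" for u w
  proof -
    obtain s where s: "s \<in> S" "w = place a s" using c u w unfolding copy_at_def by blast
    have "u \<in> S" using u T(7) by blast
    then have "{u, s} \<in> H" using c s w unfolding copy_at_def by blast
    then have "s \<in> nball H (Suc r) x" using u by auto
    then show ?thesis using s by blast
  qed
  have "nball E (Suc r) (place a x) = place a ` nball H (Suc r) x"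
    by (rule nball_image[of H r x "place a" E x 0 "Suc r"]) (use adj closed in auto)
  then show "nball E (Suc r) (place a x) \<subseteq> place a ` S" using T(7)[of "Suc r"] by blast
  have "loc q H E ((\<lambda>u. (u, place a u)) ` {x})" if "2 ^ q \<le> Suc r"
    by (rule loc_of_ball_iso[of "place a" H r x E "{x}" 0 q])
      (use adj closed inj_on_subset[OF inj T(7)] that in \<open>auto simp del: nball.simps(2)\<close>)
  then show "2 ^ q \<le> Suc r \<Longrightarrow> loc q H E {(x, place a x)}" by simp
qed

text \<open>A lower bound for the probability that a vertex has no unforced neighbour on one given
  side.\<close>

definition forbidden_prod :: "nat \<Rightarrow> real" where
  "forbidden_prod n = (\<Prod>l\<in>{1..n} - {lstar}. 1 - p l)"

lemma forbidden_prod_pos: "forbidden_prod n > 0"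
  unfolding forbidden_prod_def by (intro prod_pos) (use p_less_1 in auto)

lemma forbidden_prod_large:
  assumes "\<eta> > 0"
  shows "eventually (\<lambda>n. forbidden_prod n \<ge> real n powr (- \<eta>)) sequentially"
proof -
  have "eventually (\<lambda>n. ln (forbidden_prod n) / ln (real n) > - \<eta>) sequentially"
    using order_tendstoD(1)[OF log_prod, of "- \<eta>"] assms unfolding forbidden_prod_def by simp
  moreover have "eventually (\<lambda>n::nat. n > 2) sequentially" by (rule eventually_gt_at_top)
  ultimately show ?thesis
  proof eventually_elim
    case (elim n)
    then have "ln (real n) > 0" by simp
    then have "ln (forbidden_prod n) \<ge> - \<eta> * ln (real n)" using elim(1) by (simp add: field_simps)
    then have "exp (ln (forbidden_prod n)) \<ge> exp (- \<eta> * ln (real n))" by simp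
    then show ?case using elim(2) forbidden_prod_pos[of n] by (simp add: powr_def)
  qed
qed

section \<open>Many disjoint exact copies of a template\<close>

definition need :: "int set \<Rightarrow> int set set \<Rightarrow> nat \<Rightarrow> nat set set" where
  "need S H a = {{place a u, place a w} | u w. u \<in> S \<and> w \<in> S \<and> {u, w} \<in> H}"

definition avoid1 :: "int set \<Rightarrow> int set set \<Rightarrow> nat \<Rightarrow> nat set set" where
  "avoid1 S H a = {{place a u, place a w} | u w. u \<in> S \<and> w \<in> S \<and> u \<noteq> w \<and> {u, w} \<notin> H}"

text \<open>The pairs leaving the copy at \<open>u\<close>. Unlike \<open>avoid1\<close> their
  number grows with \<open>n\<close>, and here the slow decay of \<open>forbidden_prod\<close>
  enters.\<close>

definition avoid2 :: "nat \<Rightarrow> int set \<Rightarrow> nat \<Rightarrow> int \<Rightarrow> nat set set" where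
  "avoid2 n S a u = {{place a u, w} | w. w \<in> {1..n} \<and> w \<notin> place a ` S}"

definition avoid :: "nat \<Rightarrow> int set \<Rightarrow> int set set \<Rightarrow> int \<Rightarrow> nat \<Rightarrow> nat \<Rightarrow> nat set set" where
  "avoid r S H x n a = avoid1 S H a \<union> (\<Union>u\<in>nball H r x. avoid2 n S a u)"

lemma edge_prob_place:
  assumes "1 \<le> int a + u" "1 \<le> int a + w" "u \<noteq> w"
  shows "edge_prob {place a u, place a w} = wgt (w - u)"
  using assms by (subst edge_prob_pair) (auto simp: place_def)

lemma card_pairs_le:
  assumes "finite S"
  shows "finite {f u w | u w. u \<in> S \<and> w \<in> S \<and> P u w}" "card {f u w | u w. u \<in> S \<and> w \<in> S \<and> P u w} \<le> (card S)\<^sup>2"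
proof -
  have sub: "{f u w | u w. u \<in> S \<and> w \<in> S \<and> P u w} \<subseteq> (\<lambda>(u, w). f u w) ` (S \<times> S)" by force
  show "finite {f u w | u w. u \<in> S \<and> w \<in> S \<and> P u w}" by (rule finite_subset[OF sub]) (use assms in simp)
  have "card {f u w | u w. u \<in> S \<and> w \<in> S \<and> P u w} \<le> card ((\<lambda>(u, w). f u w) ` (S \<times> S))"
    by (rule card_mono[OF _ sub]) (use assms in simp)
  also have "\<dots> \<le> card (S \<times> S)" by (rule card_image_le) (use assms in simp)
  finally show "card {f u w | u w. u \<in> S \<and> w \<in> S \<and> P u w} \<le> (card S)\<^sup>2" by (simp add: power2_eq_square card_cartesian_product)
qed

text \<open>About \<open>sqrt n\<close> translates are tested, each exact with probability at least
  \<open>c0 * real n powr (- 1 / 4)\<close>, so the expected number tends to infinity. Two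
  translates interact only through pairs joining them, which are long and hence unlikely edges, so
  the second moment method applies.\<close>

lemma template_copies_prob:
  assumes t: "template r S H x" and "\<epsilon> > 0"
  shows "eventually (\<lambda>n. measure_pmf.prob (coins (vertex_pairs n) edge_prob)
     {f. \<not> copies r S H x m n (graph_of n f)} \<le> \<epsilon>) sequentially"
proof -
  note T = templateD[OF t]
  define k where "k = (card S)\<^sup>2"
  \<comment> \<open>Each central vertex costs two factors \<open>forbidden_prod\<close>, one for
    each side.\<close>
  define h where "h = 2 * card (nball H r x)"
  have finB: "finite (nball H r x)" using T(1,7) finite_subset by blast
  obtain s0 :: nat where s0: "\<And>u. u \<in> S \<Longrightarrow> \<bar>u\<bar> \<le> int s0"
  proof
    fix u assume "u \<in> S"
    then have "\<bar>u\<bar> \<le> (\<Sum>u\<in>S. \<bar>u\<bar>)" using T(1) by (intro member_le_sum) auto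
    then show "\<bar>u\<bar> \<le> int (nat (\<Sum>u\<in>S. \<bar>u\<bar>))" by simp
  qed
  \<comment> \<open>A common lower bound for the probability of each required edge and non-edge
    inside the pattern. For non-edges it is positive because all pairs at distance
    \<open>lstar\<close> are edges.\<close>
  obtain \<theta> where \<theta>: "0 < \<theta>" "\<theta> \<le> 1" "\<And>u w. u \<in> S \<Longrightarrow> w \<in> S \<Longrightarrow> {u, w} \<in> H \<Longrightarrow> \<theta> \<le> wgt (w - u)"
    "\<And>u w. u \<in> S \<Longrightarrow> w \<in> S \<Longrightarrow> u \<noteq> w \<Longrightarrow> {u, w} \<notin> H \<Longrightarrow> \<theta> \<le> 1 - wgt (w - u)"
  proof -
    define Z where "Z = insert 1 ((\<lambda>(u, w). if {u, w} \<in> H then wgt (w - u) else if u \<noteq> w then 1 - wgt (w - u) else 1) ` (S \<times> S))"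
    have finZ: "finite Z" "Z \<noteq> {}" using T(1) by (auto simp: Z_def)
    have "z > 0" if z: "z \<in> Z" for z
    proof -
      have "0 < (if {u, w} \<in> H then wgt (w - u) else if u \<noteq> w then 1 - wgt (w - u) else 1)"
        if uw: "u \<in> S" "w \<in> S" for u w
      proof (cases "{u, w} \<in> H")
        case True
        obtain u' w' where "{u, w} = {u', w'}" "wgt (w' - u') > 0" using T(3)[OF True] by blast
        then have "wgt (w - u) > 0" using wgt_minus[of "w - u"] by (auto simp: doubleton_eq_iff)
        then show ?thesis using True by simp
      next
        case False
        have "wgt (w - u) < 1" if "u \<noteq> w"
        proof -
          have "w - u \<noteq> int lstar" using T(4)[OF uw] False by blast
          moreover have "u - w \<noteq> int lstar" using T(4)[OF uw(2,1)] False by (metis insert_commute)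
          ultimately have "nat \<bar>w - u\<bar> \<noteq> lstar" by linarith
          then show ?thesis using p_less_1[of "nat \<bar>w - u\<bar>"] that by (simp add: wgt_def)
        qed
        then show ?thesis using False by simp
      qed
      then show ?thesis using z by (auto simp: Z_def simp del: split_paired_All)
    qed
    then have "Min Z > 0" using finZ by (simp add: Min_gr_iff)
    moreover have "Min Z \<le> 1" using finZ by (intro Min_le) (auto simp: Z_def)
    moreover have mem: "(if {u, w} \<in> H then wgt (w - u) else if u \<noteq> w then 1 - wgt (w - u) else 1) \<in> Z"
      if "u \<in> S" "w \<in> S" for u w using that unfolding Z_def by (intro insertI2 image_eqI[of _ _ "(u, w)"]) auto
    ultimately show thesis
    proof (intro that[of "Min Z"])
      show "Min Z \<le> wgt (w - u)" if "u \<in> S" "w \<in> S" "{u, w} \<in> H" for u w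
        using Min_le[OF finZ(1) mem[OF that(1,2)]] that(3) by simp
      show "Min Z \<le> 1 - wgt (w - u)" if "u \<in> S" "w \<in> S" "u \<noteq> w" "{u, w} \<notin> H" for u w
        using Min_le[OF finZ(1) mem[OF that(1,2)]] that(3,4) by simp
    qed
  qed
  define c0 where "c0 = \<theta> ^ k * \<theta> ^ k"
  have c0: "c0 > 0" using \<theta> by (simp add: c0_def)
  define d where "d = \<epsilon> / 8"
  have d: "d > 0" using assms(2) by (simp add: d_def)
  \<comment> \<open>By Bernoulli's inequality \<open>k\<close> independent events of probability at
    most \<open>\<pi>\<close> all fail with probability at least \<open>1 / (1 + d)\<close>.\<close>
  define \<pi> where "\<pi> = d / ((1 + d) * (real k + 1))"
  have \<pi>: "0 < \<pi>" "real k * \<pi> \<le> d / (1 + d)" "\<pi> \<le> 1"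
  proof -
    show "0 < \<pi>" using d by (simp add: \<pi>_def)
    have "real k * \<pi> = (real k / (real k + 1)) * (d / (1 + d))" by (simp add: \<pi>_def)
    also have "\<dots> \<le> 1 * (d / (1 + d))" using d by (intro mult_right_mono) auto
    finally show "real k * \<pi> \<le> d / (1 + d)" by simp
    have "d \<le> (1 + d) * (real k + 1)" using d by (simp add: algebra_simps)
    then show "\<pi> \<le> 1" using d by (simp add: \<pi>_def)
  qed
  have bern: "1 / (1 + d) \<le> (1 - \<pi>) ^ k"
  proof -
    have "1 / (1 + d) = 1 - d / (1 + d)" using d by (simp add: field_simps)
    also have "\<dots> \<le> 1 + real k * (- \<pi>)" using \<pi>(2) by simp
    also have "\<dots> \<le> (1 + (- \<pi>)) ^ k" by (rule Bernoulli_inequality) (use \<pi> in simp)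
    finally show ?thesis by simp
  qed
  obtain G where G: "\<And>s. \<bar>s\<bar> \<ge> int G \<Longrightarrow> wgt s \<le> \<pi>" using wgt_small[OF \<pi>(1)] by blast
  have "real h * (1 / (4 * (real h + 1))) \<le> 1 / 4" by (simp add: field_simps)
  \<comment> \<open>With this exponent the \<open>h\<close> factors together stay above
    \<open>real n powr (- 1 / 4)\<close>, which \<open>sqrt n\<close> trials outweigh.\<close>
  have ev1: "eventually (\<lambda>n. forbidden_prod n \<ge> real n powr (- (1 / (4 * (real h + 1))))) sequentially"
    by (rule forbidden_prod_large) simp
  have "filterlim (\<lambda>n. (sqrt (real n) - 2) * (c0 * real n powr (- 1 / 4))) at_top sequentially"
    using c0 by real_asymp
  then have ev2: "eventually (\<lambda>n. (sqrt (real n) - 2) * (c0 * real n powr (- 1 / 4)) \<ge> max (8 / \<epsilon>) (2 * real m)) sequentially"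
    unfolding filterlim_at_top by blast
  have ev3: "eventually (\<lambda>n. n \<ge> (2 * s0 + G + 3)\<^sup>2) sequentially" by (rule eventually_ge_at_top)
  show ?thesis
    using ev1 ev2 ev3
  proof eventually_elim
    case (elim n)
    let ?P = "measure_pmf.prob (coins (vertex_pairs n) edge_prob)"
    \<comment> \<open>Translates sit at multiples of \<open>w\<close>, so that both their number and
      their spacing grow like \<open>sqrt n\<close>.\<close>
    define w where "w = nat \<lfloor>sqrt (real n)\<rfloor>"
    have w1: "w * w \<le> n" "sqrt (real n) - 1 \<le> real w" "2 * s0 + G + 3 \<le> w"
    proof -
      have "real w \<le> sqrt (real n)" by (simp add: w_def)
      then have "real w * real w \<le> sqrt (real n) * sqrt (real n)" by (intro mult_mono) auto
      then have "real (w * w) \<le> real n" by simp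
      then show "w * w \<le> n" by (simp only: of_nat_le_iff)
      show "sqrt (real n) - 1 \<le> real w" unfolding w_def by linarith
      have "real ((2 * s0 + G + 3)\<^sup>2) \<le> real n" using elim(3) by (simp only: of_nat_le_iff)
      then have "(real (2 * s0 + G + 3))\<^sup>2 \<le> real n" by (simp only: of_nat_power)
      then have "real (2 * s0 + G + 3) \<le> sqrt (real n)" by (rule real_le_rsqrt)
      then show "2 * s0 + G + 3 \<le> w" unfolding w_def by (rule le_nat_floor)
    qed
    define I where "I = (\<lambda>j. j * w) ` {1..w - 1}"
    have w0: "w > 0" using w1 by simp
    have cI: "finite I" "card I = w - 1"
      unfolding I_def using w0 by (auto simp: card_image inj_on_def)
    have rng: "int w - int s0 \<le> int a + u \<and> int a + u \<le> int n" if a: "a \<in> I" and u: "u \<in> S" for a u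
    proof -
      obtain j where j: "a = j * w" "1 \<le> j" "j \<le> w - 1"
        using a unfolding I_def image_iff Bex_def atLeastAtMost_iff by blast
      have "1 * w \<le> a" unfolding j(1) using j(2) by (rule mult_le_mono1)
      moreover have "a \<le> (w - 1) * w" unfolding j(1) using j(3) by (rule mult_le_mono1)
      moreover have "(w - 1) * w + w = w * w" using w0 by (cases w) auto
      ultimately show ?thesis using s0[OF u] w1 by linarith
    qed
    have one: "1 \<le> int a + u" if "a \<in> I" "u \<in> S" for a u using rng[OF that] w1 by linarith
    have apart: "int G \<le> \<bar>(int a' + u') - (int a + u)\<bar>" if a: "a \<in> I" "a' \<in> I" "a \<noteq> a'" and u: "u \<in> S" "u' \<in> S" for a a' u u'
    proof -
      obtain j j' where j: "a = j * w" "a' = j' * w"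
        using a unfolding I_def by blast
      have "\<bar>int j' - int j\<bar> \<ge> 1" using a(3) j by (cases "j = j'") auto
      then have "\<bar>int j' - int j\<bar> * int w \<ge> 1 * int w" by (intro mult_right_mono) auto
      then have "\<bar>int a' - int a\<bar> \<ge> int w" 
        by (simp add: j abs_mult left_diff_distrib[symmetric])
      then show ?thesis using s0[OF u(1)] s0[OF u(2)] w1 by linarith
    qed
    have pl: "int (place a u) = int a + u" if "a \<in> I" "u \<in> S" for a u using one[OF that] by (simp add: place_def)
    have pln: "place a u \<in> {1..n}" if "a \<in> I" "u \<in> S" for a u
      using pl[OF that] one[OF that] rng[OF that] by simp
    have plinj: "place a u = place a v \<longleftrightarrow> u = v" if "a \<in> I" "u \<in> S" "v \<in> S" for a u v
      using pl[OF that(1,2)] pl[OF that(1,3)] by (metis add_left_cancel)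
    have disj: "place a ` S \<inter> place a' ` S = {}" if a: "a \<in> I" "a' \<in> I" "a \<noteq> a'" for a a'
    proof (rule ccontr)
      assume "place a ` S \<inter> place a' ` S \<noteq> {}"
      then obtain u u' where u: "u \<in> S" "u' \<in> S" "place a u = place a' u'" by blast
      obtain j j' where j: "a = j * w" "a' = j' * w"
        using a unfolding I_def by blast
      have "\<bar>int j' - int j\<bar> \<ge> 1" using a(3) j by (cases "j = j'") auto
      then have "\<bar>int j' - int j\<bar> * int w \<ge> 1 * int w" by (intro mult_right_mono) auto
      then have "\<bar>int a' - int a\<bar> \<ge> int w" 
        by (simp add: j abs_mult left_diff_distrib[symmetric])
      moreover have "int a + u = int a' + u'" using pl[OF a(1) u(1)] pl[OF a(2) u(2)] u(3) by simp
      ultimately show False using s0[OF u(1)] s0[OF u(2)] w1 by linarith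
    qed
    define N where "N = need S H"
    define V where "V = avoid r S H x n"
    define A where "A = (\<lambda>a. pattern (N a) (V a))"
    have BS: "nball H r x \<subseteq> S" by (rule T(7))
    have loop: "{u} \<notin> H" for u
    proof
      assume "{u} \<in> H"
      from T(3)[OF this] obtain a b where "{u} = {a, b}" "wgt (b - a) > 0" by blast
      then show False by (auto simp: doubleton_eq_iff)
    qed
    have NV: "N a \<subseteq> vertex_pairs n" if a: "a \<in> I" for a
      unfolding N_def need_def using pln[OF a] plinj[OF a] loop by (auto simp: pair_in_vertex_pairs)
    have V1V: "avoid1 S H a \<subseteq> vertex_pairs n" if a: "a \<in> I" for a
      unfolding avoid1_def using pln[OF a] plinj[OF a] by (auto simp: pair_in_vertex_pairs)
    have V2V: "avoid2 n S a u \<subseteq> vertex_pairs n" if a: "a \<in> I" and u: "u \<in> nball H r x" for a u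
    proof -
      have "u \<in> S" using BS u by blast
      then show ?thesis unfolding avoid2_def using pln[OF a] by (auto simp: pair_in_vertex_pairs)
    qed
    have VV: "V a \<subseteq> vertex_pairs n" if a: "a \<in> I" for a
      using V1V[OF a] V2V[OF a] unfolding V_def avoid_def by blast
    have Nsub: "e \<subseteq> place a ` S" if "e \<in> N a" for e a
      using that unfolding N_def need_def by auto
    have Vmeet: "e \<inter> place a ` S \<noteq> {}" if "e \<in> V a" for e a
      using that BS unfolding V_def avoid_def avoid1_def avoid2_def by blast
    have NVdisj: "N a \<inter> V a = {}" if a: "a \<in> I" for a
    proof (rule ccontr)
      assume "N a \<inter> V a \<noteq> {}"
      then obtain e where e: "e \<in> N a" "e \<in> V a" by blast
      obtain u w where uw: "e = {place a u, place a w}" "u \<in> S" "w \<in> S" "{u, w} \<in> H"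
        using e(1) unfolding N_def need_def by blast
      from e(2) consider "e \<in> avoid1 S H a" | v where "v \<in> nball H r x" "e \<in> avoid2 n S a v"
        unfolding V_def avoid_def by blast
      then show False
      proof cases
        case 1
        then obtain u' w' where "e = {place a u', place a w'}" "u' \<in> S" "w' \<in> S" "{u', w'} \<notin> H"
          unfolding avoid1_def by blast
        then show False using uw plinj[OF a] by (auto simp: doubleton_eq_iff insert_commute)
      next
        case 2
        then obtain w' where "e = {place a v, w'}" "w' \<notin> place a ` S" unfolding avoid2_def by blast
        then show False using uw by (auto simp: doubleton_eq_iff)
      qed
    qed
    have bounds: "0 \<le> edge_prob e \<and> edge_prob e \<le> 1" if "e \<in> vertex_pairs n" for e
      using edge_prob_bounds[OF that] .
    have PA: "?P (A a) = (\<Prod>e\<in>N a. edge_prob e) * (\<Prod>e\<in>V a. 1 - edge_prob e)" if a: "a \<in> I" for a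
      unfolding A_def by (rule prob_pattern) (use bounds NV[OF a] VV[OF a] NVdisj[OF a] in auto)
    have occurs: "copy_at r S H x n (graph_of n f) a" if a: "a \<in> I" and f: "f \<in> A a" for a f
      unfolding copy_at_def
    proof (intro conjI ballI allI impI)
      show "1 \<le> int a + u" "int a + u \<le> int n" if "u \<in> S" for u using one[OF a that] rng[OF a that] by auto
      show "({place a u, place a w} \<in> graph_of n f) = ({u, w} \<in> H)" if uw: "u \<in> S" "w \<in> S" for u w
      proof (cases "{u, w} \<in> H")
        case True
        then have "{place a u, place a w} \<in> N a" using uw unfolding N_def need_def by blast
        then show ?thesis using True f NV[OF a] by (auto simp: A_def pattern_def graph_of_def)
      next
        case False
        show ?thesis
        proof (cases "u = w")
          case True
          then show ?thesis using loop by (auto simp: graph_of_def pair_in_vertex_pairs[of "place a w" "place a w", simplified])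
        next
          case neq: False
          then have "{place a u, place a w} \<in> V a" using False uw unfolding V_def avoid_def avoid1_def by blast
          then show ?thesis using False f by (auto simp: A_def pattern_def graph_of_def)
        qed
      qed
      show "v \<in> place a ` S" if u: "u \<in> nball H r x" and e: "{place a u, v} \<in> graph_of n f" for u v
      proof (rule ccontr)
        assume nv: "v \<notin> place a ` S"
        have "v \<in> {1..n}" using e by (auto simp: graph_of_def pair_in_vertex_pairs)
        then have "{place a u, v} \<in> V a" using nv u unfolding V_def avoid_def avoid2_def by blast
        then show False using f e by (auto simp: A_def pattern_def graph_of_def)
      qed
    qed
    have lower: "c0 * real n powr (- 1 / 4) \<le> ?P (A a)" if a: "a \<in> I" for a
    proof -
      have 1: "\<theta> ^ k \<le> (\<Prod>e\<in>N a. edge_prob e)"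
      proof (rule prod_ge_power)
        show "0 \<le> \<theta>" "\<theta> \<le> 1" using \<theta> by auto
        show "card (N a) \<le> k" unfolding N_def need_def k_def
          using card_pairs_le(2)[OF T(1), of "\<lambda>u w. {place a u, place a w}" "\<lambda>u w. {u, w} \<in> H"] by simp
        fix e assume "e \<in> N a"
        then obtain u w where uw: "e = {place a u, place a w}" "u \<in> S" "w \<in> S" "{u, w} \<in> H"
          unfolding N_def need_def by blast
        have "u \<noteq> w" using uw(4) loop by auto
        then show "\<theta> \<le> edge_prob e"
          using \<theta>(3)[OF uw(2-4)] edge_prob_place[OF one[OF a uw(2)] one[OF a uw(3)]] uw(1) by simp
      qed
      have 2: "\<theta> ^ k \<le> (\<Prod>e\<in>avoid1 S H a. 1 - edge_prob e)"
      proof (rule prod_ge_power)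
        show "0 \<le> \<theta>" "\<theta> \<le> 1" using \<theta> by auto
        show "card (avoid1 S H a) \<le> k" unfolding avoid1_def k_def
          using card_pairs_le(2)[OF T(1), of "\<lambda>u w. {place a u, place a w}" "\<lambda>u w. u \<noteq> w \<and> {u, w} \<notin> H"] by simp
        fix e assume "e \<in> avoid1 S H a"
        then obtain u w where uw: "e = {place a u, place a w}" "u \<in> S" "w \<in> S" "u \<noteq> w" "{u, w} \<notin> H"
          unfolding avoid1_def by blast
        then show "\<theta> \<le> 1 - edge_prob e"
          using \<theta>(4)[OF uw(2-5)] edge_prob_place[OF one[OF a uw(2)] one[OF a uw(3)] uw(4)] by simp
      qed
      \<comment> \<open>Neighbours above and below are treated separately, each side injecting into
        the lengths other than \<open>lstar\<close>: the two forced neighbours belong to the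
        copy.\<close>
      have 3: "forbidden_prod n * forbidden_prod n \<le> (\<Prod>e\<in>avoid2 n S a u. 1 - edge_prob e)" if u: "u \<in> nball H r x" for u
      proof -
        define P where "P = place a u"
        have uS: "u \<in> S" using u BS by blast
        have P: "P \<in> {1..n}" "int P = int a + u" unfolding P_def using pln[OF a uS] pl[OF a uS] by auto
        define up where "up = {w \<in> {1..n}. w \<notin> place a ` S \<and> P < w}"
        define dn where "dn = {w \<in> {1..n}. w \<notin> place a ` S \<and> w < P}"
        have PS: "P \<in> place a ` S" using uS by (simp add: P_def)
        have eq: "avoid2 n S a u = (\<lambda>w. {P, w}) ` up \<union> (\<lambda>w. {P, w}) ` dn"
        proof -
          have "{w \<in> {1..n}. w \<notin> place a ` S} = up \<union> dn"
            using PS by (auto simp: up_def dn_def)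
          then show ?thesis unfolding avoid2_def P_def[symmetric] by blast
        qed
        have notL: "w \<noteq> P + lstar" "P \<noteq> w + lstar" if "w \<notin> place a ` S" for w
        proof -
          have S2: "u + int lstar \<in> S" "u - int lstar \<in> S" using T(5)[OF u] by auto
          have "int (place a (u + int lstar)) = int P + int lstar" using pl[OF a S2(1)] P(2) by simp
          then have "place a (u + int lstar) = P + lstar" by (simp flip: of_nat_add)
          then show "w \<noteq> P + lstar" using that S2(1) by (metis imageI)
          have "int (place a (u - int lstar)) + int lstar = int P" using pl[OF a S2(2)] P(2) by simp
          then have "place a (u - int lstar) + lstar = P" by (simp flip: of_nat_add)
          then show "P \<noteq> w + lstar" using that S2(2) by (metis add_right_cancel imageI)
        qed
        have b01: "0 \<le> 1 - p l \<and> 1 - p l \<le> 1" if "l \<in> {1..n} - {lstar}" for l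
          using that p_nonneg[of l] p_le_1[of l] by auto
        have inj: "inj_on (\<lambda>w. {P, w}) Z" if "P \<notin> Z" for Z using that by (auto simp: inj_on_def doubleton_eq_iff)
        have imup: "w - P \<in> {1..n} - {lstar}" if "w \<in> up" for w
        proof -
          have "w \<noteq> P + lstar" "P < w" "w \<le> n" using that notL(1)[of w] by (auto simp: up_def)
          then have "w - P \<noteq> lstar" "1 \<le> w - P" "w - P \<le> n" by linarith+
          then show ?thesis by simp
        qed
        have imdn: "P - w \<in> {1..n} - {lstar}" if "w \<in> dn" for w
        proof -
          have "P \<noteq> w + lstar" "w < P" "P \<le> n" using that notL(2)[of w] P(1) by (auto simp: dn_def)
          then have "P - w \<noteq> lstar" "1 \<le> P - w" "P - w \<le> n" by linarith+
          then show ?thesis by simp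
        qed
        have "forbidden_prod n \<le> (\<Prod>w\<in>up. 1 - p (w - P))"
          unfolding forbidden_prod_def
          by (rule prod_reindex_ge[of "\<lambda>w. w - P"]) (use imup b01 in \<open>auto simp: up_def inj_on_def\<close>)
        also have "\<dots> = (\<Prod>w\<in>up. 1 - edge_prob {P, w})"
          by (intro prod.cong refl) (auto simp: up_def edge_prob_def)
        also have "\<dots> = (\<Prod>e\<in>(\<lambda>w. {P, w}) ` up. 1 - edge_prob e)"
          by (subst prod.reindex[OF inj]) (auto simp: up_def)
        finally have u1: "forbidden_prod n \<le> (\<Prod>e\<in>(\<lambda>w. {P, w}) ` up. 1 - edge_prob e)" .
        have "forbidden_prod n \<le> (\<Prod>w\<in>dn. 1 - p (P - w))"
          unfolding forbidden_prod_def
          by (rule prod_reindex_ge[of "\<lambda>w. P - w"]) (use imdn b01 in \<open>auto simp: dn_def inj_on_def\<close>)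
        also have "\<dots> = (\<Prod>w\<in>dn. 1 - edge_prob {P, w})"
          by (intro prod.cong refl) (auto simp: dn_def edge_prob_def)
        also have "\<dots> = (\<Prod>e\<in>(\<lambda>w. {P, w}) ` dn. 1 - edge_prob e)"
          by (subst prod.reindex[OF inj]) (auto simp: dn_def)
        finally have d1: "forbidden_prod n \<le> (\<Prod>e\<in>(\<lambda>w. {P, w}) ` dn. 1 - edge_prob e)" .
        have "forbidden_prod n * forbidden_prod n \<le>
            (\<Prod>e\<in>(\<lambda>w. {P, w}) ` up. 1 - edge_prob e) * (\<Prod>e\<in>(\<lambda>w. {P, w}) ` dn. 1 - edge_prob e)"
          using u1 d1 forbidden_prod_pos[of n] by (intro mult_mono) auto
        also have "\<dots> \<le> (\<Prod>e\<in>avoid2 n S a u. 1 - edge_prob e)"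
          unfolding eq
        proof (rule prod_Un_ge)
          fix e assume "e \<in> (\<lambda>w. {P, w}) ` up \<union> (\<lambda>w. {P, w}) ` dn"
          then have "e \<in> vertex_pairs n" using V2V[OF a u] eq by blast
          then show "0 \<le> 1 - edge_prob e \<and> 1 - edge_prob e \<le> 1" using bounds by auto
        qed (auto simp: up_def dn_def)
        finally show ?thesis .
      qed
      have fin1: "finite (avoid1 S H a)" using V1V[OF a] finite_subset finite_vertex_pairs by blast
      have fin2: "finite (avoid2 n S a u)" if "u \<in> nball H r x" for u
        using V2V[OF a that] finite_subset finite_vertex_pairs by blast
      have b1: "0 \<le> 1 - edge_prob e \<and> 1 - edge_prob e \<le> 1" if "e \<in> V a" for e using VV[OF a] that bounds by auto
      have "forbidden_prod n ^ h = (\<Prod>u\<in>nball H r x. forbidden_prod n * forbidden_prod n)"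
        by (simp add: h_def power_mult power2_eq_square)
      also have "\<dots> \<le> (\<Prod>u\<in>nball H r x. \<Prod>e\<in>avoid2 n S a u. 1 - edge_prob e)"
        using 3 forbidden_prod_pos[of n] by (intro prod_mono) (auto intro: less_imp_le)
      also have "\<dots> \<le> (\<Prod>e\<in>(\<Union>u\<in>nball H r x. avoid2 n S a u). 1 - edge_prob e)"
        by (rule prod_UN_ge[OF finB fin2]) (use b1 in \<open>auto simp: V_def avoid_def\<close>)
      finally have 4: "forbidden_prod n ^ h \<le> (\<Prod>e\<in>(\<Union>u\<in>nball H r x. avoid2 n S a u). 1 - edge_prob e)" .
      have nn: "0 \<le> \<theta> ^ k" "0 \<le> forbidden_prod n ^ h"
        using \<theta>(1) forbidden_prod_pos[of n] by auto
      have "\<theta> ^ k * forbidden_prod n ^ h \<le>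
          (\<Prod>e\<in>avoid1 S H a. 1 - edge_prob e) * (\<Prod>e\<in>(\<Union>u\<in>nball H r x. avoid2 n S a u). 1 - edge_prob e)"
        using 2 4 nn by (intro mult_mono) linarith+
      also have "\<dots> \<le> (\<Prod>e\<in>V a. 1 - edge_prob e)"
        unfolding V_def avoid_def by (rule prod_Un_ge) (use fin1 finB fin2 b1 in \<open>auto simp: V_def avoid_def\<close>)
      finally have 5: "\<theta> ^ k * forbidden_prod n ^ h \<le> (\<Prod>e\<in>V a. 1 - edge_prob e)" .
      have n1: "real n \<ge> 1" using elim(3) by (cases n) auto
      have "real n powr (- 1 / 4) \<le> real n powr (- (1 / (4 * (real h + 1))) * real h)"
        using n1 by (intro powr_mono) (auto simp: field_simps)
      also have "\<dots> = (real n powr (- (1 / (4 * (real h + 1))))) ^ h"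
        using n1 by (simp add: powr_powr powr_realpow[symmetric])
      also have "\<dots> \<le> forbidden_prod n ^ h" using elim(1) by (intro power_mono) auto
      finally have 6: "real n powr (- 1 / 4) \<le> forbidden_prod n ^ h" .
      have "c0 * real n powr (- 1 / 4) \<le> c0 * forbidden_prod n ^ h" using 6 c0 by (intro mult_left_mono) auto
      also have "\<dots> = \<theta> ^ k * (\<theta> ^ k * forbidden_prod n ^ h)" by (simp add: c0_def)
      also have "\<dots> \<le> (\<Prod>e\<in>N a. edge_prob e) * (\<Prod>e\<in>V a. 1 - edge_prob e)"
        using 1 5 nn by (intro mult_mono) auto
      also have "\<dots> = ?P (A a)" using PA[OF a] by simp
      finally show ?thesis .
    qed
    have pair: "?P (A a \<inter> A a') \<le> (1 + d) * (?P (A a) * ?P (A a'))" if a: "a \<in> I" "a' \<in> I" "a \<noteq> a'" for a a'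
    proof -
      have dj: "place a ` S \<inter> place a' ` S = {}" by (rule disj[OF a])
      have NVx: "N b \<inter> V b' = {}" if "place b ` S \<inter> place b' ` S = {}" for b b'
      proof (rule equals0I)
        fix e assume "e \<in> N b \<inter> V b'"
        then show False using Nsub[of e b] Vmeet[of e b'] that by blast
      qed
      have x1: "N a \<inter> V a' = {}" by (rule NVx[OF dj])
      have x2: "N a' \<inter> V a = {}" by (rule NVx) (use dj in blast)
      have Nne: "e \<noteq> {}" if "e \<in> N b" for e b using that unfolding N_def need_def by auto
      have x3: "N a \<inter> N a' = {}"
      proof (rule equals0I)
        fix e assume "e \<in> N a \<inter> N a'"
        then show False using Nsub[of e a] Nsub[of e a'] Nne[of e a] dj by blast
      qed
      have fin: "finite (N a)" "finite (N a')" "finite (V a)" "finite (V a')"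
        using finite_subset[OF NV[OF a(1)]] finite_subset[OF NV[OF a(2)]]
          finite_subset[OF VV[OF a(1)]] finite_subset[OF VV[OF a(2)]] by simp_all
      have "?P (A a \<inter> A a') = (\<Prod>e\<in>N a \<union> N a'. edge_prob e) * (\<Prod>e\<in>V a \<union> V a'. 1 - edge_prob e)"
        unfolding A_def pattern_Int
        by (rule prob_pattern)
          (use bounds NV[OF a(1)] NV[OF a(2)] VV[OF a(1)] VV[OF a(2)] NVdisj[OF a(1)] NVdisj[OF a(2)] x1 x2 in auto)
      also have "(\<Prod>e\<in>N a \<union> N a'. edge_prob e) = (\<Prod>e\<in>N a. edge_prob e) * (\<Prod>e\<in>N a'. edge_prob e)"
        by (rule prod.union_disjoint[OF fin(1,2) x3])
      finally have P0: "?P (A a \<inter> A a') = (\<Prod>e\<in>N a. edge_prob e) * (\<Prod>e\<in>N a'. edge_prob e) * (\<Prod>e\<in>V a \<union> V a'. 1 - edge_prob e)" .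
      \<comment> \<open>A pair avoided by both copies meets both and therefore joins them; there are
        at most \<open>k\<close> of these, of length at least \<open>G\<close>. They are the only
        factors that the product of the two probabilities counts twice.\<close>
      have "(1 - \<pi>) ^ k \<le> (\<Prod>e\<in>V a \<inter> V a'. 1 - edge_prob e)"
      proof (rule prod_ge_power)
        show "0 \<le> 1 - \<pi>" "1 - \<pi> \<le> 1" using \<pi> by auto
        have cross: "\<exists>u\<in>S. \<exists>u'\<in>S. e = {place a u, place a' u'}" if e: "e \<in> V a \<inter> V a'" for e
        proof -
          obtain u u' where u: "u \<in> S" "u' \<in> S" "place a u \<in> e" "place a' u' \<in> e" using Vmeet[of e a] Vmeet[of e a'] e by blast
          have "e \<in> vertex_pairs n" using VV[OF a(1)] e by blast
          then obtain i j where "e = {i, j}" by (auto simp: vertex_pairs_def)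
          moreover have "place a u \<noteq> place a' u'" using dj u by blast
          ultimately show ?thesis using u by (intro bexI[of _ u] bexI[of _ u']) auto
        qed
        have sub: "V a \<inter> V a' \<subseteq> {{place a u, place a' u'} | u u'. u \<in> S \<and> u' \<in> S \<and> True}" using cross by blast
        have "card (V a \<inter> V a') \<le> card {{place a u, place a' u'} | u u'. u \<in> S \<and> u' \<in> S \<and> True}"
          by (rule card_mono[OF card_pairs_le(1)[OF T(1)] sub])
        also have "\<dots> \<le> k" unfolding k_def by (rule card_pairs_le(2)[OF T(1)])
        finally show "card (V a \<inter> V a') \<le> k" .
        fix e assume "e \<in> V a \<inter> V a'"
        then obtain u u' where u: "u \<in> S" "u' \<in> S" "e = {place a u, place a' u'}" using cross by blast
        have "place a u \<noteq> place a' u'" using dj u by blast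
        then have "edge_prob e = wgt (int (place a' u') - int (place a u))" unfolding u(3) by (rule edge_prob_pair)
        also have "\<dots> \<le> \<pi>" using G apart[OF a u(1,2)] pl[OF a(1) u(1)] pl[OF a(2) u(2)] by simp
        finally show "1 - \<pi> \<le> 1 - edge_prob e" by simp
      qed
      then have "1 / (1 + d) \<le> (\<Prod>e\<in>V a \<inter> V a'. 1 - edge_prob e)" using bern by linarith
      then have i1: "1 \<le> (1 + d) * (\<Prod>e\<in>V a \<inter> V a'. 1 - edge_prob e)" using d by (simp add: field_simps)
      have U0: "0 \<le> (\<Prod>e\<in>V a \<union> V a'. 1 - edge_prob e)" using bounds VV a by (intro prod_nonneg) auto
      have "(\<Prod>e\<in>V a \<union> V a'. 1 - edge_prob e) * 1 \<le>
          (\<Prod>e\<in>V a \<union> V a'. 1 - edge_prob e) * ((1 + d) * (\<Prod>e\<in>V a \<inter> V a'. 1 - edge_prob e))"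
        by (rule mult_left_mono[OF i1 U0])
      also have "\<dots> = (1 + d) * ((\<Prod>e\<in>V a. 1 - edge_prob e) * (\<Prod>e\<in>V a'. 1 - edge_prob e))"
        using prod.union_inter[OF fin(3,4), of "\<lambda>e. 1 - edge_prob e"] by (simp add: mult_ac)
      finally have i2: "(\<Prod>e\<in>V a \<union> V a'. 1 - edge_prob e) \<le>
          (1 + d) * ((\<Prod>e\<in>V a. 1 - edge_prob e) * (\<Prod>e\<in>V a'. 1 - edge_prob e))" by simp
      have N0: "0 \<le> (\<Prod>e\<in>N a. edge_prob e) * (\<Prod>e\<in>N a'. edge_prob e)"
        using bounds NV a by (intro mult_nonneg_nonneg prod_nonneg) auto
      show ?thesis unfolding P0 PA[OF a(1)] PA[OF a(2)] using mult_left_mono[OF i2 N0] by (simp add: mult_ac)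
    qed
    define mu where "mu = (\<Sum>a\<in>I. ?P (A a))"
    have "max (8 / \<epsilon>) (2 * real m) \<le> (sqrt (real n) - 2) * (c0 * real n powr (- 1 / 4))" using elim(2) .
    also have "\<dots> \<le> real (w - 1) * (c0 * real n powr (- 1 / 4))"
      using w1 c0 by (intro mult_right_mono) auto
    also have "\<dots> = (\<Sum>a\<in>I. c0 * real n powr (- 1 / 4))" using cI by simp
    also have "\<dots> \<le> mu" unfolding mu_def by (rule sum_mono[OF lower])
    finally have mu: "8 / \<epsilon> \<le> mu" "2 * real m \<le> mu" by auto
    have "8 / \<epsilon> > 0" using assms(2) by simp
    then have mu_pos: "mu > 0" using mu by linarith
    have "?P {f. real (card {a \<in> I. f \<in> A a}) \<le> mu / 2} \<le> 4 * (1 / mu + d)"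
      by (rule prob_card_le_half[OF cI(1) _ mu_def mu_pos pair]) (use d in auto)
    also have "\<dots> \<le> \<epsilon>"
    proof -
      have "1 / mu \<le> 1 / (8 / \<epsilon>)" using mu(1) assms(2) mu_pos by (intro divide_left_mono) auto
      then show ?thesis using assms(2) by (simp add: d_def)
    qed
    finally have small: "?P {f. real (card {a \<in> I. f \<in> A a}) \<le> mu / 2} \<le> \<epsilon>" .
    have "{f. \<not> copies r S H x m n (graph_of n f)} \<subseteq> {f. real (card {a \<in> I. f \<in> A a}) \<le> mu / 2}"
    proof (rule subsetI, rule ccontr)
      fix f assume f: "f \<in> {f. \<not> copies r S H x m n (graph_of n f)}" "f \<notin> {f. real (card {a \<in> I. f \<in> A a}) \<le> mu / 2}"
      let ?As = "{a \<in> I. f \<in> A a}"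
      have "real m < real (card ?As)" using f(2) mu(2) by simp
      then have "m \<le> card ?As" by simp
      then have "copies r S H x m n (graph_of n f)"
        unfolding copies_def using cI(1) occurs disj by (intro exI[of _ ?As]) auto
      then show False using f(1) by simp
    qed
    then show ?case using small prob_mono order_trans by blast
  qed
qed

end

subsection \<open>Balls near the border\<close>

context distance_graph
begin

fun chain_pairs :: "nat \<Rightarrow> nat list \<Rightarrow> (nat \<times> nat) set" where
  "chain_pairs v [] = {}"
| "chain_pairs v (y # ys) = insert (v, y) (chain_pairs (y + lstar) ys)"

fun chain_walk :: "nat \<Rightarrow> nat list \<Rightarrow> nat list" where
  "chain_walk v [] = [v]"
| "chain_walk v (y # ys) = v # y # chain_walk (y + lstar) ys"

lemma chain_walk_hd: "chain_walk v ys \<noteq> [] \<and> hd (chain_walk v ys) = v"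
  by (cases ys) auto

lemma chain_walk_last: "last (chain_walk v ys) = (if ys = [] then v else last ys + lstar)"
  using chain_walk_hd by (induction v ys rule: chain_walk.induct) auto

lemma chain_walk_length: "length (chain_walk v ys) = 2 * length ys + 1"
  by (induction v ys rule: chain_walk.induct) auto

lemma chain_mono: "chain R K g E v ys \<Longrightarrow> g' \<le> g \<Longrightarrow> chain R K g' E v ys"
  by (induction ys arbitrary: v) auto

lemma chain_pairsD:
  assumes "chain R K g E v ys" "(a, y) \<in> chain_pairs v ys"
  shows "{a, y} \<in> E" "a + g \<le> y" "v \<le> a" "y \<in> set ys" "\<And>u. u \<in> segment R y \<Longrightarrow> clean E K u"
    "a = v \<or> (\<exists>a' y'. (a', y') \<in> chain_pairs v ys \<and> a = y' + lstar)"
    "y = last ys \<or> y + lstar \<in> fst ` chain_pairs v ys"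
proof -
  have "{a, y} \<in> E \<and> a + g \<le> y \<and> v \<le> a \<and> y \<in> set ys \<and> (\<forall>u\<in>segment R y. clean E K u) \<and>
    (a = v \<or> (\<exists>a' y'. (a', y') \<in> chain_pairs v ys \<and> a = y' + lstar)) \<and>
    (y = last ys \<or> y + lstar \<in> fst ` chain_pairs v ys)"
    using assms
  proof (induction ys arbitrary: v)
    case (Cons z zs)
    show ?case
    proof (cases "(a, y) = (v, z)")
      case True
      then show ?thesis using Cons.prems by (cases zs) auto
    next
      case False
      then have m: "(a, y) \<in> chain_pairs (z + lstar) zs" using Cons.prems(2) by auto
      have IH: "{a, y} \<in> E \<and> a + g \<le> y \<and> z + lstar \<le> a \<and> y \<in> set zs \<and> (\<forall>u\<in>segment R y. clean E K u) \<and>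
        (a = z + lstar \<or> (\<exists>a' y'. (a', y') \<in> chain_pairs (z + lstar) zs \<and> a = y' + lstar)) \<and>
        (y = last zs \<or> y + lstar \<in> fst ` chain_pairs (z + lstar) zs)"
        by (rule Cons.IH[OF _ m]) (use Cons.prems in simp)
      moreover have "zs \<noteq> []" using m by auto
      moreover have "v \<le> z" using Cons.prems by auto
      moreover have "a = v \<or> (\<exists>a' y'. (a', y') \<in> chain_pairs v (z # zs) \<and> a = y' + lstar)"
        using IH by auto
      ultimately show ?thesis by auto
    qed
  qed simp
  then show "{a, y} \<in> E" "a + g \<le> y" "v \<le> a" "y \<in> set ys" "\<And>u. u \<in> segment R y \<Longrightarrow> clean E K u"
    "a = v \<or> (\<exists>a' y'. (a', y') \<in> chain_pairs v ys \<and> a = y' + lstar)"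
    "y = last ys \<or> y + lstar \<in> fst ` chain_pairs v ys"
    by blast+
qed

lemma chain_pairs_order:
  assumes "chain R K g E v ys" "(a, y) \<in> chain_pairs v ys" "(a', y') \<in> chain_pairs v ys" "0 < g"
  shows "(a = a' \<longleftrightarrow> y = y') \<and> (y < y' \<longrightarrow> y + g \<le> y')"
  using assms(1-3)
proof (induction ys arbitrary: v)
  case (Cons z zs)
  have c: "chain R K g E (z + lstar) zs" "v + g \<le> z" using Cons.prems by auto
  have tail: "v < b \<and> z < w \<and> z + g \<le> w" if "(b, w) \<in> chain_pairs (z + lstar) zs" for b w
    using chain_pairsD(2,3)[OF c(1) that] c(2) lstar_ge_1 assms(4) by linarith
  consider "(a, y) = (v, z)" "(a', y') = (v, z)"
    | "(a, y) = (v, z)" "(a', y') \<in> chain_pairs (z + lstar) zs"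
    | "(a, y) \<in> chain_pairs (z + lstar) zs" "(a', y') = (v, z)"
    | "(a, y) \<in> chain_pairs (z + lstar) zs" "(a', y') \<in> chain_pairs (z + lstar) zs"
    using Cons.prems by auto
  then show ?case
  proof cases
    case 1
    then show ?thesis by simp
  next
    case 2
    then show ?thesis using tail[OF 2(2)] by simp
  next
    case 3
    then show ?thesis using tail[OF 3(1)] by auto
  next
    case 4
    then show ?thesis using Cons.IH[OF c(1)] by blast
  qed
qed simp

lemma chain_pairs_source: "ys \<noteq> [] \<Longrightarrow> v \<in> fst ` chain_pairs v ys"
  by (cases ys) auto

lemma chain_pairs_member: "y \<in> set ys \<Longrightarrow> \<exists>a. (a, y) \<in> chain_pairs v ys"
  by (induction v ys rule: chain_pairs.induct) auto

lemma chain_walk_walk: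
  assumes "chain R K g E v ys" "\<And>y. y \<in> set ys \<Longrightarrow> {y, y + lstar} \<in> E"
  shows "walk E (chain_walk v ys)"
  using assms
proof (induction ys arbitrary: v)
  case (Cons y ys)
  obtain b where b: "chain_walk (y + lstar) ys = (y + lstar) # b"
    using chain_walk_hd[of "y + lstar" ys] by (cases "chain_walk (y + lstar) ys") auto
  have "walk E (chain_walk (y + lstar) ys)" using Cons by simp
  then show ?case using Cons.prems b by (auto simp: walk_def)
qed (simp add: walk_def)

text \<open>A test function for \<open>closed_walk_sum\<close>: the signed number of crossings of
  the cut edges above the vertices of \<open>Y\<close>.\<close>

definition up_count :: "nat set \<Rightarrow> nat \<Rightarrow> nat \<Rightarrow> int" where
  "up_count Y a b = (if b = a + lstar \<and> a \<in> Y then 1 else if a = b + lstar \<and> b \<in> Y then - 1 else 0)"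

lemma chain_walk_up_count:
  assumes "chain R K g E v ys" "lstar < g" "set ys \<subseteq> Y"
  shows "walk_sum (up_count Y) (chain_walk v ys) = int (length ys)"
  using assms
proof (induction ys arbitrary: v)
  case (Cons y ys)
  obtain b where b: "chain_walk (y + lstar) ys = (y + lstar) # b"
    using chain_walk_hd[of "y + lstar" ys] by (cases "chain_walk (y + lstar) ys") auto
  have "walk_sum (up_count Y) (chain_walk (y + lstar) ys) = int (length ys)"
    using Cons by simp
  moreover have "up_count Y v y = 0" "up_count Y y (y + lstar) = 1" using Cons.prems by (auto simp: up_count_def)
  ultimately show ?case using b by simp
qed simp

text \<open>All edges of a chain are bridges, so its end is at large distance from its start.\<close>

lemma chain_end_far:
  assumes c: "chain R K g E v ys" "lstar < g" "\<And>y. y \<in> set ys \<Longrightarrow> {y, y + lstar} \<in> E"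
    and ne: "ys \<noteq> []" and loops: "\<And>u. {u} \<notin> E"
    and near: "last ys + lstar \<in> nball E m v" and m: "m < length ys" "m + 2 * length ys \<le> K"
  shows False
proof -
  let ?z = "last ys + lstar" and ?Y = "set ys"
  obtain vs where vs: "walk E vs" "hd vs = v" "last vs = ?z" "length vs \<le> Suc m"
    using near unfolding nball_walk by blast
  obtain a where a: "chain_walk v ys = a @ [?z]"
    using chain_walk_last[of v ys] chain_walk_hd[of v ys] ne by (metis append_butlast_last_id)
  have rv: "walk E (rev vs)" "hd (rev vs) = ?z" "last (rev vs) = v"
    using vs by (auto simp: walk_def path_edges_rev hd_rev last_rev)
  then obtain q where q: "rev vs = ?z # q" by (cases "rev vs") (auto simp: walk_def)
  let ?C = "a @ ?z # q"
  have clean: "clean E K y" if "y \<in> ?Y" for y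
  proof -
    obtain a where "(a, y) \<in> chain_pairs v ys" using chain_pairs_member[OF \<open>y \<in> ?Y\<close>] ..
    moreover have "y \<in> segment R y" by (auto simp: segment_def intro: exI[of _ 0])
    ultimately show ?thesis using chain_pairsD(5)[OF c(1)] by blast
  qed
  have "walk E (a @ [?z])" using chain_walk_walk[OF c(1,3)] a by simp
  moreover have "walk E (?z # q)" using rv q by simp
  ultimately have "walk E ?C" using path_edges_split[of a ?z q] by (auto simp: walk_def)
  moreover have "hd ?C = last ?C"
  proof -
    have "last ?C = v" using rv(3) q by simp
    moreover have "hd ?C = v" using chain_walk_hd[of v ys] a by (cases a) auto
    ultimately show ?thesis by simp
  qed
  moreover have "length ?C \<le> Suc K"
    using chain_walk_length[of v ys] a vs(4) arg_cong[OF q, of length] m by simp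
  moreover have "up_count ?Y b a = - up_count ?Y a b" for a b using lstar_ge_1 by (auto simp: up_count_def)
  moreover have "a \<in> ?Y \<or> b \<in> ?Y" if "up_count ?Y a b \<noteq> 0" for a b
    using that by (auto simp: up_count_def split: if_splits)
  ultimately have "walk_sum (up_count ?Y) ?C = 0"
    using clean loops by (intro closed_walk_sum[of "up_count ?Y" ?Y E K])
  moreover have "walk_sum (up_count ?Y) ?C = int (length ys) + walk_sum (up_count ?Y) (rev vs)"
    using walk_sum_split[of "up_count ?Y" a ?z q] a q chain_walk_up_count[OF c(1,2), of ?Y] by simp
  \<comment> \<open>A return walk of at most \<open>m\<close> edges cannot cancel the
    \<open>length ys\<close> upward crossings made along the chain.\<close>
  moreover have "\<bar>walk_sum (up_count ?Y) (rev vs)\<bar> \<le> int (length (rev vs) - 1) * 1"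
    by (rule walk_sum_bound) (simp add: up_count_def)
  ultimately show False using vs(4) m(1) by simp
qed

text \<open>The spacing demanded by \<open>joints\<close>; the added 1 makes the inequality
  strict.\<close>

definition gap :: "nat \<Rightarrow> nat" where
  "gap r = (2 * (2 * r + 4) + 8) * lstar + 1"

text \<open>Chains are stacked in the order of their starting vertices so that targets are spaced
  across chains as well. The bound \<open>D\<close> will not depend on \<open>n\<close>.\<close>

definition border_chains :: "nat \<Rightarrow> nat \<Rightarrow> nat \<Rightarrow> nat set set \<Rightarrow> bool" where
  "border_chains r m D E \<longleftrightarrow> (\<exists>ys. \<forall>b\<in>{1..m}. length (ys b) = 2 * r + 1 \<and>
     chain (2 * r + 4) (6 * r + 12) (gap r) E b (ys b) \<and> (\<forall>y\<in>set (ys b). y + lstar \<le> D) \<and>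
     (\<forall>b'\<in>{1..m}. b < b' \<longrightarrow> (\<forall>y\<in>set (ys b). \<forall>y'\<in>set (ys b'). y + gap r \<le> y')))"

text \<open>Only chains starting in the ball supply joints. Such a chain starts within
  \<open>r\<close> of \<open>x\<close>, and by \<open>chain_end_far\<close> its final defect is more
  than \<open>2 * r\<close> from its start, hence outside the ball; every earlier defect is the
  source of the next joint.\<close>

lemma realizable_of_chains:
  assumes E: "possible_graph n E" and ch: "border_chains r lstar D E" and D: "D \<le> n"
    and x: "x \<in> {1..n}" and high: "\<And>u. u \<in> nball E r x \<Longrightarrow> u + lstar \<le> n"
  shows "realizable E r x"
proof -
  let ?R = "2 * r + 4" and ?K = "6 * r + 12"
  obtain ys where Y: "\<forall>b\<in>{1..lstar}. length (ys b) = 2 * r + 1 \<and>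
     chain ?R ?K (gap r) E b (ys b) \<and> (\<forall>y\<in>set (ys b). y + lstar \<le> D) \<and>
     (\<forall>b'\<in>{1..lstar}. b < b' \<longrightarrow> (\<forall>y\<in>set (ys b). \<forall>y'\<in>set (ys b'). y + gap r \<le> y'))"
    using ch unfolding border_chains_def by (elim exE)
  have ys: "length (ys b) = 2 * r + 1" "chain ?R ?K (gap r) E b (ys b)"
    "y \<in> set (ys b) \<Longrightarrow> y + lstar \<le> D" if "b \<in> {1..lstar}" for b y
    using bspec[OF Y that] by blast+
  have ys_sep: "y + gap r \<le> y'" if "b \<in> {1..lstar}" "b' \<in> {1..lstar}" "b < b'" "y \<in> set (ys b)" "y' \<in> set (ys b')"
    for b b' y y'
    using bspec[OF Y that(1)] that(2-5) by blast
  have EV: "E \<subseteq> vertex_pairs n" using E by (simp add: possible_graph_def)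
  have loops: "{u} \<notin> E" for u
  proof
    assume "{u} \<in> E"
    then have "{u, u} \<in> vertex_pairs n" using EV by auto
    then show False by (simp only: pair_in_vertex_pairs) simp
  qed
  define Bd where "Bd = {b \<in> {1..lstar}. b \<in> nball E r x}"
  define J where "J = (\<Union>b\<in>Bd. chain_pairs b (ys b))"
  have Bd: "b \<in> {1..lstar}" "b \<in> nball E r x" if "b \<in> Bd" for b using that by (auto simp: Bd_def)
  have "1 * lstar \<le> (2 * (2 * r + 4) + 8) * lstar" by (rule mult_le_mono1) simp
  then have gL: "lstar < gap r" "0 < gap r" unfolding gap_def by linarith+
  have JD: "\<exists>b\<in>Bd. (v, y) \<in> chain_pairs b (ys b)" if "(v, y) \<in> J" for v y
    using that unfolding J_def by blast
  have low: "u \<in> fst ` J" if "u \<in> nball E r x" "u \<le> lstar" for u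
  proof -
    have "\<Union>E \<subseteq> {1..n}" using EV by (auto simp: vertex_pairs_def)
    then have "u \<in> {1..n}" using nball_subset[OF x] that(1) by blast
    then have u: "u \<in> Bd" using that by (simp add: Bd_def)
    then have "ys u \<noteq> []" using ys(1)[OF Bd(1)[OF u]] by auto
    then have "u \<in> fst ` chain_pairs u (ys u)" by (rule chain_pairs_source)
    then show ?thesis using u unfolding J_def by blast
  qed
  have yE: "{y, y + lstar} \<in> E" if b: "b \<in> Bd" and y: "y \<in> set (ys b)" for b y
  proof -
    obtain a where a: "(a, y) \<in> chain_pairs b (ys b)" using chain_pairs_member[OF y] ..
    have "1 \<le> y" using chain_pairsD(2)[OF ys(2)[OF Bd(1)[OF b]] a] gL(2) by simp
    moreover have "y + lstar \<le> n" using ys(3)[OF Bd(1)[OF b] y] D by simp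
    ultimately show ?thesis using E by (simp add: possible_graph_def)
  qed
  have mid: "y + lstar \<in> fst ` J" if vy: "(v, y) \<in> J" and near: "y + lstar \<in> nball E r x" for v y
  proof (rule ccontr)
    assume no: "y + lstar \<notin> fst ` J"
    obtain b where b: "b \<in> Bd" "(v, y) \<in> chain_pairs b (ys b)" using JD[OF vy] by blast
    note c = ys(2)[OF Bd(1)[OF b(1)]]
    have "y + lstar \<notin> fst ` chain_pairs b (ys b)" using no b(1) unfolding J_def by blast
    then have "y = last (ys b)" using chain_pairsD(7)[OF c b(2)] by blast
    moreover have "x \<in> nball E r b" by (rule nball_sym[OF Bd(2)[OF b(1)]])
    ultimately have "last (ys b) + lstar \<in> nball E (r + r) b" using near by (intro nball_trans[of x]) auto
    moreover have len: "length (ys b) = 2 * r + 1" by (rule ys(1)[OF Bd(1)[OF b(1)]])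
    moreover have "ys b \<noteq> []" using len by auto
    ultimately show False
      using chain_end_far[OF c gL(1) yE[OF b(1)] _ loops, of "r + r"] by simp
  qed
  have "joints n E J r"
    unfolding joints_def Let_def
  proof (intro conjI ballI)
    fix z assume z: "z \<in> J"
    obtain v y where e: "z = (v, y)" by (metis surj_pair)
    obtain b where b: "b \<in> Bd" "(v, y) \<in> chain_pairs b (ys b)" using JD z e by blast
    note c = ys(2)[OF Bd(1)[OF b(1)]]
    note P = chain_pairsD[OF c b(2)]
    have 1: "{v, y} \<in> E" "v < y" "(2 * ?R + 8) * lstar < y" "y + lstar \<le> n"
      using P(1,2) gL(2) ys(3)[OF Bd(1)[OF b(1)] P(4)] D by (auto simp: gap_def)
    have 2: "\<forall>u\<in>segment ?R y. clean E ?K u" using P(5) by blast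
    have 3: "v \<le> lstar \<or> (\<exists>(v', y')\<in>J. v = y' + lstar)"
      using P(6) Bd(1)[OF b(1)] b(1) unfolding J_def by (elim disjE) auto
    show "case z of (v, y) \<Rightarrow> {v, y} \<in> E \<and> v < y \<and> (2 * ?R + 8) * lstar < y \<and> y + lstar \<le> n \<and>
        (\<forall>u\<in>segment ?R y. clean E ?K u) \<and> (v \<le> lstar \<or> (\<exists>(v', y')\<in>J. v = y' + lstar))"
      unfolding e prod.case using 1 2 3 by (intro conjI)
    show "case z of (v, y) \<Rightarrow> \<forall>(v', y')\<in>J. (v = v' \<longleftrightarrow> y = y') \<and> (y < y' \<longrightarrow> y + (2 * ?R + 8) * lstar < y')"
      unfolding e prod.case
    proof
      fix z' assume z': "z' \<in> J"
      obtain v' y' where e': "z' = (v', y')" by (metis surj_pair)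
      obtain b' where b': "b' \<in> Bd" "(v', y') \<in> chain_pairs b' (ys b')" using JD z' e' by blast
      note c' = ys(2)[OF Bd(1)[OF b'(1)]]
      have far: "v1 \<noteq> v2 \<and> y1 < y2 \<and> y1 + gap r \<le> y2"
        if B: "b1 \<in> Bd" "b2 \<in> Bd" "b1 < b2" "(v1, y1) \<in> chain_pairs b1 (ys b1)" "(v2, y2) \<in> chain_pairs b2 (ys b2)"
        for b1 b2 v1 y1 v2 y2
      proof -
        note c1 = ys(2)[OF Bd(1)[OF B(1)]] and c2 = ys(2)[OF Bd(1)[OF B(2)]]
        note P1 = chain_pairsD[OF c1 B(4)] and P2 = chain_pairsD[OF c2 B(5)]
        have s: "y + gap r \<le> y'" if "y \<in> set (ys b1)" "y' \<in> set (ys b2)" for y y'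
          by (rule ys_sep[OF Bd(1)[OF B(1)] Bd(1)[OF B(2)] B(3) that])
        have lb: "gap r \<le> y" if "(a, y) \<in> chain_pairs b (ys b)" "b \<in> Bd" for a b y
          using chain_pairsD(2)[OF ys(2)[OF Bd(1)[OF that(2)]] that(1)] by simp
        have "v1 \<noteq> v2"
          using P1(6) P2(6)
        proof (elim disjE exE conjE)
          assume "v1 = b1" "v2 = b2" then show ?thesis using B(3) by simp
        next
          fix a y assume "v1 = b1" "(a, y) \<in> chain_pairs b2 (ys b2)" "v2 = y + lstar"
          then show ?thesis using lb[of a y b2] B Bd(1)[OF B(1)] gL by auto
        next
          fix a y assume "v2 = b2" "(a, y) \<in> chain_pairs b1 (ys b1)" "v1 = y + lstar"
          then show ?thesis using lb[of a y b1] B Bd(1)[OF B(2)] gL by auto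
        next
          fix a y a' y' assume "(a, y) \<in> chain_pairs b1 (ys b1)" "v1 = y + lstar"
            "(a', y') \<in> chain_pairs b2 (ys b2)" "v2 = y' + lstar"
          then show ?thesis using s[of y y'] chain_pairsD(4)[OF c1, of a y] chain_pairsD(4)[OF c2, of a' y'] gL by auto
        qed
        then show ?thesis using s[OF P1(4) P2(4)] gL by simp
      qed
      have "(v = v' \<longleftrightarrow> y = y') \<and> (y < y' \<longrightarrow> y + gap r \<le> y')"
      proof (cases b b' rule: linorder_cases)
        case less
        then show ?thesis using far[OF b(1) b'(1) less b(2) b'(2)] by auto
      next
        case equal
        then show ?thesis using chain_pairs_order[OF c b(2) _ gL(2)] b'(2) by simp
      next
        case greater
        then show ?thesis using far[OF b'(1) b(1) greater b'(2) b(2)] by auto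
      qed
      then show "case z' of (v', y') \<Rightarrow> (v = v' \<longleftrightarrow> y = y') \<and> (y < y' \<longrightarrow> y + (2 * ?R + 8) * lstar < y')"
        unfolding e' prod.case by (auto simp: gap_def)
    qed
  qed
  then interpret joint_ball p lstar n E J r x
    using E x low mid high by unfold_locales
  show ?thesis by (rule realizable)
qed

text \<open>Border vertices are added one at a time. Requiring joints of length at least
  \<open>gap r + D1\<close> puts the new targets beyond all earlier ones. No conditioning is
  involved, the failure probabilities are simply added.\<close>

lemma border_chains_prob:
  assumes "\<epsilon> > 0"
  shows "\<exists>D. \<forall>n\<ge>D. measure_pmf.prob (coins (vertex_pairs n) edge_prob)
    {f. \<not> border_chains r m D (graph_of n f)} \<le> \<epsilon>"
  using assms
proof (induction m arbitrary: \<epsilon>)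
  case 0
  have "border_chains r 0 0 E" for E by (simp add: border_chains_def)
  then show ?case using 0 by (intro exI[of _ 0]) simp
next
  case (Suc m)
  let ?R = "2 * r + 4" and ?K = "6 * r + 12"
  have e2: "\<epsilon> / 2 > 0" using Suc.prems by simp
  obtain D1 where D1: "\<And>n. n \<ge> D1 \<Longrightarrow> measure_pmf.prob (coins (vertex_pairs n) edge_prob)
    {f. \<not> border_chains r m D1 (graph_of n f)} \<le> \<epsilon> / 2" using Suc.IH[OF e2] by blast
  obtain D2 where D2: "\<And>n v X q. 1 \<le> v \<Longrightarrow> v + D2 \<le> n \<Longrightarrow> card X \<le> 0 \<Longrightarrow> agrees n X q \<Longrightarrow>
    measure_pmf.prob (coins (vertex_pairs n) q)
      {f. \<not> has_chain ?R ?K (2 * r + 1) (gap r + D1) D2 (graph_of n f) v} \<le> \<epsilon> / 2"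
    using chain_prob[OF e2, of 0 ?R ?K "2 * r + 1" "gap r + D1"] by blast
  define D where "D = max D1 (Suc m + D2)"
  have step: "border_chains r (Suc m) D E"
    if A: "border_chains r m D1 E" and B: "has_chain ?R ?K (2 * r + 1) (gap r + D1) D2 E (Suc m)" for E
  proof -
    obtain ys where ys: "\<forall>b\<in>{1..m}. length (ys b) = 2 * r + 1 \<and>
     chain ?R ?K (gap r) E b (ys b) \<and> (\<forall>y\<in>set (ys b). y + lstar \<le> D1) \<and>
     (\<forall>b'\<in>{1..m}. b < b' \<longrightarrow> (\<forall>y\<in>set (ys b). \<forall>y'\<in>set (ys b'). y + gap r \<le> y'))"
      using A unfolding border_chains_def by (elim exE)
    obtain zs where zs: "length zs = 2 * r + 1" "chain ?R ?K (gap r + D1) E (Suc m) zs"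
      "\<forall>y\<in>set zs. y + lstar \<le> Suc m + D2" using B unfolding has_chain_def by blast
    have zlow: "gap r + D1 \<le> z" if z: "z \<in> set zs" for z
    proof -
      obtain a where "(a, z) \<in> chain_pairs (Suc m) zs" using chain_pairs_member[OF z] ..
      from chain_pairsD(2)[OF zs(2) this] show ?thesis by simp
    qed
    have zc: "chain ?R ?K (gap r) E (Suc m) zs" by (rule chain_mono[OF zs(2)]) simp
    define ys' where "ys' = ys(Suc m := zs)"
    show ?thesis
      unfolding border_chains_def
    proof (intro exI[of _ ys'] ballI)
      fix b assume b: "b \<in> {1..Suc m}"
      show "length (ys' b) = 2 * r + 1 \<and> chain ?R ?K (gap r) E b (ys' b) \<and> (\<forall>y\<in>set (ys' b). y + lstar \<le> D) \<and>
         (\<forall>b'\<in>{1..Suc m}. b < b' \<longrightarrow> (\<forall>y\<in>set (ys' b). \<forall>y'\<in>set (ys' b'). y + gap r \<le> y'))"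
      proof (cases "b = Suc m")
        case True
        have "\<forall>y\<in>set zs. y + lstar \<le> D" using zs(3) by (auto simp: D_def)
        then show ?thesis using True zs(1) zc by (auto simp: ys'_def)
      next
        case False
        then have bm: "b \<in> {1..m}" using b by auto
        note Y = bspec[OF ys bm]
        have S: "y + gap r \<le> y'" if "b' \<in> {1..Suc m}" "b < b'" "y \<in> set (ys' b)" "y' \<in> set (ys' b')" for b' y y'
        proof (cases "b' = Suc m")
          case True
          have "y + lstar \<le> D1" using Y that(3) False by (simp add: ys'_def)
          moreover have "gap r + D1 \<le> y'" using zlow that(4) True by (simp add: ys'_def)
          ultimately show ?thesis by simp
        next
          case F: False
          then have "b' \<in> {1..m}" using that(1) by auto
          have "\<forall>b'\<in>{1..m}. b < b' \<longrightarrow> (\<forall>y\<in>set (ys b). \<forall>y'\<in>set (ys b'). y + gap r \<le> y')"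
            using Y by blast
          from this[rule_format, OF \<open>b' \<in> {1..m}\<close> that(2)]
          show ?thesis using that(3,4) F False by (simp add: ys'_def)
        qed
        have yb: "ys' b = ys b" using False by (simp add: ys'_def)
        show ?thesis
        proof (intro conjI)
          show "length (ys' b) = 2 * r + 1" "chain ?R ?K (gap r) E b (ys' b)" using Y yb by simp_all
          show "\<forall>y\<in>set (ys' b). y + lstar \<le> D" using Y yb by (auto simp: D_def)
          show "\<forall>b'\<in>{1..Suc m}. b < b' \<longrightarrow> (\<forall>y\<in>set (ys' b). \<forall>y'\<in>set (ys' b'). y + gap r \<le> y')"
            using S by blast
        qed
      qed
    qed
  qed
  have "measure_pmf.prob (coins (vertex_pairs n) edge_prob) {f. \<not> border_chains r (Suc m) D (graph_of n f)} \<le> \<epsilon>"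
    if n: "n \<ge> D" for n
  proof -
    let ?P = "measure_pmf.prob (coins (vertex_pairs n) edge_prob)"
    have "?P {f. \<not> border_chains r (Suc m) D (graph_of n f)} \<le>
      ?P ({f. \<not> border_chains r m D1 (graph_of n f)} \<union>
        {f. \<not> has_chain ?R ?K (2 * r + 1) (gap r + D1) D2 (graph_of n f) (Suc m)})"
      by (rule prob_mono) (use step in blast)
    also have "\<dots> \<le> ?P {f. \<not> border_chains r m D1 (graph_of n f)} +
        ?P {f. \<not> has_chain ?R ?K (2 * r + 1) (gap r + D1) D2 (graph_of n f) (Suc m)}"
      by (rule prob_Un_le)
    also have "?P {f. \<not> border_chains r m D1 (graph_of n f)} \<le> \<epsilon> / 2"
      by (rule D1) (use n in \<open>simp add: D_def\<close>)
    also have "?P {f. \<not> has_chain ?R ?K (2 * r + 1) (gap r + D1) D2 (graph_of n f) (Suc m)} \<le> \<epsilon> / 2"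
      by (rule D2[of _ _ "{}"]) (use n edge_prob_bounds in \<open>auto simp: D_def agrees_def\<close>)
    finally show ?thesis by simp
  qed
  then show ?case by blast
qed

text \<open>First moment: the ends of such a path are almost \<open>n\<close> apart, so by
  \<open>conv_vanishes\<close> each of the boundedly many choices of ends and length contributes at
  most \<open>e\<close>.\<close>

lemma borders_apart_prob:
  assumes "\<epsilon> > 0"
  shows "\<exists>N. \<forall>n\<ge>N. measure_pmf.prob (coins (vertex_pairs n) edge_prob)
    {f. \<exists>b\<in>{1..lstar}. \<exists>h\<in>{1..n}. n < h + lstar \<and> h \<in> nball (graph_of n f) m b} \<le> \<epsilon>"
proof -
  define e where "e = \<epsilon> / (real lstar * real lstar * real (m + 1))"
  have L: "real lstar > 0" using lstar_ge_1 by simp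
  have e: "e > 0" using assms L by (simp add: e_def)
  have "\<forall>k. \<exists>T. \<forall>N t. \<bar>t\<bar> \<ge> int T \<longrightarrow> conv k N t \<le> e" using conv_vanishes[OF e] by blast
  from choice[OF this] obtain TT where TT: "\<And>k N t. \<bar>t\<bar> \<ge> int (TT k) \<Longrightarrow> conv k N t \<le> e" by blast
  define T where "T = Max (TT ` {..m})"
  have T: "conv k N t \<le> e" if "k \<le> m" "\<bar>t\<bar> \<ge> int T" for k N t
  proof -
    have "TT k \<le> T" unfolding T_def using that(1) by (intro Max_ge) auto
    then show ?thesis using TT that(2) by simp
  qed
  have "measure_pmf.prob (coins (vertex_pairs n) edge_prob)
    {f. \<exists>b\<in>{1..lstar}. \<exists>h\<in>{1..n}. n < h + lstar \<and> h \<in> nball (graph_of n f) m b} \<le> \<epsilon>"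
    if n: "n \<ge> T + 2 * lstar" for n
  proof -
    let ?P = "measure_pmf.prob (coins (vertex_pairs n) edge_prob)"
    define Z where "Z = {1..lstar} \<times> {n - lstar<..n} \<times> {..m}"
    define Q where "Q = (\<lambda>(b, h, k). {vs. vs \<noteq> [] \<and> distinct vs \<and> hd vs = b \<and> last vs = h \<and> length vs = Suc k \<and> set vs \<subseteq> {1..n}})"
    have finZ: "finite Z" by (simp add: Z_def)
    have finQ: "finite (Q z)" for z
    proof -
      obtain b h k where z: "z = (b, h, k)" by (metis surj_pair)
      show ?thesis unfolding z
        by (rule finite_subset[OF _ finite_lists_length_eq[of "{1..n}" "Suc k"]]) (auto simp: Q_def)
    qed
    have "{f. \<exists>b\<in>{1..lstar}. \<exists>h\<in>{1..n}. n < h + lstar \<and> h \<in> nball (graph_of n f) m b}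
        \<subseteq> (\<Union>z\<in>Z. \<Union>vs\<in>Q z. pattern (path_edges vs) {})"
    proof
      fix f assume "f \<in> {f. \<exists>b\<in>{1..lstar}. \<exists>h\<in>{1..n}. n < h + lstar \<and> h \<in> nball (graph_of n f) m b}"
      then obtain b h where bh: "b \<in> {1..lstar}" "h \<in> {1..n}" "n < h + lstar" "h \<in> nball (graph_of n f) m b" by blast
      obtain us where us: "walk (graph_of n f) us" "hd us = b" "last us = h" "length us \<le> Suc m"
        using bh(4) unfolding nball_walk by blast
      obtain vs where vs: "walk (graph_of n f) vs" "distinct vs" "hd vs = b" "last vs = h" "length vs \<le> Suc m"
        using walk_shorten[OF us(1)] us by (metis order_trans)
      have "\<Union>(graph_of n f) \<subseteq> {1..n}" by (auto simp: graph_of_def vertex_pairs_def)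
      moreover have "hd vs \<in> {1..n}" using bh(1) vs(3) n by auto
      ultimately have "set vs \<subseteq> {1..n}" using vs(1) by (intro path_edges_vertices) (auto simp: walk_def)
      then have "vs \<in> Q (b, h, length vs - 1)" using vs by (cases vs) (auto simp: Q_def walk_def)
      moreover have "(b, h, length vs - 1) \<in> Z" using bh vs(5) by (auto simp: Z_def)
      moreover have "f \<in> pattern (path_edges vs) {}" using vs(1) by (auto simp: pattern_def walk_def graph_of_def)
      ultimately show "f \<in> (\<Union>z\<in>Z. \<Union>vs\<in>Q z. pattern (path_edges vs) {})" by blast
    qed
    then have "?P {f. \<exists>b\<in>{1..lstar}. \<exists>h\<in>{1..n}. n < h + lstar \<and> h \<in> nball (graph_of n f) m b} \<le>
        ?P (\<Union>z\<in>Z. \<Union>vs\<in>Q z. pattern (path_edges vs) {})" by (rule prob_mono)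
    also have "\<dots> \<le> (\<Sum>z\<in>Z. ?P (\<Union>vs\<in>Q z. pattern (path_edges vs) {}))" by (rule prob_UN_le[OF finZ])
    also have "\<dots> \<le> (\<Sum>z\<in>Z. e)"
    proof (rule sum_mono)
      fix z assume "z \<in> Z"
      then obtain b h k where z: "z = (b, h, k)" "b \<in> {1..lstar}" "n - lstar < h" "h \<le> n" "k \<le> m" by (auto simp: Z_def)
      have "?P (\<Union>vs\<in>Q z. pattern (path_edges vs) {}) \<le> (\<Sum>vs\<in>Q z. ?P (pattern (path_edges vs) {}))"
        by (rule prob_UN_le[OF finQ])
      also have "\<dots> = (\<Sum>vs\<in>Q z. wt (steps vs))"
      proof (rule sum.cong[OF refl])
        fix vs assume "vs \<in> Q z"
        then have vs: "distinct vs" "set vs \<subseteq> {1..n}" by (auto simp: Q_def z)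
        have "?P (pattern (path_edges vs) {}) = (\<Prod>e\<in>path_edges vs. edge_prob e) * (\<Prod>e\<in>{}. 1 - edge_prob e)"
          by (rule prob_pattern) (use edge_prob_bounds path_edges_in_pairs[OF vs] in auto)
        then show "?P (pattern (path_edges vs) {}) = wt (steps vs)" by (simp add: prod_path_edges[OF vs(1)])
      qed
      also have "\<dots> \<le> (\<Sum>xs\<in>step_lists k n (int h - int b). wt xs)"
      proof (rule sum_wt_steps_le)
        fix vs assume "vs \<in> Q z"
        then have vs: "vs \<noteq> []" "hd vs = b" "last vs = h" "length vs = Suc k" "set vs \<subseteq> {1..n}" by (auto simp: Q_def z)
        then show "hd vs = b \<and> length vs = Suc k \<and> steps vs \<in> step_lists k n (int h - int b)"
          using steps_bounded[OF vs(5)] by (simp add: step_lists_def length_steps sum_steps)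
      qed simp
      also have "\<dots> = conv k n (int h - int b)" by (simp add: conv_def)
      also have "\<dots> \<le> e" by (rule T) (use z n in auto)
      finally show "?P (\<Union>vs\<in>Q z. pattern (path_edges vs) {}) \<le> e" .
    qed
    also have "\<dots> = real (card Z) * e" by simp
    also have "card Z = lstar * (lstar * (m + 1))" using n by (simp add: Z_def card_cartesian_product)
    also have "real (lstar * (lstar * (m + 1))) * e = \<epsilon>"
    proof -
      have "real (lstar * (lstar * (m + 1))) = real lstar * real lstar * real (m + 1)" by (simp add: algebra_simps)
      moreover have "real lstar * real lstar * real (m + 1) \<noteq> 0" using L by simp
      ultimately show ?thesis unfolding e_def by simp
    qed
    finally show ?thesis .
  qed
  then show ?thesis by blast
qed

end

subsection \<open>Reflection\<close>

text \<open>Being the identity outside \<open>vertex_pairs n\<close> makes it an involution on all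
  sets, so precomposing coin assignments with it is injective.\<close>

definition refl_edge :: "nat \<Rightarrow> nat set \<Rightarrow> nat set" where
  "refl_edge n e = (if e \<in> vertex_pairs n then (\<lambda>v. n + 1 - v) ` e else e)"

lemma refl_edge_pair:
  "a \<in> {1..n} \<Longrightarrow> b \<in> {1..n} \<Longrightarrow> a \<noteq> b \<Longrightarrow> refl_edge n {a, b} = {n + 1 - a, n + 1 - b}"
  by (simp add: refl_edge_def pair_in_vertex_pairs)

lemma refl_edge_in: "e \<in> vertex_pairs n \<Longrightarrow> refl_edge n e \<in> vertex_pairs n"
proof -
  assume "e \<in> vertex_pairs n"
  then obtain a b where ab: "e = {a, b}" "a \<in> {1..n}" "b \<in> {1..n}" "a \<noteq> b" by (auto simp: vertex_pairs_def)
  have "refl_edge n e = {n + 1 - a, n + 1 - b}" unfolding ab(1) by (rule refl_edge_pair[OF ab(2-4)])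
  moreover have "{n + 1 - a, n + 1 - b} \<in> vertex_pairs n"
    unfolding pair_in_vertex_pairs using ab by auto
  ultimately show ?thesis by simp
qed

lemma refl_edge_idem: "refl_edge n (refl_edge n e) = e"
proof (cases "e \<in> vertex_pairs n")
  case True
  then obtain a b where ab: "e = {a, b}" "a \<in> {1..n}" "b \<in> {1..n}" "a \<noteq> b" by (auto simp: vertex_pairs_def)
  have "refl_edge n e = {n + 1 - a, n + 1 - b}" using ab by (simp add: refl_edge_pair)
  moreover have "refl_edge n {n + 1 - a, n + 1 - b} = {n + 1 - (n + 1 - a), n + 1 - (n + 1 - b)}"
    using ab by (intro refl_edge_pair) auto
  ultimately show ?thesis using ab by simp
qed (simp add: refl_edge_def)

lemma coins_involution:
  assumes V: "finite V" and h: "\<And>e. h (h e) = e" "\<And>e. e \<in> V \<Longrightarrow> h e \<in> V" "\<And>e. e \<in> V \<Longrightarrow> q (h e) = q e"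
  shows "map_pmf (\<lambda>f. f \<circ> h) (coins V q) = coins V q"
proof (rule pmf_eqI)
  fix g :: "_ \<Rightarrow> bool"
  have inj: "inj (\<lambda>f. f \<circ> h)"
  proof (rule injI)
    fix f f' assume "f \<circ> h = f' \<circ> h"
    then have "f (h (h e)) = f' (h (h e))" for e by (metis comp_apply)
    then show "f = f'" by (simp add: h(1) fun_eq_iff)
  qed
  have hh: "(g \<circ> h) \<circ> h = g" by (simp add: fun_eq_iff h(1))
  have "pmf (map_pmf (\<lambda>f. f \<circ> h) (coins V q)) ((g \<circ> h) \<circ> h) = pmf (coins V q) (g \<circ> h)"
    by (rule pmf_map_inj'[OF inj])
  then have "pmf (map_pmf (\<lambda>f. f \<circ> h) (coins V q)) g = pmf (coins V q) (g \<circ> h)" by (simp only: hh)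
  also have "\<dots> = pmf (coins V q) g"
  proof -
    have out: "(\<forall>e. e \<notin> V \<longrightarrow> (g \<circ> h) e = False) \<longleftrightarrow> (\<forall>e. e \<notin> V \<longrightarrow> g e = False)"
      by (metis comp_apply h(1,2))
    have bij: "bij_betw h V V" by (rule bij_betwI[of h V V h]) (use h in auto)
    have "(\<Prod>e\<in>V. pmf (bernoulli_pmf (q e)) ((g \<circ> h) e)) = (\<Prod>e\<in>V. pmf (bernoulli_pmf (q (h e))) (g (h e)))"
      using h(3) by (intro prod.cong refl) simp
    also have "\<dots> = (\<Prod>e\<in>V. pmf (bernoulli_pmf (q e)) (g e))"
      by (rule prod.reindex_bij_betw[OF bij])
    finally have pr: "(\<Prod>e\<in>V. pmf (bernoulli_pmf (q e)) ((g \<circ> h) e)) = (\<Prod>e\<in>V. pmf (bernoulli_pmf (q e)) (g e))" .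
    show ?thesis unfolding coins_def pmf_Pi[OF V] by (rule if_cong[OF out pr refl])
  qed
  finally show "pmf (map_pmf (\<lambda>f. f \<circ> h) (coins V q)) g = pmf (coins V q) g" .
qed

context distance_graph
begin

lemma edge_prob_refl: "e \<in> vertex_pairs n \<Longrightarrow> edge_prob (refl_edge n e) = edge_prob e"
proof -
  assume "e \<in> vertex_pairs n"
  then obtain a b where ab: "e = {a, b}" "a \<in> {1..n}" "b \<in> {1..n}" "a \<noteq> b" by (auto simp: vertex_pairs_def)
  have "n + 1 - a \<noteq> n + 1 - b" using ab by auto
  then have "edge_prob {n + 1 - a, n + 1 - b} = wgt (int (n + 1 - b) - int (n + 1 - a))" by (rule edge_prob_pair)
  also have "int (n + 1 - b) - int (n + 1 - a) = - (int b - int a)" using ab by auto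
  also have "wgt (- (int b - int a)) = edge_prob {a, b}" by (simp only: wgt_minus edge_prob_pair[OF ab(4)])
  finally show ?thesis using ab by (simp add: refl_edge_pair)
qed

text \<open>Edge probabilities depend on distances only, so mirroring preserves the law and
  estimates at the lower border carry over to the upper one.\<close>

lemma prob_reflect:
  "measure_pmf.prob (coins (vertex_pairs n) edge_prob) {f. P (graph_of n (f \<circ> refl_edge n))} =
   measure_pmf.prob (coins (vertex_pairs n) edge_prob) {f. P (graph_of n f)}"
proof -
  have "map_pmf (\<lambda>f. f \<circ> refl_edge n) (coins (vertex_pairs n) edge_prob) = coins (vertex_pairs n) edge_prob"
    by (rule coins_involution) (simp_all add: refl_edge_idem refl_edge_in edge_prob_refl)
  then have "measure_pmf.prob (coins (vertex_pairs n) edge_prob) {f. P (graph_of n f)} =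
    measure_pmf.prob (map_pmf (\<lambda>f. f \<circ> refl_edge n) (coins (vertex_pairs n) edge_prob)) {f. P (graph_of n f)}"
    by simp
  also have "\<dots> = measure_pmf.prob (coins (vertex_pairs n) edge_prob)
      ((\<lambda>f. f \<circ> refl_edge n) -` {f. P (graph_of n f)})" by simp
  finally show ?thesis by (simp add: vimage_def)
qed

lemma reflect_adj:
  assumes "a \<in> {1..n}" "b \<in> {1..n}"
  shows "{n + 1 - a, n + 1 - b} \<in> graph_of n (f \<circ> refl_edge n) \<longleftrightarrow> {a, b} \<in> graph_of n f"
proof (cases "a = b")
  case True
  have "{c} \<notin> vertex_pairs n" for c using pair_in_vertex_pairs[of c c n] by simp
  then show ?thesis using True by (simp add: graph_of_def)
next
  case False
  have *: "n + 1 - a \<in> {1..n}" "n + 1 - b \<in> {1..n}" "n + 1 - a \<noteq> n + 1 - b" using assms False by auto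
  have "refl_edge n {n + 1 - a, n + 1 - b} = {n + 1 - (n + 1 - a), n + 1 - (n + 1 - b)}"
    by (rule refl_edge_pair[OF *])
  then have "refl_edge n {n + 1 - a, n + 1 - b} = {a, b}" using assms by simp
  moreover have "{n + 1 - a, n + 1 - b} \<in> vertex_pairs n" "{a, b} \<in> vertex_pairs n"
    using * assms False by (simp_all only: pair_in_vertex_pairs) auto
  ultimately show ?thesis by (simp add: graph_of_def)
qed

end

subsection \<open>The zero-one law\<close>

context distance_graph
begin

lemma template_type_of_realizable:
  assumes "realizable E r x" "2 ^ q \<le> Suc r"
  shows "\<exists>S H h. template r S H h \<and> loc q H E {(h, x)}"
proof -
  obtain S H f where t: "template r S H (f x)" and inj: "inj_on f (nball E (Suc r) x)"
    and S: "S = f ` nball E (Suc r) x"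
    and adj: "\<forall>u\<in>nball E (Suc r) x. \<forall>w\<in>nball E (Suc r) x. {f u, f w} \<in> H \<longleftrightarrow> {u, w} \<in> E"
    using assms(1) unfolding realizable_def by blast
  have "loc q E H ((\<lambda>u. (u, f u)) ` {x})"
  proof (rule loc_of_ball_iso[OF inj, where m = 0])
    fix u w assume "{f u, w} \<in> H"
    then have "w \<in> S" using templateD(6)[OF t] by blast
    then show "w \<in> f ` nball E (Suc r) x" by (simp only: S)
  qed (use adj assms(2) in auto)
  then have "loc q E H {(x, f x)}" by simp
  then have "loc q H E {(f x, x)}" by (rule loc_sym1)
  then show ?thesis using t by blast
qed

lemma possible_graph_support:
  assumes "f \<in> set_pmf (coins (vertex_pairs n) edge_prob)"
  shows "possible_graph n (graph_of n f)"
proof -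
  have f: "f e \<in> set_pmf (bernoulli_pmf (edge_prob e))" if "e \<in> vertex_pairs n" for e
    using assms that unfolding coins_def by (auto simp: set_Pi_pmf PiE_dflt_def)
  have pos: "edge_prob e > 0" if e: "e \<in> vertex_pairs n" "f e" for e
  proof -
    have "pmf (bernoulli_pmf (edge_prob e)) True \<noteq> 0" using f[OF e(1)] e(2) by (simp add: set_pmf_iff)
    then show ?thesis using edge_prob_bounds[OF e(1)] by (auto simp: order_less_le)
  qed
  show ?thesis
    unfolding possible_graph_def
  proof (intro conjI allI impI ballI)
    show "graph_of n f \<subseteq> vertex_pairs n" by (auto simp: graph_of_def)
    fix u w
    show "wgt (int w - int u) > 0" if "{u, w} \<in> graph_of n f"
    proof -
      have e: "{u, w} \<in> vertex_pairs n" "f {u, w}" using that by (auto simp: graph_of_def)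
      then have "u \<noteq> w" by (simp add: pair_in_vertex_pairs)
      then show ?thesis using pos[OF e] by (simp add: edge_prob_pair)
    qed
    assume u: "u \<in> {1..n}" "u + lstar \<le> n"
    have e: "{u, u + lstar} \<in> vertex_pairs n" using u lstar_ge_1 by (simp add: pair_in_vertex_pairs)
    have "edge_prob {u, u + lstar} = 1" using edge_prob_step[OF lstar_ge_1] p_lstar by simp
    then have "f {u, u + lstar}" using f[OF e] by (cases "f {u, u + lstar}") (auto simp: set_pmf_iff)
    then show "{u, u + lstar} \<in> graph_of n f" using e by (simp add: graph_of_def)
  qed
qed

lemma reflect_adj':
  assumes "u \<in> {1..n}" "{n + 1 - u, w} \<in> graph_of n (f \<circ> refl_edge n)"
  shows "w \<in> {1..n}" "{u, n + 1 - w} \<in> graph_of n f"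
proof -
  show w: "w \<in> {1..n}" using assms(2) by (auto simp: graph_of_def pair_in_vertex_pairs)
  then have "n + 1 - (n + 1 - w) = w" "n + 1 - w \<in> {1..n}" by auto
  then show "{u, n + 1 - w} \<in> graph_of n f"
    using reflect_adj[OF assms(1), of "n + 1 - w" f] assms(2) w by simp
qed

lemma possible_graph_reflect:
  assumes "possible_graph n (graph_of n f)"
  shows "possible_graph n (graph_of n (f \<circ> refl_edge n))"
  unfolding possible_graph_def
proof (intro conjI allI impI ballI)
  show "graph_of n (f \<circ> refl_edge n) \<subseteq> vertex_pairs n" by (auto simp: graph_of_def)
  fix u w
  show "wgt (int w - int u) > 0" if e: "{u, w} \<in> graph_of n (f \<circ> refl_edge n)"
  proof -
    have u: "u \<in> {1..n}" "w \<in> {1..n}" using e by (auto simp: graph_of_def pair_in_vertex_pairs)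
    have "{n + 1 - u, n + 1 - w} \<in> graph_of n f"
      by (rule reflect_adj'(2)) (use u e in auto)
    then have "wgt (int (n + 1 - w) - int (n + 1 - u)) > 0" using assms unfolding possible_graph_def by blast
    moreover have "int (n + 1 - w) - int (n + 1 - u) = - (int w - int u)" using u by auto
    ultimately show ?thesis by (metis wgt_minus)
  qed
  assume u: "u \<in> {1..n}" "u + lstar \<le> n"
  define v where "v = n + 1 - (u + lstar)"
  have v: "v \<in> {1..n}" "v + lstar \<le> n" "n + 1 - (v + lstar) = u" "n + 1 - v = u + lstar" using u by (auto simp: v_def)
  have "{v, v + lstar} \<in> graph_of n f" using assms v unfolding possible_graph_def by blast
  then have "{n + 1 - v, n + 1 - (v + lstar)} \<in> graph_of n (f \<circ> refl_edge n)"
    using reflect_adj[of v n "v + lstar" f] v by simp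
  then show "{u, u + lstar} \<in> graph_of n (f \<circ> refl_edge n)" unfolding v(3,4) by (simp add: insert_commute)
qed

text \<open>By \<open>apart\<close> a ball reaching the upper border stays away from the lower one.
  Its mirror image is then clear of the upper border of the reflected graph, whose chains realize
  it, and the type is carried back along the reflection.\<close>

lemma all_template_types:
  assumes f: "possible_graph n (graph_of n f)" and D: "D \<le> n"
    and low: "border_chains r lstar D (graph_of n f)"
    and high: "border_chains r lstar D (graph_of n (f \<circ> refl_edge n))"
    and apart: "\<not> (\<exists>b\<in>{1..lstar}. \<exists>h\<in>{1..n}. n < h + lstar \<and> h \<in> nball (graph_of n f) (2 * r) b)"
    and q: "2 ^ q \<le> Suc r" and x: "x \<in> {1..n}"
  shows "\<exists>S H h. template r S H h \<and> loc q H (graph_of n f) {(h, x)}"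
proof (cases "\<forall>u\<in>nball (graph_of n f) r x. u + lstar \<le> n")
  case True
  then show ?thesis
    using template_type_of_realizable[OF realizable_of_chains[OF f low D x] q] by blast
next
  case False
  let ?E = "graph_of n f" and ?F = "graph_of n (f \<circ> refl_edge n)"
  obtain h where h: "h \<in> nball ?E r x" "n < h + lstar" using False by auto
  have EV: "\<Union>?E \<subseteq> {1..n}" by (auto simp: graph_of_def vertex_pairs_def)
  have inV: "u \<in> {1..n}" if "u \<in> nball ?E k x" for u k using nball_subset[OF x EV] that by blast
  have far: "lstar < u" if u: "u \<in> nball ?E r x" for u
  proof (rule ccontr)
    assume "\<not> lstar < u"
    then have "u \<in> {1..lstar}" using inV[OF u] by auto
    moreover have "h \<in> nball ?E (r + r) u" by (rule nball_trans[OF nball_sym[OF u] h(1)])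
    ultimately show False using apart inV[OF h(1)] h(2) by (auto simp: mult_2)
  qed
  define g where "g = (\<lambda>u. n + 1 - u)"
  have adj: "{g u, g w} \<in> ?F \<longleftrightarrow> {u, w} \<in> ?E" if "u \<in> nball ?E (Suc r) x" "w \<in> nball ?E (Suc r) x" for u w
    unfolding g_def by (rule reflect_adj[OF inV[OF that(1)] inV[OF that(2)]])
  have closed: "w \<in> g ` nball ?E (Suc r) x" if u: "u \<in> nball ?E r x" and w: "{g u, w} \<in> ?F" for u w
  proof -
    have "w \<in> {1..n}" "{u, n + 1 - w} \<in> ?E" using reflect_adj'[OF inV[OF u]] w unfolding g_def by auto
    then have "n + 1 - w \<in> nball ?E (Suc r) x" "w = g (n + 1 - w)" using u by (auto simp: g_def)
    then show ?thesis by blast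
  qed
  have inj: "inj_on g (nball ?E (Suc r) x)"
  proof (rule inj_onI)
    fix u w assume "u \<in> nball ?E (Suc r) x" "w \<in> nball ?E (Suc r) x" "g u = g w"
    then show "u = w" using inV[of u "Suc r"] inV[of w "Suc r"] unfolding g_def by (simp del: nball.simps) linarith
  qed
  have ball: "nball ?F r (g x) = g ` nball ?E r x"
    by (rule nball_image[of ?E r x g ?F x 0 r]) (use adj closed in auto)
  have "u + lstar \<le> n" if u: "u \<in> nball ?F r (g x)" for u
  proof -
    obtain w where "w \<in> nball ?E r x" "u = g w" using u unfolding ball by blast
    then show ?thesis using far[of w] inV[of w r] by (auto simp: g_def)
  qed
  moreover have "g x \<in> {1..n}" using x by (auto simp: g_def)
  ultimately have "realizable ?F r (g x)"
    using realizable_of_chains[OF possible_graph_reflect[OF f] high D] by blast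
  then obtain S H y where t: "template r S H y" "loc q H ?F {(y, g x)}"
    using template_type_of_realizable[OF _ q] by blast
  have "loc q ?E ?F ((\<lambda>u. (u, g u)) ` {x})"
    by (rule loc_of_ball_iso[OF inj adj closed, where m = 0]) (use q in auto)
  then have "loc q ?F ?E {(g x, x)}" using loc_sym1[of q ?E ?F x "g x"] by simp
  then have "loc q H ?E {(y, x)}" by (rule loc_trans1[OF t(2)])
  then show ?thesis using t(1) by blast
qed

text \<open>\<open>Rp\<close> is meant to hold representatives of the local types of templates, and
  \<open>S\<close> chooses a vertex set for each of them.\<close>

definition good :: "nat \<Rightarrow> (int set set \<times> int list) set \<Rightarrow> (int set set \<times> int list \<Rightarrow> int set) \<Rightarrow>
    nat \<Rightarrow> nat set set \<Rightarrow> bool" where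
  "good Q Rp S n E \<longleftrightarrow> \<Union>E \<subseteq> {1..n} \<and>
     (\<forall>x\<in>{1..n}. \<exists>S H h. template (2 ^ Suc Q) S H h \<and> loc Q H E {(h, x)}) \<and>
     (\<forall>z\<in>Rp. copies (2 ^ Suc Q) (S z) (fst z) (hd (snd z)) (Suc Q) n E)"

text \<open>The point \<open>v\<close> has the local type of a template, hence of a representative.
  Among \<open>Suc Q\<close> disjoint copies one has its centre far from \<open>Y\<close>: otherwise
  two centres are near the same point of \<open>Y\<close>, so within \<open>2 ^ Suc Q\<close> of
  each other and inside a single copy.\<close>

lemma rich_of_good:
  assumes Rp: "\<And>S H h. template (2 ^ Suc Q) S H h \<Longrightarrow> \<exists>z\<in>Rp. loc Q H (fst z) {(h, hd (snd z))}"
    and S: "\<And>z. z \<in> Rp \<Longrightarrow> template (2 ^ Suc Q) (S z) (fst z) (hd (snd z))"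
    and E: "good Q Rp S n E" and F: "good Q Rp S m F"
  shows "rich Q {1..n} E {1..m} F"
  unfolding rich_def
proof (intro ballI allI impI)
  fix v Y assume v: "v \<in> {1..n}" and Y: "finite Y \<and> Y \<subseteq> {1..m} \<and> card Y \<le> Q"
  let ?r = "2 ^ Suc Q :: nat"
  obtain S0 H h where t: "template ?r S0 H h" "loc Q H E {(h, v)}"
    using E v unfolding good_def by blast
  obtain z where z: "z \<in> Rp" "loc Q H (fst z) {(h, hd (snd z))}" using Rp[OF t(1)] by blast
  let ?x = "hd (snd z)"
  note tz = S[OF z(1)]
  have "copies ?r (S z) (fst z) ?x (Suc Q) m F" using F z(1) unfolding good_def by blast
  then obtain As where As: "finite As" "Suc Q \<le> card As"
    "\<forall>a\<in>As. copy_at ?r (S z) (fst z) ?x m F a"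
    "\<forall>a\<in>As. \<forall>a'\<in>As. a \<noteq> a' \<longrightarrow> place a ` S z \<inter> place a' ` S z = {}"
    unfolding copies_def by (elim exE conjE)
  have copy: "copy_at ?r (S z) (fst z) ?x m F a" if "a \<in> As" for a
    using As(3) that by blast
  have loc: "loc Q E F {(v, place a ?x)}" if a: "a \<in> As" for a
  proof -
    have "loc Q (fst z) F {(?x, place a ?x)}"
      by (rule copy_at_ball(2)[OF tz copy[OF a]]) simp
    then have "loc Q H F {(h, place a ?x)}" by (rule loc_trans1[OF z(2)])
    then show ?thesis by (rule loc_trans1[OF loc_sym1[OF t(2)]])
  qed
  have "\<exists>a\<in>As. place a ?x \<notin> near F (2 ^ Q) Y"
  proof (rule ccontr)
    assume "\<not> ?thesis"
    then have "\<forall>a\<in>As. \<exists>y. y \<in> Y \<and> place a ?x \<in> nball F (2 ^ Q) y" unfolding near_def by blast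
    from bchoice[OF this] obtain g where g: "\<And>a. a \<in> As \<Longrightarrow> g a \<in> Y \<and> place a ?x \<in> nball F (2 ^ Q) (g a)"
      by blast
    have "\<not> inj_on g As"
    proof
      assume "inj_on g As"
      then have "card As \<le> card Y" using g Y by (intro card_inj_on_le[of g]) auto
      then show False using As(2) Y by simp
    qed
    then obtain a a' where a: "a \<in> As" "a' \<in> As" "a \<noteq> a'" "g a = g a'" unfolding inj_on_def by blast
    have "g a \<in> nball F (2 ^ Q) (place a ?x)" by (rule nball_sym) (use g[OF a(1)] in simp)
    moreover have "place a' ?x \<in> nball F (2 ^ Q) (g a)" using g[OF a(2)] a(4) by simp
    ultimately have "place a' ?x \<in> nball F (2 ^ Q + 2 ^ Q) (place a ?x)" by (rule nball_trans)
    moreover have "nball F (2 ^ Q + 2 ^ Q) (place a ?x) \<subseteq> nball F (Suc ?r) (place a ?x)"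
      by (rule nball_mono) simp
    ultimately have "place a' ?x \<in> place a ` S z"
      using copy_at_ball(1)[OF tz copy[OF a(1)]] by blast
    moreover have "place a' ?x \<in> place a' ` S z" using templateD(2)[OF tz] by blast
    ultimately show False using As(4)[rule_format, OF a(1-3)] by blast
  qed
  then obtain a where a: "a \<in> As" "place a ?x \<notin> near F (2 ^ Q) Y" by blast
  have "?x \<in> S z" by (rule templateD(2)[OF tz])
  then have "1 \<le> int a + ?x" "int a + ?x \<le> int m" using copy[OF a(1)] unfolding copy_at_def by blast+
  then have "place a ?x \<in> {1..m}" by (auto simp: place_def)
  then show "\<exists>w\<in>{1..m}. loc Q E F {(v, w)} \<and> w \<notin> near F (2 ^ Q) Y"
    using loc[OF a(1)] a(2) by blast
qed

lemma good_prob: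
  assumes Rp: "finite Rp" and S: "\<And>z. z \<in> Rp \<Longrightarrow> template (2 ^ Suc Q) (S z) (fst z) (hd (snd z))"
    and "\<epsilon> > 0"
  shows "eventually (\<lambda>n. measure_pmf.prob (coins (vertex_pairs n) edge_prob)
    {f. \<not> good Q Rp S n (graph_of n f)} \<le> \<epsilon>) sequentially"
proof -
  let ?r = "2 ^ Suc Q :: nat"
  \<comment> \<open>One share for each representative, and three for the lower border, the upper
    border and their separation.\<close>
  define e where "e = \<epsilon> / (real (card Rp) + 3)"
  have e: "e > 0" using assms(3) by (simp add: e_def)
  obtain D where D: "\<And>n. n \<ge> D \<Longrightarrow> measure_pmf.prob (coins (vertex_pairs n) edge_prob)
    {f. \<not> border_chains ?r lstar D (graph_of n f)} \<le> e" using border_chains_prob[OF e] by blast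
  obtain N where N: "\<And>n. n \<ge> N \<Longrightarrow> measure_pmf.prob (coins (vertex_pairs n) edge_prob)
    {f. \<exists>b\<in>{1..lstar}. \<exists>h\<in>{1..n}. n < h + lstar \<and> h \<in> nball (graph_of n f) (2 * ?r) b} \<le> e"
    using borders_apart_prob[OF e, of "2 * ?r"] by blast
  have "eventually (\<lambda>n. \<forall>z\<in>Rp. measure_pmf.prob (coins (vertex_pairs n) edge_prob)
     {f. \<not> copies ?r (S z) (fst z) (hd (snd z)) (Suc Q) n (graph_of n f)} \<le> e) sequentially"
    using Rp template_copies_prob[OF S e] by (simp add: eventually_ball_finite_distrib)
  moreover have "eventually (\<lambda>n. n \<ge> max D N) sequentially" by (rule eventually_ge_at_top)
  ultimately show ?thesis
  proof eventually_elim
    case (elim n)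
    let ?M = "coins (vertex_pairs n) edge_prob"
    let ?P = "measure_pmf.prob ?M"
    define A where "A = {f. \<not> border_chains ?r lstar D (graph_of n f)}"
    define A' where "A' = {f. \<not> border_chains ?r lstar D (graph_of n (f \<circ> refl_edge n))}"
    define B where "B = {f. \<exists>b\<in>{1..lstar}. \<exists>h\<in>{1..n}. n < h + lstar \<and> h \<in> nball (graph_of n f) (2 * ?r) b}"
    define C where "C = (\<lambda>z. {f. \<not> copies ?r (S z) (fst z) (hd (snd z)) (Suc Q) n (graph_of n f)})"
    have "{f. \<not> good Q Rp S n (graph_of n f)} \<inter> set_pmf ?M \<subseteq> A \<union> (A' \<union> (B \<union> (\<Union>z\<in>Rp. C z)))"
    proof (rule subsetI, rule ccontr)
      fix f assume f: "f \<in> {f. \<not> good Q Rp S n (graph_of n f)} \<inter> set_pmf ?M"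
        and nf: "f \<notin> A \<union> (A' \<union> (B \<union> (\<Union>z\<in>Rp. C z)))"
      have "\<exists>S H h. template ?r S H h \<and> loc Q H (graph_of n f) {(h, x)}" if "x \<in> {1..n}" for x
      proof (rule all_template_types[OF possible_graph_support _ _ _ _ _ that, of f D])
        show "f \<in> set_pmf ?M" "D \<le> n" using f elim(2) by auto
        show "border_chains ?r lstar D (graph_of n f)" using nf by (auto simp: A_def)
        show "border_chains ?r lstar D (graph_of n (f \<circ> refl_edge n))" using nf by (auto simp: A'_def)
        show "\<not> (\<exists>b\<in>{1..lstar}. \<exists>h\<in>{1..n}. n < h + lstar \<and> h \<in> nball (graph_of n f) (2 * ?r) b)"
          using nf by (auto simp: B_def)
      qed simp
      moreover have "\<forall>z\<in>Rp. copies ?r (S z) (fst z) (hd (snd z)) (Suc Q) n (graph_of n f)"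
        using nf by (auto simp: C_def)
      moreover have "\<Union>(graph_of n f) \<subseteq> {1..n}" by (auto simp: graph_of_def vertex_pairs_def)
      ultimately have "good Q Rp S n (graph_of n f)" unfolding good_def by blast
      then show False using f by blast
    qed
    then have "?P ({f. \<not> good Q Rp S n (graph_of n f)} \<inter> set_pmf ?M) \<le> ?P (A \<union> (A' \<union> (B \<union> (\<Union>z\<in>Rp. C z))))"
      by (rule prob_mono)
    then have "?P {f. \<not> good Q Rp S n (graph_of n f)} \<le> ?P (A \<union> (A' \<union> (B \<union> (\<Union>z\<in>Rp. C z))))"
      by (simp only: measure_Int_set_pmf)
    also have "\<dots> \<le> ?P A + (?P A' + (?P B + (\<Sum>z\<in>Rp. ?P (C z))))"
      by (intro order_trans[OF prob_Un_le] add_mono order_refl prob_UN_le Rp)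
    also have "\<dots> \<le> e + (e + (e + (\<Sum>z\<in>Rp. e)))"
    proof (intro add_mono sum_mono)
      show "?P A \<le> e" unfolding A_def using D elim(2) by simp
      have "?P A' = ?P A" unfolding A_def A'_def by (rule prob_reflect)
      then show "?P A' \<le> e" using \<open>?P A \<le> e\<close> by simp
      show "?P B \<le> e" unfolding B_def using N elim(2) by simp
      show "?P (C z) \<le> e" if "z \<in> Rp" for z using elim(1) that unfolding C_def by blast
    qed
    also have "\<dots> = (real (card Rp) + 3) * e" by (simp add: algebra_simps)
    also have "\<dots> = \<epsilon>" by (simp add: e_def)
    finally show ?case .
  qed
qed

lemma random_graph_coins: "random_graph p n = map_pmf (graph_of n) (coins (vertex_pairs n) edge_prob)"
  unfolding random_graph_def coins_def graph_of_def edge_prob_def by simp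

text \<open>Any two good graphs agree on \<open>\<psi>\<close>, so the limit is 1 if some good graph
  satisfies it and 0 otherwise; the error is at most the probability of not being good.\<close>

lemma zero_one_law: "zero_one_law p"
  unfolding zero_one_law_def
proof (intro allI impI)
  fix \<psi> assume \<psi>: "sentence \<psi>"
  define Q where "Q = qd \<psi>"
  \<comment> \<open>The radius is twice that of the game, so that centres of different copies cannot
    both be near one point.\<close>
  define A where "A = {(H, [h]) | H h. \<exists>S. template (2 ^ Suc Q) S H h}"
  have "\<forall>(H, xs)\<in>A. length xs = 1" by (auto simp: A_def)
  from loc_finite_index[OF this, of Q] obtain Rp where Rp: "finite Rp" "Rp \<subseteq> A"
    "\<forall>(H, xs)\<in>A. \<exists>(F, ys)\<in>Rp. loc Q H F (set (zip xs ys))" by (elim exE conjE)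
  have "\<forall>z\<in>Rp. \<exists>S. template (2 ^ Suc Q) S (fst z) (hd (snd z))"
  proof
    fix z assume "z \<in> Rp"
    then have "z \<in> A" using Rp(2) by blast
    then obtain H h S where "z = (H, [h])" "template (2 ^ Suc Q) S H h" unfolding A_def by blast
    then show "\<exists>S. template (2 ^ Suc Q) S (fst z) (hd (snd z))" by (metis fst_conv list.sel(1) snd_conv)
  qed
  from bchoice[OF this] obtain S where S: "\<And>z. z \<in> Rp \<Longrightarrow> template (2 ^ Suc Q) (S z) (fst z) (hd (snd z))"
    by blast
  have rep: "\<exists>z\<in>Rp. loc Q H (fst z) {(h, hd (snd z))}" if t: "template (2 ^ Suc Q) S H h" for S H h
  proof -
    have "(H, [h]) \<in> A" using t by (auto simp: A_def)
    from bspec[OF Rp(3) this] obtain F ys where F: "(F, ys) \<in> Rp" "loc Q H F (set (zip [h] ys))" by auto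
    then have "(F, ys) \<in> A" using Rp(2) by blast
    then obtain y where "ys = [y]" unfolding A_def by blast
    then show ?thesis using F by (intro bexI[of _ "(F, ys)"]) auto
  qed
  have agree: "models {1..n} E \<psi> \<longleftrightarrow> models {1..m} F \<psi>" if g: "good Q Rp S n E" "good Q Rp S m F" for n m E F
    by (rule models_eq_of_rich[OF rich_of_good[OF rep S g] rich_of_good[OF rep S g(2,1)] _ _ \<psi>])
      (use g in \<open>auto simp: good_def Q_def\<close>)
  let ?Pr = "\<lambda>n. measure_pmf.prob (random_graph p n) {E. models {1..n} E \<psi>}"
  let ?P = "\<lambda>n. measure_pmf.prob (coins (vertex_pairs n) edge_prob)"
  have Pr: "?Pr n = ?P n {f. models {1..n} (graph_of n f) \<psi>}" for n
    by (simp add: random_graph_coins vimage_def)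
  have lim: "?Pr \<longlonglongrightarrow> c"
    if c: "\<And>n. \<bar>?Pr n - c\<bar> \<le> ?P n {f. \<not> good Q Rp S n (graph_of n f)}" for c
  proof (rule LIMSEQ_I)
    fix e :: real assume "e > 0"
    then have "e / 2 > 0" by simp
    from good_prob[OF Rp(1) S this] obtain N where
      N: "\<And>n. n \<ge> N \<Longrightarrow> ?P n {f. \<not> good Q Rp S n (graph_of n f)} \<le> e / 2"
      unfolding eventually_sequentially by blast
    have "norm (?Pr n - c) < e" if "n \<ge> N" for n
      using c[of n] N[OF that] \<open>e > 0\<close> by simp
    then show "\<exists>no. \<forall>n\<ge>no. norm (?Pr n - c) < e" by blast
  qed
  show "\<exists>c\<in>{0, 1}. ?Pr \<longlonglongrightarrow> c"
  proof (cases "\<exists>n E. good Q Rp S n E \<and> models {1..n} E \<psi>")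
    case True
    have "\<bar>?Pr n - 1\<bar> \<le> ?P n {f. \<not> good Q Rp S n (graph_of n f)}" for n
    proof -
      have "1 - ?Pr n = ?P n (- {f. models {1..n} (graph_of n f) \<psi>})"
        unfolding Pr using measure_pmf.prob_compl[of "{f. models {1..n} (graph_of n f) \<psi>}"]
        by (simp add: Compl_eq_Diff_UNIV)
      also have "\<dots> \<le> ?P n {f. \<not> good Q Rp S n (graph_of n f)}"
        by (rule prob_mono) (use True agree in blast)
      finally show ?thesis using measure_pmf.prob_le_1[of "random_graph p n"] by simp
    qed
    then show ?thesis using lim[of 1] by blast
  next
    case False
    have "\<bar>?Pr n - 0\<bar> \<le> ?P n {f. \<not> good Q Rp S n (graph_of n f)}" for n
    proof -
      have "?Pr n \<le> ?P n {f. \<not> good Q Rp S n (graph_of n f)}"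
        unfolding Pr by (rule prob_mono) (use False in blast)
      then show ?thesis by simp
    qed
    then show ?thesis using lim[of 0] by blast
  qed
qed

end

theorem theorem5p14:
  fixes p :: "nat \<Rightarrow> real" and lstar :: nat
  assumes "prob_seq p"
    and "{l. l \<ge> 1 \<and> p l = 1} = {lstar}"
    and "(\<lambda>n. ln (\<Prod>l\<in>{1..n} - {lstar}. 1 - p l) / ln (real n)) \<longlonglongrightarrow> 0"
    and "no_unavoidable_circles p"
    and "filterlim (\<lambda>n. \<Sum>l=1..n. p l) at_top sequentially"
    and "summable (\<lambda>l. (p (Suc l))\<^sup>2)"
  shows "zero_one_law p"
proof -
  interpret distance_graph p lstar
    using assms by unfold_locales
  show ?thesis by (rule zero_one_law)
qed

end
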